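(* Let $\{X_{i,n},1\le i\le n\}_{n\ge1}$ be a triangular array of square integrable, centered, real-valued random variables; for each $n$ let $(\mathcal{F}_{i,n})_i$ be a filtration to which $(X_{i,n})_i$ is adapted. With $S_{k,n}$, $\mathbb{E}_{k,n}$, $\theta_{k,n}^m$, $A(u)$ and $B(\ell,m)$ as defined in the context, assume: (i) $\sup_{n\ge1}\sum_{j=1}^n\mathbb{E}(X_{j,n}^2)\le C<\infty$ for some constant $C$, and for every $\varepsilon>0$, $\lim_{n\to\infty}\sum_{k=1}^n\mathbb{E}\{X_{k,n}^2I(|X_{k,n}|>\varepsilon)\}=0$; (ii) $\lim_{j\to\infty}2^{-j/2}A(2^j)=0$ and $\liminf_{j\to\infty}\sum_{\ell\ge j}B(2^\ell,2^j)=0$; (iii) there exist a sequence of non-decreasing and right-continuous functions $v_n(\cdot):[0,1]\to\{0,1,2,\ldots,n\}$ and a non-negative real $c^2$ (with $c\ge0$) such that, for every $t\in(0,1]$ and every $\varepsilon>0$, $$\lim_{m\to\infty}\limsup_{n\to\infty}\mathbb{P}\Big(\Big|\sum_{k=1}^{v_n(t)}\big(X_{k,n}^2+2X_{k,n}\theta_{k,n}^m\big)-tc^2\Big|>\varepsilon\Big)=0.$$ Then $\big\{\sum_{k=1}^{v_n(t)}X_{k,n},\ t\in[0,1]\big\}$ converges in distribution in $D([0,1])$ to $cW$, where $W$ is a standard Brownian motion.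
   Context: Conventions: $X_{k,n}=0$ and $\mathcal{F}_{k,n}=\mathcal{F}_{n,n}$ for $k>n$; the filtration $(\mathcal{F}_{i,n})_{i\in\mathbb{Z}}$ is non-decreasing in $i$ and indexed by all integers (negative indices occur only in the definition of $B$). Write $\mathbb{E}_{k,n}(\cdot)=\mathbb{E}(\cdot\mid\mathcal{F}_{k,n})$, $S_{0,n}=0$, $S_{k,n}=\sum_{i=1}^kX_{i,n}$, and $$\theta_{k,n}^m=\frac1m\sum_{i=1}^{m-1}\mathbb{E}_{k,n}(S_{k+i,n}-S_{k,n}).$$ For a non-negative integer $u$ and positive integers $\ell,m$, the non-negative quantities $A(u)$ and $B(\ell,m)$ are defined by $$A^2(u)=\sup_{n\ge1}\sum_{k=0}^{n-1}\|\mathbb{E}_{k,n}(S_{k+u,n}-S_{k,n})\|_2^2,\qquad B^2(\ell,m)=\sup_{n\ge1}\sum_{k=0}^{[n/\ell]}\|\bar S_{k,n}(\ell,m)\|_2^2,$$ $$\bar S_{k,n}(\ell,m)=\frac1m\sum_{u=0}^{m-1}\mathbb{E}_{(k-1)\ell+1,n}\big(S_{(k+1)\ell+u,n}-S_{k\ell+u,n}\big).$$ $\|\cdot\|_2$ is the $\mathbb{L}^2(\mathbb{P})$ norm, $[x]$ the integer part, $I(A)$ the indicator. $D([0,1])$ is the space of right-continuous functions on $[0,1]$ with finite left-hand limits, endowed with the uniform topology. *)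

theory Defs
  imports "HOL-Probability.Probability"
begin

subsection \<open>The space D([0,1]) with the uniform topology\<close>

definition cadlag :: "(real \<Rightarrow> real) \<Rightarrow> bool" where
  "cadlag f \<longleftrightarrow>
     (\<forall>t\<in>{0..<1}. (f \<longlongrightarrow> f t) (at_right t)) \<and>
     (\<forall>t\<in>{0<..1}. \<exists>l. (f \<longlongrightarrow> l) (at_left t))"

lemma cadlag_bounded:
  assumes "cadlag f"
  shows "bounded (f ` {0..1})"
proof -
  have left: "\<exists>e>0. \<exists>b. \<forall>s. t - e < s \<and> s < t \<longrightarrow> \<bar>f s\<bar> \<le> b" if t: "t \<in> {0<..1}" for t
  proof -
    obtain l where "(f \<longlongrightarrow> l) (at_left t)"
      using assms t unfolding cadlag_def by blast
    then have "\<forall>\<^sub>F s in at_left t. dist (f s) l < 1"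
      by (rule tendstoD) simp
    then obtain a where a: "a < t" "\<And>s. a < s \<Longrightarrow> s < t \<Longrightarrow> dist (f s) l < 1"
      unfolding eventually_at_left_field by blast
    have "\<bar>f s\<bar> \<le> \<bar>l\<bar> + 1" if "t - (t - a) < s" "s < t" for s
      using a(2)[of s] that by (auto simp: dist_real_def)
    then show ?thesis
      using a(1) by (intro exI[of _ "t - a"] conjI exI[of _ "\<bar>l\<bar> + 1"]) auto
  qed
  have right: "\<exists>e>0. \<exists>b. \<forall>s. t < s \<and> s < t + e \<longrightarrow> \<bar>f s\<bar> \<le> b" if t: "t \<in> {0..<1}" for t
  proof -
    have "(f \<longlongrightarrow> f t) (at_right t)"
      using assms t unfolding cadlag_def by blast
    then have "\<forall>\<^sub>F s in at_right t. dist (f s) (f t) < 1"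
      by (rule tendstoD) simp
    then obtain a where a: "t < a" "\<And>s. t < s \<Longrightarrow> s < a \<Longrightarrow> dist (f s) (f t) < 1"
      unfolding eventually_at_right_field by blast
    have "\<bar>f s\<bar> \<le> \<bar>f t\<bar> + 1" if "t < s" "s < t + (a - t)" for s
      using a(2)[of s] that by (auto simp: dist_real_def)
    then show ?thesis
      using a(1) by (intro exI[of _ "a - t"] conjI exI[of _ "\<bar>f t\<bar> + 1"]) auto
  qed
  have "\<exists>e>0. \<exists>b. \<forall>s\<in>ball t e \<inter> {0..1}. \<bar>f s\<bar> \<le> b" if t: "t \<in> {0..1}" for t
  proof -
    have "\<exists>e>0. \<exists>b. \<forall>s. t - e < s \<and> s < t \<and> 0 \<le> s \<longrightarrow> \<bar>f s\<bar> \<le> b"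
    proof (cases "t = 0")
      case True
      then show ?thesis by (intro exI[of _ 1]) auto
    next
      case False
      then show ?thesis using left[of t] t by fastforce
    qed
    then obtain e1 b1 where 1: "e1 > 0" "\<And>s. t - e1 < s \<Longrightarrow> s < t \<Longrightarrow> 0 \<le> s \<Longrightarrow> \<bar>f s\<bar> \<le> b1"
      by blast
    have "\<exists>e>0. \<exists>b. \<forall>s. t < s \<and> s < t + e \<and> s \<le> 1 \<longrightarrow> \<bar>f s\<bar> \<le> b"
    proof (cases "t = 1")
      case True
      then show ?thesis by (intro exI[of _ 1]) auto
    next
      case False
      then show ?thesis using right[of t] t by fastforce
    qed
    then obtain e2 b2 where 2: "e2 > 0" "\<And>s. t < s \<Longrightarrow> s < t + e2 \<Longrightarrow> s \<le> 1 \<Longrightarrow> \<bar>f s\<bar> \<le> b2"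
      by blast
    have "\<bar>f s\<bar> \<le> max \<bar>f t\<bar> (max b1 b2)" if "s \<in> ball t (min e1 e2) \<inter> {0..1}" for s
    proof -
      have s: "t - e1 < s" "s < t + e2" "0 \<le> s" "s \<le> 1"
        using that by (auto simp: dist_real_def)
      consider "s < t" | "s = t" | "t < s" by linarith
      then show ?thesis
        using 1(2)[of s] 2(2)[of s] s by cases auto
    qed
    moreover have "min e1 e2 > 0"
      using 1(1) 2(1) by simp
    ultimately show ?thesis by blast
  qed
  then obtain e b where eb: "\<And>t. t \<in> {0..1} \<Longrightarrow> e t > 0"
      "\<And>t s. t \<in> {0..1} \<Longrightarrow> s \<in> ball t (e t) \<inter> {0..1} \<Longrightarrow> \<bar>f s\<bar> \<le> b t"
    by metis
  have "{0..1::real} \<subseteq> (\<Union>t\<in>{0..1}. ball t (e t))"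
    using eb(1) by force
  then obtain T where T: "T \<subseteq> {0..1}" "finite T" "{0..1::real} \<subseteq> (\<Union>t\<in>T. ball t (e t))"
    using compactE_image[OF compact_Icc, of "{0..1}" "\<lambda>t. ball t (e t)" "0::real" 1] by auto
  have "\<bar>f s\<bar> \<le> (\<Sum>t\<in>T. \<bar>b t\<bar>)" if s: "s \<in> {0..1}" for s
  proof -
    obtain t where t: "t \<in> T" "s \<in> ball t (e t)" using T(3) s by blast
    then have "\<bar>f s\<bar> \<le> b t" using eb(2)[of t s] T(1) s by auto
    also have "\<dots> \<le> \<bar>b t\<bar>" by simp
    also have "\<dots> \<le> (\<Sum>t\<in>T. \<bar>b t\<bar>)"
      using T(2) t(1) by (intro member_le_sum) auto
    finally show ?thesis .
  qed
  then show ?thesis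
    unfolding bounded_iff by (auto simp del: atLeastAtMost_iff)
qed

lemma cadlag_restrict:
  assumes "cadlag f"
  shows "cadlag (restrict f {0..1})"
  unfolding cadlag_def
proof safe
  fix t :: real assume t: "t \<in> {0..<1}"
  have "\<forall>\<^sub>F s in at_right t. f s = restrict f {0..1} s"
    using t unfolding eventually_at_right_field by (intro exI[of _ 1]) auto
  moreover have "(f \<longlongrightarrow> f t) (at_right t)" "restrict f {0..1} t = f t"
    using assms t unfolding cadlag_def by auto
  ultimately show "(restrict f {0..1} \<longlongrightarrow> restrict f {0..1} t) (at_right t)"
    by (metis Lim_transform_eventually)
next
  fix t :: real assume t: "t \<in> {0<..1}"
  have "\<forall>\<^sub>F s in at_left t. f s = restrict f {0..1} s"
    using t unfolding eventually_at_left_field by (intro exI[of _ 0]) auto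
  moreover obtain l where "(f \<longlongrightarrow> l) (at_left t)"
    using assms t unfolding cadlag_def by blast
  ultimately show "\<exists>l. (restrict f {0..1} \<longlongrightarrow> l) (at_left t)"
    by (metis Lim_transform_eventually)
qed

lemma cadlag_continuous:
  assumes "continuous_on {0..1} f"
  shows "cadlag f"
  unfolding cadlag_def
proof safe
  fix t :: real assume t: "t \<in> {0..<1}"
  have "(f \<longlongrightarrow> f t) (at t within {0..1})"
    using assms t unfolding continuous_on_def by auto
  moreover have "at_right t \<le> at t within {0..1}"
    using t at_within_Icc_at_right[of t 1] at_le[of "{t..1}" "{0..1}" t] by auto
  ultimately show "(f \<longlongrightarrow> f t) (at_right t)"
    by (rule tendsto_mono[rotated])
next
  fix t :: real assume t: "t \<in> {0<..1}"
  have "(f \<longlongrightarrow> f t) (at t within {0..1})"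
    using assms t unfolding continuous_on_def by auto
  moreover have "at_left t \<le> at t within {0..1}"
    using t at_within_Icc_at_left[of 0 t] at_le[of "{0..t}" "{0..1}" t] by auto
  ultimately show "\<exists>l. (f \<longlongrightarrow> l) (at_left t)"
    using tendsto_mono by blast
qed

typedef D01 = "{f. cadlag f \<and> f \<in> extensional {0..1}}"
  morphisms path_of Abs_D01
  using cadlag_restrict[OF cadlag_continuous[OF continuous_on_const[of "{0..1}" 0]]] by blast

instantiation D01 :: metric_space
begin

definition dist_D01 :: "D01 \<Rightarrow> D01 \<Rightarrow> real" where
  "dist_D01 x y = (SUP t\<in>{0..1}. \<bar>path_of x t - path_of y t\<bar>)"

definition uniformity_D01 :: "(D01 \<times> D01) filter" where
  "uniformity_D01 = (INF e\<in>{0 <..}. principal {(x, y). dist x y < e})"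

definition open_D01 :: "D01 set \<Rightarrow> bool" where
  "open_D01 U = (\<forall>x\<in>U. \<forall>\<^sub>F (x', y) in uniformity. x' = x \<longrightarrow> y \<in> U)"

instance
proof
  have bdd: "bdd_above ((\<lambda>t. \<bar>path_of x t - path_of y t\<bar>) ` {0..1})" for x y
  proof -
    have "bounded (path_of x ` {0..1})" "bounded (path_of y ` {0..1})"
      using path_of[of x] path_of[of y] cadlag_bounded by auto
    then obtain a b where "\<And>t. t \<in> {0..1} \<Longrightarrow> \<bar>path_of x t\<bar> \<le> a"
        "\<And>t. t \<in> {0..1} \<Longrightarrow> \<bar>path_of y t\<bar> \<le> b"
      unfolding bounded_iff by (metis imageI real_norm_def)
    then have "\<bar>path_of x t - path_of y t\<bar> \<le> a + b" if "t \<in> {0..1}" for t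
      using that by (smt (verit))
    then show ?thesis by (intro bdd_aboveI2)
  qed
  fix x y z :: D01
  show "dist x y = 0 \<longleftrightarrow> x = y"
  proof
    assume d: "dist x y = 0"
    have "path_of x t = path_of y t" for t
    proof (cases "t \<in> {0..1}")
      case True
      then have "\<bar>path_of x t - path_of y t\<bar> \<le> dist x y"
        unfolding dist_D01_def by (intro cSUP_upper bdd)
      then show ?thesis using d by simp
    next
      case False
      then show ?thesis using path_of[of x] path_of[of y] by (auto simp: extensional_def)
    qed
    then show "x = y" by (simp add: path_of_inject[symmetric] fun_eq_iff)
  next
    assume "x = y"
    then show "dist x y = 0" by (simp add: dist_D01_def)
  qed
  show "dist x y \<le> dist x z + dist y z"
    unfolding dist_D01_def[of x y]
  proof (rule cSUP_least)
    fix t :: real assume t: "t \<in> {0..1}"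
    have "\<bar>path_of x t - path_of z t\<bar> \<le> dist x z" "\<bar>path_of y t - path_of z t\<bar> \<le> dist y z"
      using t unfolding dist_D01_def by (auto intro!: cSUP_upper bdd simp del: atLeastAtMost_iff)
    then show "\<bar>path_of x t - path_of y t\<bar> \<le> dist x z + dist y z" by linarith
  qed simp
qed (simp_all add: uniformity_D01_def open_D01_def)

end

text \<open>The element of D([0,1]) given by a function that is cadlag on [0,1]; the value is
  unspecified if the function is not cadlag there.\<close>

definition to_D01 :: "(real \<Rightarrow> real) \<Rightarrow> D01" where
  "to_D01 f = Abs_D01 (restrict f {0..1})"

lemma path_of_to_D01:
  assumes "cadlag f" "t \<in> {0..1}"
  shows "path_of (to_D01 f) t = f t"
  using assms cadlag_restrict[OF assms(1)] unfolding to_D01_def by (subst Abs_D01_inverse) auto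

text \<open>Partial sums along a non-decreasing right-continuous integer-valued time scale form
  cadlag functions, so \<open>to_D01\<close> is applied within its domain to them.\<close>

lemma cadlag_time_change:
  fixes v :: "real \<Rightarrow> nat" and g :: "nat \<Rightarrow> real"
  assumes mono: "mono_on {0..1} v"
    and right: "\<And>t. t \<in> {0..<1} \<Longrightarrow> (v \<longlongrightarrow> v t) (at_right t)"
  shows "cadlag (\<lambda>t. g (v t))"
  unfolding cadlag_def
proof safe
  fix t :: real assume t: "t \<in> {0..<1}"
  have "\<forall>\<^sub>F s in at_right t. v s = v t"
    using right[OF t] by (simp add: tendsto_discrete)
  then have "\<forall>\<^sub>F s in at_right t. g (v s) = g (v t)"
    by (rule eventually_mono) simp
  then show "((\<lambda>s. g (v s)) \<longlongrightarrow> g (v t)) (at_right t)"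
    by (rule tendsto_eventually)
next
  fix t :: real assume t: "t \<in> {0<..1}"
  let ?R = "v ` {0..<t}"
  have "?R \<subseteq> {..v t}"
  proof
    fix x assume "x \<in> ?R"
    then obtain s where "s \<in> {0..<t}" "x = v s" by blast
    then show "x \<in> {..v t}" using t mono_onD[OF mono, of s t] by simp
  qed
  then have fin: "finite ?R" by (rule finite_subset) simp
  have "?R \<noteq> {}" using t by auto
  then have "Max ?R \<in> ?R" using fin by (intro Max_in)
  then obtain r where "r \<in> {0..<t}" "Max ?R = v r" by (rule imageE)
  then have r: "0 \<le> r" "r < t" "v r = Max ?R" by simp_all
  have "v s = v r" if "r < s" "s < t" for s
  proof (rule antisym)
    show "v s \<le> v r" unfolding r(3) using that r(1) by (intro Max_ge fin imageI) simp
    show "v r \<le> v s" using that r(1,2) t mono_onD[OF mono, of r s] by simp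
  qed
  then have "\<forall>s>r. s < t \<longrightarrow> g (v s) = g (v r)" by metis
  then have "\<forall>\<^sub>F s in at_left t. g (v s) = g (v r)"
    unfolding eventually_at_left_field using r(2) by blast
  then show "\<exists>l. ((\<lambda>s. g (v s)) \<longlongrightarrow> l) (at_left t)"
    by (intro exI[of _ "g (v r)"] tendsto_eventually)
qed

subsection \<open>Brownian motion and convergence in distribution\<close>

text \<open>Standard Brownian motion with time parameter in [0,1].\<close>

definition standard_brownian_motion :: "'b measure \<Rightarrow> (real \<Rightarrow> 'b \<Rightarrow> real) \<Rightarrow> bool" where
  "standard_brownian_motion N W \<longleftrightarrow>
     prob_space N \<and>
     (\<forall>t\<in>{0..1}. W t \<in> borel_measurable N) \<and>
     (AE \<omega> in N. W 0 \<omega> = 0) \<and>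
     (\<forall>\<omega>\<in>space N. continuous_on {0..1} (\<lambda>t. W t \<omega>)) \<and>
     (\<forall>s t. 0 \<le> s \<and> s < t \<and> t \<le> 1 \<longrightarrow>
        distributed N lborel (\<lambda>\<omega>. W t \<omega> - W s \<omega>) (normal_density 0 (sqrt (t - s)))) \<and>
     (\<forall>(r::nat) (\<tau>::nat \<Rightarrow> real).
        (\<forall>i\<le>r. \<tau> i \<in> {0..1}) \<and> (\<forall>i<r. \<tau> i \<le> \<tau> (Suc i)) \<longrightarrow>
        prob_space.indep_vars N (\<lambda>_. borel) (\<lambda>i \<omega>. W (\<tau> (Suc i)) \<omega> - W (\<tau> i) \<omega>) {..<r})"

text \<open>The uniform topology on D([0,1]) is not separable, so measurability of the maps with
  respect to its Borel sigma-algebra is not automatic for stochastic processes with cadlag paths;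
  it is made part of the notion, so that the integrals below are genuine. The sequence is indexed by the positive integers.\<close>

definition converges_in_distribution ::
  "'a measure \<Rightarrow> (nat \<Rightarrow> 'a \<Rightarrow> 'd::topological_space) \<Rightarrow> 'b measure \<Rightarrow> ('b \<Rightarrow> 'd) \<Rightarrow> bool" where
  "converges_in_distribution M Y N Z \<longleftrightarrow>
     (\<forall>n\<ge>1. Y n \<in> measurable M borel) \<and> Z \<in> measurable N borel \<and>
     (\<forall>f :: 'd \<Rightarrow> real. continuous_on UNIV f \<and> bounded (range f) \<longrightarrow>
        (\<lambda>n. \<integral>\<omega>. f (Y n \<omega>) \<partial>M) \<longlonglongrightarrow> (\<integral>\<omega>. f (Z \<omega>) \<partial>N))"

subsection \<open>Quantities attached to a triangular array\<close>

text \<open>The row index comes first: \<open>X n i\<close> and \<open>\<F> n i\<close> are the i-th variable and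
  the i-th sigma-algebra of the n-th row.\<close>

definition row_sum :: "(nat \<Rightarrow> nat \<Rightarrow> 'a \<Rightarrow> real) \<Rightarrow> nat \<Rightarrow> nat \<Rightarrow> 'a \<Rightarrow> real" where
  "row_sum X n k \<omega> = (\<Sum>i=1..k. X n i \<omega>)"

definition theta ::
  "'a measure \<Rightarrow> (nat \<Rightarrow> int \<Rightarrow> 'a measure) \<Rightarrow> (nat \<Rightarrow> nat \<Rightarrow> 'a \<Rightarrow> real) \<Rightarrow>
    nat \<Rightarrow> nat \<Rightarrow> nat \<Rightarrow> 'a \<Rightarrow> real" where
  "theta M \<F> X m n k \<omega> =
     1 / real m * (\<Sum>i=1..<m.
       real_cond_exp M (\<F> n (int k)) (\<lambda>\<omega>'. row_sum X n (k + i) \<omega>' - row_sum X n k \<omega>') \<omega>)"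

text \<open>The suprema defining $A^2$ and $B^2$ are taken in \<open>[0, \<infinity>]\<close>, hence the
  square root on \<^typ>\<open>ennreal\<close>.\<close>

definition ennreal_sqrt :: "ennreal \<Rightarrow> ennreal" where
  "ennreal_sqrt x = (if x = \<infinity> then \<infinity> else ennreal (sqrt (enn2real x)))"

definition L2_norm :: "'a measure \<Rightarrow> ('a \<Rightarrow> real) \<Rightarrow> ennreal" where
  "L2_norm M f = ennreal_sqrt (\<integral>\<^sup>+\<omega>. ennreal ((f \<omega>)\<^sup>2) \<partial>M)"

definition A_coeff ::
  "'a measure \<Rightarrow> (nat \<Rightarrow> int \<Rightarrow> 'a measure) \<Rightarrow> (nat \<Rightarrow> nat \<Rightarrow> 'a \<Rightarrow> real) \<Rightarrow> nat \<Rightarrow> ennreal" where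
  "A_coeff M \<F> X u = ennreal_sqrt (SUP n\<in>{1..}. \<Sum>k=0..<n.
     (L2_norm M (real_cond_exp M (\<F> n (int k))
        (\<lambda>\<omega>. row_sum X n (k + u) \<omega> - row_sum X n k \<omega>)))\<^sup>2)"

definition S_bar ::
  "'a measure \<Rightarrow> (nat \<Rightarrow> int \<Rightarrow> 'a measure) \<Rightarrow> (nat \<Rightarrow> nat \<Rightarrow> 'a \<Rightarrow> real) \<Rightarrow>
    nat \<Rightarrow> nat \<Rightarrow> nat \<Rightarrow> nat \<Rightarrow> 'a \<Rightarrow> real" where
  "S_bar M \<F> X l m n k \<omega> =
     1 / real m * (\<Sum>u=0..<m.
       real_cond_exp M (\<F> n ((int k - 1) * int l + 1))
         (\<lambda>\<omega>'. row_sum X n ((k + 1) * l + u) \<omega>' - row_sum X n (k * l + u) \<omega>') \<omega>)"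

definition B_coeff ::
  "'a measure \<Rightarrow> (nat \<Rightarrow> int \<Rightarrow> 'a measure) \<Rightarrow> (nat \<Rightarrow> nat \<Rightarrow> 'a \<Rightarrow> real) \<Rightarrow>
    nat \<Rightarrow> nat \<Rightarrow> ennreal" where
  "B_coeff M \<F> X l m = ennreal_sqrt (SUP n\<in>{1..}. \<Sum>k=0..n div l.
     (L2_norm M (S_bar M \<F> X l m n k))\<^sup>2)"

end

theory Submission
  imports Defs
begin


text \<open>
  Fix a window length \<open>m\<close>, write \<open>E\<^sub>k\<close> for the conditional expectation given the k-th sigma-algebra of a row, let
  \<open>\<theta>\<^sub>k\<close> be the average of \<open>E\<^sub>k(S\<^bsub>k+i\<^esub> - S\<^sub>k)\<close> over \<open>0 \<le> i < m\<close>, and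
  \<open>\<rho>\<^sub>k = E\<^sub>k(S\<^bsub>k+m\<^esub> - S\<^sub>k) / m\<close>. Since \<open>E\<^sub>k(X\<^bsub>k+1\<^esub> + \<theta>\<^bsub>k+1\<^esub>) = \<theta>\<^sub>k + \<rho>\<^sub>k\<close>, the variables
  \<open>X\<^bsub>k+1\<^esub> + \<theta>\<^bsub>k+1\<^esub> - \<theta>\<^sub>k - \<rho>\<^sub>k\<close> are martingale differences, and the partial sums of a row are
  \<open>S\<^sub>k = M\<^sub>k + \<theta>\<^sub>0 - \<theta>\<^sub>k + \<rho>\<^sub>0 + \<dots> + \<rho>\<^bsub>k-1\<^esub>\<close> with a martingale \<open>M\<close> (\<open>row_martingale\<close>,
  \<open>S_decomposition\<close>).

  For fixed \<open>m\<close> the \<open>\<theta>\<^sub>k\<close> are uniformly small as \<open>n \<longlonglongrightarrow> \<infinity>\<close>, by the Lindeberg condition (\<open>max_theta\<close>). The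
  maximum of the partial sums of the \<open>\<rho>\<^sub>j\<close> is bounded in \<open>L\<^sup>2\<close> by a dyadic argument (\<open>max_rho\<close>): group the
  summands into blocks of length \<open>m 2\<^sup>i\<close>; replacing the block sums by their projections on the past leaves martingale
  differences, which Doob's inequality controls, and the projections at scale \<open>i\<close> are the variables in the definition
  of \<open>B(m 2\<^sup>i, m)\<close>. The outcome is a bound by a multiple of \<open>A(m) / \<surd>m + \<Sum>\<^sub>i B(m 2\<^sup>i, m)\<close>, which is small for
  suitable powers \<open>m\<close> of 2. An algebraic identity (\<open>mart_diff_square\<close>) compares the sum of the squared martingale
  differences with the sum of \<open>X\<^sub>k\<^sup>2 + 2 X\<^sub>k \<theta>\<^sub>k\<close>, so the former is close to \<open>t c\<^sup>2\<close> at the time \<open>v\<^sub>n(t)\<close>.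
  Hence the rows are approximated by martingales with any prescribed accuracy (\<open>martingale_approximation\<close>).

  For a single martingale, McLeish's product \<open>\<Prod>(1 + i u D\<^sub>k)\<close>, stopped when the sum of squares becomes too large,
  gives a quantitative estimate of \<open>E(g e\<^bsup>iuM\<^esup>)\<close> for every bounded \<open>g\<close> measurable with respect to the initial
  sigma-algebra (\<open>martingale_char_bound\<close>). Because of the factor \<open>g\<close>, the increment of the partial sums over a block
  is asymptotically normal and asymptotically independent of everything before the block (\<open>asymptotic_independence\<close>).
  The argument applies Levy's continuity theorem on the line to the probability measures with density proportional to
  \<open>1 + g / 2\<close>. Finite-dimensional convergence follows by adding one block at a time (\<open>fdd_convergence\<close>).
  Tightness comes from a maximal inequality whose bound is the expectation of \<open>(|M| - \<alpha>)\<^sup>+\<close> for the increment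
  \<open>M\<close> of the martingale over a block: in the limit this is at most a fourth moment of a normal law divided by
  \<open>\<alpha>\<^sup>3\<close>, so the probability of a large oscillation is of the order of the squared block length, and the sum over
  all blocks vanishes as the mesh tends to 0 (\<open>block_oscillation\<close>).

  The space \<open>D([0,1])\<close> with the uniform topology is not separable. Only Lipschitz functions and step functions on
  finite grids are therefore compared directly (\<open>lipschitz_expectation_limit\<close>), and a bounded continuous function is
  reached as an increasing limit of Lipschitz functions (\<open>weak_convergence_from_lipschitz\<close>).
\<close>

section \<open>Square integrable random variables\<close>

definition L2_rv :: "'a measure \<Rightarrow> ('a \<Rightarrow> real) \<Rightarrow> bool" where
  "L2_rv M f \<longleftrightarrow> f \<in> borel_measurable M \<and> integrable M (\<lambda>\<omega>. (f \<omega>)\<^sup>2)"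

definition l2 :: "'a measure \<Rightarrow> ('a \<Rightarrow> real) \<Rightarrow> real" where
  "l2 M f = sqrt (\<integral>\<omega>. (f \<omega>)\<^sup>2 \<partial>M)"

lemma L2_rvD [dest]: "L2_rv M f \<Longrightarrow> f \<in> borel_measurable M" "L2_rv M f \<Longrightarrow> integrable M (\<lambda>\<omega>. (f \<omega>)\<^sup>2)"
  by (auto simp: L2_rv_def)

lemma L2_rv_bound:
  assumes g: "L2_rv M g" and [measurable]: "f \<in> borel_measurable M"
    and le: "AE \<omega> in M. \<bar>f \<omega>\<bar> \<le> \<bar>g \<omega>\<bar>"
  shows "L2_rv M f" "l2 M f \<le> l2 M g"
proof -
  have [measurable]: "g \<in> borel_measurable M" using g by auto
  have i: "integrable M (\<lambda>\<omega>. (f \<omega>)\<^sup>2)"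
    by (rule Bochner_Integration.integrable_bound[OF L2_rvD(2)[OF g]])
      (use le in \<open>auto simp: abs_le_square_iff\<close>)
  then show "L2_rv M f" by (simp add: L2_rv_def)
  show "l2 M f \<le> l2 M g"
    unfolding l2_def using le
    by (intro real_sqrt_le_mono integral_mono_AE i L2_rvD(2)[OF g]) (auto simp: abs_le_square_iff)
qed

lemma L2_rv_cong_AE:
  assumes g: "L2_rv M g" and f: "f \<in> borel_measurable M"
    and "AE \<omega> in M. f \<omega> = g \<omega>"
  shows "L2_rv M f" "l2 M f = l2 M g"
proof -
  have le: "AE \<omega> in M. \<bar>f \<omega>\<bar> \<le> \<bar>g \<omega>\<bar>" "AE \<omega> in M. \<bar>g \<omega>\<bar> \<le> \<bar>f \<omega>\<bar>" using assms(3) by auto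
  show fl: "L2_rv M f" using L2_rv_bound(1)[OF g f le(1)] .
  show "l2 M f = l2 M g" 
    using L2_rv_bound(2)[OF g f le(1)] L2_rv_bound(2)[OF fl L2_rvD(1)[OF g] le(2)] by simp
qed

lemma l2_nonneg [simp]: "0 \<le> l2 M f"
  by (simp add: l2_def)

lemma l2_power2: "(l2 M f)\<^sup>2 = (\<integral>\<omega>. (f \<omega>)\<^sup>2 \<partial>M)"
  by (simp add: l2_def)

lemma l2_abs [simp]: "l2 M (\<lambda>\<omega>. \<bar>f \<omega>\<bar>) = l2 M f"
  by (simp add: l2_def)

lemma L2_rv_abs: "L2_rv M f \<Longrightarrow> L2_rv M (\<lambda>\<omega>. \<bar>f \<omega>\<bar>)"
  by (auto simp: L2_rv_def)

lemma L2_rv_cmult: "L2_rv M f \<Longrightarrow> L2_rv M (\<lambda>\<omega>. c * f \<omega>)"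
  by (auto simp: L2_rv_def power_mult_distrib)

lemma l2_cmult: "l2 M (\<lambda>\<omega>. c * f \<omega>) = \<bar>c\<bar> * l2 M f"
  by (simp add: l2_def power_mult_distrib real_sqrt_mult)

lemma L2_rv_mult_integrable:
  assumes f: "L2_rv M f" and g: "L2_rv M g"
  shows "integrable M (\<lambda>\<omega>. f \<omega> * g \<omega>)"
proof (rule Bochner_Integration.integrable_bound)
  have [measurable]: "f \<in> borel_measurable M" "g \<in> borel_measurable M" using f g by auto
  show "integrable M (\<lambda>\<omega>. (f \<omega>)\<^sup>2 + (g \<omega>)\<^sup>2)" using f g by auto
  show "(\<lambda>\<omega>. f \<omega> * g \<omega>) \<in> borel_measurable M" by measurable
  have "\<bar>x * y\<bar> \<le> x\<^sup>2 + y\<^sup>2" for x y :: real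
  proof -
    have "2 * \<bar>x\<bar> * \<bar>y\<bar> \<le> \<bar>x\<bar>\<^sup>2 + \<bar>y\<bar>\<^sup>2" by (rule sum_squares_bound)
    moreover have "0 \<le> \<bar>x\<bar> * \<bar>y\<bar>" by simp
    ultimately show ?thesis unfolding abs_mult power2_abs by linarith
  qed
  then show "AE \<omega> in M. norm (f \<omega> * g \<omega>) \<le> norm ((f \<omega>)\<^sup>2 + (g \<omega>)\<^sup>2)"
    by auto
qed

lemma L2_rv_add:
  assumes f: "L2_rv M f" and g: "L2_rv M g"
  shows "L2_rv M (\<lambda>\<omega>. f \<omega> + g \<omega>)"
  using L2_rvD[OF f] L2_rvD[OF g] L2_rv_mult_integrable[OF f g]
  by (auto simp: L2_rv_def power2_sum mult.assoc)

lemma L2_rv_minus: "L2_rv M f \<Longrightarrow> L2_rv M (\<lambda>\<omega>. - f \<omega>)"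
  by (auto simp: L2_rv_def)

lemma L2_rv_diff: "L2_rv M f \<Longrightarrow> L2_rv M g \<Longrightarrow> L2_rv M (\<lambda>\<omega>. f \<omega> - g \<omega>)"
  using L2_rv_add[of M f "\<lambda>\<omega>. - g \<omega>"] L2_rv_minus[of M g] by simp

lemma L2_rv_zero [simp]: "L2_rv M (\<lambda>\<omega>. 0)"
  by (auto simp: L2_rv_def)

lemma l2_zero [simp]: "l2 M (\<lambda>\<omega>. 0) = 0"
  by (simp add: l2_def)

lemma L2_rv_sum: "(\<And>i. i \<in> I \<Longrightarrow> L2_rv M (f i)) \<Longrightarrow> L2_rv M (\<lambda>\<omega>. \<Sum>i\<in>I. f i \<omega>)"
  by (induction I rule: infinite_finite_induct) (auto intro: L2_rv_add)

text \<open>The quadratic \<open>t \<mapsto> \<integral>(f + t g)\<^sup>2\<close> is nonnegative, so its discriminant is not positive.\<close>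

lemma l2_Cauchy_Schwarz:
  assumes f: "L2_rv M f" and g: "L2_rv M g"
  shows "\<bar>\<integral>\<omega>. f \<omega> * g \<omega> \<partial>M\<bar> \<le> l2 M f * l2 M g"
proof -
  define a b c where "a = (\<integral>\<omega>. (f \<omega>)\<^sup>2 \<partial>M)" and "b = (\<integral>\<omega>. f \<omega> * g \<omega> \<partial>M)"
    and "c = (\<integral>\<omega>. (g \<omega>)\<^sup>2 \<partial>M)"
  have q: "0 \<le> a + 2 * t * b + t\<^sup>2 * c" for t
  proof -
    have "0 \<le> (\<integral>\<omega>. (f \<omega> + t * g \<omega>)\<^sup>2 \<partial>M)" by simp
    also have "\<dots> = (\<integral>\<omega>. (f \<omega>)\<^sup>2 + 2 * t * (f \<omega> * g \<omega>) + t\<^sup>2 * (g \<omega>)\<^sup>2 \<partial>M)"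
      by (intro Bochner_Integration.integral_cong refl) (simp add: power2_sum power_mult_distrib algebra_simps)
    also have "\<dots> = a + 2 * t * b + t\<^sup>2 * c"
      using L2_rvD[OF f] L2_rvD[OF g] L2_rv_mult_integrable[OF f g]
      by (simp add: a_def b_def c_def)
    finally show ?thesis .
  qed
  have c: "0 \<le> c" "0 \<le> a" by (auto simp: c_def a_def)
  have "b\<^sup>2 \<le> a * c"
  proof (cases "c = 0")
    case True
    have "b = 0"
    proof (rule ccontr)
      assume "b \<noteq> 0"
      then have "a + 2 * (-(a+1)/(2*b)) * b + 0 = -1" by (simp add: field_simps)
      then show False using q[of "-(a+1)/(2*b)"] True by simp
    qed
    then show ?thesis using True by simp
  next
    case False
    then have "c > 0" using c by simp
    then have "0 \<le> (a + 2 * (-b/c) * b + (-b/c)\<^sup>2 * c) * c" using q[of "-b/c"] by simp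
    also have "\<dots> = a * c - b\<^sup>2" using False by (simp add: field_simps power2_eq_square)
    finally show ?thesis by simp
  qed
  then have "sqrt (b\<^sup>2) \<le> sqrt (a * c)" by (rule real_sqrt_le_mono)
  then have "\<bar>b\<bar> \<le> sqrt a * sqrt c" by (simp only: real_sqrt_abs real_sqrt_mult)
  then show ?thesis by (simp add: a_def b_def c_def l2_def)
qed

lemma l2_add:
  assumes f: "L2_rv M f" and g: "L2_rv M g"
  shows "l2 M (\<lambda>\<omega>. f \<omega> + g \<omega>) \<le> l2 M f + l2 M g"
proof (rule power2_le_imp_le)
  have "(l2 M (\<lambda>\<omega>. f \<omega> + g \<omega>))\<^sup>2 = (\<integral>\<omega>. (f \<omega>)\<^sup>2 + 2 * (f \<omega> * g \<omega>) + (g \<omega>)\<^sup>2 \<partial>M)"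
    unfolding l2_power2 by (intro Bochner_Integration.integral_cong refl) (simp add: power2_sum)
  also have "\<dots> = (l2 M f)\<^sup>2 + 2 * (\<integral>\<omega>. f \<omega> * g \<omega> \<partial>M) + (l2 M g)\<^sup>2"
    using L2_rvD[OF f] L2_rvD[OF g] L2_rv_mult_integrable[OF f g] by (simp add: l2_power2)
  also have "\<dots> \<le> (l2 M f)\<^sup>2 + 2 * (l2 M f * l2 M g) + (l2 M g)\<^sup>2"
    using l2_Cauchy_Schwarz[OF f g] by linarith
  finally show "(l2 M (\<lambda>\<omega>. f \<omega> + g \<omega>))\<^sup>2 \<le> (l2 M f + l2 M g)\<^sup>2"
    by (simp add: power2_sum algebra_simps)
qed simp

lemma l2_minus [simp]: "l2 M (\<lambda>\<omega>. - f \<omega>) = l2 M f"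
  by (simp add: l2_def)

lemma l2_diff:
  assumes "L2_rv M f" "L2_rv M g"
  shows "l2 M (\<lambda>\<omega>. f \<omega> - g \<omega>) \<le> l2 M f + l2 M g"
  using l2_add[OF assms(1) L2_rv_minus[OF assms(2)]] by simp

lemma l2_sum:
  assumes "\<And>i. i \<in> I \<Longrightarrow> L2_rv M (f i)"
  shows "l2 M (\<lambda>\<omega>. \<Sum>i\<in>I. f i \<omega>) \<le> (\<Sum>i\<in>I. l2 M (f i))"
  using assms
proof (induction I rule: infinite_finite_induct)
  case (insert i I)
  have "l2 M (\<lambda>\<omega>. \<Sum>i\<in>insert i I. f i \<omega>) = l2 M (\<lambda>\<omega>. f i \<omega> + (\<Sum>i\<in>I. f i \<omega>))"
    using insert by simp
  also have "\<dots> \<le> l2 M (f i) + l2 M (\<lambda>\<omega>. \<Sum>i\<in>I. f i \<omega>)"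
    using insert by (intro l2_add L2_rv_sum) auto
  also have "\<dots> \<le> (\<Sum>i\<in>insert i I. l2 M (f i))" using insert by simp
  finally show ?case .
qed auto

text \<open>Minkowski's inequality in \<open>\<ell>\<^sup>2(L\<^sup>2)\<close>.\<close>

lemma L2_set_l2_sum_le:
  assumes "\<And>i k. i \<in> I \<Longrightarrow> k \<in> K \<Longrightarrow> L2_rv M (f i k)" "finite I"
  shows "L2_set (\<lambda>k. l2 M (\<lambda>\<omega>. \<Sum>i\<in>I. f i k \<omega>)) K \<le> (\<Sum>i\<in>I. L2_set (\<lambda>k. l2 M (f i k)) K)"
  using assms(2,1)
proof (induction I)
  case (insert i I)
  have "L2_set (\<lambda>k. l2 M (\<lambda>\<omega>. \<Sum>i\<in>insert i I. f i k \<omega>)) K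
      = L2_set (\<lambda>k. l2 M (\<lambda>\<omega>. f i k \<omega> + (\<Sum>i\<in>I. f i k \<omega>))) K"
    using insert(1,2) by simp
  also have "\<dots> \<le> L2_set (\<lambda>k. l2 M (f i k) + l2 M (\<lambda>\<omega>. \<Sum>i\<in>I. f i k \<omega>)) K"
    using insert(4) by (intro L2_set_mono l2_add L2_rv_sum) auto
  also have "\<dots> \<le> L2_set (\<lambda>k. l2 M (f i k)) K + L2_set (\<lambda>k. l2 M (\<lambda>\<omega>. \<Sum>i\<in>I. f i k \<omega>)) K"
    by (rule L2_set_triangle_ineq)
  also have "\<dots> \<le> L2_set (\<lambda>k. l2 M (f i k)) K + (\<Sum>i\<in>I. L2_set (\<lambda>k. l2 M (f i k)) K)"
    using insert by auto
  finally show ?case using insert(1,2) by simp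
qed (simp add: L2_set_def)

context prob_space begin

lemma L2_rv_integrable: 
  assumes "L2_rv M f" shows "integrable M f"
  by (rule square_integrable_imp_integrable) (use assms in auto)

lemma L2_rv_const [simp]: "L2_rv M (\<lambda>\<omega>. c)"
  by (auto simp: L2_rv_def)

lemma l2_const [simp]: "l2 M (\<lambda>\<omega>. c) = \<bar>c\<bar>"
  by (simp add: l2_def prob_space)

lemma L2_rv_bounded:
  assumes "f \<in> borel_measurable M" "\<And>\<omega>. \<bar>f \<omega>\<bar> \<le> B"
  shows "L2_rv M f"
proof (rule L2_rv_bound(1)[OF L2_rv_const[of B] assms(1)])
  show "AE \<omega> in M. \<bar>f \<omega>\<bar> \<le> \<bar>B\<bar>"
    using assms(2) order_trans[OF assms(2) abs_ge_self] by (intro AE_I2) blast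
qed

lemma integral_abs_le_l2:
  assumes "L2_rv M f" shows "(\<integral>\<omega>. \<bar>f \<omega>\<bar> \<partial>M) \<le> l2 M f"
  using l2_Cauchy_Schwarz[OF L2_rv_abs[OF assms] L2_rv_const[of 1]] by simp

lemma Chebyshev_l2:
  assumes "L2_rv M f" "a > 0"
  shows "prob {\<omega>\<in>space M. \<bar>f \<omega>\<bar> \<ge> a} \<le> (l2 M f)\<^sup>2 / a\<^sup>2"
proof -
  have [measurable]: "f \<in> borel_measurable M" using assms by auto
  have eq: "{\<omega>\<in>space M. \<bar>f \<omega>\<bar> \<ge> a} = {\<omega>\<in>space M. (f \<omega>)\<^sup>2 \<ge> a\<^sup>2}"
    using assms(2) by (auto simp: abs_le_square_iff[symmetric])
  show ?thesis unfolding eq l2_power2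
    using assms by (intro integral_Markov_inequality_measure[where A="{}"]) auto
qed

lemma sigma_finite_subalgebraI:
  "subalgebra M G \<Longrightarrow> sigma_finite_subalgebra M G"
  using finite_measure_subalgebra.intro[of M G] finite_measure_subalgebra_axioms.intro[of M G]
    finite_measure_axioms finite_measure_subalgebra_is_sigma_finite by blast

end

text \<open>\<open>Y\<close> is a version of the conditional expectation of \<open>Z\<close>, expressed by testing against
  square integrable variables only. In this weak form the linearity and tower properties hold for the functions
  themselves, without exceptional null sets.\<close>

definition cond_proj :: "'a measure \<Rightarrow> 'a measure \<Rightarrow> ('a \<Rightarrow> real) \<Rightarrow> ('a \<Rightarrow> real) \<Rightarrow> bool" where
  "cond_proj M G Z Y \<longleftrightarrow> L2_rv M Z \<and> L2_rv M Y \<and> Y \<in> borel_measurable G \<and>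
     (\<forall>H. H \<in> borel_measurable G \<longrightarrow> L2_rv M H \<longrightarrow> (\<integral>\<omega>. H \<omega> * Z \<omega> \<partial>M) = (\<integral>\<omega>. H \<omega> * Y \<omega> \<partial>M))"

lemma cond_projD:
  assumes "cond_proj M G Z Y"
  shows "L2_rv M Z" "L2_rv M Y" "Y \<in> borel_measurable G"
    "H \<in> borel_measurable G \<Longrightarrow> L2_rv M H \<Longrightarrow> (\<integral>\<omega>. H \<omega> * Z \<omega> \<partial>M) = (\<integral>\<omega>. H \<omega> * Y \<omega> \<partial>M)"
  using assms unfolding cond_proj_def by auto

lemma cond_proj_sum:
  assumes "\<And>i. i \<in> I \<Longrightarrow> cond_proj M G (Z i) (Y i)" and "finite I"
  shows "cond_proj M G (\<lambda>\<omega>. \<Sum>i\<in>I. Z i \<omega>) (\<lambda>\<omega>. \<Sum>i\<in>I. Y i \<omega>)"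
proof -
  note a = cond_projD[OF assms(1)]
  have "(\<integral>\<omega>. H \<omega> * (\<Sum>i\<in>I. Z i \<omega>) \<partial>M) = (\<integral>\<omega>. H \<omega> * (\<Sum>i\<in>I. Y i \<omega>) \<partial>M)"
    if H: "H \<in> borel_measurable G" "L2_rv M H" for H
    using a(4)[OF _ H] L2_rv_mult_integrable[OF H(2) a(1)] L2_rv_mult_integrable[OF H(2) a(2)]
    by (simp add: sum_distrib_left)
  then show ?thesis
    unfolding cond_proj_def using a by (auto intro!: L2_rv_sum borel_measurable_sum)
qed

lemma cond_proj_cmult:
  assumes "cond_proj M G Z Y"
  shows "cond_proj M G (\<lambda>\<omega>. c * Z \<omega>) (\<lambda>\<omega>. c * Y \<omega>)"
proof -
  note a = cond_projD[OF assms]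
  have "(\<integral>\<omega>. H \<omega> * (c * Z \<omega>) \<partial>M) = (\<integral>\<omega>. H \<omega> * (c * Y \<omega>) \<partial>M)"
    if H: "H \<in> borel_measurable G" "L2_rv M H" for H
    using a(4)[OF H] by (simp add: mult.left_commute)
  then show ?thesis
    unfolding cond_proj_def using a by (auto intro!: L2_rv_cmult)
qed

lemma cond_proj_tower:
  assumes Y: "cond_proj M G Z Y" and Y': "cond_proj M G' Z Y'"
    and sub: "\<And>H :: 'a \<Rightarrow> real. H \<in> borel_measurable G \<Longrightarrow> H \<in> borel_measurable G'"
  shows "cond_proj M G Y' Y"
  unfolding cond_proj_def
  using cond_projD[OF Y] cond_projD[OF Y'] sub by fastforce

text \<open>Pythagoras: the residual \<open>Z - Y\<close> is orthogonal to \<open>Y\<close>.\<close>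

lemma cond_proj_l2:
  assumes "cond_proj M G Z Y"
  shows "l2 M Y \<le> l2 M Z" "l2 M (\<lambda>\<omega>. Z \<omega> - Y \<omega>) \<le> l2 M Z"
proof -
  note a = cond_projD[OF assms]
  have d: "L2_rv M (\<lambda>\<omega>. Z \<omega> - Y \<omega>)" by (rule L2_rv_diff[OF a(1,2)])
  have o: "(\<integral>\<omega>. Y \<omega> * (Z \<omega> - Y \<omega>) \<partial>M) = 0"
    using a(4)[OF a(3,2)] L2_rv_mult_integrable[OF a(2) a(1)] L2_rv_mult_integrable[OF a(2) a(2)]
    by (simp add: algebra_simps)
  have "(l2 M Z)\<^sup>2 = (\<integral>\<omega>. (Z \<omega> - Y \<omega>)\<^sup>2 + 2 * (Y \<omega> * (Z \<omega> - Y \<omega>)) + (Y \<omega>)\<^sup>2 \<partial>M)"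
    unfolding l2_power2 by (intro Bochner_Integration.integral_cong refl) (simp add: power2_eq_square algebra_simps)
  also have "\<dots> = (l2 M (\<lambda>\<omega>. Z \<omega> - Y \<omega>))\<^sup>2 + (l2 M Y)\<^sup>2"
    using L2_rvD(2)[OF d] L2_rvD(2)[OF a(2)] L2_rv_mult_integrable[OF a(2) d] o by (simp add: l2_power2)
  finally have "(l2 M Y)\<^sup>2 \<le> (l2 M Z)\<^sup>2" "(l2 M (\<lambda>\<omega>. Z \<omega> - Y \<omega>))\<^sup>2 \<le> (l2 M Z)\<^sup>2" by simp_all
  then show "l2 M Y \<le> l2 M Z" "l2 M (\<lambda>\<omega>. Z \<omega> - Y \<omega>) \<le> l2 M Z"
    by (auto intro: power2_le_imp_le)
qed

context prob_space begin

lemma cond_proj_cond_exp: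
  assumes G: "subalgebra M G" and f: "L2_rv M f"
  shows "cond_proj M G f (real_cond_exp M G f)"
proof -
  interpret G: sigma_finite_subalgebra M G using G by (rule sigma_finite_subalgebraI)
  have "L2_rv M (real_cond_exp M G f)"
    using f L2_rv_integrable[OF f] unfolding L2_rv_def
    by (intro conjI G.integrable_convex_cond_exp[where I=UNIV and q="\<lambda>x. x\<^sup>2"]; auto intro: convex_power2)+
  moreover have "(\<integral>\<omega>. H \<omega> * f \<omega> \<partial>M) = (\<integral>\<omega>. H \<omega> * real_cond_exp M G f \<omega> \<partial>M)"
    if H: "H \<in> borel_measurable G" "L2_rv M H" for H
    by (rule G.real_cond_exp_intg(2)[OF L2_rv_mult_integrable[OF H(2) f] H(1), symmetric]) (use f in auto)
  ultimately show ?thesis using f by (auto simp: cond_proj_def)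
qed

end


section \<open>Square integrable martingales in discrete time\<close>

text \<open>The differences are indexed from 0: \<open>D k\<close> is known at time \<open>k + 1\<close> and orthogonal to the past up to time \<open>k\<close>.
  Orthogonality to square integrable variables replaces the conditional expectation, so no null sets appear.\<close>

locale L2_martingale = prob_space M
  for M :: "'a measure" +
  fixes G :: "nat \<Rightarrow> 'a measure" and D :: "nat \<Rightarrow> 'a \<Rightarrow> real"
  assumes G_sub: "subalgebra M (G k)"
    and G_mono: "i \<le> j \<Longrightarrow> sets (G i) \<subseteq> sets (G j)"
    and D_adapted: "D k \<in> borel_measurable (G (Suc k))"
    and D_L2: "L2_rv M (D k)"
    and D_orth: "H \<in> borel_measurable (G k) \<Longrightarrow> L2_rv M H \<Longrightarrow> (\<integral>\<omega>. H \<omega> * D k \<omega> \<partial>M) = 0"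
begin

definition mg :: "nat \<Rightarrow> 'a \<Rightarrow> real" where
  "mg k \<omega> = (\<Sum>i<k. D i \<omega>)"

lemma mg_0 [simp]: "mg 0 \<omega> = 0" and mg_Suc: "mg (Suc k) \<omega> = mg k \<omega> + D k \<omega>"
  by (auto simp: mg_def)

lemma G_subalg: "i \<le> j \<Longrightarrow> subalgebra (G j) (G i)"
  using G_mono[of i j] G_sub[of i] G_sub[of j] by (auto simp: subalgebra_def)

lemma G_measurable_mono: "f \<in> borel_measurable (G i) \<Longrightarrow> i \<le> j \<Longrightarrow> f \<in> borel_measurable (G j)"
  using measurable_from_subalg[OF G_subalg] by blast

lemma G_measurable_M: "f \<in> borel_measurable (G i) \<Longrightarrow> f \<in> borel_measurable M"
  using measurable_from_subalg[OF G_sub] by blast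

lemma mg_adapted: "k \<le> n \<Longrightarrow> mg k \<in> borel_measurable (G n)"
  unfolding mg_def
  by (intro borel_measurable_sum G_measurable_mono[OF D_adapted]) auto

lemma mg_L2: "L2_rv M (mg k)"
  unfolding mg_def by (intro L2_rv_sum D_L2)

lemma mg_M [measurable]: "mg k \<in> borel_measurable M" and D_M [measurable]: "D k \<in> borel_measurable M"
  using mg_L2 D_L2 by auto

lemma l2_mg: "(l2 M (mg n))\<^sup>2 = (\<Sum>k<n. (l2 M (D k))\<^sup>2)"
proof (induction n)
  case 0
  then show ?case by (simp add: l2_def)
next
  case (Suc n)
  have "(l2 M (mg (Suc n)))\<^sup>2 = (\<integral>\<omega>. (mg n \<omega>)\<^sup>2 + 2 * (mg n \<omega> * D n \<omega>) + (D n \<omega>)\<^sup>2 \<partial>M)"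
    unfolding l2_power2 mg_Suc by (intro Bochner_Integration.integral_cong refl) (simp add: power2_sum)
  also have "\<dots> = (l2 M (mg n))\<^sup>2 + 2 * (\<integral>\<omega>. mg n \<omega> * D n \<omega> \<partial>M) + (l2 M (D n))\<^sup>2"
    using L2_rvD(2)[OF mg_L2] L2_rvD(2)[OF D_L2] L2_rv_mult_integrable[OF mg_L2 D_L2]
    by (simp add: l2_power2)
  also have "(\<integral>\<omega>. mg n \<omega> * D n \<omega> \<partial>M) = 0"
    by (intro D_orth mg_adapted mg_L2 order_refl)
  finally show ?case using Suc by simp
qed

lemma martingale_transform:
  assumes H: "\<And>k. H k \<in> borel_measurable (G k)" and B: "\<And>k \<omega>. \<bar>H k \<omega>\<bar> \<le> B"
  shows "L2_martingale M G (\<lambda>k \<omega>. H k \<omega> * D k \<omega>)"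
proof unfold_locales
  show "subalgebra M (G k)" for k by (rule G_sub)
  show "i \<le> j \<Longrightarrow> sets (G i) \<subseteq> sets (G j)" for i j by (rule G_mono)
  show "(\<lambda>\<omega>. H k \<omega> * D k \<omega>) \<in> borel_measurable (G (Suc k))" for k
    by (intro borel_measurable_times D_adapted G_measurable_mono[OF H]) simp
  have HM [measurable]: "H k \<in> borel_measurable M" for k by (rule G_measurable_M[OF H])
  have B0: "0 \<le> B" using B[of 0 undefined] by linarith
  show "L2_rv M (\<lambda>\<omega>. H k \<omega> * D k \<omega>)" for k
  proof (rule L2_rv_bound(1)[OF L2_rv_cmult[OF D_L2[of k], of B]])
    show "AE \<omega> in M. \<bar>H k \<omega> * D k \<omega>\<bar> \<le> \<bar>B * D k \<omega>\<bar>"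
      using B[of k] B0 by (intro AE_I2) (simp add: abs_mult mult_right_mono)
  qed measurable
  fix K k assume K: "K \<in> borel_measurable (G k)" "L2_rv M K"
  have [measurable]: "K \<in> borel_measurable M" using K by auto
  have "L2_rv M (\<lambda>\<omega>. K \<omega> * H k \<omega>)"
  proof (rule L2_rv_bound(1)[OF L2_rv_cmult[OF K(2), of B]])
    show "AE \<omega> in M. \<bar>K \<omega> * H k \<omega>\<bar> \<le> \<bar>B * K \<omega>\<bar>"
      using mult_left_mono[OF B[of k] abs_ge_zero] B0 by (intro AE_I2) (simp add: abs_mult mult.commute[of B])
  qed measurable
  from D_orth[OF _ this] K(1) H[of k] have "(\<integral>\<omega>. (K \<omega> * H k \<omega>) * D k \<omega> \<partial>M) = 0"
    by (simp add: borel_measurable_times)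
  then show "(\<integral>\<omega>. K \<omega> * (H k \<omega> * D k \<omega>) \<partial>M) = 0" by (simp add: mult.assoc)
qed

lemma martingale_shift: "L2_martingale M (\<lambda>k. G (a + k)) (\<lambda>k. D (a + k))"
proof
  show "subalgebra M (G (a + k))" for k by (rule G_sub)
  show "i \<le> j \<Longrightarrow> sets (G (a + i)) \<subseteq> sets (G (a + j))" for i j by (rule G_mono) simp
  show "D (a + k) \<in> borel_measurable (G (a + Suc k))" for k using D_adapted[of "a + k"] by simp
  show "L2_rv M (D (a + k))" for k by (rule D_L2)
  show "(\<integral>\<omega>. H \<omega> * D (a + k) \<omega> \<partial>M) = 0" if "H \<in> borel_measurable (G (a + k))" "L2_rv M H" for H k
    using that by (rule D_orth)
qed

end

subsection \<open>Maximal inequalities\<close>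

definition run_max :: "(nat \<Rightarrow> real) \<Rightarrow> nat \<Rightarrow> real" where
  "run_max s n = Max (s ` {..n})"

lemma run_max_0 [simp]: "run_max s 0 = s 0"
  by (simp add: run_max_def)

lemma run_max_Suc: "run_max s (Suc n) = max (s (Suc n)) (run_max s n)"
  by (simp add: run_max_def atMost_Suc)

lemma run_max_ge: "k \<le> n \<Longrightarrow> s k \<le> run_max s n"
  by (simp add: run_max_def)

lemma run_max_le: "(\<And>k. k \<le> n \<Longrightarrow> s k \<le> b) \<Longrightarrow> run_max s n \<le> b"
  by (simp add: run_max_def)

lemma run_max_measurable [measurable (raw)]:
  assumes "\<And>k. k \<le> n \<Longrightarrow> (\<lambda>\<omega>. s \<omega> k) \<in> borel_measurable G"
  shows "(\<lambda>\<omega>. run_max (s \<omega>) n) \<in> borel_measurable G"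
  unfolding run_max_def using assms by (intro borel_measurable_Max) auto

text \<open>Summation by parts, using that \<open>s\<close> agrees with its running maximum whenever the latter increases. For
  \<open>s = |M|\<close> the sum on the left dominates a martingale transform, so taking expectations yields Doob's
  \<open>L\<^sup>2\<close> inequality.\<close>

lemma pathwise_Doob:
  fixes s :: "nat \<Rightarrow> real"
  assumes "s 0 = 0"
  shows "(run_max s n)\<^sup>2 + 4 * (\<Sum>k<n. run_max s k * (s (Suc k) - s k)) \<le> 4 * (s n)\<^sup>2"
proof -
  have "(\<Sum>k<n. run_max s k * (s (Suc k) - s k)) \<le> run_max s n * s n - (run_max s n)\<^sup>2 / 2"
  proof (induction n)
    case 0
    show ?case using assms by simp
  next
    case (Suc n)
    define a b x y where "a = run_max s n" and "b = run_max s (Suc n)" and "x = s n" and "y = s (Suc n)"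
    have "b = y \<and> a \<le> y \<or> b = a" unfolding a_def b_def y_def run_max_Suc by linarith
    moreover have "(a - y)\<^sup>2 \<ge> 0" by simp
    ultimately have "a * x - a\<^sup>2 / 2 + a * (y - x) \<le> b * y - b\<^sup>2 / 2"
      by (auto simp: power2_eq_square algebra_simps)
    then show ?case using Suc by (simp add: a_def b_def x_def y_def)
  qed
  moreover have "0 \<le> (run_max s n - 2 * s n)\<^sup>2" by simp
  ultimately show ?thesis by (simp add: power2_eq_square algebra_simps)
qed

lemma abs_sgn_increment:
  fixes x d :: real
  shows "sgn x * d \<le> \<bar>x + d\<bar> - \<bar>x\<bar>"
  by (cases x "0::real" rule: linorder_cases) auto

text \<open>When the running maximum of \<open>|m|\<close> first reaches \<open>2 \<alpha>\<close>, the excess \<open>(|m| - \<alpha>)\<^sup>+\<close> is at least \<open>\<alpha>\<close>; afterwards, by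
  convexity, it grows at least as fast as the transform of \<open>m\<close> by \<open>h\<close>.\<close>

lemma pathwise_excess:
  fixes m d :: "nat \<Rightarrow> real"
  assumes "m 0 = 0" and "\<And>k. m (Suc k) = m k + d k" and "\<alpha> > 0"
  defines "h \<equiv> \<lambda>k. (if 2 * \<alpha> \<le> run_max (\<lambda>i. \<bar>m i\<bar>) k \<and> \<alpha> < \<bar>m k\<bar> then sgn (m k) else 0)"
  shows "(if 2 * \<alpha> \<le> run_max (\<lambda>i. \<bar>m i\<bar>) n then \<alpha> else 0) + (\<Sum>k<n. h k * d k) \<le> max 0 (\<bar>m n\<bar> - \<alpha>)"
proof (induction n)
  case 0
  then show ?case using assms by simp
next
  case (Suc n)
  let ?r = "run_max (\<lambda>i. \<bar>m i\<bar>)"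
  have hh: "h n * d n \<le> max 0 (\<bar>m (Suc n)\<bar> - \<alpha>) - max 0 (\<bar>m n\<bar> - \<alpha>)" if "2 * \<alpha> \<le> ?r n"
    using that abs_sgn_increment[of "m n" "d n"] assms(3) unfolding h_def assms(2) by auto
  show ?case
  proof (cases "2 * \<alpha> \<le> ?r n")
    case True
    then have "2 * \<alpha> \<le> ?r (Suc n)" by (simp add: run_max_Suc)
    then show ?thesis using hh[OF True] True Suc by simp
  next
    case False
    have "h k = 0" if "k \<le> n" for k
    proof -
      have "?r k \<le> ?r n" using that by (intro run_max_le run_max_ge) auto
      then show ?thesis using False by (simp add: h_def)
    qed
    then have z: "(\<Sum>k<Suc n. h k * d k) = 0" by (intro sum.neutral) auto
    show ?thesis unfolding z using False assms(3) by (auto simp: run_max_Suc max_def)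
  qed
qed

context L2_martingale begin

lemma L2_run_max_abs: "L2_rv M (\<lambda>\<omega>. run_max (\<lambda>i. \<bar>mg i \<omega>\<bar>) n)"
proof (rule L2_rv_bound(1))
  show "L2_rv M (\<lambda>\<omega>. \<Sum>i\<le>n. \<bar>mg i \<omega>\<bar>)" by (intro L2_rv_sum L2_rv_abs mg_L2)
  have "\<bar>run_max (\<lambda>i. \<bar>mg i \<omega>\<bar>) n\<bar> \<le> \<bar>\<Sum>i\<le>n. \<bar>mg i \<omega>\<bar>\<bar>" for \<omega>
  proof -
    have "0 \<le> run_max (\<lambda>i. \<bar>mg i \<omega>\<bar>) n" using run_max_ge[of 0 n "\<lambda>i. \<bar>mg i \<omega>\<bar>"] by simp
    moreover have "run_max (\<lambda>i. \<bar>mg i \<omega>\<bar>) n \<le> (\<Sum>i\<le>n. \<bar>mg i \<omega>\<bar>)"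
      by (intro run_max_le member_le_sum) auto
    moreover have "0 \<le> (\<Sum>i\<le>n. \<bar>mg i \<omega>\<bar>)" by (intro sum_nonneg) auto
    ultimately show ?thesis by linarith
  qed
  then show "AE \<omega> in M. \<bar>run_max (\<lambda>i. \<bar>mg i \<omega>\<bar>) n\<bar> \<le> \<bar>\<Sum>i\<le>n. \<bar>mg i \<omega>\<bar>\<bar>" by auto
qed measurable

lemma Doob_L2:
  "(l2 M (\<lambda>\<omega>. run_max (\<lambda>i. \<bar>mg i \<omega>\<bar>) n))\<^sup>2 \<le> 4 * (\<Sum>k<n. (l2 M (D k))\<^sup>2)"
proof -
  let ?r = "\<lambda>\<omega> k. run_max (\<lambda>i. \<bar>mg i \<omega>\<bar>) k"
  let ?H = "\<lambda>k \<omega>. ?r \<omega> k * sgn (mg k \<omega>)"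
  have mgk: "mg i \<in> borel_measurable (G k)" if "i \<le> k" for i k using mg_adapted that by blast
  have HG: "?H k \<in> borel_measurable (G k)" for k
    using mgk by (intro borel_measurable_times run_max_measurable borel_measurable_abs borel_measurable_sgn) auto
  have HL: "L2_rv M (?H k)" for k
    by (rule L2_rv_bound(1)[OF L2_run_max_abs[of k]]) (auto simp: abs_mult abs_sgn_eq)
  have pw: "(?r \<omega> n)\<^sup>2 \<le> 4 * (mg n \<omega>)\<^sup>2 - 4 * (\<Sum>k<n. ?H k \<omega> * D k \<omega>)" for \<omega>
  proof -
    have "(\<Sum>k<n. ?H k \<omega> * D k \<omega>) \<le> (\<Sum>k<n. ?r \<omega> k * (\<bar>mg (Suc k) \<omega>\<bar> - \<bar>mg k \<omega>\<bar>))"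
    proof (rule sum_mono)
      fix k
      have "0 \<le> ?r \<omega> k" using run_max_ge[of 0 k "\<lambda>i. \<bar>mg i \<omega>\<bar>"] by simp
      then show "?H k \<omega> * D k \<omega> \<le> ?r \<omega> k * (\<bar>mg (Suc k) \<omega>\<bar> - \<bar>mg k \<omega>\<bar>)"
        using abs_sgn_increment[of "mg k \<omega>" "D k \<omega>"] by (simp add: mg_Suc mult.assoc mult_left_mono)
    qed
    then show ?thesis using pathwise_Doob[of "\<lambda>i. \<bar>mg i \<omega>\<bar>" n] by simp
  qed
  have i: "integrable M (\<lambda>\<omega>. ?H k \<omega> * D k \<omega>)" for k by (rule L2_rv_mult_integrable[OF HL D_L2])
  have "(l2 M (\<lambda>\<omega>. ?r \<omega> n))\<^sup>2 \<le> (\<integral>\<omega>. 4 * (mg n \<omega>)\<^sup>2 - 4 * (\<Sum>k<n. ?H k \<omega> * D k \<omega>) \<partial>M)"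
    unfolding l2_power2
    using L2_rvD(2)[OF mg_L2[of n]] L2_rvD(2)[OF L2_run_max_abs[of n]] i pw by (intro integral_mono) auto
  also have "\<dots> = 4 * (l2 M (mg n))\<^sup>2 - 4 * (\<Sum>k<n. \<integral>\<omega>. ?H k \<omega> * D k \<omega> \<partial>M)"
    using L2_rvD(2)[OF mg_L2[of n]] i by (simp add: l2_power2)
  also have "(\<Sum>k<n. \<integral>\<omega>. ?H k \<omega> * D k \<omega> \<partial>M) = 0"
    by (intro sum.neutral ballI D_orth HG HL)
  finally show ?thesis by (simp add: l2_mg)
qed

text \<open>For an approximately normal \<open>M\<close> of variance \<open>r\<close> the right-hand side is of order \<open>r\<^sup>2 / \<alpha>\<^sup>3\<close>. Chebyshev's inequality
  would give only the order \<open>r\<close>, which does not become small when summed over many short blocks.\<close>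

lemma maximal_excess:
  assumes "\<alpha> > 0"
  shows "\<alpha> * prob {\<omega>\<in>space M. 2 * \<alpha> \<le> run_max (\<lambda>i. \<bar>mg i \<omega>\<bar>) n} \<le> (\<integral>\<omega>. max 0 (\<bar>mg n \<omega>\<bar> - \<alpha>) \<partial>M)"
proof -
  let ?r = "\<lambda>\<omega> k. run_max (\<lambda>i. \<bar>mg i \<omega>\<bar>) k"
  let ?H = "\<lambda>k \<omega>. (if 2 * \<alpha> \<le> ?r \<omega> k \<and> \<alpha> < \<bar>mg k \<omega>\<bar> then sgn (mg k \<omega>) else 0)"
  have HG: "?H k \<in> borel_measurable (G k)" for k
  proof -
    have [measurable]: "mg k \<in> borel_measurable (G k)" "(\<lambda>\<omega>. ?r \<omega> k) \<in> borel_measurable (G k)"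
      by (auto intro!: run_max_measurable borel_measurable_abs mg_adapted)
    show ?thesis by measurable
  qed
  have HL: "L2_rv M (?H k)" for k
    by (rule L2_rv_bounded[where B=1, OF G_measurable_M[OF HG]]) (auto simp: abs_sgn_eq)
  have i: "integrable M (\<lambda>\<omega>. ?H k \<omega> * D k \<omega>)" for k by (rule L2_rv_mult_integrable[OF HL D_L2])
  define A where "A = {\<omega>\<in>space M. 2 * \<alpha> \<le> ?r \<omega> n}"
  have [measurable]: "A \<in> sets M" unfolding A_def by measurable
  have iA: "integrable M (indicat_real A)"
    by (rule integrable_real_indicator) (auto simp: emeasure_eq_measure)
  have "\<alpha> * prob A = (\<integral>\<omega>. \<alpha> * indicator A \<omega> \<partial>M)" by simp
  also have "\<dots> = (\<integral>\<omega>. \<alpha> * indicator A \<omega> \<partial>M) + (\<Sum>k<n. \<integral>\<omega>. ?H k \<omega> * D k \<omega> \<partial>M)"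
    using D_orth[OF HG HL] by simp
  also have "\<dots> = (\<integral>\<omega>. \<alpha> * indicator A \<omega> + (\<Sum>k<n. ?H k \<omega> * D k \<omega>) \<partial>M)"
    using i iA by (subst Bochner_Integration.integral_add) auto
  also have "\<dots> \<le> (\<integral>\<omega>. max 0 (\<bar>mg n \<omega>\<bar> - \<alpha>) \<partial>M)"
  proof (rule integral_mono)
    show "integrable M (\<lambda>\<omega>. \<alpha> * indicator A \<omega> + (\<Sum>k<n. ?H k \<omega> * D k \<omega>))"
      using i iA by auto
    show "integrable M (\<lambda>\<omega>. max 0 (\<bar>mg n \<omega>\<bar> - \<alpha>))"
      using L2_rv_integrable[OF mg_L2[of n]] by auto
    show "\<alpha> * indicator A \<omega> + (\<Sum>k<n. ?H k \<omega> * D k \<omega>) \<le> max 0 (\<bar>mg n \<omega>\<bar> - \<alpha>)" if "\<omega> \<in> space M" for \<omega>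
      using pathwise_excess[of "\<lambda>k. mg k \<omega>" "\<lambda>k. D k \<omega>" \<alpha> n, OF mg_0 mg_Suc assms] that
      by (auto simp: A_def split: if_splits)
  qed
  finally show ?thesis unfolding A_def .
qed

end


section \<open>A quantitative central limit theorem for martingales\<close>

lemma norm_diff3: "norm (a - b - c) \<le> norm a + norm b + norm (c :: 'a :: real_normed_vector)"
  using norm_triangle_ineq4[of "a - b" c] norm_triangle_ineq4[of a b] by linarith

text \<open>Both sides have the expansion \<open>1 + i x - x\<^sup>2 / 2\<close> up to terms of third order. The second bound makes it
  possible to multiply the estimates over many factors without loss.\<close>

lemma iexp_McLeish_factor:
  fixes x :: real
  assumes "\<bar>x\<bar> \<le> 1"
  shows "cmod ((1 + \<i> * x) * exp (- (x\<^sup>2 / 2)) - iexp x) \<le> 2 * \<bar>x\<bar> ^ 3"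
    and "cmod ((1 + \<i> * x) * exp (- (x\<^sup>2 / 2))) \<le> 1"
proof -
  define y where "y = x\<^sup>2 / 2"
  have x2: "x\<^sup>2 \<le> 1" using assms by (simp add: abs_square_le_1)
  have y: "0 \<le> y" "y \<le> 1" using x2 by (auto simp: y_def)
  have n1: "cmod (1 + \<i> * x) = sqrt (1 + 2 * y)" by (simp add: cmod_def y_def)
  have "cmod (iexp x - (\<Sum>k\<le>2. (\<i> * x)^k / fact k)) \<le> \<bar>x\<bar>^(Suc 2) / fact (Suc 2)"
    by (rule iexp_approx1)
  moreover have "(\<Sum>k\<le>2. (\<i> * x)^k / fact k) = 1 + \<i> * x - complex_of_real y"
    by (simp add: complex_eq_iff numeral_2_eq_2 power2_eq_square y_def)
  ultimately have e1: "cmod (iexp x - (1 + \<i> * x - complex_of_real y)) \<le> \<bar>x\<bar> ^ 3 / 6"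
    by (simp add: fact_numeral numeral_3_eq_3[symmetric] del: of_real_exp)
  have e2: "\<bar>exp (- y) - (1 - y)\<bar> \<le> y\<^sup>2"
  proof -
    have l: "1 - y \<le> exp (- y)" using exp_ge_add_one_self[of "-y"] by simp
    have "(1 - y + y\<^sup>2) * (1 + y) = 1 + y ^ 3" by (simp add: power2_eq_square power3_eq_cube algebra_simps)
    then have "1 \<le> (1 - y + y\<^sup>2) * (1 + y)" using y by simp
    then have "1 / (1 + y) \<le> 1 - y + y\<^sup>2" using y by (simp add: pos_divide_le_eq)
    moreover have "exp (- y) \<le> 1 / (1 + y)"
      using exp_ge_add_one_self[of y] y by (simp add: exp_minus inverse_eq_divide frac_le)
    ultimately show ?thesis using l by simp
  qed
  have "cmod ((1 + \<i> * x) * exp (- y) - iexp x)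
    = cmod ((1 + \<i> * x) * complex_of_real (exp (- y) - (1 - y)) - \<i> * (x * y) - (iexp x - (1 + \<i> * x - complex_of_real y)))"
    by (rule arg_cong[where f=cmod]) (simp add: algebra_simps)
  also have "\<dots> \<le> cmod ((1 + \<i> * x) * complex_of_real (exp (- y) - (1 - y))) + cmod (\<i> * (x * y))
       + cmod (iexp x - (1 + \<i> * x - complex_of_real y))"
    by (rule norm_diff3)
  also have "\<dots> \<le> 2 * y\<^sup>2 + \<bar>x\<bar> * y + \<bar>x\<bar> ^ 3 / 6"
  proof (intro add_mono e1)
    have "sqrt (1 + 2 * y) \<le> sqrt 4" using y by (intro real_sqrt_le_mono) simp
    then show "cmod ((1 + \<i> * x) * complex_of_real (exp (- y) - (1 - y))) \<le> 2 * y\<^sup>2"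
      unfolding norm_mult n1 norm_of_real using e2 by (intro mult_mono) auto
    show "cmod (\<i> * (x * y)) \<le> \<bar>x\<bar> * y" using y by (simp add: norm_mult)
  qed
  also have "\<dots> \<le> 2 * \<bar>x\<bar> ^ 3"
  proof -
    have "x\<^sup>2 * \<bar>x\<bar>\<^sup>2 = \<bar>x\<bar> ^ 3 * \<bar>x\<bar>"
      by (metis power2_abs power3_eq_cube power2_eq_square mult.assoc)
    also have "\<dots> \<le> \<bar>x\<bar> ^ 3 * 1" by (rule mult_left_mono[OF assms]) simp
    finally have "x\<^sup>2 * \<bar>x\<bar>\<^sup>2 \<le> \<bar>x\<bar> ^ 3 * 1" .
    then have "2 * y\<^sup>2 \<le> \<bar>x\<bar> ^ 3 / 2" by (simp add: y_def power2_eq_square)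
    moreover have "\<bar>x\<bar> * y = \<bar>x\<bar> ^ 3 / 2"
      by (simp add: y_def power2_eq_square power3_eq_cube)
    moreover have "0 \<le> \<bar>x\<bar> ^ 3" by simp
    ultimately show ?thesis by linarith
  qed
  finally show "cmod ((1 + \<i> * x) * exp (- (x\<^sup>2 / 2)) - iexp x) \<le> 2 * \<bar>x\<bar> ^ 3" by (simp add: y_def)
  have "sqrt (1 + 2 * y) \<le> 1 + y"
    using y by (intro real_le_lsqrt) (auto simp: power2_eq_square algebra_simps)
  also have "\<dots> \<le> exp y" by simp
  finally have "cmod (1 + \<i> * x) * exp (- y) \<le> exp y * exp (- y)" unfolding n1 by (intro mult_right_mono) auto
  then show "cmod ((1 + \<i> * x) * exp (- (x\<^sup>2 / 2))) \<le> 1"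
    by (simp only: norm_mult y_def norm_of_real abs_exp_cancel) (simp add: exp_minus)
qed

lemma abs_exp_minus_diff_le:
  fixes a b :: real
  assumes "0 \<le> a" "0 \<le> b"
  shows "\<bar>exp (- a) - exp (- b)\<bar> \<le> \<bar>a - b\<bar>"
proof -
  have *: "\<bar>exp (- a) - exp (- b)\<bar> \<le> b - a" if "0 \<le> a" "a \<le> b" for a b :: real
  proof -
    have "exp (- a) - exp (- b) = exp (- a) * (1 - exp (- (b - a)))"
      by (simp add: exp_diff exp_minus field_simps)
    also have "\<dots> \<le> 1 * (b - a)"
      using that exp_ge_add_one_self[of "- (b - a)"] by (intro mult_mono) (auto simp: algebra_simps)
    finally show ?thesis using that by simp
  qed
  show ?thesis using *[of a b] *[of b a] assms by (cases "a \<le> b") auto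
qed

text \<open>The factors of McLeish's exponential martingale, as complex numbers attached to a real sequence
  \<open>d\<close>; a factor is switched off once the sum of the preceding squares exceeds \<open>r\<close>,
  a predictable rule under which only the last active factor can be large.\<close>

definition McLeish :: "real \<Rightarrow> real \<Rightarrow> (nat \<Rightarrow> real) \<Rightarrow> nat \<Rightarrow> complex" where
  "McLeish u r d n = (\<Prod>k<n. 1 + \<i> * u * ((if (\<Sum>i<k. (d i)\<^sup>2) \<le> r then d k else 0)))"

lemma McLeish_Suc: "McLeish u r d (Suc n) = McLeish u r d n
    * (1 + \<i> * u * ((if (\<Sum>i<n. (d i)\<^sup>2) \<le> r then d n else 0)))"
  by (simp add: McLeish_def)

lemma McLeish_norm_active:
  assumes "(\<Sum>i<n. (d i)\<^sup>2) \<le> r"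
  shows "(cmod (McLeish u r d n))\<^sup>2 \<le> exp (u\<^sup>2 * r)"
proof -
  have "(cmod (McLeish u r d k))\<^sup>2 \<le> exp (u\<^sup>2 * (\<Sum>i<k. (d i)\<^sup>2))" for k
  proof (induction k)
    case 0
    then show ?case by (simp add: McLeish_def)
  next
    case (Suc k)
    define z where "z = (if (\<Sum>i<k. (d i)\<^sup>2) \<le> r then d k else 0)"
    have "(cmod (1 + \<i> * u * z))\<^sup>2 = 1 + (u * z)\<^sup>2" by (simp add: cmod_power2)
    also have "\<dots> \<le> 1 + u\<^sup>2 * (d k)\<^sup>2" by (simp add: z_def power_mult_distrib)
    also have "\<dots> \<le> exp (u\<^sup>2 * (d k)\<^sup>2)" by (rule exp_ge_add_one_self)
    finally have "(cmod (McLeish u r d k))\<^sup>2 * (cmod (1 + \<i> * u * z))\<^sup>2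
      \<le> exp (u\<^sup>2 * (\<Sum>i<k. (d i)\<^sup>2)) * exp (u\<^sup>2 * (d k)\<^sup>2)"
      using Suc by (intro mult_mono) auto
    then show ?case
      unfolding McLeish_Suc z_def[symmetric] norm_mult power_mult_distrib
      by (simp add: distrib_left exp_add)
  qed
  also have "exp (u\<^sup>2 * (\<Sum>i<n. (d i)\<^sup>2)) \<le> exp (u\<^sup>2 * r)" using assms by (simp add: mult_left_mono)
  finally show ?thesis .
qed

text \<open>The product may contain one factor beyond the moment when the sum of squares exceeds \<open>r\<close>; that factor is
  controlled by the bound \<open>q\<close> for a single difference.\<close>

lemma McLeish_norm:
  assumes "\<And>i. i < n \<Longrightarrow> \<bar>d i\<bar> \<le> q" "0 \<le> r"
  shows "(cmod (McLeish u r d n))\<^sup>2 \<le> exp (u\<^sup>2 * r) * (1 + u\<^sup>2 * q\<^sup>2)"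
  using assms(1)
proof (induction n)
  case 0
  have "1 \<le> exp (u\<^sup>2 * r)" "1 \<le> 1 + u\<^sup>2 * q\<^sup>2" using assms(2) by auto
  from mult_mono[OF this] show ?case by (simp add: McLeish_def)
next
  case (Suc n)
  show ?case
  proof (cases "(\<Sum>i<n. (d i)\<^sup>2) \<le> r")
    case True
    have "(cmod (1 + \<i> * u * d n))\<^sup>2 = 1 + u\<^sup>2 * (d n)\<^sup>2" by (simp add: cmod_power2 power_mult_distrib)
    also have "\<dots> \<le> 1 + u\<^sup>2 * q\<^sup>2"
      using Suc.prems[of n] by (intro add_left_mono mult_left_mono) (auto intro: abs_le_square_iff[THEN iffD1])
    finally show ?thesis
      using McLeish_norm_active[OF True, of u] True
      by (auto simp: McLeish_Suc norm_mult power_mult_distrib intro!: mult_mono)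
  next
    case False
    then show ?thesis using Suc by (simp add: McLeish_Suc)
  qed
qed

text \<open>On the event that the increments are small and their squares sum to about \<open>s\<close>, the
  exponential martingale is \<open>exp(i u M + u\<^sup>2 s / 2)\<close> up to a small error.\<close>

lemma McLeish_approx:
  assumes small: "\<And>i. i < n \<Longrightarrow> \<bar>d i\<bar> \<le> \<delta>" and V: "\<bar>(\<Sum>i<n. (d i)\<^sup>2) - s\<bar> \<le> \<delta>"
    and s: "0 \<le> s" and d: "\<delta> \<le> 1" "\<bar>u\<bar> * \<delta> \<le> 1"
  shows "cmod (iexp (u * (\<Sum>i<n. d i)) - McLeish u (s + 1) d n * exp (- (u\<^sup>2 * s / 2)))
    \<le> \<delta> * (2 * \<bar>u\<bar> ^ 3 * (s + 1) + u\<^sup>2 * exp (u\<^sup>2 * (s + 1)))"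
proof -
  define v where "v = (\<Sum>i<n. (d i)\<^sup>2)"
  let ?p = "\<lambda>i. (1 + \<i> * (u * d i)) * exp (- ((u * d i)\<^sup>2 / 2))"
  let ?T = "McLeish u (s + 1) d n"
  have d0: "0 \<le> \<delta>" using V by linarith
  have vn: "0 \<le> v" by (simp add: v_def sum_nonneg)
  have act: "(\<Sum>i<k. (d i)\<^sup>2) \<le> s + 1" if "k \<le> n" for k
  proof -
    have "(\<Sum>i<k. (d i)\<^sup>2) \<le> v" unfolding v_def using that by (intro sum_mono2) auto
    then show ?thesis using V d(1) by (simp add: v_def)
  qed
  have T: "?T = (\<Prod>i<n. 1 + \<i> * (u * d i))"
    unfolding McLeish_def by (intro prod.cong refl) (use act in auto)
  have x: "\<bar>u * d i\<bar> \<le> 1" if "i < n" for i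
    using order_trans[OF mult_left_mono[OF small[OF that] abs_ge_zero] d(2)] by (simp add: abs_mult)
  have "(\<Prod>i<n. complex_of_real (exp (- ((u * d i)\<^sup>2 / 2)))) = exp (- (u\<^sup>2 * v / 2))"
    by (simp add: exp_sum[symmetric] of_real_prod[symmetric] v_def sum_distrib_left sum_divide_distrib sum_negf power_mult_distrib
      del: of_real_exp of_real_prod)
  then have pT: "(\<Prod>i<n. ?p i) = ?T * exp (- (u\<^sup>2 * v / 2))" unfolding T prod.distrib by simp
  have qM: "(\<Prod>i<n. iexp (u * d i)) = iexp (u * (\<Sum>i<n. d i))"
    by (simp add: exp_sum[symmetric] sum_distrib_left)
  have "cmod ((\<Prod>i<n. ?p i) - (\<Prod>i<n. iexp (u * d i))) \<le> (\<Sum>i<n. cmod (?p i - iexp (u * d i)))"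
    by (rule norm_prod_diff) (use iexp_McLeish_factor(2)[OF x] in auto)
  also have "\<dots> \<le> (\<Sum>i<n. 2 * \<bar>u\<bar> ^ 3 * \<delta> * (d i)\<^sup>2)"
  proof (rule sum_mono)
    fix i assume "i \<in> {..<n}"
    then have i: "i < n" by simp
    have "\<bar>d i\<bar> ^ 3 = \<bar>d i\<bar> * \<bar>d i\<bar>\<^sup>2" by (simp only: power3_eq_cube power2_eq_square mult.assoc)
    then have "\<bar>u * d i\<bar> ^ 3 = \<bar>u\<bar> ^ 3 * (\<bar>d i\<bar> * (d i)\<^sup>2)"
      by (simp add: abs_mult power_mult_distrib)
    also have "\<dots> \<le> \<bar>u\<bar> ^ 3 * (\<delta> * (d i)\<^sup>2)"
      using small[OF i] by (intro mult_left_mono mult_right_mono) auto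
    finally show "cmod (?p i - iexp (u * d i)) \<le> 2 * \<bar>u\<bar> ^ 3 * \<delta> * (d i)\<^sup>2"
      using iexp_McLeish_factor(1)[OF x[OF i]] by (simp add: mult.assoc)
  qed
  also have "\<dots> = 2 * \<bar>u\<bar> ^ 3 * \<delta> * v" by (simp add: v_def sum_distrib_left)
  also have "\<dots> \<le> 2 * \<bar>u\<bar> ^ 3 * \<delta> * (s + 1)"
    using act[of n] d0 by (intro mult_left_mono) (auto simp: v_def)
  finally have 1: "cmod (?T * exp (- (u\<^sup>2 * v / 2)) - iexp (u * (\<Sum>i<n. d i))) \<le> 2 * \<bar>u\<bar> ^ 3 * \<delta> * (s + 1)"
    unfolding pT qM .
  have Tn: "cmod ?T \<le> exp (u\<^sup>2 * (s + 1))"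
  proof (rule power2_le_imp_le)
    have "(cmod ?T)\<^sup>2 \<le> exp (u\<^sup>2 * (s + 1))" using act by (intro McLeish_norm_active) auto
    also have "\<dots> \<le> (exp (u\<^sup>2 * (s + 1)))\<^sup>2" using s by (intro self_le_power) auto
    finally show "(cmod ?T)\<^sup>2 \<le> (exp (u\<^sup>2 * (s + 1)))\<^sup>2" .
  qed simp
  have "cmod (?T * exp (- (u\<^sup>2 * v / 2)) - ?T * exp (- (u\<^sup>2 * s / 2)))
      = cmod ?T * \<bar>exp (- (u\<^sup>2 * v / 2)) - exp (- (u\<^sup>2 * s / 2))\<bar>"
    by (simp only: right_diff_distrib[symmetric] norm_mult of_real_diff[symmetric] norm_of_real)
  also have "\<dots> \<le> exp (u\<^sup>2 * (s + 1)) * \<bar>u\<^sup>2 * v / 2 - u\<^sup>2 * s / 2\<bar>"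
    using s vn by (intro mult_mono Tn abs_exp_minus_diff_le) auto
  also have "\<bar>u\<^sup>2 * v / 2 - u\<^sup>2 * s / 2\<bar> = u\<^sup>2 / 2 * \<bar>v - s\<bar>"
    by (simp add: abs_mult right_diff_distrib[symmetric] diff_divide_distrib[symmetric])
  also have "\<dots> \<le> u\<^sup>2 * \<delta>"
    using mult_mono[of "u\<^sup>2 / 2" "u\<^sup>2" "\<bar>v - s\<bar>" \<delta>] V by (simp add: v_def)
  finally have 2: "cmod (?T * exp (- (u\<^sup>2 * v / 2)) - ?T * exp (- (u\<^sup>2 * s / 2))) \<le> exp (u\<^sup>2 * (s + 1)) * (u\<^sup>2 * \<delta>)"
    by simp
  have "cmod (iexp (u * (\<Sum>i<n. d i)) - ?T * exp (- (u\<^sup>2 * s / 2)))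
    = cmod ((?T * exp (- (u\<^sup>2 * v / 2)) - ?T * exp (- (u\<^sup>2 * s / 2))) -
       (?T * exp (- (u\<^sup>2 * v / 2)) - iexp (u * (\<Sum>i<n. d i))))" by (simp add: algebra_simps)
  also have "\<dots> \<le> exp (u\<^sup>2 * (s + 1)) * (u\<^sup>2 * \<delta>) + 2 * \<bar>u\<bar> ^ 3 * \<delta> * (s + 1)"
    by (rule order_trans[OF norm_triangle_ineq4 add_mono[OF 2 1]])
  finally show ?thesis by (simp add: algebra_simps)
qed

text \<open>The constant that collects the error terms of \<open>martingale_char_bound\<close>.\<close>

definition McLeish_const :: "real \<Rightarrow> real \<Rightarrow> real" where
  "McLeish_const u s = 2 * \<bar>u\<bar> ^ 3 * (s + 1) + u\<^sup>2 * exp (u\<^sup>2 * (s + 1)) + 2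
     + 2 * sqrt (exp (u\<^sup>2 * (s + 1)) * (1 + u\<^sup>2))"

context L2_martingale begin

lemma McLeish_measurable: "(\<lambda>\<omega>. McLeish u r (\<lambda>k. D k \<omega>) k) \<in> borel_measurable (G k)"
proof -
  have [measurable]: "D i \<in> borel_measurable (G k)" if "i < k" for i
    using that by (intro G_measurable_mono[OF D_adapted]) auto
  have "(\<lambda>\<omega>. if (\<Sum>i<j. (D i \<omega>)\<^sup>2) \<le> r then D j \<omega> else 0) \<in> borel_measurable (G k)" if "j < k" for j
  proof -
    have [measurable]: "(\<lambda>\<omega>. \<Sum>i<j. (D i \<omega>)\<^sup>2) \<in> borel_measurable (G k)"
      using that by (intro borel_measurable_sum) measurable
    show ?thesis using that by measurable
  qed
  then show ?thesis unfolding McLeish_def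
    by (intro borel_measurable_prod borel_measurable_add borel_measurable_times borel_measurable_of_real) auto
qed

lemma McLeish_measurable_M [measurable]: "(\<lambda>\<omega>. McLeish u r (\<lambda>k. D k \<omega>) k) \<in> borel_measurable M"
  using measurable_from_subalg[OF G_sub McLeish_measurable] .

lemma McLeish_L2:
  assumes "0 \<le> r"
  shows "L2_rv M (\<lambda>\<omega>. cmod (McLeish u r (\<lambda>k. D k \<omega>) n))"
proof -
  let ?b = "\<lambda>\<omega>. exp (u\<^sup>2 * r) * (1 + u\<^sup>2 * (\<Sum>i<n. \<bar>D i \<omega>\<bar>)\<^sup>2)"
  have "L2_rv M (\<lambda>\<omega>. \<Sum>i<n. \<bar>D i \<omega>\<bar>)" by (intro L2_rv_sum L2_rv_abs D_L2)
  then have i: "integrable M ?b" by auto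
  have "integrable M (\<lambda>\<omega>. (cmod (McLeish u r (\<lambda>k. D k \<omega>) n))\<^sup>2)"
  proof (rule Bochner_Integration.integrable_bound[OF i])
    have "norm ((cmod (McLeish u r (\<lambda>k. D k \<omega>) n))\<^sup>2) \<le> norm (?b \<omega>)" for \<omega>
      using McLeish_norm[of n "\<lambda>k. D k \<omega>" "\<Sum>i<n. \<bar>D i \<omega>\<bar>" r u] assms
        member_le_sum[of _ "{..<n}" "\<lambda>i. \<bar>D i \<omega>\<bar>"] by auto
    then show "AE \<omega> in M. norm ((cmod (McLeish u r (\<lambda>k. D k \<omega>) n))\<^sup>2) \<le> norm (?b \<omega>)" by auto
  qed measurable
  then show ?thesis by (simp add: L2_rv_def)
qed

lemma McLeish_integrable:
  fixes g :: "'a \<Rightarrow> real"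
  assumes "0 \<le> r" and [measurable]: "g \<in> borel_measurable M" and "\<And>\<omega>. \<bar>g \<omega>\<bar> \<le> 1"
  shows "integrable M (\<lambda>\<omega>. complex_of_real (g \<omega>) * McLeish u r (\<lambda>k. D k \<omega>) n)"
proof (rule Bochner_Integration.integrable_bound[OF L2_rv_integrable[OF McLeish_L2[OF assms(1), of u n]]])
  have "norm (complex_of_real (g \<omega>) * McLeish u r (\<lambda>k. D k \<omega>) n) \<le> norm (cmod (McLeish u r (\<lambda>k. D k \<omega>) n))" for \<omega>
    using mult_right_mono[OF assms(3)[of \<omega>], of "cmod (McLeish u r (\<lambda>k. D k \<omega>) n)"] by (simp add: norm_mult)
  then show "AE \<omega> in M. norm (complex_of_real (g \<omega>) * McLeish u r (\<lambda>k. D k \<omega>) n) \<le> norm (cmod (McLeish u r (\<lambda>k. D k \<omega>) n))" by auto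
qed measurable

text \<open>The switched product is a complex martingale with initial value 1, so the factor \<open>g\<close> from time 0 passes through.
  The weight \<open>K\<close> of \<open>D n\<close> is bounded because a factor is only added while the sum of squares is at most \<open>r\<close>.\<close>

lemma McLeish_martingale:
  fixes g :: "'a \<Rightarrow> real"
  assumes r: "0 \<le> r" and g: "g \<in> borel_measurable (G 0)" "\<And>\<omega>. \<bar>g \<omega>\<bar> \<le> 1"
  shows "(\<integral>\<omega>. complex_of_real (g \<omega>) * McLeish u r (\<lambda>k. D k \<omega>) n \<partial>M) = (\<integral>\<omega>. g \<omega> \<partial>M)"
proof (induction n)
  case 0
  then show ?case by (simp add: McLeish_def)
next
  case (Suc n)
  let ?T = "\<lambda>n \<omega>. McLeish u r (\<lambda>k. D k \<omega>) n"
  define K where "K = (\<lambda>\<omega>. complex_of_real (g \<omega>) * (if (\<Sum>i<n. (D i \<omega>)\<^sup>2) \<le> r then ?T n \<omega> else 0))"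
  have gM [measurable]: "g \<in> borel_measurable M" using G_measurable_M g(1) by blast
  have KG: "K \<in> borel_measurable (G n)"
  proof -
    have [measurable]: "D i \<in> borel_measurable (G n)" if "i < n" for i
      using that by (intro G_measurable_mono[OF D_adapted]) auto
    have [measurable]: "(\<lambda>\<omega>. \<Sum>i<n. (D i \<omega>)\<^sup>2) \<in> borel_measurable (G n)"
      by (intro borel_measurable_sum) measurable
    have [measurable]: "g \<in> borel_measurable (G n)" "?T n \<in> borel_measurable (G n)"
      using G_measurable_mono[OF g(1)] McLeish_measurable by auto
    show ?thesis unfolding K_def by measurable
  qed
  have Kb: "cmod (K \<omega>) \<le> exp (u\<^sup>2 * r)" for \<omega>
  proof (cases "(\<Sum>i<n. (D i \<omega>)\<^sup>2) \<le> r")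
    case True
    have "cmod (?T n \<omega>) \<le> exp (u\<^sup>2 * r)"
    proof (rule power2_le_imp_le)
      have "(cmod (?T n \<omega>))\<^sup>2 \<le> exp (u\<^sup>2 * r)" by (rule McLeish_norm_active[OF True])
      also have "\<dots> \<le> (exp (u\<^sup>2 * r))\<^sup>2" using r by (intro self_le_power) auto
      finally show "(cmod (?T n \<omega>))\<^sup>2 \<le> (exp (u\<^sup>2 * r))\<^sup>2" .
    qed simp
    from mult_mono[OF g(2)[of \<omega>] this] show ?thesis using True by (simp add: K_def norm_mult)
  qed (simp add: K_def)
  have cp: "(\<lambda>\<omega>. Re (K \<omega>)) \<in> borel_measurable (G n)" "(\<lambda>\<omega>. Im (K \<omega>)) \<in> borel_measurable (G n)"
    using KG by measurable
  have L: "L2_rv M (\<lambda>\<omega>. Re (K \<omega>))" "L2_rv M (\<lambda>\<omega>. Im (K \<omega>))"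
    by (auto intro!: L2_rv_bounded[where B="exp (u\<^sup>2 * r)"] G_measurable_M[OF cp(1)] G_measurable_M[OF cp(2)]
       order_trans[OF abs_Re_le_cmod Kb] order_trans[OF abs_Im_le_cmod Kb])
  have i: "integrable M (\<lambda>\<omega>. K \<omega> * D n \<omega>)"
  proof (rule Bochner_Integration.integrable_bound)
    show "integrable M (\<lambda>\<omega>. exp (u\<^sup>2 * r) * D n \<omega>)" using L2_rv_integrable[OF D_L2[of n]] by simp
    have [measurable]: "K \<in> borel_measurable M" using measurable_from_subalg[OF G_sub KG] .
    show "(\<lambda>\<omega>. K \<omega> * D n \<omega>) \<in> borel_measurable M" by measurable
    show "AE \<omega> in M. norm (K \<omega> * D n \<omega>) \<le> norm (exp (u\<^sup>2 * r) * D n \<omega>)"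
      using Kb by (auto simp: norm_mult abs_mult intro!: mult_right_mono)
  qed
  have z: "(\<integral>\<omega>. K \<omega> * D n \<omega> \<partial>M) = 0"
    using D_orth[OF cp(1) L(1)] D_orth[OF cp(2) L(2)] integral_Re[OF i] integral_Im[OF i]
    by (simp add: complex_eq_iff)
  have "(\<integral>\<omega>. g \<omega> * ?T (Suc n) \<omega> \<partial>M) = (\<integral>\<omega>. g \<omega> * ?T n \<omega> + (\<i> * u) * (K \<omega> * D n \<omega>) \<partial>M)"
    by (intro Bochner_Integration.integral_cong refl) (auto simp: McLeish_Suc K_def algebra_simps)
  also have "\<dots> = (\<integral>\<omega>. g \<omega> * ?T n \<omega> \<partial>M) + (\<i> * u) * (\<integral>\<omega>. K \<omega> * D n \<omega> \<partial>M)"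
    using McLeish_integrable[OF r gM g(2), of u n] i by (subst Bochner_Integration.integral_add) auto
  finally show ?case using Suc z by simp
qed

text \<open>The expectation of \<open>g\<close> times the stopped product is exactly \<open>E g\<close>. On the event that the differences are small
  and their squares sum to about \<open>s\<close>, the product times \<open>e\<^bsup>-u\<^sup>2s/2\<^esup>\<close> is close to \<open>e\<^bsup>iuM\<^esup>\<close>; the complementary event \<open>A\<close>
  is handled by the Cauchy-Schwarz inequality and the bound of the product in \<open>L\<^sup>2\<close>.\<close>

lemma martingale_char_bound:
  fixes g :: "'a \<Rightarrow> real"
  assumes Q: "L2_rv M Q" "AE \<omega> in M. \<forall>i<n. \<bar>D i \<omega>\<bar> \<le> Q \<omega>" "l2 M Q \<le> \<delta>\<^sup>2"
    and V: "prob {\<omega>\<in>space M. \<bar>(\<Sum>i<n. (D i \<omega>)\<^sup>2) - s\<bar> > \<delta>} \<le> \<delta>\<^sup>2"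
    and s: "0 \<le> s" and d: "0 < \<delta>" "\<delta> \<le> 1" "\<bar>u\<bar> * \<delta> \<le> 1"
    and g: "g \<in> borel_measurable (G 0)" "\<And>\<omega>. \<bar>g \<omega>\<bar> \<le> 1"
  shows "cmod ((\<integral>\<omega>. g \<omega> * iexp (u * mg n \<omega>) \<partial>M) - (\<integral>\<omega>. g \<omega> \<partial>M) * exp (- (u\<^sup>2 * s / 2)))
    \<le> \<delta> * McLeish_const u s"
proof -
  let ?T = "\<lambda>\<omega>. McLeish u (s + 1) (\<lambda>k. D k \<omega>) n"
  define e where "e = exp (- (u\<^sup>2 * s / 2))"
  have e: "0 \<le> e" "e \<le> 1" using s by (auto simp: e_def)
  define c where "c = \<delta> * (2 * \<bar>u\<bar> ^ 3 * (s + 1) + u\<^sup>2 * exp (u\<^sup>2 * (s + 1)))"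
  have c0: "0 \<le> c" using s d by (simp add: c_def)
  define A where "A = {\<omega>\<in>space M. \<bar>Q \<omega>\<bar> \<ge> \<delta>} \<union> {\<omega>\<in>space M. \<bar>(\<Sum>i<n. (D i \<omega>)\<^sup>2) - s\<bar> > \<delta>}"
  have [measurable]: "Q \<in> borel_measurable M" using Q(1) by auto
  have A [measurable]: "A \<in> sets M" unfolding A_def by measurable
  have pA: "prob A \<le> 2 * \<delta>\<^sup>2"
  proof -
    have "prob A \<le> prob {\<omega>\<in>space M. \<bar>Q \<omega>\<bar> \<ge> \<delta>} + prob {\<omega>\<in>space M. \<bar>(\<Sum>i<n. (D i \<omega>)\<^sup>2) - s\<bar> > \<delta>}"
      unfolding A_def by (rule measure_Un_le) measurable
    moreover have "prob {\<omega>\<in>space M. \<bar>Q \<omega>\<bar> \<ge> \<delta>} \<le> (l2 M Q)\<^sup>2 / \<delta>\<^sup>2" by (rule Chebyshev_l2[OF Q(1) d(1)])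
    moreover have "(l2 M Q)\<^sup>2 / \<delta>\<^sup>2 \<le> (\<delta>\<^sup>2)\<^sup>2 / \<delta>\<^sup>2" using Q(3) by (intro divide_right_mono power_mono) auto
    moreover have "(\<delta>\<^sup>2)\<^sup>2 / \<delta>\<^sup>2 = \<delta>\<^sup>2" using d by (simp add: power2_eq_square)
    ultimately show ?thesis using V by simp
  qed
  have gM [measurable]: "g \<in> borel_measurable M" using G_measurable_M g(1) by blast
  have s1: "0 \<le> s + 1" using s by simp
  have TL: "L2_rv M (\<lambda>\<omega>. cmod (?T \<omega>))" by (rule McLeish_L2[OF s1])
  have Ti: "integrable M (\<lambda>\<omega>. g \<omega> * ?T \<omega>)" by (rule McLeish_integrable[where g=g]) (use s1 gM g(2) in auto)
  have Ei: "integrable M (\<lambda>\<omega>. g \<omega> * iexp (u * mg n \<omega>))"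
    by (rule Bochner_Integration.integrable_bound[OF integrable_const[of "1::real"]])
      (use g(2) in \<open>auto simp: norm_mult\<close>)
  have "(\<integral>\<omega>. g \<omega> \<partial>M) * complex_of_real e = (\<integral>\<omega>. g \<omega> * ?T \<omega> * e \<partial>M)"
    using McLeish_martingale[OF s1 g, of u n] by simp
  then have "cmod ((\<integral>\<omega>. g \<omega> * iexp (u * mg n \<omega>) \<partial>M) - (\<integral>\<omega>. g \<omega> \<partial>M) * complex_of_real e)
    = cmod (\<integral>\<omega>. g \<omega> * iexp (u * mg n \<omega>) - g \<omega> * ?T \<omega> * e \<partial>M)"
    using Ti Ei by (subst Bochner_Integration.integral_diff) auto
  also have "\<dots> \<le> (\<integral>\<omega>. cmod (g \<omega> * iexp (u * mg n \<omega>) - g \<omega> * ?T \<omega> * e) \<partial>M)"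
    by (rule integral_norm_bound)
  also have "\<dots> \<le> (\<integral>\<omega>. c + indicator A \<omega> + cmod (?T \<omega>) * indicator A \<omega> \<partial>M)"
  proof (rule integral_mono_AE)
    have iA: "integrable M (indicat_real A)" by (rule integrable_real_indicator) (auto simp: emeasure_eq_measure)
    show "integrable M (\<lambda>\<omega>. c + indicator A \<omega> + cmod (?T \<omega>) * indicator A \<omega>)"
      using iA integrable_real_mult_indicator[OF A L2_rv_integrable[OF TL]] by auto
    show "integrable M (\<lambda>\<omega>. cmod (g \<omega> * iexp (u * mg n \<omega>) - g \<omega> * ?T \<omega> * e))"
      using Ti Ei by auto
    show "AE \<omega> in M. cmod (g \<omega> * iexp (u * mg n \<omega>) - g \<omega> * ?T \<omega> * e)
       \<le> c + indicator A \<omega> + cmod (?T \<omega>) * indicator A \<omega>"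
      using Q(2) AE_space
    proof eventually_elim
      case (elim \<omega>)
      have "cmod (g \<omega> * iexp (u * mg n \<omega>) - g \<omega> * ?T \<omega> * e) = cmod (g \<omega> * (iexp (u * mg n \<omega>) - ?T \<omega> * e))"
        by (simp add: algebra_simps)
      also have "\<dots> \<le> 1 * cmod (iexp (u * mg n \<omega>) - ?T \<omega> * e)"
        unfolding norm_mult using g(2) by (intro mult_right_mono) auto
      finally have 1: "cmod (g \<omega> * iexp (u * mg n \<omega>) - g \<omega> * ?T \<omega> * e) \<le> cmod (iexp (u * mg n \<omega>) - ?T \<omega> * e)" by simp
      show ?case
      proof (cases "\<omega> \<in> A")
        case True
        have "cmod (iexp (u * mg n \<omega>) - ?T \<omega> * e) \<le> 1 + cmod (?T \<omega>) * e"
          using norm_triangle_ineq4[of "iexp (u * mg n \<omega>)" "?T \<omega> * e"] e by (simp add: norm_mult)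
        also have "\<dots> \<le> 1 + cmod (?T \<omega>) * 1" using e by (intro add_left_mono mult_left_mono) auto
        finally show ?thesis using 1 c0 True by simp
      next
        case False
        have "cmod (iexp (u * mg n \<omega>) - ?T \<omega> * e) \<le> c"
          unfolding mg_def e_def c_def
          by (rule McLeish_approx) (use False elim s d in \<open>auto simp: A_def\<close>)
        then show ?thesis using 1 False by simp
      qed
    qed
  qed
  also have "\<dots> = c + prob A + (\<integral>\<omega>. cmod (?T \<omega>) * indicator A \<omega> \<partial>M)"
  proof -
    have "integrable M (indicat_real A)" by (rule integrable_real_indicator) (auto simp: emeasure_eq_measure)
    then show ?thesis
      using integrable_real_mult_indicator[OF A L2_rv_integrable[OF TL]] by (simp add: prob_space)
  qed
  also have "\<dots> \<le> \<delta> * McLeish_const u s"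
  proof -
    define b where "b = exp (u\<^sup>2 * (s + 1)) * (1 + u\<^sup>2)"
    have b0: "0 \<le> b" by (simp add: b_def)
    have Ai: "L2_rv M (indicat_real A)" by (rule L2_rv_bounded[where B=1]) (auto simp: indicator_def)
    have "(\<integral>\<omega>. (indicat_real A \<omega>)\<^sup>2 \<partial>M) = (\<integral>\<omega>. indicat_real A \<omega> \<partial>M)"
      by (intro Bochner_Integration.integral_cong refl) (auto simp: indicator_def)
    then have "l2 M (indicat_real A) = sqrt (prob A)" by (simp add: l2_def)
    also have "\<dots> \<le> sqrt (2\<^sup>2 * \<delta>\<^sup>2)" by (intro real_sqrt_le_mono order_trans[OF pA]) simp
    also have "\<dots> = 2 * \<delta>" using d by (simp add: real_sqrt_mult)
    finally have lA: "l2 M (indicat_real A) \<le> 2 * \<delta>" .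
    have lQ: "(l2 M Q)\<^sup>2 \<le> 1"
    proof -
      have "\<delta>\<^sup>2 \<le> 1" using d by (simp add: abs_square_le_1)
      then show ?thesis using order_trans[OF Q(3)] by (intro power_le_one) auto
    qed
    have "(l2 M (\<lambda>\<omega>. cmod (?T \<omega>)))\<^sup>2 \<le> (\<integral>\<omega>. exp (u\<^sup>2 * (s + 1)) * (1 + u\<^sup>2 * (Q \<omega>)\<^sup>2) \<partial>M)"
      unfolding l2_power2
    proof (rule integral_mono_AE)
      show "AE \<omega> in M. (cmod (?T \<omega>))\<^sup>2 \<le> exp (u\<^sup>2 * (s + 1)) * (1 + u\<^sup>2 * (Q \<omega>)\<^sup>2)"
        using Q(2) by eventually_elim (auto intro!: McLeish_norm s1)
    qed (use L2_rvD(2)[OF TL] L2_rvD(2)[OF Q(1)] in auto)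
    also have "\<dots> = exp (u\<^sup>2 * (s + 1)) * (1 + u\<^sup>2 * (l2 M Q)\<^sup>2)"
      using L2_rvD(2)[OF Q(1)] by (simp add: l2_power2 prob_space)
    also have "\<dots> \<le> exp (u\<^sup>2 * (s + 1)) * (1 + u\<^sup>2 * 1)"
      using lQ by (intro mult_left_mono add_left_mono) auto
    finally have "l2 M (\<lambda>\<omega>. cmod (?T \<omega>)) \<le> sqrt b"
      by (intro real_le_rsqrt) (simp add: b_def)
    then have "l2 M (\<lambda>\<omega>. cmod (?T \<omega>)) * l2 M (indicat_real A) \<le> sqrt b * (2 * \<delta>)"
      using lA b0 by (intro mult_mono) auto
    then have "(\<integral>\<omega>. cmod (?T \<omega>) * indicator A \<omega> \<partial>M) \<le> \<delta> * (2 * sqrt b)"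
      using l2_Cauchy_Schwarz[OF TL Ai] by (simp add: mult.commute mult.left_commute)
    moreover have "prob A \<le> \<delta> * 2"
      using pA mult_left_mono[OF d(2) less_imp_le[OF d(1)]] unfolding power2_eq_square by linarith
    moreover have "\<delta> * McLeish_const u s = c + \<delta> * 2 + \<delta> * (2 * sqrt b)"
      by (simp add: McLeish_const_def c_def b_def algebra_simps)
    ultimately show ?thesis by linarith
  qed
  finally show ?thesis by (simp add: e_def)
qed

end


section \<open>Maximal functions of rows\<close>

text \<open>Domination by one square integrable variable replaces the norm of a maximum: such bounds add up by Minkowski's
  inequality and tolerate the null sets of conditional expectations.\<close>

definition max_dominated :: "'a measure \<Rightarrow> (nat \<Rightarrow> 'a \<Rightarrow> real) \<Rightarrow> nat \<Rightarrow> real \<Rightarrow> bool" where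
  "max_dominated M f N c \<longleftrightarrow>
     (\<exists>Q. L2_rv M Q \<and> (AE \<omega> in M. \<forall>k\<le>N. \<bar>f k \<omega>\<bar> \<le> Q \<omega>) \<and> l2 M Q \<le> c)"

lemma max_dominatedI:
  "L2_rv M Q \<Longrightarrow> AE \<omega> in M. \<forall>k\<le>N. \<bar>f k \<omega>\<bar> \<le> Q \<omega> \<Longrightarrow> l2 M Q \<le> c \<Longrightarrow> max_dominated M f N c"
  unfolding max_dominated_def by blast

lemma max_dominated_add:
  assumes "max_dominated M f N a" "max_dominated M g N b"
    and h: "\<And>k \<omega>. k \<le> N \<Longrightarrow> \<omega> \<in> space M \<Longrightarrow> \<bar>h k \<omega>\<bar> \<le> \<bar>f k \<omega>\<bar> + \<bar>g k \<omega>\<bar>"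
  shows "max_dominated M h N (a + b)"
proof -
  obtain P Q where P: "L2_rv M P" "AE \<omega> in M. \<forall>k\<le>N. \<bar>f k \<omega>\<bar> \<le> P \<omega>" "l2 M P \<le> a"
    and Q: "L2_rv M Q" "AE \<omega> in M. \<forall>k\<le>N. \<bar>g k \<omega>\<bar> \<le> Q \<omega>" "l2 M Q \<le> b"
    using assms unfolding max_dominated_def by blast
  show ?thesis
  proof (rule max_dominatedI)
    show "L2_rv M (\<lambda>\<omega>. P \<omega> + Q \<omega>)" by (rule L2_rv_add[OF P(1) Q(1)])
    show "l2 M (\<lambda>\<omega>. P \<omega> + Q \<omega>) \<le> a + b" using l2_add[OF P(1) Q(1)] P(3) Q(3) by simp
    show "AE \<omega> in M. \<forall>k\<le>N. \<bar>h k \<omega>\<bar> \<le> P \<omega> + Q \<omega>"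
      using P(2) Q(2) AE_space
    proof eventually_elim
      case (elim \<omega>)
      then show ?case using h[of _ \<omega>] by (meson add_mono order_trans)
    qed
  qed
qed

lemma max_dominated_mono: "max_dominated M f N a \<Longrightarrow> a \<le> b \<Longrightarrow> max_dominated M f N b"
  unfolding max_dominated_def by force

lemma max_dominated_subset: "max_dominated M f N a \<Longrightarrow> N' \<le> N \<Longrightarrow> max_dominated M f N' a"
  unfolding max_dominated_def by (auto elim!: eventually_mono)

lemma max_dominated_reindex:
  assumes "max_dominated M f N a" "\<And>k. k \<le> N' \<Longrightarrow> \<tau> k \<le> N"
    and "\<And>k \<omega>. k \<le> N' \<Longrightarrow> \<omega> \<in> space M \<Longrightarrow> \<bar>g k \<omega>\<bar> \<le> \<bar>f (\<tau> k) \<omega>\<bar>"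
  shows "max_dominated M g N' a"
proof -
  obtain P where P: "L2_rv M P" "AE \<omega> in M. \<forall>k\<le>N. \<bar>f k \<omega>\<bar> \<le> P \<omega>" "l2 M P \<le> a"
    using assms(1) unfolding max_dominated_def by blast
  have "AE \<omega> in M. \<forall>k\<le>N'. \<bar>g k \<omega>\<bar> \<le> P \<omega>"
    using P(2) AE_space
  proof eventually_elim
    case (elim \<omega>)
    show ?case
    proof (intro allI impI)
      fix k assume k: "k \<le> N'"
      have "\<bar>g k \<omega>\<bar> \<le> \<bar>f (\<tau> k) \<omega>\<bar>" using assms(3)[OF k elim(2)] .
      also have "\<dots> \<le> P \<omega>" using elim(1) assms(2)[OF k] by simp
      finally show "\<bar>g k \<omega>\<bar> \<le> P \<omega>" .
    qed
  qed
  then show ?thesis using P by (intro max_dominatedI)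
qed

lemma max_dominated_cmult:
  assumes "max_dominated M f N a"
  shows "max_dominated M (\<lambda>k \<omega>. c * f k \<omega>) N (\<bar>c\<bar> * a)"
proof -
  obtain P where P: "L2_rv M P" "AE \<omega> in M. \<forall>k\<le>N. \<bar>f k \<omega>\<bar> \<le> P \<omega>" "l2 M P \<le> a"
    using assms(1) unfolding max_dominated_def by blast
  show ?thesis
  proof (rule max_dominatedI[OF L2_rv_cmult[OF P(1), of "\<bar>c\<bar>"]])
    show "AE \<omega> in M. \<forall>k\<le>N. \<bar>c * f k \<omega>\<bar> \<le> \<bar>c\<bar> * P \<omega>"
      using P(2) by eventually_elim (auto simp: abs_mult intro: mult_left_mono)
    show "l2 M (\<lambda>\<omega>. \<bar>c\<bar> * P \<omega>) \<le> \<bar>c\<bar> * a" using P(3) by (simp add: l2_cmult mult_left_mono)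
  qed
qed

lemma max_dominated_sum:
  assumes "\<And>i. i \<in> I \<Longrightarrow> max_dominated M (f i) N (a i)" "finite I"
  shows "max_dominated M (\<lambda>k \<omega>. \<Sum>i\<in>I. f i k \<omega>) N (\<Sum>i\<in>I. a i)"
  using assms(2,1)
proof (induction I)
  case empty
  show ?case by (rule max_dominatedI[of M "\<lambda>\<omega>. 0"]) auto
next
  case (insert i I)
  show ?case using insert(1,2)
    by (auto intro!: max_dominated_add[OF insert(4)[of i] insert(3)] insert(4))
qed

lemma L2_set_power2: "finite A \<Longrightarrow> (L2_set f A)\<^sup>2 = (\<Sum>i\<in>A. (f i)\<^sup>2)"
  by (simp add: L2_set_def sum_nonneg)

text \<open>Crude, but it suffices for the individual blocks of one scale: their squared norms are summable with a bound that
  does not depend on \<open>n\<close>.\<close>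

lemma max_dominated_L2_set:
  assumes f: "\<And>k. k \<le> N \<Longrightarrow> L2_rv M (f k)"
  shows "max_dominated M f N (L2_set (\<lambda>k. l2 M (f k)) {..N})"
proof (rule max_dominatedI)
  let ?Q = "\<lambda>\<omega>. L2_set (\<lambda>k. f k \<omega>) {..N}"
  have Q2: "(?Q \<omega>)\<^sup>2 = (\<Sum>k\<le>N. (f k \<omega>)\<^sup>2)" for \<omega> by (simp add: L2_set_power2)
  have [measurable]: "f k \<in> borel_measurable M" if "k \<le> N" for k using f[OF that] by auto
  have m: "?Q \<in> borel_measurable M" unfolding L2_set_def by measurable
  show "L2_rv M ?Q" unfolding L2_rv_def Q2 using m f by (auto intro!: Bochner_Integration.integrable_sum)
  show "AE \<omega> in M. \<forall>k\<le>N. \<bar>f k \<omega>\<bar> \<le> ?Q \<omega>"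
  proof (intro AE_I2 allI impI)
    fix \<omega> k assume "k \<le> N"
    then have "(f k \<omega>)\<^sup>2 \<le> (\<Sum>k\<le>N. (f k \<omega>)\<^sup>2)" by (intro member_le_sum) auto
    then show "\<bar>f k \<omega>\<bar> \<le> ?Q \<omega>" unfolding L2_set_def by (intro real_le_rsqrt) simp
  qed
  have "(l2 M ?Q)\<^sup>2 = (\<Sum>k\<le>N. (l2 M (f k))\<^sup>2)"
    unfolding l2_power2 Q2 using f by (intro Bochner_Integration.integral_sum) auto
  then show "l2 M ?Q \<le> L2_set (\<lambda>k. l2 M (f k)) {..N}"
    by (simp add: L2_set_def real_le_rsqrt)
qed

text \<open>Removing the conditional expectations from summands adapted with a delay of one step leaves
  martingale differences, so the maximum costs only the \<open>\<ell>\<^sup>2(L\<^sup>2)\<close> norm.\<close>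

lemma max_projection:
  assumes "prob_space M"
    and sub: "\<And>k :: nat. subalgebra M (G k)" and mono: "\<And>i j. i \<le> j \<Longrightarrow> sets (G i) \<subseteq> sets (G j)"
    and Z: "\<And>k. k < N \<Longrightarrow> Z k \<in> borel_measurable (G (Suc k))"
    and P: "\<And>k. k < N \<Longrightarrow> cond_proj M (G k) (Z k) (Y k)"
  shows "max_dominated M (\<lambda>K \<omega>. \<Sum>k<K. Z k \<omega> - Y k \<omega>) N (2 * L2_set (\<lambda>k. l2 M (Z k)) {..<N})"
proof -
  interpret prob_space M by fact
  define D where "D = (\<lambda>k \<omega>. if k < N then Z k \<omega> - Y k \<omega> else 0)"
  note p = cond_projD[OF P]
  interpret L2_martingale M G D
  proof unfold_locales
    fix k
    have "Y k \<in> borel_measurable (G (Suc k))" if "k < N"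
      by (rule measurable_from_subalg[OF _ p(3)[OF that]])
        (use sub[of k] sub[of "Suc k"] mono[of k "Suc k"] in \<open>auto simp: subalgebra_def\<close>)
    then show "D k \<in> borel_measurable (G (Suc k))" using Z[of k]
      by (cases "k < N") (auto simp: D_def)
    show "L2_rv M (D k)" unfolding D_def using p(1,2)[of k] by (cases "k < N") (auto intro: L2_rv_diff)
    show "(\<integral>\<omega>. H \<omega> * D k \<omega> \<partial>M) = 0" if H: "H \<in> borel_measurable (G k)" "L2_rv M H" for H
      using p(4)[OF _ H] L2_rv_mult_integrable[OF H(2) p(1)] L2_rv_mult_integrable[OF H(2) p(2)]
      by (cases "k < N") (auto simp: D_def right_diff_distrib)
  qed (use sub mono in auto)
  show ?thesis
  proof (rule max_dominatedI)
    show "L2_rv M (\<lambda>\<omega>. run_max (\<lambda>i. \<bar>mg i \<omega>\<bar>) N)" by (rule L2_run_max_abs)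
    show "AE \<omega> in M. \<forall>K\<le>N. \<bar>\<Sum>k<K. Z k \<omega> - Y k \<omega>\<bar> \<le> run_max (\<lambda>i. \<bar>mg i \<omega>\<bar>) N"
    proof (intro AE_I2 allI impI)
      fix \<omega> K assume "K \<le> N"
      then have "(\<Sum>k<K. Z k \<omega> - Y k \<omega>) = mg K \<omega>" unfolding mg_def by (intro sum.cong) (auto simp: D_def)
      then show "\<bar>\<Sum>k<K. Z k \<omega> - Y k \<omega>\<bar> \<le> run_max (\<lambda>i. \<bar>mg i \<omega>\<bar>) N"
        using run_max_ge[OF \<open>K \<le> N\<close>, of "\<lambda>i. \<bar>mg i \<omega>\<bar>"] by simp
    qed
    have "(l2 M (\<lambda>\<omega>. run_max (\<lambda>i. \<bar>mg i \<omega>\<bar>) N))\<^sup>2 \<le> 4 * (\<Sum>k<N. (l2 M (D k))\<^sup>2)" by (rule Doob_L2)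
    also have "\<dots> \<le> 4 * (\<Sum>k<N. (l2 M (Z k))\<^sup>2)"
      using cond_proj_l2(2)[OF P] by (intro mult_left_mono sum_mono power_mono) (auto simp: D_def)
    also have "\<dots> = (2 * L2_set (\<lambda>k. l2 M (Z k)) {..<N})\<^sup>2"
      by (simp add: L2_set_power2 power_mult_distrib)
    finally show "l2 M (\<lambda>\<omega>. run_max (\<lambda>i. \<bar>mg i \<omega>\<bar>) N) \<le> 2 * L2_set (\<lambda>k. l2 M (Z k)) {..<N}"
      by (rule power2_le_imp_le) (simp add: L2_set_nonneg)
  qed
qed

section \<open>Martingale approximation of a row\<close>

text \<open>A row continued by zeros, so that its increments may reach beyond \<open>n\<close>.\<close>

locale adapted_row = prob_space M
  for M :: "'a measure" +
  fixes \<F> :: "nat \<Rightarrow> int \<Rightarrow> 'a measure" and X :: "nat \<Rightarrow> nat \<Rightarrow> 'a \<Rightarrow> real" and n :: nat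
  assumes F_sub: "subalgebra M (\<F> n a)"
    and F_mono: "a \<le> b \<Longrightarrow> sets (\<F> n a) \<subseteq> sets (\<F> n b)"
    and X_adapted: "1 \<le> i \<Longrightarrow> X n i \<in> borel_measurable (\<F> n (int i))"
    and X_L2: "1 \<le> i \<Longrightarrow> L2_rv M (X n i)"
    and X_zero: "n < i \<Longrightarrow> \<omega> \<in> space M \<Longrightarrow> X n i \<omega> = 0"
begin

abbreviation S :: "nat \<Rightarrow> 'a \<Rightarrow> real" where "S \<equiv> row_sum X n"

lemma F_subalg: "i \<le> j \<Longrightarrow> subalgebra (\<F> n j) (\<F> n i)"
  using F_mono[of i j] F_sub[of i] F_sub[of j] by (auto simp: subalgebra_def)

lemma F_measurable_mono: "f \<in> borel_measurable (\<F> n i) \<Longrightarrow> i \<le> j \<Longrightarrow> f \<in> borel_measurable (\<F> n j)"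
  using measurable_from_subalg[OF F_subalg] by blast

lemma S_L2: "L2_rv M (S k)"
  unfolding row_sum_def using X_L2 by (intro L2_rv_sum) auto

lemma S_adapted: "S k \<in> borel_measurable (\<F> n (int k))"
  unfolding row_sum_def
  by (intro borel_measurable_sum F_measurable_mono[OF X_adapted]) auto

lemma S_diff: "S (k + u) \<omega> - S k \<omega> = (\<Sum>i=1..u. X n (k + i) \<omega>)"
  by (induction u) (auto simp: row_sum_def)

lemma S_diff_zero: "n \<le> k \<Longrightarrow> \<omega> \<in> space M \<Longrightarrow> S (k + u) \<omega> - S k \<omega> = 0"
  unfolding S_diff using X_zero by (intro sum.neutral) auto

definition cond_incr :: "nat \<Rightarrow> nat \<Rightarrow> 'a \<Rightarrow> real" where
  "cond_incr k u = real_cond_exp M (\<F> n (int k)) (\<lambda>\<omega>. S (k + u) \<omega> - S k \<omega>)"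

lemma cond_incr_proj: "cond_proj M (\<F> n (int k)) (\<lambda>\<omega>. S (k + u) \<omega> - S k \<omega>) (cond_incr k u)"
  unfolding cond_incr_def by (intro cond_proj_cond_exp F_sub L2_rv_diff S_L2)

lemmas cond_incr_L2 = cond_projD(2)[OF cond_incr_proj] and cond_incr_adapted = cond_projD(3)[OF cond_incr_proj]

lemma cond_incr_M [measurable]: "cond_incr k u \<in> borel_measurable M"
  using cond_incr_L2 by auto

text \<open>Testing against a variable of the past does not see the conditional expectation.\<close>

lemma cond_incr_test:
  assumes "H \<in> borel_measurable (\<F> n i)" "i \<le> int k" "L2_rv M H"
  shows "(\<integral>\<omega>. H \<omega> * cond_incr k u \<omega> \<partial>M) = (\<integral>\<omega>. H \<omega> * (S (k + u) \<omega> - S k \<omega>) \<partial>M)"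
  using cond_projD(4)[OF cond_incr_proj F_measurable_mono[OF assms(1,2)] assms(3)] by simp

lemma l2_cond_incr_zero: "n \<le> k \<Longrightarrow> l2 M (cond_incr k u) = 0"
proof -
  assume "n \<le> k"
  then have "l2 M (\<lambda>\<omega>. S (k + u) \<omega> - S k \<omega>) = l2 M (\<lambda>\<omega>. 0)"
    using S_diff_zero[of k] L2_rvD(1)[OF L2_rv_diff[OF S_L2 S_L2, of "k+u" k]]
    by (intro L2_rv_cong_AE(2) L2_rv_zero) auto
  then show "l2 M (cond_incr k u) = 0" using cond_proj_l2(1)[OF cond_incr_proj, of k u] by (simp add: order.antisym)
qed

text \<open>The quantity whose supremum over the rows is \<open>A(u)\<close>.\<close>

definition a_norm :: "nat \<Rightarrow> real" where
  "a_norm u = L2_set (\<lambda>k. l2 M (cond_incr k u)) {..<n}"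

lemma a_norm_nonneg: "0 \<le> a_norm u"
  by (simp add: a_norm_def L2_set_nonneg)

lemma L2_set_cond_incr_le: "finite K \<Longrightarrow> L2_set (\<lambda>k. l2 M (cond_incr k u)) K \<le> a_norm u"
proof -
  assume K: "finite K"
  have "i < n" if "l2 M (cond_incr i u) \<noteq> 0" for i using that l2_cond_incr_zero[of i u] by force
  then have "(\<Sum>k\<in>K. (l2 M (cond_incr k u))\<^sup>2) = (\<Sum>k\<in>K \<inter> {..<n}. (l2 M (cond_incr k u))\<^sup>2)"
    using K by (intro sum.mono_neutral_right) auto
  also have "\<dots> \<le> (\<Sum>k<n. (l2 M (cond_incr k u))\<^sup>2)" by (intro sum_mono2) auto
  finally show ?thesis unfolding a_norm_def L2_set_def by simp
qed

lemma L2_set_cond_incr_shift_le: "finite K \<Longrightarrow> L2_set (\<lambda>k. l2 M (cond_incr (k + i) u)) K \<le> a_norm u"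
proof -
  assume K: "finite K"
  have "L2_set (\<lambda>k. l2 M (cond_incr (k + i) u)) K = L2_set (\<lambda>k. l2 M (cond_incr k u)) ((\<lambda>k. k + i) ` K)"
    unfolding L2_set_def by (subst sum.reindex) (auto simp: inj_on_def)
  then show ?thesis using K L2_set_cond_incr_le by simp
qed

text \<open>The second increment may be conditioned first on its own starting point, where conditioning on the earlier
  sigma-algebra only decreases the norm.\<close>

lemma a_norm_add: "a_norm (i + j) \<le> a_norm i + a_norm j"
proof -
  have "l2 M (cond_incr k (i + j)) \<le> l2 M (cond_incr k i) + l2 M (cond_incr (k + i) j)" for k
  proof -
    have "cond_proj M (\<F> n (int k)) (\<lambda>\<omega>. cond_incr k i \<omega> + cond_incr (k + i) j \<omega>) (cond_incr k (i + j))"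
      unfolding cond_proj_def
    proof (intro conjI allI impI)
      fix H assume H: "H \<in> borel_measurable (\<F> n (int k))" "L2_rv M H"
      note I = L2_rv_mult_integrable[OF H(2)]
      have "(\<integral>\<omega>. H \<omega> * (cond_incr k i \<omega> + cond_incr (k + i) j \<omega>) \<partial>M)
          = (\<integral>\<omega>. H \<omega> * (S (k + i) \<omega> - S k \<omega>) \<partial>M) + (\<integral>\<omega>. H \<omega> * (S (k + i + j) \<omega> - S (k + i) \<omega>) \<partial>M)"
        using cond_incr_test[OF H(1) _ H(2), of k i] cond_incr_test[OF H(1) _ H(2), of "k + i" j]
          I[OF cond_incr_L2[of k i]] I[OF cond_incr_L2[of "k+i" j]]
        by (simp add: distrib_left)
      also have "\<dots> = (\<integral>\<omega>. H \<omega> * (S (k + (i + j)) \<omega> - S k \<omega>) \<partial>M)"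
        using I[OF L2_rv_diff[OF S_L2 S_L2, of "k + i" k]] I[OF L2_rv_diff[OF S_L2 S_L2, of "k + i + j" "k + i"]]
        by (subst Bochner_Integration.integral_add[symmetric]) (auto simp: algebra_simps)
      also have "\<dots> = (\<integral>\<omega>. H \<omega> * cond_incr k (i + j) \<omega> \<partial>M)"
        using cond_incr_test[OF H(1) _ H(2), of k "i + j"] by simp
      finally show "(\<integral>\<omega>. H \<omega> * (cond_incr k i \<omega> + cond_incr (k + i) j \<omega>) \<partial>M) = (\<integral>\<omega>. H \<omega> * cond_incr k (i + j) \<omega> \<partial>M)" .
    qed (auto intro: L2_rv_add cond_incr_L2 cond_incr_adapted)
    from cond_proj_l2(1)[OF this] show ?thesis using l2_add[OF cond_incr_L2[of k i] cond_incr_L2[of "k+i" j]] by simp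
  qed
  then have "a_norm (i + j) \<le> L2_set (\<lambda>k. l2 M (cond_incr k i) + l2 M (cond_incr (k + i) j)) {..<n}"
    unfolding a_norm_def by (intro L2_set_mono) auto
  also have "\<dots> \<le> L2_set (\<lambda>k. l2 M (cond_incr k i)) {..<n} + L2_set (\<lambda>k. l2 M (cond_incr (k + i) j)) {..<n}"
    by (rule L2_set_triangle_ineq)
  also have "\<dots> \<le> a_norm i + a_norm j"
    using L2_set_cond_incr_shift_le[of "{..<n}" i j] by (simp add: a_norm_def)
  finally show ?thesis .
qed

lemma a_norm_zero [simp]: "a_norm 0 = 0"
proof -
  have "l2 M (cond_incr k 0) \<le> 0" for k
    using cond_proj_l2(1)[OF cond_incr_proj, of k 0] by simp
  then have "l2 M (cond_incr k 0) = 0" for k by (simp add: order.antisym)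
  then show ?thesis by (simp add: a_norm_def L2_set_def)
qed

text \<open>Binary expansion: control along powers of two gives control everywhere.\<close>

lemma a_norm_dyadic:
  assumes K: "\<And>q. q < p \<Longrightarrow> a_norm (2 ^ q) \<le> K * sqrt (2 ^ q)" and "0 \<le> K"
  shows "i < 2 ^ p \<Longrightarrow> a_norm i \<le> K * (\<Sum>q<p. sqrt (2 ^ q))"
  using K
proof (induction p arbitrary: i)
  case 0
  then show ?case by simp
next
  case (Suc p)
  show ?case
  proof (cases "i < 2 ^ p")
    case True
    then have "a_norm i \<le> K * (\<Sum>q<p. sqrt (2 ^ q))" using Suc.IH Suc.prems(2) by simp
    also have "\<dots> \<le> K * (\<Sum>q<Suc p. sqrt (2 ^ q))" using \<open>0 \<le> K\<close> by (intro mult_left_mono) auto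
    finally show ?thesis .
  next
    case False
    then obtain j where j: "i = 2 ^ p + j" using le_iff_add[of "2^p" i] by auto
    have "a_norm i \<le> a_norm (2 ^ p) + a_norm j" unfolding j by (rule a_norm_add)
    also have "\<dots> \<le> K * sqrt (2 ^ p) + K * (\<Sum>q<p. sqrt (2 ^ q))"
      using Suc.prems j by (intro add_mono Suc.IH Suc.prems(2)) auto
    finally show ?thesis by (simp add: algebra_simps)
  qed
qed

lemma sum_sqrt_power2_le: "(\<Sum>q<p. sqrt (2 ^ q)) \<le> 3 * sqrt (2 ^ p)"
proof (induction p)
  case (Suc p)
  have "(4::real) / 3 \<le> sqrt 2" by (rule real_le_rsqrt) (simp add: power2_eq_square)
  then have "4 * sqrt (2 ^ p) \<le> 3 * sqrt (2 ^ Suc p)" by (simp add: real_sqrt_mult)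
  then show ?case using Suc by simp
qed simp

end


context adapted_row begin

definition rho :: "nat \<Rightarrow> nat \<Rightarrow> 'a \<Rightarrow> real" where
  "rho m k \<omega> = cond_incr k m \<omega> / real m"

lemma rho_cmult: "rho m k = (\<lambda>\<omega>. (1 / real m) * cond_incr k m \<omega>)"
  by (auto simp: rho_def)

lemma rho_L2: "L2_rv M (rho m k)"
  unfolding rho_cmult by (intro L2_rv_cmult cond_incr_L2)

lemma rho_adapted: "rho m k \<in> borel_measurable (\<F> n (int k))"
  unfolding rho_cmult using cond_incr_adapted by measurable

lemma l2_rho: "l2 M (rho m k) = l2 M (cond_incr k m) / m"
  unfolding rho_cmult l2_cmult by simp

abbreviation \<theta> :: "nat \<Rightarrow> nat \<Rightarrow> 'a \<Rightarrow> real" where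
  "\<theta> m k \<equiv> theta M \<F> X m n k"

lemma theta_eq: "\<theta> m k = (\<lambda>\<omega>. 1 / real m * (\<Sum>i=1..<m. cond_incr k i \<omega>))"
  by (auto simp: theta_def cond_incr_def fun_eq_iff)

lemma theta_L2: "L2_rv M (\<theta> m k)"
  unfolding theta_eq by (intro L2_rv_cmult L2_rv_sum cond_incr_L2)

lemma theta_adapted: "\<theta> m k \<in> borel_measurable (\<F> n (int k))"
  unfolding theta_eq using cond_incr_adapted by measurable

subsection \<open>The compensator is small: a dyadic maximal inequality\<close>

text \<open>The variable whose projection on the past is \<open>S_bar\<close>.\<close>

definition block_average :: "nat \<Rightarrow> nat \<Rightarrow> nat \<Rightarrow> 'a \<Rightarrow> real" where
  "block_average l m k \<omega> = (1 / real m) * (\<Sum>u=0..<m. S ((k + 1) * l + u) \<omega> - S (k * l + u) \<omega>)"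

abbreviation SB :: "nat \<Rightarrow> nat \<Rightarrow> nat \<Rightarrow> 'a \<Rightarrow> real" where
  "SB l m k \<equiv> S_bar M \<F> X l m n k"

lemma SB_proj: "cond_proj M (\<F> n ((int k - 1) * int l + 1)) (block_average l m k) (SB l m k)"
  unfolding block_average_def[abs_def] S_bar_def[abs_def]
  by (intro cond_proj_cmult cond_proj_sum cond_proj_cond_exp F_sub L2_rv_diff S_L2) auto

lemmas SB_L2 = cond_projD(2)[OF SB_proj]
lemmas SB_adapted = cond_projD(3)[OF SB_proj]

lemma block_average_double: "block_average (2 * l) m k \<omega> = block_average l m (2 * k) \<omega> + block_average l m (2 * k + 1) \<omega>"
  unfolding block_average_def distrib_left[symmetric] sum.distrib[symmetric]
  by (intro arg_cong2[where f="(*)"] sum.cong refl) (simp add: algebra_simps)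

text \<open>One step of the dyadic scheme: grouping two blocks and projecting them on the past.\<close>

lemma SB_double_proj:
  "cond_proj M (\<F> n ((int k - 1) * int (2 * l) + 1)) (\<lambda>\<omega>. SB l m (2 * k) \<omega> + SB l m (2 * k + 1) \<omega>) (SB (2 * l) m k)"
proof -
  let ?G = "\<F> n ((int k - 1) * int (2 * l) + 1)"
  have le: "(int k - 1) * int (2 * l) + 1 \<le> (int (2 * k) - 1) * int l + 1"
    "(int k - 1) * int (2 * l) + 1 \<le> (int (2 * k + 1) - 1) * int l + 1"
    by (simp_all add: algebra_simps)
  have "(\<integral>\<omega>. H \<omega> * (SB l m (2 * k) \<omega> + SB l m (2 * k + 1) \<omega>) \<partial>M) = (\<integral>\<omega>. H \<omega> * SB (2 * l) m k \<omega> \<partial>M)"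
    if H: "H \<in> borel_measurable ?G" "L2_rv M H" for H
  proof -
    note I = L2_rv_mult_integrable[OF H(2)]
    have "(\<integral>\<omega>. H \<omega> * (SB l m (2 * k) \<omega> + SB l m (2 * k + 1) \<omega>) \<partial>M)
        = (\<integral>\<omega>. H \<omega> * SB l m (2 * k) \<omega> \<partial>M) + (\<integral>\<omega>. H \<omega> * SB l m (2 * k + 1) \<omega> \<partial>M)"
      using I[OF SB_L2[of l m "2*k"]] I[OF SB_L2[of l m "2*k+1"]] by (simp add: distrib_left)
    also have "\<dots> = (\<integral>\<omega>. H \<omega> * block_average l m (2 * k) \<omega> \<partial>M) + (\<integral>\<omega>. H \<omega> * block_average l m (2 * k + 1) \<omega> \<partial>M)"
      using cond_projD(4)[OF SB_proj F_measurable_mono[OF H(1) le(1)] H(2)]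
        cond_projD(4)[OF SB_proj F_measurable_mono[OF H(1) le(2)] H(2)] by simp
    also have "\<dots> = (\<integral>\<omega>. H \<omega> * block_average (2 * l) m k \<omega> \<partial>M)"
      unfolding block_average_double distrib_left
      using I[OF cond_projD(1)[OF SB_proj[of "2*k" l m]]] I[OF cond_projD(1)[OF SB_proj[of "2*k+1" l m]]] by simp
    also have "\<dots> = (\<integral>\<omega>. H \<omega> * SB (2 * l) m k \<omega> \<partial>M)"
      by (rule cond_projD(4)[OF SB_proj H])
    finally show ?thesis .
  qed
  then show ?thesis
    unfolding cond_proj_def using SB_adapted[of "2 * l" m k] by (intro conjI allI impI L2_rv_add SB_L2)
qed

definition b_norm :: "nat \<Rightarrow> nat \<Rightarrow> real" where
  "b_norm l m = L2_set (\<lambda>k. l2 M (SB l m k)) {..n div l}"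

text \<open>Partial sums at scale \<open>l\<close> are partial sums of pairs up to one single block. A pair is known when the next pair
  begins, so by \<open>max_projection\<close> it may be replaced by its projection, which is a block at scale \<open>2 l\<close>.\<close>

lemma max_SB_step:
  assumes l: "1 \<le> l"
    and c: "max_dominated M (\<lambda>K \<omega>. \<Sum>k<K. SB (2 * l) m k \<omega>) (n div (2 * l) + 1) c"
  shows "max_dominated M (\<lambda>K \<omega>. \<Sum>k<K. SB l m k \<omega>) (n div l + 1) (4 * b_norm l m + c)"
proof -
  define N where "N = (n div l + 1) div 2"
  let ?G = "\<lambda>k. \<F> n ((int k - 1) * int (2 * l) + 1)"
  let ?Z = "\<lambda>k \<omega>. SB l m (2 * k) \<omega> + SB l m (2 * k + 1) \<omega>"
  let ?b = "b_norm l m"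
  have Nle: "N \<le> n div (2 * l) + 1" unfolding N_def by (simp add: div_mult2_eq mult.commute[of 2])
  have idx: "2 * k + 1 \<le> n div l" if "k < N" for k using that by (simp add: N_def)
  have P: "max_dominated M (\<lambda>K \<omega>. \<Sum>k<K. ?Z k \<omega> - SB (2 * l) m k \<omega>) N (2 * L2_set (\<lambda>k. l2 M (?Z k)) {..<N})"
  proof (rule max_projection[OF prob_space_axioms, of ?G])
    show "subalgebra M (?G k)" for k by (rule F_sub)
    show "sets (?G i) \<subseteq> sets (?G j)" if "i \<le> j" for i j
      using that by (intro F_mono add_right_mono mult_right_mono) auto
    show "?Z k \<in> borel_measurable (?G (Suc k))" for k
    proof -
      have "(int (2 * k) - 1) * int l + 1 \<le> (int (Suc k) - 1) * int (2 * l) + 1"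
        "(int (2 * k + 1) - 1) * int l + 1 \<le> (int (Suc k) - 1) * int (2 * l) + 1"
        by (simp_all add: algebra_simps)
      then show ?thesis
        by (intro borel_measurable_add F_measurable_mono[OF SB_adapted])
    qed
    show "cond_proj M (?G k) (?Z k) (SB (2 * l) m k)" for k by (rule SB_double_proj)
  qed
  have Zb: "2 * L2_set (\<lambda>k. l2 M (?Z k)) {..<N} \<le> 3 * ?b"
  proof -
    have "(\<Sum>k<N. (l2 M (?Z k))\<^sup>2) \<le> (\<Sum>k<N. 2 * ((l2 M (SB l m (2 * k)))\<^sup>2 + (l2 M (SB l m (2 * k + 1)))\<^sup>2))"
    proof (rule sum_mono)
      fix k
      let ?x = "l2 M (SB l m (2 * k))" and ?y = "l2 M (SB l m (2 * k + 1))"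
      have "(l2 M (?Z k))\<^sup>2 \<le> (?x + ?y)\<^sup>2"
        by (intro power_mono l2_add SB_L2) auto
      also have "\<dots> \<le> 2 * (?x\<^sup>2 + ?y\<^sup>2)"
        using sum_squares_bound[of ?x ?y] by (simp add: power2_sum)
      finally show "(l2 M (?Z k))\<^sup>2 \<le> 2 * (?x\<^sup>2 + ?y\<^sup>2)" .
    qed
    also have "\<dots> = 2 * (\<Sum>j<N * 2. (l2 M (SB l m j))\<^sup>2)"
      by (subst sum.nat_group[symmetric]) (simp add: sum_distrib_left mult.commute numeral_2_eq_2)
    also have "\<dots> \<le> 2 * (\<Sum>j\<le>n div l. (l2 M (SB l m j))\<^sup>2)"
      by (intro mult_left_mono sum_mono2) (auto simp: N_def)
    finally have "(L2_set (\<lambda>k. l2 M (?Z k)) {..<N})\<^sup>2 \<le> 2 * ?b\<^sup>2"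
      by (simp add: L2_set_power2 b_norm_def)
    moreover have "0 \<le> ?b\<^sup>2" by simp
    ultimately have "(2 * L2_set (\<lambda>k. l2 M (?Z k)) {..<N})\<^sup>2 \<le> (3 * ?b)\<^sup>2"
      by (simp add: power_mult_distrib) (use zero_le_power2[of ?b] in linarith)
    then show ?thesis by (rule power2_le_imp_le) (simp add: b_norm_def L2_set_nonneg)
  qed
  have single: "max_dominated M (\<lambda>k. SB l m k) (n div l) ?b"
    unfolding b_norm_def by (intro max_dominated_L2_set SB_L2)
  have main: "max_dominated M (\<lambda>K \<omega>. \<Sum>k<K. ?Z k \<omega>) N (3 * ?b + c)"
  proof (rule max_dominated_add[OF max_dominated_mono[OF P Zb] max_dominated_subset[OF c Nle]])
    fix K \<omega>
    have "(\<Sum>k<K. ?Z k \<omega>) = (\<Sum>k<K. ?Z k \<omega> - SB (2 * l) m k \<omega>) + (\<Sum>k<K. SB (2 * l) m k \<omega>)"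
      by (simp add: sum_subtractf)
    then show "\<bar>\<Sum>k<K. ?Z k \<omega>\<bar> \<le> \<bar>\<Sum>k<K. ?Z k \<omega> - SB (2 * l) m k \<omega>\<bar> + \<bar>\<Sum>k<K. SB (2 * l) m k \<omega>\<bar>" by linarith
  qed
  have main': "max_dominated M (\<lambda>K \<omega>. \<Sum>k<K div 2. ?Z k \<omega>) (n div l + 1) (3 * ?b + c)"
    by (rule max_dominated_reindex[OF main, where \<tau>="\<lambda>K. K div 2"]) (auto simp: N_def intro: div_le_mono)
  have single': "max_dominated M (\<lambda>K \<omega>. if K = 0 then 0 else SB l m (K - 1) \<omega>) (n div l + 1) ?b"
    by (rule max_dominated_reindex[OF single, where \<tau>="\<lambda>K. K - 1"]) auto
  have "max_dominated M (\<lambda>K \<omega>. \<Sum>k<K. SB l m k \<omega>) (n div l + 1) ((3 * ?b + c) + ?b)"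
  proof (rule max_dominated_add[OF main' single'])
    fix K \<omega>
    have g: "(\<Sum>k<J. ?Z k \<omega>) = (\<Sum>j<J * 2. SB l m j \<omega>)" for J
      by (induction J) (auto simp: mult.commute[of _ 2])
    show "\<bar>\<Sum>k<K. SB l m k \<omega>\<bar> \<le> \<bar>\<Sum>k<K div 2. ?Z k \<omega>\<bar> + \<bar>if K = 0 then 0 else SB l m (K - 1) \<omega>\<bar>"
    proof (cases "even K")
      case True
      then have "K div 2 * 2 = K" by simp
      then show ?thesis unfolding g by simp
    next
      case False
      then have K: "K = Suc (K div 2 * 2)" by presburger
      have "(\<Sum>k<K. SB l m k \<omega>) = (\<Sum>j<K div 2 * 2. SB l m j \<omega>) + SB l m (K div 2 * 2) \<omega>"
        by (subst K) simp
      moreover have "K \<noteq> 0" "K - 1 = K div 2 * 2" using K by linarith+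
      ultimately show ?thesis
        unfolding g using abs_triangle_ineq[of "\<Sum>j<K div 2 * 2. SB l m j \<omega>" "SB l m (K div 2 * 2) \<omega>"] by presburger
    qed
  qed
  then show ?thesis by (simp add: algebra_simps)
qed

text \<open>Iterating the doubling until the scale exceeds \<open>n\<close>, where a single block remains.\<close>

lemma max_SB:
  assumes "1 \<le> l" "n < l * 2 ^ L"
  shows "max_dominated M (\<lambda>K \<omega>. \<Sum>k<K. SB l m k \<omega>) (n div l + 1) (4 * (\<Sum>i\<le>L. b_norm (l * 2 ^ i) m))"
  using assms
proof (induction L arbitrary: l)
  case 0
  then have z: "n div l = 0" by simp
  have single: "max_dominated M (\<lambda>k. SB l m k) (n div l) (b_norm l m)"
    unfolding b_norm_def by (intro max_dominated_L2_set SB_L2)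
  have "max_dominated M (\<lambda>K \<omega>. \<Sum>k<K. SB l m k \<omega>) (n div l + 1) (b_norm l m)"
  proof (rule max_dominated_reindex[OF single, where \<tau>="\<lambda>_. 0"])
    fix k \<omega> assume "k \<le> n div l + 1"
    then have "k = 0 \<or> k = Suc 0" using z by auto
    then show "\<bar>\<Sum>j<k. SB l m j \<omega>\<bar> \<le> \<bar>SB l m 0 \<omega>\<bar>" by auto
  qed simp
  then show ?case by (rule max_dominated_mono) (simp add: b_norm_def L2_set_nonneg)
next
  case (Suc L)
  have "max_dominated M (\<lambda>K \<omega>. \<Sum>k<K. SB (2 * l) m k \<omega>) (n div (2 * l) + 1) (4 * (\<Sum>i\<le>L. b_norm (2 * l * 2 ^ i) m))"
    by (rule Suc.IH) (use Suc.prems in \<open>auto simp: mult_ac\<close>)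
  from max_SB_step[OF Suc.prems(1) this]
  have "max_dominated M (\<lambda>K \<omega>. \<Sum>k<K. SB l m k \<omega>) (n div l + 1)
     (4 * b_norm l m + 4 * (\<Sum>i\<le>L. b_norm (2 * l * 2 ^ i) m))" .
  moreover have "4 * b_norm l m + 4 * (\<Sum>i\<le>L. b_norm (2 * l * 2 ^ i) m) = 4 * (\<Sum>i\<le>Suc L. b_norm (l * 2 ^ i) m)"
    by (subst sum.atMost_Suc_shift) (simp add: mult_ac)
  ultimately show ?case by simp
qed

text \<open>At the scale \<open>m\<close> the block sums \<open>U k\<close> are known only two steps of the coarse filtration after the time on which
  \<open>SB m m k\<close> is conditioned, so they are projected twice; each projection and the incomplete last block
  cost a multiple of \<open>A(m) / \<surd>m\<close>.\<close>

lemma max_rho: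
  assumes m: "1 \<le> m" "n < m * 2 ^ L"
  shows "max_dominated M (\<lambda>k \<omega>. \<Sum>j<k. rho m j \<omega>) n
    (5 * (a_norm m / sqrt m) + 4 * (\<Sum>i\<le>L. b_norm (m * 2 ^ i) m))"
proof -
  define N where "N = n div m + 1"
  define U where "U = (\<lambda>k \<omega>. \<Sum>j=k*m..<k*m+m. rho m j \<omega>)"
  define Ua where "Ua = (\<lambda>k \<omega>. \<Sum>j=k*m..<k*m+m. \<bar>rho m j \<omega>\<bar>)"
  define a where "a = a_norm m / sqrt m"
  let ?G = "\<lambda>k::nat. \<F> n ((int k - 1) * int m + 1)"
  define Y where "Y = (\<lambda>k. real_cond_exp M (?G (Suc k)) (U k))"
  have U_L2: "L2_rv M (U k)" for k unfolding U_def by (intro L2_rv_sum rho_L2)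
  have Ua_L2: "L2_rv M (Ua k)" for k unfolding Ua_def by (intro L2_rv_sum L2_rv_abs rho_L2)
  have Gmono: "sets (?G i) \<subseteq> sets (?G j)" if "i \<le> j" for i j
    using that by (intro F_mono add_right_mono mult_right_mono) auto
  have sumsq: "(\<Sum>k<N. (\<Sum>j=k*m..<k*m+m. l2 M (rho m j))\<^sup>2) \<le> a\<^sup>2"
  proof -
    have "(\<Sum>k<N. (\<Sum>j=k*m..<k*m+m. l2 M (rho m j))\<^sup>2) \<le> (\<Sum>k<N. m * (\<Sum>j=k*m..<k*m+m. (l2 M (rho m j))\<^sup>2))"
    proof (rule sum_mono)
      fix k
      show "(\<Sum>j=k*m..<k*m+m. l2 M (rho m j))\<^sup>2 \<le> m * (\<Sum>j=k*m..<k*m+m. (l2 M (rho m j))\<^sup>2)"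
        using Cauchy_Schwarz_ineq_sum[of "\<lambda>j. 1" "\<lambda>j. l2 M (rho m j)" "{k*m..<k*m+m}"] by simp
    qed
    also have "\<dots> = m * (\<Sum>j<N * m. (l2 M (rho m j))\<^sup>2)"
      by (simp add: sum_distrib_left[symmetric] sum.nat_group)
    also have "\<dots> = m * ((L2_set (\<lambda>k. l2 M (cond_incr k m)) {..<N * m})\<^sup>2 / m\<^sup>2)"
      by (simp add: L2_set_power2 l2_rho power_divide sum_divide_distrib)
    also have "\<dots> \<le> m * ((a_norm m)\<^sup>2 / m\<^sup>2)"
      by (intro mult_left_mono divide_right_mono power_mono L2_set_cond_incr_le) (auto simp: L2_set_nonneg)
    also have "\<dots> = a\<^sup>2" using m by (simp add: a_def power_divide power2_eq_square)
    finally show ?thesis .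
  qed
  have a0: "0 \<le> a" by (simp add: a_def a_norm_nonneg)
  have L2U: "L2_set (\<lambda>k. l2 M (U k)) {..<N} \<le> a"
  proof (rule power2_le_imp_le[OF _ a0])
    have "(L2_set (\<lambda>k. l2 M (U k)) {..<N})\<^sup>2 \<le> (\<Sum>k<N. (\<Sum>j=k*m..<k*m+m. l2 M (rho m j))\<^sup>2)"
      unfolding L2_set_power2[OF finite_lessThan] U_def by (intro sum_mono power_mono l2_sum rho_L2) auto
    then show "(L2_set (\<lambda>k. l2 M (U k)) {..<N})\<^sup>2 \<le> a\<^sup>2" using sumsq by simp
  qed
  have L2Ua: "L2_set (\<lambda>k. l2 M (Ua k)) {..<N} \<le> a"
  proof (rule power2_le_imp_le[OF _ a0])
    have "l2 M (Ua k) \<le> (\<Sum>j=k*m..<k*m+m. l2 M (rho m j))" for k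
      using l2_sum[of "{k*m..<k*m+m}" M "\<lambda>j \<omega>. \<bar>rho m j \<omega>\<bar>"] L2_rv_abs[OF rho_L2] by (simp add: Ua_def)
    then have "(L2_set (\<lambda>k. l2 M (Ua k)) {..<N})\<^sup>2 \<le> (\<Sum>k<N. (\<Sum>j=k*m..<k*m+m. l2 M (rho m j))\<^sup>2)"
      unfolding L2_set_power2[OF finite_lessThan] by (intro sum_mono power_mono) auto
    then show "(L2_set (\<lambda>k. l2 M (Ua k)) {..<N})\<^sup>2 \<le> a\<^sup>2" using sumsq by simp
  qed
  have U_meas: "U k \<in> borel_measurable (?G (Suc (Suc k)))" for k
    unfolding U_def
  proof (intro borel_measurable_sum F_measurable_mono[OF rho_adapted])
    fix j assume "j \<in> {k*m..<k*m+m}"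
    then have "j \<le> k * m + m" by simp
    then have "int j \<le> int (k * m + m)" by (rule of_nat_mono)
    also have "\<dots> \<le> (int (Suc (Suc k)) - 1) * int m + 1" by (simp add: algebra_simps)
    finally show "int j \<le> (int (Suc (Suc k)) - 1) * int m + 1" .
  qed
  have Y_proj: "cond_proj M (?G (Suc k)) (U k) (Y k)" for k
    unfolding Y_def by (intro cond_proj_cond_exp F_sub U_L2)
  have SB_U: "cond_proj M (?G k) (U k) (SB m m k)" for k
    unfolding cond_proj_def
  proof (intro conjI allI impI)
    fix H assume H: "H \<in> borel_measurable (?G k)" "L2_rv M H"
    have t: "(\<integral>\<omega>. H \<omega> * rho m (k * m + u) \<omega> \<partial>M) = (\<integral>\<omega>. H \<omega> * ((S ((k + 1) * m + u) \<omega> - S (k * m + u) \<omega>) / m) \<partial>M)" for u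
    proof -
      have "(int k - 1) * int m + 1 \<le> int (k * m + u)" using m by (simp add: algebra_simps)
      from cond_incr_test[OF H(1) this H(2), of m] show ?thesis
        by (simp add: rho_def algebra_simps)
    qed
    note I = L2_rv_mult_integrable[OF H(2)]
    have U: "U k \<omega> = (\<Sum>u=0..<m. rho m (k * m + u) \<omega>)" for \<omega>
      unfolding U_def using sum.shift_bounds_nat_ivl[of "\<lambda>j. rho m j \<omega>" 0 "k*m" m] by (simp add: add.commute)
    have "(\<integral>\<omega>. H \<omega> * U k \<omega> \<partial>M) = (\<Sum>u=0..<m. \<integral>\<omega>. H \<omega> * rho m (k * m + u) \<omega> \<partial>M)"
      unfolding U sum_distrib_left by (intro Bochner_Integration.integral_sum I rho_L2)
    also have "\<dots> = (\<integral>\<omega>. H \<omega> * block_average m m k \<omega> \<partial>M)"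
      unfolding t block_average_def sum_distrib_left
      by (subst Bochner_Integration.integral_sum[symmetric])
        (auto intro!: I L2_rv_cmult[of M _ "1/m", simplified] L2_rv_diff S_L2)
    also have "\<dots> = (\<integral>\<omega>. H \<omega> * SB m m k \<omega> \<partial>M)" by (rule cond_projD(4)[OF SB_proj H])
    finally show "(\<integral>\<omega>. H \<omega> * U k \<omega> \<partial>M) = (\<integral>\<omega>. H \<omega> * SB m m k \<omega> \<partial>M)" .
  qed (auto intro: U_L2 SB_L2 SB_adapted)
  have SB_Y: "cond_proj M (?G k) (Y k) (SB m m k)" for k
    by (rule cond_proj_tower[OF SB_U Y_proj])
      (rule F_measurable_mono, auto simp: algebra_simps)
  have 1: "max_dominated M (\<lambda>K \<omega>. \<Sum>k<K. U k \<omega> - Y k \<omega>) N (2 * L2_set (\<lambda>k. l2 M (U k)) {..<N})"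
    by (rule max_projection[OF prob_space_axioms, of "\<lambda>k. ?G (Suc k)"])
      (rule F_sub Gmono U_meas Y_proj Suc_le_mono[THEN iffD2] | assumption)+
  have 2: "max_dominated M (\<lambda>K \<omega>. \<Sum>k<K. Y k \<omega> - SB m m k \<omega>) N (2 * L2_set (\<lambda>k. l2 M (Y k)) {..<N})"
    by (rule max_projection[OF prob_space_axioms, of ?G])
      (rule F_sub Gmono cond_projD(3)[OF Y_proj] SB_Y | assumption)+
  have L2Y: "L2_set (\<lambda>k. l2 M (Y k)) {..<N} \<le> a"
    by (rule order_trans[OF L2_set_mono L2U]) (use cond_proj_l2(1)[OF Y_proj] in auto)
  have 3: "max_dominated M (\<lambda>K \<omega>. \<Sum>k<K. SB m m k \<omega>) N (4 * (\<Sum>i\<le>L. b_norm (m * 2 ^ i) m))"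
    unfolding N_def by (rule max_SB[OF m])
  have 4: "max_dominated M (\<lambda>K \<omega>. \<Sum>k<K. U k \<omega>) N (2 * a + (2 * a + 4 * (\<Sum>i\<le>L. b_norm (m * 2 ^ i) m)))"
  proof (rule max_dominated_add[OF max_dominated_mono[OF 1]])
    show "max_dominated M (\<lambda>K \<omega>. \<Sum>k<K. Y k \<omega>) N (2 * a + 4 * (\<Sum>i\<le>L. b_norm (m * 2 ^ i) m))"
      by (rule max_dominated_add[OF max_dominated_mono[OF 2] 3]) (use L2Y in \<open>auto simp: sum_subtractf\<close>)
  qed (use L2U in \<open>auto simp: sum_subtractf\<close>)
  have 5: "max_dominated M Ua (n div m) a"
    by (rule max_dominated_mono[OF max_dominated_L2_set[OF Ua_L2]])
      (use L2Ua in \<open>simp add: N_def lessThan_Suc_atMost\<close>)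
  have "max_dominated M (\<lambda>k \<omega>. \<Sum>j<k. rho m j \<omega>) n ((2 * a + (2 * a + 4 * (\<Sum>i\<le>L. b_norm (m * 2 ^ i) m))) + a)"
  proof (rule max_dominated_add)
    show "max_dominated M (\<lambda>k \<omega>. \<Sum>\<kappa><k div m. U \<kappa> \<omega>) n (2 * a + (2 * a + 4 * (\<Sum>i\<le>L. b_norm (m * 2 ^ i) m)))"
      by (rule max_dominated_reindex[OF 4, where \<tau>="\<lambda>k. k div m"]) (auto simp: N_def div_le_mono le_SucI)
    show "max_dominated M (\<lambda>k. Ua (k div m)) n a"
      by (rule max_dominated_reindex[OF 5, where \<tau>="\<lambda>k. k div m"]) (auto simp: div_le_mono)
    fix k \<omega>
    let ?K = "k div m"
    have km: "?K * m \<le> k" "k \<le> ?K * m + m"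
      using m div_mult_mod_eq[of k m] mod_less_divisor[of m k] by linarith+
    have "(\<Sum>j<k. rho m j \<omega>) = (\<Sum>j<?K * m. rho m j \<omega>) + (\<Sum>j=?K * m..<k. rho m j \<omega>)"
      using km(1) by (simp add: lessThan_atLeast0 sum.atLeastLessThan_concat)
    moreover have "(\<Sum>j<?K * m. rho m j \<omega>) = (\<Sum>\<kappa><?K. U \<kappa> \<omega>)"
      unfolding U_def by (simp add: sum.nat_group)
    moreover have "\<bar>\<Sum>j=?K * m..<k. rho m j \<omega>\<bar> \<le> Ua ?K \<omega>"
      unfolding Ua_def using km by (intro order_trans[OF sum_abs] sum_mono2) auto
    ultimately show "\<bar>\<Sum>j<k. rho m j \<omega>\<bar> \<le> \<bar>\<Sum>\<kappa><?K. U \<kappa> \<omega>\<bar> + \<bar>Ua ?K \<omega>\<bar>" by linarith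
  qed
  then show ?thesis by (simp add: a_def algebra_simps)
qed

end


text \<open>With \<open>s i = \<integral>H S\<^sub>i\<close> this expresses that the martingale differences below are orthogonal to \<open>H\<close>.\<close>

lemma telescoped_averages:
  fixes s :: "nat \<Rightarrow> real"
  assumes "1 \<le> m"
  shows "m * (s (Suc j) - s j) + (\<Sum>i=1..<m. s (Suc j + i) - s (Suc j)) - (\<Sum>i=1..<m. s (j + i) - s j)
    - (s (j + m) - s j) = 0"
  using assms
proof (induction m rule: dec_induct)
  case base
  show ?case by simp
next
  case (step m)
  then show ?case by (simp add: algebra_simps)
qed

lemma max_dominated_AE:
  assumes "max_dominated M f N a" "\<And>k. k \<le> N \<Longrightarrow> AE \<omega> in M. \<bar>h k \<omega>\<bar> \<le> \<bar>f k \<omega>\<bar>"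
  shows "max_dominated M h N a"
proof -
  obtain P where P: "L2_rv M P" "AE \<omega> in M. \<forall>k\<le>N. \<bar>f k \<omega>\<bar> \<le> P \<omega>" "l2 M P \<le> a"
    using assms(1) unfolding max_dominated_def by blast
  have "AE \<omega> in M. \<forall>k\<in>{..N}. \<bar>h k \<omega>\<bar> \<le> \<bar>f k \<omega>\<bar>"
    using assms(2) by (intro AE_finite_allI) auto
  then have "AE \<omega> in M. \<forall>k\<le>N. \<bar>h k \<omega>\<bar> \<le> P \<omega>"
    using P(2) by eventually_elim (meson atMost_iff order_trans)
  then show ?thesis using P by (intro max_dominatedI)
qed

context adapted_row begin

definition mart_diff :: "nat \<Rightarrow> nat \<Rightarrow> 'a \<Rightarrow> real" where
  "mart_diff m j \<omega> = X n (Suc j) \<omega> + \<theta> m (Suc j) \<omega> - \<theta> m j \<omega> - rho m j \<omega>"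

lemma mart_diff_L2: "L2_rv M (mart_diff m j)"
  unfolding mart_diff_def[abs_def] by (intro L2_rv_add L2_rv_diff theta_L2 rho_L2 X_L2) simp

lemma row_martingale:
  assumes m: "1 \<le> m"
  shows "L2_martingale M (\<lambda>k. \<F> n (int k)) (mart_diff m)"
proof
  show "subalgebra M (\<F> n (int k))" for k by (rule F_sub)
  show "sets (\<F> n (int i)) \<subseteq> sets (\<F> n (int j))" if "i \<le> j" for i j using that by (intro F_mono) simp
  show "L2_rv M (mart_diff m j)" for j by (rule mart_diff_L2)
  show "mart_diff m j \<in> borel_measurable (\<F> n (int (Suc j)))" for j
    unfolding mart_diff_def[abs_def]
    by (intro borel_measurable_add borel_measurable_diff X_adapted theta_adapted
       F_measurable_mono[OF theta_adapted] F_measurable_mono[OF rho_adapted]) auto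
  fix H j assume H: "H \<in> borel_measurable (\<F> n (int j))" "L2_rv M H"
  define s where "s = (\<lambda>i. \<integral>\<omega>. H \<omega> * S i \<omega> \<partial>M)"
  note I = L2_rv_mult_integrable[OF H(2)]
  have sd: "(\<integral>\<omega>. H \<omega> * (S a \<omega> - S b \<omega>) \<partial>M) = s a - s b" for a b
    using I[OF S_L2[of a]] I[OF S_L2[of b]] by (simp add: s_def right_diff_distrib)
  have d: "(\<integral>\<omega>. H \<omega> * cond_incr k u \<omega> \<partial>M) = s (k + u) - s k" if "j \<le> k" for k u
    using cond_incr_test[OF H(1) _ H(2), of k u] that sd by simp
  have t: "(\<integral>\<omega>. H \<omega> * \<theta> m k \<omega> \<partial>M) = 1 / m * (\<Sum>i=1..<m. s (k + i) - s k)" if "j \<le> k" for k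
  proof -
    have "(\<integral>\<omega>. H \<omega> * \<theta> m k \<omega> \<partial>M) = (\<integral>\<omega>. 1 / m * (\<Sum>i=1..<m. H \<omega> * cond_incr k i \<omega>) \<partial>M)"
      by (intro Bochner_Integration.integral_cong refl) (simp add: theta_eq sum_distrib_left algebra_simps)
    also have "\<dots> = 1 / m * (\<Sum>i=1..<m. \<integral>\<omega>. H \<omega> * cond_incr k i \<omega> \<partial>M)"
      using I[OF cond_incr_L2] by simp
    finally show ?thesis using d[OF that] by simp
  qed
  have X: "X n (Suc j) \<omega> = S (Suc j) \<omega> - S j \<omega>" for \<omega> by (simp add: row_sum_def)
  have "(\<integral>\<omega>. H \<omega> * mart_diff m j \<omega> \<partial>M) = (\<integral>\<omega>. H \<omega> * (S (Suc j) \<omega> - S j \<omega>) \<partial>M) + (\<integral>\<omega>. H \<omega> * \<theta> m (Suc j) \<omega> \<partial>M)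
     - (\<integral>\<omega>. H \<omega> * \<theta> m j \<omega> \<partial>M) - (\<integral>\<omega>. H \<omega> * rho m j \<omega> \<partial>M)"
    unfolding mart_diff_def X
    using I[OF L2_rv_diff[OF S_L2 S_L2, of "Suc j" j]] I[OF theta_L2[of m]] I[OF rho_L2[of m j]]
    by (simp add: right_diff_distrib distrib_left del: of_nat_Suc)
  also have "(\<integral>\<omega>. H \<omega> * rho m j \<omega> \<partial>M) = 1 / m * (s (j + m) - s j)"
    using d[of j m] by (simp add: rho_def)
  finally have eq: "(\<integral>\<omega>. H \<omega> * mart_diff m j \<omega> \<partial>M) = (s (Suc j) - s j) + 1 / m * (\<Sum>i=1..<m. s (Suc j + i) - s (Suc j))
      - 1 / m * (\<Sum>i=1..<m. s (j + i) - s j) - 1 / m * (s (j + m) - s j)"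
    unfolding sd t[OF order_refl] t[OF le_SucI[OF order_refl]] .
  have r: "m * (x + 1 / m * a - 1 / m * b - 1 / m * c) = m * x + a - b - c" for x a b c :: real
    using m by (simp add: right_diff_distrib distrib_left)
  have "m * (\<integral>\<omega>. H \<omega> * mart_diff m j \<omega> \<partial>M) = m * (s (Suc j) - s j) + (\<Sum>i=1..<m. s (Suc j + i) - s (Suc j))
      - (\<Sum>i=1..<m. s (j + i) - s j) - (s (j + m) - s j)"
    unfolding eq by (rule r)
  then show "(\<integral>\<omega>. H \<omega> * mart_diff m j \<omega> \<partial>M) = 0"
    unfolding telescoped_averages[OF m] using m by simp
qed

lemma S_decomposition:
  "S k \<omega> = (\<Sum>j<k. mart_diff m j \<omega>) + \<theta> m 0 \<omega> - \<theta> m k \<omega> + (\<Sum>j<k. rho m j \<omega>)"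
  by (induction k) (auto simp: mart_diff_def row_sum_def)

subsection \<open>Negligibility of the individual terms\<close>

definition lindeberg_sum :: "real \<Rightarrow> real" where
  "lindeberg_sum \<epsilon> = (\<Sum>k=1..n. \<integral>\<omega>. (X n k \<omega>)\<^sup>2 * indicator {\<omega>'. \<bar>X n k \<omega>'\<bar> > \<epsilon>} \<omega> \<partial>M)"

definition large_part :: "real \<Rightarrow> nat \<Rightarrow> 'a \<Rightarrow> real" where
  "large_part \<epsilon> k \<omega> = \<bar>X n k \<omega>\<bar> * indicator {\<omega>'. \<bar>X n k \<omega>'\<bar> > \<epsilon>} \<omega>"

lemma lindeberg_sum_nonneg: "0 \<le> lindeberg_sum \<epsilon>"
  unfolding lindeberg_sum_def by (intro sum_nonneg integral_nonneg_AE) auto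

lemma large_part_le: "\<bar>X n k \<omega>\<bar> \<le> \<epsilon> + large_part \<epsilon> k \<omega>" if "0 < \<epsilon>"
  using that by (auto simp: large_part_def indicator_def)

lemma large_part_nonneg: "0 \<le> large_part \<epsilon> k \<omega>"
  by (simp add: large_part_def)

lemma large_part_L2: "1 \<le> k \<Longrightarrow> L2_rv M (large_part \<epsilon> k)"
proof -
  assume k: "1 \<le> k"
  have [measurable]: "X n k \<in> borel_measurable M" using X_L2[OF k] by auto
  have "large_part \<epsilon> k = (\<lambda>\<omega>. if \<bar>X n k \<omega>\<bar> > \<epsilon> then \<bar>X n k \<omega>\<bar> else 0)" by (auto simp: large_part_def fun_eq_iff)
  then have "large_part \<epsilon> k \<in> borel_measurable M" by simp
  then show ?thesis
    by (rule L2_rv_bound(1)[OF X_L2[OF k]]) (auto simp: large_part_def indicator_def)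
qed

lemma L2_set_large_part: "finite K \<Longrightarrow> 1 \<le> i \<Longrightarrow> L2_set (\<lambda>k. l2 M (large_part \<epsilon> (k + i))) K \<le> sqrt (lindeberg_sum \<epsilon>)"
proof -
  assume K: "finite K" and i: "1 \<le> i"
  have z: "l2 M (large_part \<epsilon> k) = 0" if "n < k" for k
  proof -
    have "l2 M (large_part \<epsilon> k) = l2 M (\<lambda>\<omega>. 0)"
      using X_zero[OF that] large_part_L2[of k \<epsilon>] that by (intro L2_rv_cong_AE(2) L2_rv_zero) (auto simp: large_part_def)
    then show ?thesis by simp
  qed
  have z': "k \<le> n" if "l2 M (large_part \<epsilon> k) \<noteq> 0" for k using that z[of k] by force
  have "(\<Sum>k\<in>K. (l2 M (large_part \<epsilon> (k + i)))\<^sup>2) = (\<Sum>k\<in>(\<lambda>k. k + i) ` K. (l2 M (large_part \<epsilon> k))\<^sup>2)"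
    by (subst sum.reindex) (auto simp: inj_on_def)
  also have "\<dots> = (\<Sum>k\<in>(\<lambda>k. k + i) ` K \<inter> {1..n}. (l2 M (large_part \<epsilon> k))\<^sup>2)"
    using K i z' by (intro sum.mono_neutral_right) auto
  also have "\<dots> \<le> (\<Sum>k=1..n. (l2 M (large_part \<epsilon> k))\<^sup>2)"
    by (intro sum_mono2) auto
  also have "\<dots> = lindeberg_sum \<epsilon>"
    unfolding lindeberg_sum_def l2_power2
    by (intro sum.cong refl Bochner_Integration.integral_cong) (auto simp: large_part_def power_mult_distrib indicator_def)
  finally show ?thesis unfolding L2_set_def by simp
qed

lemma max_dominated_const: "max_dominated M (\<lambda>k \<omega>. c) N \<bar>c\<bar>"
  by (rule max_dominatedI[of M "\<lambda>\<omega>. \<bar>c\<bar>"]) auto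

text \<open>Each variable is at most \<open>\<epsilon>\<close> plus its large part, and the maximum over \<open>k\<close> of the conditional expectations
  of the large parts is at most the root of the sum of their squares. Projecting decreases the \<open>L\<^sup>2\<close> norm, so that sum
  has expectation at most the Lindeberg sum of the large parts themselves.\<close>

lemma max_cond_incr:
  assumes "0 < \<epsilon>"
  shows "max_dominated M (\<lambda>k. cond_incr k u) N (u * (\<epsilon> + sqrt (lindeberg_sum \<epsilon>)))"
proof -
  define Xi where "Xi = (\<lambda>k \<omega>. \<Sum>i=1..u. large_part \<epsilon> (k + i) \<omega>)"
  define E where "E = (\<lambda>k. real_cond_exp M (\<F> n (int k)) (Xi k))"
  have Xi_L2: "L2_rv M (Xi k)" for k unfolding Xi_def by (intro L2_rv_sum large_part_L2) auto
  have E: "cond_proj M (\<F> n (int k)) (Xi k) (E k)" for k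
    unfolding E_def by (intro cond_proj_cond_exp F_sub Xi_L2)
  have "max_dominated M E N (L2_set (\<lambda>k. l2 M (E k)) {..N})"
    by (rule max_dominated_L2_set) (rule cond_projD(2)[OF E])
  moreover have "L2_set (\<lambda>k. l2 M (E k)) {..N} \<le> u * sqrt (lindeberg_sum \<epsilon>)"
  proof -
    have "L2_set (\<lambda>k. l2 M (E k)) {..N} \<le> L2_set (\<lambda>k. l2 M (Xi k)) {..N}"
      using cond_proj_l2(1)[OF E] by (intro L2_set_mono) auto
    also have "\<dots> \<le> (\<Sum>i=1..u. L2_set (\<lambda>k. l2 M (large_part \<epsilon> (k + i))) {..N})"
      unfolding Xi_def by (intro L2_set_l2_sum_le large_part_L2) auto
    also have "\<dots> \<le> (\<Sum>i=1..u. sqrt (lindeberg_sum \<epsilon>))" by (intro sum_mono L2_set_large_part) auto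
    finally show ?thesis by simp
  qed
  ultimately have "max_dominated M E N (u * sqrt (lindeberg_sum \<epsilon>))" by (rule max_dominated_mono)
  then have m: "max_dominated M (\<lambda>k \<omega>. u * \<epsilon> + E k \<omega>) N (\<bar>u * \<epsilon>\<bar> + u * sqrt (lindeberg_sum \<epsilon>))"
    by (rule max_dominated_add[OF max_dominated_const]) (rule abs_triangle_ineq)
  have "max_dominated M (\<lambda>k. cond_incr k u) N (\<bar>u * \<epsilon>\<bar> + u * sqrt (lindeberg_sum \<epsilon>))"
  proof (rule max_dominated_AE[OF m])
    fix k
    interpret G: sigma_finite_subalgebra M "\<F> n (int k)" by (rule sigma_finite_subalgebraI[OF F_sub])
    let ?f = "\<lambda>\<omega>. S (k + u) \<omega> - S k \<omega>" and ?g = "\<lambda>\<omega>. u * \<epsilon> + Xi k \<omega>"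
    have le: "\<bar>?f \<omega>\<bar> \<le> ?g \<omega>" for \<omega>
    proof -
      have "\<bar>?f \<omega>\<bar> \<le> (\<Sum>i=1..u. \<epsilon> + large_part \<epsilon> (k + i) \<omega>)"
        unfolding S_diff by (intro order_trans[OF sum_abs] sum_mono large_part_le[OF assms])
      then show ?thesis by (simp add: Xi_def sum.distrib)
    qed
    have i: "integrable M ?f" "integrable M ?g" "integrable M (Xi k)" "integrable M (\<lambda>\<omega>. - ?g \<omega>)" "integrable M (\<lambda>\<omega>. real u * \<epsilon>)"
      using L2_rv_integrable[OF L2_rv_diff[OF S_L2 S_L2, of "k+u" k]] L2_rv_integrable[OF Xi_L2[of k]] by auto
    have "AE \<omega> in M. cond_incr k u \<omega> \<le> real_cond_exp M (\<F> n (int k)) ?g \<omega>"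
      unfolding cond_incr_def using le by (intro G.real_cond_exp_mono i AE_I2) (meson abs_le_D1)
    moreover have "AE \<omega> in M. real_cond_exp M (\<F> n (int k)) (\<lambda>\<omega>. - ?g \<omega>) \<omega> \<le> cond_incr k u \<omega>"
      unfolding cond_incr_def using le by (intro G.real_cond_exp_mono i AE_I2) (smt (verit))
    moreover have "AE \<omega> in M. real_cond_exp M (\<F> n (int k)) (\<lambda>\<omega>. - ?g \<omega>) \<omega> = - real_cond_exp M (\<F> n (int k)) ?g \<omega>"
      using G.real_cond_exp_cmult[OF i(2), of "-1"] by simp
    moreover have "AE \<omega> in M. real_cond_exp M (\<F> n (int k)) ?g \<omega> = real_cond_exp M (\<F> n (int k)) (\<lambda>\<omega>. real u * \<epsilon>) \<omega> + E k \<omega>"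
      unfolding E_def by (rule G.real_cond_exp_add[OF i(5) i(3)])
    moreover have "AE \<omega> in M. real_cond_exp M (\<F> n (int k)) (\<lambda>\<omega>. real u * \<epsilon>) \<omega> = u * \<epsilon>"
      by (rule G.real_cond_exp_F_meas[OF i(5)]) simp
    ultimately show "AE \<omega> in M. \<bar>cond_incr k u \<omega>\<bar> \<le> \<bar>u * \<epsilon> + E k \<omega>\<bar>"
      by eventually_elim linarith
  qed
  then show ?thesis using assms by (simp add: distrib_left abs_mult)
qed

lemma max_X:
  assumes "0 < \<epsilon>"
  shows "max_dominated M (\<lambda>k. X n (Suc k)) N (\<epsilon> + sqrt (lindeberg_sum \<epsilon>))"
proof -
  have "max_dominated M (\<lambda>k. large_part \<epsilon> (k + 1)) N (sqrt (lindeberg_sum \<epsilon>))"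
    using max_dominated_mono[OF max_dominated_L2_set, of N M "\<lambda>k. large_part \<epsilon> (k + 1)"]
      large_part_L2[of "_ + 1"] L2_set_large_part[of "{..N}" 1 \<epsilon>] by simp
  from max_dominated_add[OF max_dominated_const[of \<epsilon>] this, of "\<lambda>k. X n (Suc k)"] show ?thesis
    using assms large_part_le[OF assms] large_part_nonneg by simp
qed

lemma max_theta:
  assumes "0 < \<epsilon>"
  shows "max_dominated M (\<theta> m) N (m * (\<epsilon> + sqrt (lindeberg_sum \<epsilon>)))"
proof -
  let ?t = "\<epsilon> + sqrt (lindeberg_sum \<epsilon>)"
  have t0: "0 \<le> ?t" using assms lindeberg_sum_nonneg by simp
  have "max_dominated M (\<lambda>k \<omega>. 1 / m * (\<Sum>i=1..<m. cond_incr k i \<omega>)) N (\<bar>1 / m\<bar> * (\<Sum>i=1..<m. i * ?t))"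
    by (intro max_dominated_cmult max_dominated_sum max_cond_incr[OF assms]) auto
  moreover have "\<bar>1 / m\<bar> * (\<Sum>i=1..<m. i * ?t) \<le> m * ?t"
  proof -
    have "(\<Sum>i=1..<m. i * ?t) \<le> (\<Sum>i=1..<m. m * ?t)" using t0 by (intro sum_mono mult_right_mono) auto
    also have "\<dots> \<le> m * (m * ?t)" using t0 by (simp add: mult_right_mono)
    finally show ?thesis using t0 by (cases "m = 0") (simp_all add: divide_le_eq mult.commute)
  qed
  ultimately have "max_dominated M (\<lambda>k \<omega>. 1 / m * (\<Sum>i=1..<m. cond_incr k i \<omega>)) N (m * ?t)"
    by (rule max_dominated_mono)
  then show ?thesis by (simp add: theta_eq)
qed

lemma max_rho_single:
  assumes "0 < \<epsilon>"
  shows "max_dominated M (rho m) N (\<epsilon> + sqrt (lindeberg_sum \<epsilon>))"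
proof -
  have "max_dominated M (\<lambda>k \<omega>. 1 / m * cond_incr k m \<omega>) N (\<bar>1 / m\<bar> * (m * (\<epsilon> + sqrt (lindeberg_sum \<epsilon>))))"
    by (intro max_dominated_cmult max_cond_incr assms)
  then have "max_dominated M (rho m) N (\<bar>1 / m\<bar> * (m * (\<epsilon> + sqrt (lindeberg_sum \<epsilon>))))"
    using ext[of "rho m", OF rho_cmult] by simp
  moreover have "\<bar>1 / m\<bar> * (m * (\<epsilon> + sqrt (lindeberg_sum \<epsilon>))) \<le> \<epsilon> + sqrt (lindeberg_sum \<epsilon>)"
    using assms lindeberg_sum_nonneg[of \<epsilon>] by (cases "m = 0") auto
  ultimately show ?thesis by (rule max_dominated_mono)
qed

lemma max_mart_diff:
  assumes "0 < \<epsilon>"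
  shows "max_dominated M (mart_diff m) N ((2 * m + 2) * (\<epsilon> + sqrt (lindeberg_sum \<epsilon>)))"
proof -
  let ?t = "\<epsilon> + sqrt (lindeberg_sum \<epsilon>)"
  have th: "max_dominated M (\<lambda>k. \<theta> m (Suc k)) N (m * ?t)"
    by (rule max_dominated_reindex[OF max_theta[OF assms, of m "Suc N"], where \<tau>=Suc]) auto
  have 1: "max_dominated M (\<lambda>k \<omega>. X n (Suc k) \<omega> + \<theta> m (Suc k) \<omega>) N (?t + m * ?t)"
    by (rule max_dominated_add[OF max_X[OF assms] th]) simp
  have 2: "max_dominated M (\<lambda>k \<omega>. \<theta> m k \<omega> + rho m k \<omega>) N (m * ?t + ?t)"
    by (rule max_dominated_add[OF max_theta[OF assms, of m] max_rho_single[OF assms, of m]]) simp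
  have "max_dominated M (mart_diff m) N ((?t + m * ?t) + (m * ?t + ?t))"
    by (rule max_dominated_add[OF 1 2]) (simp add: mart_diff_def)
  then show ?thesis by (simp add: algebra_simps)
qed

subsection \<open>Second moments and quadratic variation\<close>

lemma L2_set_theta:
  assumes \<kappa>: "\<And>i. i < m \<Longrightarrow> a_norm i \<le> \<kappa>" "0 \<le> \<kappa>" and "finite K"
  shows "L2_set (\<lambda>k. l2 M (\<theta> m k)) K \<le> \<kappa>"
proof -
  have "L2_set (\<lambda>k. l2 M (\<theta> m k)) K = 1 / m * L2_set (\<lambda>k. l2 M (\<lambda>\<omega>. \<Sum>i=1..<m. cond_incr k i \<omega>)) K"
    unfolding theta_eq l2_cmult by (subst L2_set_right_distrib) auto
  also have "\<dots> \<le> 1 / m * (\<Sum>i=1..<m. L2_set (\<lambda>k. l2 M (cond_incr k i)) K)"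
    by (intro mult_left_mono L2_set_l2_sum_le cond_incr_L2) auto
  also have "\<dots> \<le> 1 / m * (\<Sum>i=1..<m. \<kappa>)"
    using \<kappa> L2_set_cond_incr_le[OF \<open>finite K\<close>] by (intro mult_left_mono sum_mono) (auto intro: order_trans)
  also have "\<dots> \<le> \<kappa>"
    using \<kappa>(2) by (cases "m = 0") (auto simp: field_simps of_nat_diff)
  finally show ?thesis .
qed

lemma L2_set_rho: "finite K \<Longrightarrow> L2_set (\<lambda>k. l2 M (rho m k)) K \<le> a_norm m / m"
proof -
  assume K: "finite K"
  have "L2_set (\<lambda>k. l2 M (rho m k)) K = 1 / m * L2_set (\<lambda>k. l2 M (cond_incr k m)) K"
    unfolding rho_cmult l2_cmult by (subst L2_set_right_distrib) auto
  also have "\<dots> \<le> 1 / m * a_norm m" by (intro mult_left_mono L2_set_cond_incr_le[OF K]) auto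
  finally show ?thesis by simp
qed

lemma L2_set_mart_diff:
  assumes \<kappa>: "\<And>i. i < m \<Longrightarrow> a_norm i \<le> \<kappa>" "0 \<le> \<kappa>" and C: "(\<Sum>j=1..n. \<integral>\<omega>. (X n j \<omega>)\<^sup>2 \<partial>M) \<le> C"
  shows "L2_set (\<lambda>j. l2 M (mart_diff m j)) {..<n} \<le> sqrt C + 2 * \<kappa> + a_norm m / m"
proof -
  let ?f = "\<lambda>j. l2 M (X n (Suc j))" and ?g = "\<lambda>j. l2 M (\<theta> m (Suc j))"
    and ?h = "\<lambda>j. l2 M (\<theta> m j)" and ?r = "\<lambda>j. l2 M (rho m j)"
  have XL: "L2_rv M (X n (Suc j))" for j by (rule X_L2) simp
  have "l2 M (mart_diff m j) \<le> ((?f j + ?g j) + ?h j) + ?r j" for j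
    unfolding mart_diff_def[abs_def]
    by (intro order_trans[OF l2_diff] add_right_mono L2_rv_add L2_rv_diff XL theta_L2 rho_L2)
      (intro order_trans[OF l2_diff] add_right_mono L2_rv_add L2_rv_diff XL theta_L2 rho_L2 l2_add)
  then have "L2_set (\<lambda>j. l2 M (mart_diff m j)) {..<n} \<le> L2_set (\<lambda>j. ((?f j + ?g j) + ?h j) + ?r j) {..<n}"
    by (intro L2_set_mono) auto
  also have "\<dots> \<le> ((L2_set ?f {..<n} + L2_set ?g {..<n}) + L2_set ?h {..<n}) + L2_set ?r {..<n}"
    using L2_set_triangle_ineq[of "\<lambda>j. (?f j + ?g j) + ?h j" ?r "{..<n}"]
      L2_set_triangle_ineq[of "\<lambda>j. ?f j + ?g j" ?h "{..<n}"] L2_set_triangle_ineq[of ?f ?g "{..<n}"] by linarith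
  also have "\<dots> \<le> ((sqrt C + \<kappa>) + \<kappa>) + a_norm m / m"
  proof (intro add_mono L2_set_theta \<kappa> L2_set_rho finite_lessThan)
    have "(\<Sum>j<n. (?f j)\<^sup>2) = (\<Sum>j=1..n. \<integral>\<omega>. (X n j \<omega>)\<^sup>2 \<partial>M)"
      unfolding l2_power2 by (rule sum.reindex_bij_witness[where i="\<lambda>j. j - 1" and j=Suc]) auto
    then show "L2_set ?f {..<n} \<le> sqrt C" using C by (simp add: L2_set_def)
    have "L2_set ?g {..<n} = L2_set ?h (Suc ` {..<n})"
      unfolding L2_set_def by (subst sum.reindex) auto
    then show "L2_set ?g {..<n} \<le> \<kappa>" using L2_set_theta[OF \<kappa>, where K="Suc ` {..<n}"] by simp
  qed
  finally show ?thesis by simp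
qed

text \<open>With \<open>e = \<theta>\<^sub>j + \<rho>\<^sub>j\<close> and \<open>h = X\<^bsub>j+1\<^esub> + \<theta>\<^bsub>j+1\<^esub>\<close> the difference is \<open>D = h - e\<close>, hence \<open>D\<^sup>2 = h\<^sup>2 - 2 e D - e\<^sup>2\<close>. The terms
  \<open>\<theta>\<^sub>j\<^sup>2\<close> telescope and \<open>e D\<close> is a martingale difference.\<close>

lemma mart_diff_square:
  "(\<Sum>j<K. (mart_diff m j \<omega>)\<^sup>2) - (\<Sum>k=1..K. (X n k \<omega>)\<^sup>2 + 2 * X n k \<omega> * \<theta> m k \<omega>)
    = (\<theta> m K \<omega>)\<^sup>2 - (\<theta> m 0 \<omega>)\<^sup>2 - (\<Sum>j<K. 2 * (\<theta> m j \<omega> * rho m j \<omega>) + (rho m j \<omega>)\<^sup>2)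
       - 2 * (\<Sum>j<K. (\<theta> m j \<omega> + rho m j \<omega>) * mart_diff m j \<omega>)"
proof (induction K)
  case (Suc K)
  have "(mart_diff m K \<omega>)\<^sup>2 - ((X n (Suc K) \<omega>)\<^sup>2 + 2 * X n (Suc K) \<omega> * \<theta> m (Suc K) \<omega>)
    = (\<theta> m (Suc K) \<omega>)\<^sup>2 - (\<theta> m K \<omega>)\<^sup>2 - (2 * (\<theta> m K \<omega> * rho m K \<omega>) + (rho m K \<omega>)\<^sup>2)
       - 2 * ((\<theta> m K \<omega> + rho m K \<omega>) * mart_diff m K \<omega>)"
    unfolding mart_diff_def by (simp add: power2_eq_square algebra_simps)
  then show ?case using Suc by simp
qed simp

text \<open>The remainder of the previous identity: the boundary terms and the products \<open>\<theta> \<rho>\<close>, \<open>\<rho>\<^sup>2\<close> are bounded in \<open>L\<^sup>1\<close>, and the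
  transform \<open>\<Sum> e D\<close> in \<open>L\<^sup>2\<close> after truncating \<open>e\<close> at the level \<open>\<delta>\<close>.\<close>

lemma variation_bound:
  assumes m: "1 \<le> m" and \<kappa>: "\<And>i. i < m \<Longrightarrow> a_norm i \<le> \<kappa>" "0 \<le> \<kappa>"
    and C: "(\<Sum>j=1..n. \<integral>\<omega>. (X n j \<omega>)\<^sup>2 \<partial>M) \<le> C"
    and pos: "0 < \<epsilon>" "0 < \<eta>" "0 < \<delta>" and K: "K \<le> n"
  defines "t \<equiv> \<epsilon> + sqrt (lindeberg_sum \<epsilon>)" and "\<alpha> \<equiv> a_norm m / m"
  shows "prob {\<omega>\<in>space M. \<bar>(\<Sum>j<K. (mart_diff m j \<omega>)\<^sup>2) - (\<Sum>k=1..K. (X n k \<omega>)\<^sup>2 + 2 * X n k \<omega> * \<theta> m k \<omega>)\<bar> > 4 * \<eta>}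
    \<le> (2 * (m * t)\<^sup>2 + 2 * \<kappa> * \<alpha> + \<alpha>\<^sup>2) / \<eta> + ((real m + 1) * t)\<^sup>2 / \<delta>\<^sup>2 + \<delta>\<^sup>2 * (sqrt C + 2 * \<kappa> + \<alpha>)\<^sup>2 / \<eta>\<^sup>2"
proof -
  interpret D: L2_martingale M "\<lambda>k. \<F> n (int k)" "mart_diff m" by (rule row_martingale[OF m])
  have tM [measurable]: "\<theta> m k \<in> borel_measurable M" "rho m k \<in> borel_measurable M" for k
    by (rule L2_rvD(1)[OF theta_L2], rule L2_rvD(1)[OF rho_L2])
  define e where "e = (\<lambda>j \<omega>. \<theta> m j \<omega> + rho m j \<omega>)"
  define H where "H = (\<lambda>j \<omega>. if \<bar>e j \<omega>\<bar> \<le> \<delta> then e j \<omega> else 0)"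
  have eG: "e j \<in> borel_measurable (\<F> n (int j))" for j
    unfolding e_def using theta_adapted rho_adapted by measurable
  have eM [measurable]: "e j \<in> borel_measurable M" for j unfolding e_def by measurable
  have HM [measurable]: "H j \<in> borel_measurable M" for j unfolding H_def by measurable
  have HG: "H j \<in> borel_measurable (\<F> n (int j))" for j
    unfolding H_def using eG[of j] by measurable
  interpret HD: L2_martingale M "\<lambda>k. \<F> n (int k)" "\<lambda>j \<omega>. H j \<omega> * mart_diff m j \<omega>"
    by (rule D.martingale_transform[where B=\<delta>]) (use HG pos in \<open>auto simp: H_def\<close>)
  define P where "P = (\<lambda>\<omega>. (\<theta> m K \<omega>)\<^sup>2 + (\<theta> m 0 \<omega>)\<^sup>2 + (\<Sum>j<n. 2 * \<bar>\<theta> m j \<omega> * rho m j \<omega>\<bar> + (rho m j \<omega>)\<^sup>2))"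
  have "max_dominated M e n (m * t + t)"
    unfolding e_def t_def by (rule max_dominated_add[OF max_theta[OF pos(1), of m] max_rho_single[OF pos(1), of m]]) simp
  then obtain Q where Q: "L2_rv M Q" "AE \<omega> in M. \<forall>k\<le>n. \<bar>e k \<omega>\<bar> \<le> Q \<omega>" "l2 M Q \<le> m * t + t"
    unfolding max_dominated_def by blast
  have [measurable]: "Q \<in> borel_measurable M" using Q by auto
  have [measurable]: "P \<in> borel_measurable M" unfolding P_def by measurable
  have DM [measurable]: "mart_diff m j \<in> borel_measurable M" for j by (rule D.D_M)
  let ?B = "{\<omega>\<in>space M. \<bar>(\<Sum>j<K. (mart_diff m j \<omega>)\<^sup>2) - (\<Sum>k=1..K. (X n k \<omega>)\<^sup>2 + 2 * X n k \<omega> * \<theta> m k \<omega>)\<bar> > 4 * \<eta>}"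
  let ?B1 = "{\<omega>\<in>space M. P \<omega> \<ge> \<eta>}" and ?B2 = "{\<omega>\<in>space M. \<bar>Q \<omega>\<bar> \<ge> \<delta>}" and ?B3 = "{\<omega>\<in>space M. \<bar>HD.mg K \<omega>\<bar> \<ge> \<eta>}"
  have "prob ?B \<le> prob (?B1 \<union> ?B2 \<union> ?B3)"
  proof (rule finite_measure_mono_AE)
    show "AE \<omega> in M. \<omega> \<in> ?B \<longrightarrow> \<omega> \<in> ?B1 \<union> ?B2 \<union> ?B3"
      using Q(2) AE_space
    proof eventually_elim
      case (elim \<omega>)
      show ?case
      proof (rule impI, rule ccontr)
        assume B: "\<omega> \<in> ?B" and no: "\<omega> \<notin> ?B1 \<union> ?B2 \<union> ?B3"
        have P: "P \<omega> < \<eta>" and q: "\<bar>Q \<omega>\<bar> < \<delta>" and h: "\<bar>HD.mg K \<omega>\<bar> < \<eta>" using no elim(2) by auto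
        have "e j \<omega> = H j \<omega>" if "j < K" for j
        proof -
          have "\<bar>e j \<omega>\<bar> \<le> Q \<omega>" using elim(1) that K by simp
          then show ?thesis using q by (simp add: H_def)
        qed
        then have s: "(\<Sum>j<K. (\<theta> m j \<omega> + rho m j \<omega>) * mart_diff m j \<omega>) = HD.mg K \<omega>"
          unfolding HD.mg_def e_def by (intro sum.cong) auto
        have "\<bar>\<Sum>j<K. 2 * (\<theta> m j \<omega> * rho m j \<omega>) + (rho m j \<omega>)\<^sup>2\<bar> \<le> (\<Sum>j<K. 2 * \<bar>\<theta> m j \<omega> * rho m j \<omega>\<bar> + (rho m j \<omega>)\<^sup>2)"
          by (intro order_trans[OF sum_abs] sum_mono order_trans[OF abs_triangle_ineq]) (simp add: abs_mult)
        also have "\<dots> \<le> (\<Sum>j<n. 2 * \<bar>\<theta> m j \<omega> * rho m j \<omega>\<bar> + (rho m j \<omega>)\<^sup>2)"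
          using K by (intro sum_mono2) auto
        finally have "\<bar>\<Sum>j<K. 2 * (\<theta> m j \<omega> * rho m j \<omega>) + (rho m j \<omega>)\<^sup>2\<bar> + (\<theta> m K \<omega>)\<^sup>2 + (\<theta> m 0 \<omega>)\<^sup>2 < \<eta>"
          using P unfolding P_def by linarith
        moreover have "0 \<le> (\<theta> m K \<omega>)\<^sup>2" "0 \<le> (\<theta> m 0 \<omega>)\<^sup>2" by simp_all
        ultimately have "\<bar>(\<Sum>j<K. (mart_diff m j \<omega>)\<^sup>2) - (\<Sum>k=1..K. (X n k \<omega>)\<^sup>2 + 2 * X n k \<omega> * \<theta> m k \<omega>)\<bar> \<le> 4 * \<eta>"
          unfolding mart_diff_square s using h pos(2) by linarith
        then show False using B by simp
      qed
    qed
  qed measurable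
  also have "\<dots> \<le> prob ?B1 + prob ?B2 + prob ?B3"
    by (intro order_trans[OF measure_Un_le] add_right_mono measure_Un_le) measurable
  also have "\<dots> \<le> (2 * (m * t)\<^sup>2 + 2 * \<kappa> * \<alpha> + \<alpha>\<^sup>2) / \<eta> + ((real m + 1) * t)\<^sup>2 / \<delta>\<^sup>2 + \<delta>\<^sup>2 * (sqrt C + 2 * \<kappa> + \<alpha>)\<^sup>2 / \<eta>\<^sup>2"
  proof (intro add_mono)
    have th: "(l2 M (\<theta> m k))\<^sup>2 \<le> (m * t)\<^sup>2" if "k \<le> n" for k
    proof -
      obtain R where R: "L2_rv M R" "AE \<omega> in M. \<forall>k\<le>n. \<bar>\<theta> m k \<omega>\<bar> \<le> R \<omega>" "l2 M R \<le> m * t"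
        using max_theta[OF pos(1), of m n] unfolding max_dominated_def t_def by blast
      have "AE \<omega> in M. \<bar>\<theta> m k \<omega>\<bar> \<le> \<bar>R \<omega>\<bar>"
        using R(2) by eventually_elim (use that abs_ge_self order_trans in blast)
      from L2_rv_bound(2)[OF R(1) tM(1) this] R(3) show ?thesis by (intro power_mono) auto
    qed
    note I = L2_rv_mult_integrable[OF theta_L2 rho_L2]
    have Pi: "integrable M P"
      unfolding P_def using I L2_rvD(2)[OF theta_L2] L2_rvD(2)[OF rho_L2]
      by (intro Bochner_Integration.integrable_add Bochner_Integration.integrable_sum
          integrable_mult_right integrable_abs)
    have tr: "(\<integral>\<omega>. \<bar>\<theta> m j \<omega> * rho m j \<omega>\<bar> \<partial>M) \<le> l2 M (\<theta> m j) * l2 M (rho m j)" for j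
      using l2_Cauchy_Schwarz[OF L2_rv_abs[OF theta_L2[of m j]] L2_rv_abs[OF rho_L2[of m j]]] by (simp add: abs_mult)
    have "(\<integral>\<omega>. P \<omega> \<partial>M) = (l2 M (\<theta> m K))\<^sup>2 + (l2 M (\<theta> m 0))\<^sup>2
        + (\<Sum>j<n. 2 * (\<integral>\<omega>. \<bar>\<theta> m j \<omega> * rho m j \<omega>\<bar> \<partial>M) + (l2 M (rho m j))\<^sup>2)"
      unfolding P_def l2_power2 using I L2_rvD(2)[OF theta_L2] L2_rvD(2)[OF rho_L2] by simp
    also have "\<dots> \<le> (m * t)\<^sup>2 + (m * t)\<^sup>2 + (\<Sum>j<n. 2 * (l2 M (\<theta> m j) * l2 M (rho m j)) + (l2 M (rho m j))\<^sup>2)"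
      using K by (intro add_mono sum_mono th mult_left_mono tr) auto
    also have "\<dots> = 2 * (m * t)\<^sup>2 + 2 * (\<Sum>j<n. l2 M (\<theta> m j) * l2 M (rho m j)) + (L2_set (\<lambda>j. l2 M (rho m j)) {..<n})\<^sup>2"
      by (simp add: sum.distrib sum_distrib_left L2_set_power2)
    also have "\<dots> \<le> 2 * (m * t)\<^sup>2 + 2 * (\<kappa> * \<alpha>) + \<alpha>\<^sup>2"
    proof (intro add_mono mult_left_mono order_refl power_mono)
      have "(\<Sum>j<n. l2 M (\<theta> m j) * l2 M (rho m j)) \<le> L2_set (\<lambda>j. l2 M (\<theta> m j)) {..<n} * L2_set (\<lambda>j. l2 M (rho m j)) {..<n}"
        using L2_set_mult_ineq[where A="{..<n}" and f="\<lambda>j. l2 M (\<theta> m j)" and g="\<lambda>j. l2 M (rho m j)"] by simp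
      also have "\<dots> \<le> \<kappa> * \<alpha>"
        unfolding \<alpha>_def by (intro mult_mono L2_set_theta \<kappa> L2_set_rho) (auto simp: L2_set_nonneg \<kappa>)
      finally show "(\<Sum>j<n. l2 M (\<theta> m j) * l2 M (rho m j)) \<le> \<kappa> * \<alpha>" .
    qed (auto simp: \<alpha>_def L2_set_rho L2_set_nonneg)
    finally have EP: "(\<integral>\<omega>. P \<omega> \<partial>M) \<le> 2 * (m * t)\<^sup>2 + 2 * \<kappa> * \<alpha> + \<alpha>\<^sup>2" by simp
    have "prob ?B1 \<le> (\<integral>\<omega>. P \<omega> \<partial>M) / \<eta>"
      using pos(2) by (intro integral_Markov_inequality_measure[where A="{}"] Pi) (auto simp: P_def intro!: add_nonneg_nonneg sum_nonneg)
    then show "prob ?B1 \<le> (2 * (m * t)\<^sup>2 + 2 * \<kappa> * \<alpha> + \<alpha>\<^sup>2) / \<eta>"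
      using EP pos(2) by (meson divide_right_mono less_imp_le order_trans)
    have "prob ?B2 \<le> (l2 M Q)\<^sup>2 / \<delta>\<^sup>2" by (rule Chebyshev_l2[OF Q(1) pos(3)])
    also have "\<dots> \<le> ((real m + 1) * t)\<^sup>2 / \<delta>\<^sup>2"
      using Q(3) by (intro divide_right_mono power_mono) (auto simp: algebra_simps)
    finally show "prob ?B2 \<le> ((real m + 1) * t)\<^sup>2 / \<delta>\<^sup>2" .
    have "(l2 M (HD.mg K))\<^sup>2 = (\<Sum>k<K. (l2 M (\<lambda>\<omega>. H k \<omega> * mart_diff m k \<omega>))\<^sup>2)" by (rule HD.l2_mg)
    also have "\<dots> \<le> (\<Sum>k<K. (l2 M (\<lambda>\<omega>. \<delta> * mart_diff m k \<omega>))\<^sup>2)"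
      using pos(3) by (intro sum_mono power_mono L2_rv_bound(2)[OF L2_rv_cmult[OF mart_diff_L2]])
         (auto simp: H_def abs_mult intro!: mult_right_mono)
    also have "\<dots> \<le> \<delta>\<^sup>2 * (\<Sum>k<n. (l2 M (mart_diff m k))\<^sup>2)"
      unfolding l2_cmult power_mult_distrib power2_abs sum_distrib_left[symmetric]
      using K by (intro mult_left_mono sum_mono2) auto
    also have "\<dots> = \<delta>\<^sup>2 * (L2_set (\<lambda>j. l2 M (mart_diff m j)) {..<n})\<^sup>2" by (simp add: L2_set_power2)
    also have "\<dots> \<le> \<delta>\<^sup>2 * (sqrt C + 2 * \<kappa> + \<alpha>)\<^sup>2"
      unfolding \<alpha>_def by (intro mult_left_mono power_mono L2_set_mart_diff \<kappa> C) (auto simp: L2_set_nonneg)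
    finally have "(l2 M (HD.mg K))\<^sup>2 / \<eta>\<^sup>2 \<le> \<delta>\<^sup>2 * (sqrt C + 2 * \<kappa> + \<alpha>)\<^sup>2 / \<eta>\<^sup>2"
      by (rule divide_right_mono) simp
    then show "prob ?B3 \<le> \<delta>\<^sup>2 * (sqrt C + 2 * \<kappa> + \<alpha>)\<^sup>2 / \<eta>\<^sup>2"
      using Chebyshev_l2[OF HD.mg_L2 pos(2), of K] by simp
  qed
  finally show ?thesis .
qed

end


section \<open>Uniform martingale approximation of the array\<close>

lemma ennreal_sqrt_ennreal: "0 \<le> x \<Longrightarrow> ennreal_sqrt (ennreal x) = ennreal (sqrt x)"
  by (simp add: ennreal_sqrt_def)

lemma ennreal_sqrt_mono: "x \<le> y \<Longrightarrow> ennreal_sqrt x \<le> ennreal_sqrt y"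
  by (cases x; cases y) (auto simp: ennreal_sqrt_def top_unique)

lemma L2_norm_eq: "L2_rv M f \<Longrightarrow> L2_norm M f = ennreal (l2 M f)"
  unfolding L2_norm_def l2_def
  by (subst nn_integral_eq_integral) (auto simp: ennreal_sqrt_ennreal)

lemma (in adapted_row) a_norm_le_A:
  assumes "1 \<le> n" shows "ennreal (a_norm u) \<le> A_coeff M \<F> X u"
proof -
  let ?g = "\<lambda>n. \<Sum>k=0..<n. (L2_norm M (real_cond_exp M (\<F> n (int k))
        (\<lambda>\<omega>. row_sum X n (k + u) \<omega> - row_sum X n k \<omega>)))\<^sup>2"
  have "?g n = (\<Sum>k=0..<n. (ennreal (l2 M (cond_incr k u)))\<^sup>2)"
    unfolding cond_incr_def[symmetric] using L2_norm_eq[OF cond_incr_L2] by simp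
  also have "\<dots> = ennreal ((a_norm u)\<^sup>2)"
    unfolding a_norm_def L2_set_power2[OF finite_lessThan] lessThan_atLeast0
    by (simp add: ennreal_power L2_set_power2)
  finally have g: "?g n = ennreal ((a_norm u)\<^sup>2)" .
  have "ennreal (a_norm u) = ennreal_sqrt (?g n)"
    unfolding g by (simp add: ennreal_sqrt_ennreal a_norm_nonneg)
  also have "\<dots> \<le> A_coeff M \<F> X u"
    unfolding A_coeff_def using assms by (intro ennreal_sqrt_mono SUP_upper) auto
  finally show ?thesis .
qed

lemma (in adapted_row) b_norm_le_B:
  assumes "1 \<le> n" shows "ennreal (b_norm l m) \<le> B_coeff M \<F> X l m"
proof -
  let ?g = "\<lambda>n. \<Sum>k=0..n div l. (L2_norm M (S_bar M \<F> X l m n k))\<^sup>2"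
  have "?g n = (\<Sum>k=0..n div l. (ennreal (l2 M (SB l m k)))\<^sup>2)"
    using L2_norm_eq[OF SB_L2] by simp
  also have "\<dots> = ennreal ((b_norm l m)\<^sup>2)"
    unfolding b_norm_def L2_set_power2[OF finite_atMost] atMost_atLeast0
    by (simp add: ennreal_power L2_set_power2)
  finally have g: "?g n = ennreal ((b_norm l m)\<^sup>2)" .
  have "ennreal (b_norm l m) = ennreal_sqrt (?g n)"
    unfolding g by (simp add: ennreal_sqrt_ennreal b_norm_def L2_set_nonneg)
  also have "\<dots> \<le> B_coeff M \<F> X l m"
    unfolding B_coeff_def using assms by (intro ennreal_sqrt_mono SUP_upper) auto
  finally show ?thesis .
qed

lemma (in adapted_row) a_norm_le:
  assumes C: "(\<Sum>j=1..n. \<integral>\<omega>. (X n j \<omega>)\<^sup>2 \<partial>M) \<le> C"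
  shows "a_norm u \<le> u * sqrt C"
proof (induction u)
  case (Suc u)
  have "l2 M (cond_incr k 1) \<le> l2 M (X n (Suc k))" for k
    using cond_proj_l2(1)[OF cond_incr_proj, of k 1] by (simp add: row_sum_def)
  then have "a_norm 1 \<le> L2_set (\<lambda>k. l2 M (X n (Suc k))) {..<n}"
    unfolding a_norm_def by (intro L2_set_mono) auto
  also have "\<dots> = sqrt (\<Sum>j=1..n. \<integral>\<omega>. (X n j \<omega>)\<^sup>2 \<partial>M)"
    unfolding L2_set_def l2_power2
    by (rule arg_cong[where f=sqrt]) (rule sum.reindex_bij_witness[where i="\<lambda>j. j - 1" and j=Suc], auto)
  also have "\<dots> \<le> sqrt C" using C by simp
  finally show ?case using a_norm_add[of u 1] Suc by (simp add: algebra_simps)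
qed simp

locale martingale_like_array = prob_space M
  for M :: "'a measure" +
  fixes X :: "nat \<Rightarrow> nat \<Rightarrow> 'a \<Rightarrow> real"
    and \<F> :: "nat \<Rightarrow> int \<Rightarrow> 'a measure"
    and v :: "nat \<Rightarrow> real \<Rightarrow> nat"
    and C c :: real
  assumes filtr: "\<And>n i j. n \<ge> 1 \<Longrightarrow> i \<le> j \<Longrightarrow> sets (\<F> n i) \<subseteq> sets (\<F> n j)"
    and subalg: "\<And>n i. n \<ge> 1 \<Longrightarrow> subalgebra M (\<F> n i)"
    and adapted: "\<And>n i. n \<ge> 1 \<Longrightarrow> 1 \<le> i \<Longrightarrow> i \<le> n \<Longrightarrow> X n i \<in> borel_measurable (\<F> n (int i))"
    and X_conv: "\<And>n i \<omega>. n \<ge> 1 \<Longrightarrow> i > n \<Longrightarrow> \<omega> \<in> space M \<Longrightarrow> X n i \<omega> = 0"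
    and square_int: "\<And>n i. n \<ge> 1 \<Longrightarrow> 1 \<le> i \<Longrightarrow> i \<le> n \<Longrightarrow> integrable M (\<lambda>\<omega>. (X n i \<omega>)\<^sup>2)"
    and variance_bound: "\<And>n. n \<ge> 1 \<Longrightarrow> (\<Sum>j=1..n. \<integral>\<omega>. (X n j \<omega>)\<^sup>2 \<partial>M) \<le> C"
    and lindeberg: "\<And>\<epsilon>. \<epsilon> > 0 \<Longrightarrow>
      (\<lambda>n. \<Sum>k=1..n. \<integral>\<omega>. (X n k \<omega>)\<^sup>2 * indicator {\<omega>'. \<bar>X n k \<omega>'\<bar> > \<epsilon>} \<omega> \<partial>M) \<longlonglongrightarrow> 0"
    and A_cond: "(\<lambda>j. ennreal (2 powr (- (real j / 2))) * A_coeff M \<F> X (2 ^ j)) \<longlonglongrightarrow> 0"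
    and B_cond: "liminf (\<lambda>j. \<Sum>i. B_coeff M \<F> X (2 ^ (j + i)) (2 ^ j)) = 0"
    and v_range: "\<And>n t. n \<ge> 1 \<Longrightarrow> t \<in> {0..1} \<Longrightarrow> v n t \<le> n"
    and v_mono: "\<And>n. n \<ge> 1 \<Longrightarrow> mono_on {0..1} (v n)"
    and v_right_cont: "\<And>n t. n \<ge> 1 \<Longrightarrow> t \<in> {0..<1} \<Longrightarrow> (v n \<longlongrightarrow> v n t) (at_right t)"
    and variance_conv: "\<And>t \<epsilon>. t \<in> {0<..1} \<Longrightarrow> \<epsilon> > 0 \<Longrightarrow>
      (\<lambda>m. limsup (\<lambda>n. emeasure M {\<omega> \<in> space M.
         \<bar>(\<Sum>k=1..v n t. (X n k \<omega>)\<^sup>2 + 2 * X n k \<omega> * theta M \<F> X m n k \<omega>) - t * c\<^sup>2\<bar> > \<epsilon>}))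
      \<longlonglongrightarrow> 0"
begin

lemma row: "1 \<le> n \<Longrightarrow> adapted_row M \<F> X n"
proof (unfold_locales)
  assume n: "1 \<le> n"
  show "subalgebra M (\<F> n a)" for a using n by (rule subalg)
  show "sets (\<F> n a) \<subseteq> sets (\<F> n b)" if "a \<le> b" for a b using n that by (rule filtr)
  show ad: "X n i \<in> borel_measurable (\<F> n (int i))" if i: "1 \<le> i" for i
  proof (cases "i \<le> n")
    case False
    have "space (\<F> n (int i)) = space M" using subalg[OF n] by (simp add: subalgebra_def)
    then have "X n i \<in> borel_measurable (\<F> n (int i)) \<longleftrightarrow> (\<lambda>_. 0::real) \<in> borel_measurable (\<F> n (int i))"
      using X_conv[OF n, of i] False by (intro measurable_cong) auto
    then show ?thesis by simp
  qed (use adapted[OF n i] in auto)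
  show "X n i \<omega> = 0" if "n < i" "\<omega> \<in> space M" for i \<omega> using n that by (rule X_conv)
  show "L2_rv M (X n i)" if i: "1 \<le> i" for i
  proof -
    have m: "X n i \<in> borel_measurable M" by (rule measurable_from_subalg[OF subalg[OF n] ad[OF i]])
    show ?thesis
    proof (cases "i \<le> n")
      case True
      then show ?thesis using square_int[OF n i] m by (simp add: L2_rv_def)
    next
      case False
      show ?thesis
        by (rule L2_rv_cong_AE(1)[OF L2_rv_zero m]) (use X_conv[OF n, of i] False in auto)
    qed
  qed
qed

abbreviation A_row :: "nat \<Rightarrow> nat \<Rightarrow> real" where
  "A_row n \<equiv> adapted_row.a_norm M \<F> X n"

abbreviation B_row :: "nat \<Rightarrow> nat \<Rightarrow> nat \<Rightarrow> real" where
  "B_row n \<equiv> adapted_row.b_norm M \<F> X n"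

lemma C_nonneg: "0 \<le> C"
  using variance_bound[of 1] order_trans[OF _ variance_bound[of 1]] by (simp add: sum_nonneg)

lemma A_small:
  assumes "0 < \<epsilon>"
  shows "\<forall>\<^sub>F j in sequentially. \<forall>n\<ge>1. A_row n (2 ^ j) \<le> \<epsilon> * sqrt (2 ^ j)"
proof -
  have "\<forall>\<^sub>F j in sequentially. ennreal (2 powr (- (real j / 2))) * A_coeff M \<F> X (2 ^ j) < ennreal \<epsilon>"
    using assms by (intro order_tendstoD[OF A_cond]) auto
  then show ?thesis
  proof eventually_elim
    case (elim j)
    show ?case
    proof (intro allI impI)
      fix n :: nat assume n: "1 \<le> n"
      interpret adapted_row M \<F> X n by (rule row[OF n])
      have "ennreal (2 powr (- (real j / 2)) * a_norm (2 ^ j)) \<le> ennreal (2 powr (- (real j / 2))) * A_coeff M \<F> X (2 ^ j)"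
        unfolding ennreal_mult'[OF powr_ge_zero] by (intro mult_left_mono a_norm_le_A n) auto
      then have "2 powr (- (real j / 2)) * a_norm (2 ^ j) < \<epsilon>"
        using elim assms by (meson ennreal_less_iff a_norm_nonneg mult_nonneg_nonneg order_le_less_trans powr_ge_zero)
      moreover have "2 powr (- (real j / 2)) = 1 / sqrt (2 ^ j)"
      proof -
        have "2 powr (real j / 2) = (2 powr real j) powr (1 / 2)" by (simp add: powr_powr)
        also have "\<dots> = sqrt (2 ^ j)" by (simp add: powr_half_sqrt powr_realpow)
        finally show ?thesis by (simp add: powr_minus inverse_eq_divide)
      qed
      ultimately show "a_norm (2 ^ j) \<le> \<epsilon> * sqrt (2 ^ j)"
        by (simp add: divide_less_eq)
    qed
  qed
qed

text \<open>The limit controls all but finitely many powers of 2, and those few are controlled by the crude bound \<open>a_norm_le\<close>.\<close>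

lemma A_bounded:
  obtains K where "0 \<le> K" "\<And>n q. 1 \<le> n \<Longrightarrow> A_row n (2 ^ q) \<le> K * sqrt (2 ^ q)"
proof -
  obtain J where J: "\<And>j n. J \<le> j \<Longrightarrow> 1 \<le> n \<Longrightarrow> A_row n (2 ^ j) \<le> 1 * sqrt (2 ^ j)"
    using A_small[of 1] by (auto simp: eventually_sequentially)
  define K where "K = max 1 (2 ^ J * sqrt C)"
  show ?thesis
  proof (rule that[of K])
    show "0 \<le> K" by (simp add: K_def)
    fix n q :: nat assume n: "1 \<le> n"
    interpret adapted_row M \<F> X n by (rule row[OF n])
    show "a_norm (2 ^ q) \<le> K * sqrt (2 ^ q)"
    proof (cases "J \<le> q")
      case True
      have "a_norm (2 ^ q) \<le> 1 * sqrt (2 ^ q)" by (rule J[OF True n])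
      also have "\<dots> \<le> K * sqrt (2 ^ q)" by (intro mult_right_mono) (auto simp: K_def)
      finally show ?thesis .
    next
      case False
      have "a_norm (2 ^ q) \<le> real (2 ^ q) * sqrt C" by (rule a_norm_le[OF variance_bound[OF n]])
      also have "\<dots> \<le> 2 ^ J * sqrt C" using False C_nonneg by (intro mult_right_mono) (auto intro: power_increasing)
      also have "\<dots> \<le> K * 1" by (simp add: K_def)
      also have "\<dots> \<le> K * sqrt (2 ^ q)" by (intro mult_left_mono) (auto simp: K_def)
      finally show ?thesis .
    qed
  qed
qed

lemma B_small:
  assumes "0 < \<epsilon>"
  shows "\<exists>j\<ge>J. \<forall>n\<ge>1. \<forall>L. (\<Sum>i\<le>L. B_row n (2 ^ j * 2 ^ i) (2 ^ j)) \<le> \<epsilon>"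
proof -
  let ?b = "\<lambda>j. \<Sum>i. B_coeff M \<F> X (2 ^ (j + i)) (2 ^ j)"
  have "\<exists>j\<ge>J. ?b j < ennreal \<epsilon>"
  proof (rule ccontr)
    assume "\<not> (\<exists>j\<ge>J. ?b j < ennreal \<epsilon>)"
    then have "\<forall>\<^sub>F j in sequentially. ennreal \<epsilon> \<le> ?b j"
      unfolding eventually_sequentially by (auto simp: not_less)
    then have "ennreal \<epsilon> \<le> liminf ?b" by (rule Liminf_bounded)
    then show False using B_cond assms by simp
  qed
  then obtain j where j: "J \<le> j" "?b j < ennreal \<epsilon>" by blast
  have "(\<Sum>i\<le>L. B_row n (2 ^ j * 2 ^ i) (2 ^ j)) \<le> \<epsilon>" if n: "1 \<le> n" for n L
  proof -
    interpret adapted_row M \<F> X n by (rule row[OF n])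
    have "ennreal (\<Sum>i\<le>L. b_norm (2 ^ j * 2 ^ i) (2 ^ j)) = (\<Sum>i\<le>L. ennreal (b_norm (2 ^ j * 2 ^ i) (2 ^ j)))"
      by (intro sum_ennreal[symmetric]) (simp add: b_norm_def L2_set_nonneg)
    also have "\<dots> \<le> (\<Sum>i\<le>L. B_coeff M \<F> X (2 ^ (j + i)) (2 ^ j))"
      unfolding power_add by (intro sum_mono b_norm_le_B n)
    also have "\<dots> \<le> ?b j" by (intro sum_le_suminf) auto
    also have "\<dots> < ennreal \<epsilon>" by (rule j)
    finally show ?thesis using assms by (simp add: ennreal_less_iff b_norm_def L2_set_nonneg sum_nonneg)
  qed
  then show ?thesis using j(1) by blast
qed

lemma lindeberg_sum_small:
  assumes "0 < \<tau>"
  shows "\<forall>\<^sub>F n in sequentially. \<tau> / 2 + sqrt (adapted_row.lindeberg_sum M X n (\<tau> / 2)) \<le> \<tau>"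
proof -
  have "\<forall>\<^sub>F n in sequentially. (\<Sum>k=1..n. \<integral>\<omega>. (X n k \<omega>)\<^sup>2 * indicator {\<omega>'. \<bar>X n k \<omega>'\<bar> > \<tau> / 2} \<omega> \<partial>M) < (\<tau> / 2)\<^sup>2"
    using assms by (intro order_tendstoD[OF lindeberg]) auto
  then show ?thesis using eventually_ge_at_top[of 1]
  proof eventually_elim
    case (elim n)
    interpret adapted_row M \<F> X n by (rule row[OF elim(2)])
    have "lindeberg_sum (\<tau> / 2) < (\<tau> / 2)\<^sup>2" using elim(1) by (simp add: lindeberg_sum_def)
    then have "sqrt (lindeberg_sum (\<tau> / 2)) \<le> \<tau> / 2" using assms by (intro real_le_lsqrt) (auto simp: lindeberg_sum_nonneg)
    then show ?case by simp
  qed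
qed

text \<open>All requirements become stronger as \<open>\<epsilon>\<close> decreases and \<open>T\<close> grows.\<close>

definition good_martingale :: "real \<Rightarrow> real set \<Rightarrow> nat \<Rightarrow> (nat \<Rightarrow> 'a \<Rightarrow> real) \<Rightarrow> bool" where
  "good_martingale \<epsilon> T n D \<longleftrightarrow>
     L2_martingale M (\<lambda>k. \<F> n (int k)) D \<and>
     max_dominated M (\<lambda>k \<omega>. row_sum X n k \<omega> - (\<Sum>j<k. D j \<omega>)) n \<epsilon> \<and>
     max_dominated M D n \<epsilon> \<and>
     (\<forall>t\<in>T. prob {\<omega>\<in>space M. \<bar>(\<Sum>j<v n t. (D j \<omega>)\<^sup>2) - t * c\<^sup>2\<bar> > \<epsilon>} \<le> \<epsilon>)"

lemma variance_conv_eventually: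
  assumes "t \<in> {0<..1}" "0 < \<epsilon>"
  shows "\<forall>\<^sub>F m in sequentially. \<forall>\<^sub>F n in sequentially. prob {\<omega>\<in>space M.
    \<bar>(\<Sum>k=1..v n t. (X n k \<omega>)\<^sup>2 + 2 * X n k \<omega> * theta M \<F> X m n k \<omega>) - t * c\<^sup>2\<bar> > \<epsilon>} \<le> \<epsilon>"
proof -
  let ?p = "\<lambda>m n. {\<omega>\<in>space M.
    \<bar>(\<Sum>k=1..v n t. (X n k \<omega>)\<^sup>2 + 2 * X n k \<omega> * theta M \<F> X m n k \<omega>) - t * c\<^sup>2\<bar> > \<epsilon>}"
  have "\<forall>\<^sub>F m in sequentially. limsup (\<lambda>n. emeasure M (?p m n)) < ennreal \<epsilon>"
    using assms by (intro order_tendstoD[OF variance_conv]) auto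
  then show ?thesis
  proof eventually_elim
    case (elim m)
    have "\<forall>\<^sub>F n in sequentially. emeasure M (?p m n) < ennreal \<epsilon>"
      using elim by (rule Limsup_lessD)
    then show ?case
      by eventually_elim (use assms in \<open>simp add: emeasure_eq_measure ennreal_less_iff\<close>)
  qed
qed

text \<open>The window \<open>m\<close> is chosen before \<open>n\<close>: a large power of 2 for which \<open>A(m) / \<surd>m\<close> and the sum of the \<open>B(m 2\<^sup>i, m)\<close> are
  small and the variance condition holds up to \<open>\<epsilon>\<close>. For this fixed window everything that remains is of the order of the
  Lindeberg sum and vanishes as \<open>n \<longlonglongrightarrow> \<infinity>\<close>. The bound \<open>\<sigma>\<close> for the norms of the martingale may depend on \<open>\<epsilon>\<close>.\<close>

lemma martingale_approximation:
  assumes \<epsilon>: "0 < \<epsilon>" and T: "finite T" "T \<subseteq> {0<..1}"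
  shows "\<exists>D N \<sigma>. 1 \<le> N \<and> (\<forall>n\<ge>N. good_martingale \<epsilon> T n (D n) \<and> (\<forall>k\<le>n. l2 M (\<lambda>\<omega>. \<Sum>j<k. D n j \<omega>) \<le> \<sigma>))"
proof -
  define \<eta> where "\<eta> = \<epsilon> / 8"
  have \<eta>: "0 < \<eta>" using \<epsilon> by (simp add: \<eta>_def)
  obtain K where K: "0 \<le> K" "\<And>n q. 1 \<le> n \<Longrightarrow> A_row n (2 ^ q) \<le> K * sqrt (2 ^ q)"
    using A_bounded by metis
  (* e bounds A(m)/sqrt m and the sum of the B's; both enter the maximal inequality and, through
     theta * rho, the quadratic variation *)
  have "((\<lambda>e. 2 * (3 * K) * e + e\<^sup>2) \<longlongrightarrow> 2 * (3 * K) * 0 + 0\<^sup>2) (at_right 0)" 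
    by (intro tendsto_intros)
  then have "\<forall>\<^sub>F e in at_right 0. 2 * (3 * K) * e + e\<^sup>2 < \<eta> * \<eta>" using \<eta> by (intro order_tendstoD) auto
  moreover have "\<forall>\<^sub>F e in at_right 0. (e::real) \<in> {0<..<\<epsilon> / 18}" using \<epsilon> by (intro eventually_at_right_real) auto
  ultimately have "\<forall>\<^sub>F e in at_right 0. 2 * (3 * K) * e + e\<^sup>2 < \<eta> * \<eta> \<and> e \<in> {0<..<\<epsilon> / 18}"
    by (rule eventually_conj)
  then obtain e where e: "2 * (3 * K) * e + e\<^sup>2 < \<eta> * \<eta>" "0 < e" "9 * e < \<epsilon> / 2"
    using eventually_happens[of _ "at_right (0::real)"] by (auto simp: field_simps)
  obtain J1 where J1: "\<And>j n. J1 \<le> j \<Longrightarrow> 1 \<le> n \<Longrightarrow> A_row n (2 ^ j) \<le> e * sqrt (2 ^ j)"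
    using A_small[OF e(2)] by (auto simp: eventually_sequentially)
  have "\<forall>\<^sub>F m in sequentially. \<forall>t\<in>T. \<forall>\<^sub>F n in sequentially. prob {\<omega>\<in>space M.
    \<bar>(\<Sum>k=1..v n t. (X n k \<omega>)\<^sup>2 + 2 * X n k \<omega> * theta M \<F> X m n k \<omega>) - t * c\<^sup>2\<bar> > \<epsilon> / 2} \<le> \<epsilon> / 2"
    using T \<epsilon> by (intro eventually_ball_finite ballI variance_conv_eventually) auto
  then obtain m0 where m0: "\<And>m t. m0 \<le> m \<Longrightarrow> t \<in> T \<Longrightarrow> \<forall>\<^sub>F n in sequentially. prob {\<omega>\<in>space M.
    \<bar>(\<Sum>k=1..v n t. (X n k \<omega>)\<^sup>2 + 2 * X n k \<omega> * theta M \<F> X m n k \<omega>) - t * c\<^sup>2\<bar> > \<epsilon> / 2} \<le> \<epsilon> / 2"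
    by (auto simp: eventually_sequentially[of "\<lambda>m. \<forall>t\<in>T. _ m t"])
  obtain J where J: "max J1 m0 \<le> J" "\<And>n L. 1 \<le> n \<Longrightarrow> (\<Sum>i\<le>L. B_row n (2 ^ J * 2 ^ i) (2 ^ J)) \<le> e"
    using B_small[OF e(2), of "max J1 m0"] by blast
  define m where "m = (2::nat) ^ J"
  have m1: "1 \<le> m" by (simp add: m_def)
  have mm0: "m0 \<le> m"
    unfolding m_def by (rule order_trans[OF _ less_imp_le[OF less_exp]]) (use J(1) in simp)
  define \<kappa> where "\<kappa> = 3 * K * sqrt m"
  have \<kappa>0: "0 \<le> \<kappa>" using K by (simp add: \<kappa>_def)
  define \<sigma> where "\<sigma> = sqrt C + 2 * \<kappa> + e"
  have \<sigma>: "0 < \<sigma>" using e \<kappa>0 C_nonneg by (simp add: \<sigma>_def add_nonneg_pos)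
  define \<delta> where "\<delta> = \<eta> * sqrt \<eta> / \<sigma>"
  have \<delta>: "0 < \<delta>" using \<eta> \<sigma> by (simp add: \<delta>_def)
  have \<delta>\<sigma>: "\<delta>\<^sup>2 * \<sigma>\<^sup>2 / \<eta>\<^sup>2 = \<eta>"
    using \<eta> \<sigma> by (simp add: \<delta>_def power_divide power_mult_distrib)
  have l: "((\<lambda>\<tau>::real. 2 * (real m * \<tau>)\<^sup>2) \<longlongrightarrow> 2 * (real m * 0)\<^sup>2) (at_right 0)"
    "((\<lambda>\<tau>::real. ((real m + 1) * \<tau>)\<^sup>2) \<longlongrightarrow> ((real m + 1) * 0)\<^sup>2) (at_right 0)"
    "((\<lambda>\<tau>::real. (2 * real m + 2) * \<tau>) \<longlongrightarrow> (2 * real m + 2) * 0) (at_right 0)"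
    by (intro tendsto_intros)+
  have "\<forall>\<^sub>F \<tau>::real in at_right 0. 2 * (real m * \<tau>)\<^sup>2 < \<eta> * \<eta>"
    by (rule order_tendstoD(2)[OF l(1)]) (use \<eta> in simp)
  moreover have "\<forall>\<^sub>F \<tau>::real in at_right 0. ((real m + 1) * \<tau>)\<^sup>2 < \<eta> * \<delta>\<^sup>2"
    by (rule order_tendstoD(2)[OF l(2)]) (use \<eta> \<delta> in simp)
  moreover have "\<forall>\<^sub>F \<tau>::real in at_right 0. (2 * real m + 2) * \<tau> < \<epsilon> / 2"
    by (rule order_tendstoD(2)[OF l(3)]) (use \<epsilon> in simp)
  moreover have "\<forall>\<^sub>F \<tau> in at_right 0. (\<tau>::real) > 0" by (simp add: eventually_at_right_less)
  ultimately have "\<forall>\<^sub>F \<tau> in at_right (0::real). 2 * (real m * \<tau>)\<^sup>2 < \<eta> * \<eta> \<and> ((real m + 1) * \<tau>)\<^sup>2 < \<eta> * \<delta>\<^sup>2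
      \<and> (2 * real m + 2) * \<tau> < \<epsilon> / 2 \<and> \<tau> > 0"
    by eventually_elim auto
  then obtain \<tau> where \<tau>: "2 * (real m * \<tau>)\<^sup>2 < \<eta> * \<eta>" "((real m + 1) * \<tau>)\<^sup>2 < \<eta> * \<delta>\<^sup>2" "(2 * real m + 2) * \<tau> < \<epsilon> / 2" "0 < \<tau>"
    using eventually_happens[of _ "at_right (0::real)"] by auto
  have "\<forall>\<^sub>F n in sequentially. \<forall>t\<in>T. prob {\<omega>\<in>space M.
    \<bar>(\<Sum>k=1..v n t. (X n k \<omega>)\<^sup>2 + 2 * X n k \<omega> * theta M \<F> X m n k \<omega>) - t * c\<^sup>2\<bar> > \<epsilon> / 2} \<le> \<epsilon> / 2"
    using T m0[OF mm0] by (intro eventually_ball_finite ballI) auto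
  then have "\<forall>\<^sub>F n in sequentially. 1 \<le> n \<and> \<tau> / 2 + sqrt (adapted_row.lindeberg_sum M X n (\<tau> / 2)) \<le> \<tau> \<and> (\<forall>t\<in>T. prob {\<omega>\<in>space M.
    \<bar>(\<Sum>k=1..v n t. (X n k \<omega>)\<^sup>2 + 2 * X n k \<omega> * theta M \<F> X m n k \<omega>) - t * c\<^sup>2\<bar> > \<epsilon> / 2} \<le> \<epsilon> / 2)"
    using lindeberg_sum_small[OF \<tau>(4)] eventually_ge_at_top[of 1] by eventually_elim auto
  then obtain N where N: "\<And>n. N \<le> n \<Longrightarrow> 1 \<le> n" "\<And>n. N \<le> n \<Longrightarrow> \<tau> / 2 + sqrt (adapted_row.lindeberg_sum M X n (\<tau> / 2)) \<le> \<tau>"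
    "\<And>n t. N \<le> n \<Longrightarrow> t \<in> T \<Longrightarrow> prob {\<omega>\<in>space M.
    \<bar>(\<Sum>k=1..v n t. (X n k \<omega>)\<^sup>2 + 2 * X n k \<omega> * theta M \<F> X m n k \<omega>) - t * c\<^sup>2\<bar> > \<epsilon> / 2} \<le> \<epsilon> / 2"
    unfolding eventually_sequentially by blast
  define D where "D = (\<lambda>n. adapted_row.mart_diff M \<F> X n m)"
  have "good_martingale \<epsilon> T n (D n) \<and> (\<forall>k\<le>n. l2 M (\<lambda>\<omega>. \<Sum>j<k. D n j \<omega>) \<le> \<sigma>)" if n: "N \<le> n" for n
  proof -
    note n1 = N(1)[OF n]
    interpret adapted_row M \<F> X n by (rule row[OF n1])
    interpret D: L2_martingale M "\<lambda>k. \<F> n (int k)" "mart_diff m" by (rule row_martingale[OF m1])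
    have Dn: "D n = mart_diff m" by (simp add: D_def)
    let ?t = "\<tau> / 2 + sqrt (lindeberg_sum (\<tau> / 2))"
    have t: "0 < \<tau> / 2" "?t \<le> \<tau>" "0 \<le> ?t" using N(2)[OF n] \<tau>(4) lindeberg_sum_nonneg[of "\<tau> / 2"] by auto
    have a_m: "a_norm m \<le> e * sqrt m" using J1[of J n] J(1) n1 by (simp add: m_def)
    have am: "a_norm m / m \<le> e / sqrt m"
    proof -
      have "a_norm m / m \<le> e * sqrt m / m" using a_m by (rule divide_right_mono) simp
      also have "\<dots> = e / sqrt m" using m1 by (simp add: real_div_sqrt field_simps)
      finally show ?thesis .
    qed
    have am0: "0 \<le> a_norm m / m" by (simp add: a_norm_nonneg)
    have ame: "a_norm m / m \<le> e"
    proof -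
      have "1 \<le> sqrt m" using m1 by simp
      then have "e / sqrt m \<le> e / 1" using e(2) by (intro divide_left_mono) auto
      then show ?thesis using am by simp
    qed
    have ai: "a_norm i \<le> \<kappa>" if "i < m" for i
    proof -
      have "a_norm i \<le> K * (\<Sum>q<J. sqrt (2 ^ q))"
        using that by (intro a_norm_dyadic K n1) (simp add: m_def)
      also have "\<dots> \<le> K * (3 * sqrt (2 ^ J))" by (intro mult_left_mono sum_sqrt_power2_le K)
      finally show ?thesis by (simp add: \<kappa>_def m_def)
    qed
    note C = variance_bound[OF n1]
    have DDs: "L2_set (\<lambda>j. l2 M (mart_diff m j)) {..<n} \<le> \<sigma>"
      using L2_set_mart_diff[of m, OF ai \<kappa>0 C] ame by (simp add: \<sigma>_def)
    have mgs: "l2 M (D.mg k) \<le> \<sigma>" if "k \<le> n" for k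
    proof (rule power2_le_imp_le)
      have "(l2 M (D.mg k))\<^sup>2 \<le> (\<Sum>j<n. (l2 M (mart_diff m j))\<^sup>2)"
        unfolding D.l2_mg using that by (intro sum_mono2) auto
      also have "\<dots> = (L2_set (\<lambda>j. l2 M (mart_diff m j)) {..<n})\<^sup>2" by (simp add: L2_set_power2)
      also have "\<dots> \<le> \<sigma>\<^sup>2" by (intro power_mono DDs) (simp add: L2_set_nonneg)
      finally show "(l2 M (D.mg k))\<^sup>2 \<le> \<sigma>\<^sup>2" .
    qed (use \<sigma> in simp)
    have 1: "max_dominated M (mart_diff m) n \<epsilon>"
    proof (rule max_dominated_mono[OF max_mart_diff[OF t(1), of m n]])
      have "(2 * real m + 2) * ?t \<le> (2 * real m + 2) * \<tau>" by (intro mult_left_mono t) auto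
      then show "(2 * real m + 2) * ?t \<le> \<epsilon>" using \<tau>(3) \<epsilon> by linarith
    qed
    have 2: "max_dominated M (\<lambda>k \<omega>. S k \<omega> - (\<Sum>j<k. mart_diff m j \<omega>)) n \<epsilon>"
    proof -
      have th: "max_dominated M (\<theta> m) n (m * \<tau>)"
        by (rule max_dominated_mono[OF max_theta[OF t(1)]]) (intro mult_left_mono t, simp)
      have th0: "max_dominated M (\<lambda>k. \<theta> m 0) n (m * \<tau>)"
        by (rule max_dominated_reindex[OF th, where \<tau>="\<lambda>_. 0"]) auto
      obtain L where L: "n < 2 ^ L" using less_exp by blast
      have nL: "n < m * 2 ^ L" using L m1 by (metis less_le_trans mult_le_mono1 nat_mult_1)
      have R: "max_dominated M (\<lambda>k \<omega>. \<Sum>j<k. rho m j \<omega>) n (9 * e)"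
      proof (rule max_dominated_mono[OF max_rho[OF m1 nL]])
        have "a_norm m / sqrt m \<le> e" using a_m m1 by (simp add: divide_le_eq)
        moreover have "(\<Sum>i\<le>L. b_norm (m * 2 ^ i) m) \<le> e" using J(2)[OF n1, of L] by (simp add: m_def)
        ultimately show "5 * (a_norm m / sqrt m) + 4 * (\<Sum>i\<le>L. b_norm (m * 2 ^ i) m) \<le> 9 * e" by linarith
      qed
      have td: "max_dominated M (\<lambda>k \<omega>. \<theta> m 0 \<omega> - \<theta> m k \<omega>) n (m * \<tau> + m * \<tau>)"
        by (rule max_dominated_add[OF th0 th]) (rule abs_triangle_ineq4)
      have "max_dominated M (\<lambda>k \<omega>. S k \<omega> - (\<Sum>j<k. mart_diff m j \<omega>)) n ((m * \<tau> + m * \<tau>) + 9 * e)"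
        by (rule max_dominated_add[OF td R], subst S_decomposition[of _ _ m]) linarith
      moreover have "(m * \<tau> + m * \<tau>) + 9 * e \<le> \<epsilon>" using \<tau>(3,4) e(3) by (simp add: algebra_simps)
      ultimately show ?thesis by (rule max_dominated_mono)
    qed
    have 3: "prob {\<omega>\<in>space M. \<bar>(\<Sum>j<v n t. (mart_diff m j \<omega>)\<^sup>2) - t * c\<^sup>2\<bar> > \<epsilon>} \<le> \<epsilon>" if tT: "t \<in> T" for t
    proof -
      have vn: "v n t \<le> n" using v_range[OF n1, of t] T tT by auto
      let ?V = "\<lambda>\<omega>. \<Sum>k=1..v n t. (X n k \<omega>)\<^sup>2 + 2 * X n k \<omega> * \<theta> m k \<omega>"
      let ?D = "\<lambda>\<omega>. \<Sum>j<v n t. (mart_diff m j \<omega>)\<^sup>2"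
      have [measurable]: "X n k \<in> borel_measurable M" if "1 \<le> k" for k using X_L2[OF that] by auto
      have [measurable]: "\<theta> m k \<in> borel_measurable M" for k using theta_L2 by auto
      have [measurable]: "?V \<in> borel_measurable M" by (intro borel_measurable_sum) measurable
      have [measurable]: "?D \<in> borel_measurable M" by (intro borel_measurable_sum) measurable
      have "prob {\<omega>\<in>space M. \<bar>?D \<omega> - ?V \<omega>\<bar> > 4 * \<eta>}
        \<le> (2 * (m * ?t)\<^sup>2 + 2 * \<kappa> * (a_norm m / m) + (a_norm m / m)\<^sup>2) / \<eta> + ((real m + 1) * ?t)\<^sup>2 / \<delta>\<^sup>2
          + \<delta>\<^sup>2 * (sqrt C + 2 * \<kappa> + a_norm m / m)\<^sup>2 / \<eta>\<^sup>2"
        by (rule variation_bound[of m, OF m1 ai \<kappa>0 C t(1) \<eta> \<delta> vn])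
      also have "\<dots> \<le> 2 * \<eta> + \<eta> + \<eta>"
      proof (intro add_mono)
        have "2 * (m * ?t)\<^sup>2 \<le> 2 * (m * \<tau>)\<^sup>2" using t by (intro mult_left_mono power_mono) auto
        moreover have "2 * \<kappa> * (a_norm m / m) \<le> 2 * (3 * K) * e"
        proof -
          have "2 * \<kappa> * (a_norm m / m) \<le> 2 * \<kappa> * (e / sqrt m)" using \<kappa>0 by (intro mult_left_mono am) auto
          then show ?thesis using m1 by (simp add: \<kappa>_def)
        qed
        moreover have "(a_norm m / m)\<^sup>2 \<le> e\<^sup>2" using ame am0 by (intro power_mono)
        ultimately have "2 * (m * ?t)\<^sup>2 + 2 * \<kappa> * (a_norm m / m) + (a_norm m / m)\<^sup>2 \<le> 2 * \<eta> * \<eta>"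
          using \<tau>(1) e(1) by linarith
        then show "(2 * (m * ?t)\<^sup>2 + 2 * \<kappa> * (a_norm m / m) + (a_norm m / m)\<^sup>2) / \<eta> \<le> 2 * \<eta>"
          using \<eta> by (simp add: pos_divide_le_eq)
        have "((real m + 1) * ?t)\<^sup>2 \<le> ((real m + 1) * \<tau>)\<^sup>2" using t by (intro power_mono mult_left_mono) auto
        then show "((real m + 1) * ?t)\<^sup>2 / \<delta>\<^sup>2 \<le> \<eta>"
          using \<tau>(2) \<delta> by (simp add: pos_divide_le_eq)
        have "(sqrt C + 2 * \<kappa> + a_norm m / m)\<^sup>2 \<le> \<sigma>\<^sup>2"
          using ame am0 \<kappa>0 C_nonneg by (intro power_mono) (auto simp: \<sigma>_def)
        then have "\<delta>\<^sup>2 * (sqrt C + 2 * \<kappa> + a_norm m / m)\<^sup>2 / \<eta>\<^sup>2 \<le> \<delta>\<^sup>2 * \<sigma>\<^sup>2 / \<eta>\<^sup>2"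
          by (intro divide_right_mono mult_left_mono) auto
        then show "\<delta>\<^sup>2 * (sqrt C + 2 * \<kappa> + a_norm m / m)\<^sup>2 / \<eta>\<^sup>2 \<le> \<eta>" using \<delta>\<sigma> by simp
      qed
      finally have p1: "prob {\<omega>\<in>space M. \<bar>?D \<omega> - ?V \<omega>\<bar> > 4 * \<eta>} \<le> \<epsilon> / 2" by (simp add: \<eta>_def)
      have p2: "prob {\<omega>\<in>space M. \<bar>?V \<omega> - t * c\<^sup>2\<bar> > \<epsilon> / 2} \<le> \<epsilon> / 2" by (rule N(3)[OF n tT])
      have "prob {\<omega>\<in>space M. \<bar>?D \<omega> - t * c\<^sup>2\<bar> > \<epsilon>}
        \<le> prob ({\<omega>\<in>space M. \<bar>?D \<omega> - ?V \<omega>\<bar> > 4 * \<eta>} \<union> {\<omega>\<in>space M. \<bar>?V \<omega> - t * c\<^sup>2\<bar> > \<epsilon> / 2})"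
      proof (rule finite_measure_mono)
        show "{\<omega>\<in>space M. \<bar>?D \<omega> - t * c\<^sup>2\<bar> > \<epsilon>}
          \<subseteq> {\<omega>\<in>space M. \<bar>?D \<omega> - ?V \<omega>\<bar> > 4 * \<eta>} \<union> {\<omega>\<in>space M. \<bar>?V \<omega> - t * c\<^sup>2\<bar> > \<epsilon> / 2}"
        proof
          fix \<omega> assume "\<omega> \<in> {\<omega>\<in>space M. \<bar>?D \<omega> - t * c\<^sup>2\<bar> > \<epsilon>}"
          moreover have "\<bar>x - z\<bar> > \<epsilon> \<Longrightarrow> \<bar>x - y\<bar> > 4 * \<eta> \<or> \<bar>y - z\<bar> > \<epsilon> / 2" for x y z :: real
            unfolding \<eta>_def by linarith
          ultimately show "\<omega> \<in> {\<omega>\<in>space M. \<bar>?D \<omega> - ?V \<omega>\<bar> > 4 * \<eta>} \<union> {\<omega>\<in>space M. \<bar>?V \<omega> - t * c\<^sup>2\<bar> > \<epsilon> / 2}"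
            by blast
        qed
      qed measurable
      also have "\<dots> \<le> \<epsilon> / 2 + \<epsilon> / 2"
        by (rule order_trans[OF measure_Un_le add_mono[OF p1 p2]]) measurable
      finally show ?thesis by simp
    qed
    show ?thesis
      unfolding good_martingale_def Dn using row_martingale[OF m1] 1 2 3 mgs
      by (auto simp: D.mg_def[abs_def])
  qed
  then show ?thesis by (intro exI[of _ D] exI[of _ "max N 1"] exI[of _ \<sigma>]) simp
qed

text \<open>By comparison with a single approximating martingale of accuracy 1.\<close>

lemma S_bounded:
  "\<exists>\<sigma>\<ge>0. \<exists>N\<ge>1. \<forall>n\<ge>N. \<forall>k\<le>n. l2 M (row_sum X n k) \<le> \<sigma>"
proof -
  obtain D N \<sigma> where N: "1 \<le> N"
    and D': "\<forall>n\<ge>N. good_martingale 1 {} n (D n) \<and> (\<forall>k\<le>n. l2 M (\<lambda>\<omega>. \<Sum>j<k. D n j \<omega>) \<le> \<sigma>)"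
    using martingale_approximation[of 1 "{}"] by auto
  note D = D'[rule_format, THEN conjunct1] D'[rule_format, THEN conjunct2, rule_format]
  have *: "l2 M (row_sum X n k) \<le> 1 + \<sigma>" if n: "N \<le> n" "k \<le> n" for n k
  proof -
    interpret adapted_row M \<F> X n using N n by (intro row) simp
    interpret D: L2_martingale M "\<lambda>k. \<F> n (int k)" "D n" using D(1)[OF n(1)] by (simp add: good_martingale_def)
    obtain Q where Q: "L2_rv M Q" "AE \<omega> in M. \<forall>k\<le>n. \<bar>S k \<omega> - D.mg k \<omega>\<bar> \<le> Q \<omega>" "l2 M Q \<le> 1"
      using D(1)[OF n(1)] unfolding good_martingale_def max_dominated_def D.mg_def by blast
    have d: "L2_rv M (\<lambda>\<omega>. S k \<omega> - D.mg k \<omega>)" by (intro L2_rv_diff S_L2 D.mg_L2)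
    have ae: "AE \<omega> in M. \<bar>S k \<omega> - D.mg k \<omega>\<bar> \<le> \<bar>Q \<omega>\<bar>"
      using Q(2) by eventually_elim (use n(2) abs_ge_self order_trans in blast)
    have "l2 M (\<lambda>\<omega>. (S k \<omega> - D.mg k \<omega>) + D.mg k \<omega>) \<le> l2 M (\<lambda>\<omega>. S k \<omega> - D.mg k \<omega>) + l2 M (D.mg k)"
      by (rule l2_add[OF d D.mg_L2])
    moreover have "l2 M (\<lambda>\<omega>. S k \<omega> - D.mg k \<omega>) \<le> 1"
      using L2_rv_bound(2)[OF Q(1) L2_rvD(1)[OF d] ae] Q(3) by simp
    moreover have "l2 M (D.mg k) \<le> \<sigma>" using D(2)[OF n] by (simp add: D.mg_def[abs_def])
    ultimately show ?thesis by simp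
  qed
  have "0 \<le> 1 + \<sigma>" using *[OF order_refl, of 0] l2_nonneg[of M "row_sum X N 0"] by linarith
  then show ?thesis using N * by blast
qed

end


section \<open>Limit behaviour of the blocks\<close>

lemma cmod_iexp_diff_le: "cmod (iexp x - iexp y) \<le> \<bar>x - y\<bar>"
proof -
  have "iexp x - iexp y = iexp y * (iexp (x - y) - 1)"
    by (simp add: right_diff_distrib exp_add[symmetric] algebra_simps)
  then have "cmod (iexp x - iexp y) = cmod (iexp (x - y) - 1)" by (simp add: norm_mult)
  also have "\<dots> \<le> \<bar>x - y\<bar>" using iexp_approx1[of "x - y" 0] by simp
  finally show ?thesis .
qed

context martingale_like_array begin

lemma good_martingale_mono:
  assumes "good_martingale \<delta> T n D" "\<delta> \<le> \<epsilon>" "T' \<subseteq> T"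
  shows "good_martingale \<epsilon> T' n D"
proof -
  interpret L2_martingale M "\<lambda>k. \<F> n (int k)" D using assms(1) by (simp add: good_martingale_def)
  have "prob {\<omega>\<in>space M. \<bar>(\<Sum>j<v n t. (D j \<omega>)\<^sup>2) - t * c\<^sup>2\<bar> > \<epsilon>} \<le> \<epsilon>" if "t \<in> T'" for t
  proof -
    have "prob {\<omega>\<in>space M. \<bar>(\<Sum>j<v n t. (D j \<omega>)\<^sup>2) - t * c\<^sup>2\<bar> > \<epsilon>}
        \<le> prob {\<omega>\<in>space M. \<bar>(\<Sum>j<v n t. (D j \<omega>)\<^sup>2) - t * c\<^sup>2\<bar> > \<delta>}"
      using assms(2) by (intro finite_measure_mono) auto
    also have "\<dots> \<le> \<delta>" using assms(1,3) that by (auto simp: good_martingale_def)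
    finally show ?thesis using assms(2) by simp
  qed
  then show ?thesis using assms max_dominated_mono unfolding good_martingale_def by blast
qed

text \<open>The block \<open>(a n, b n]\<close> has asymptotic variance \<open>r\<close>. The condition is imposed on every sufficiently good
  approximating martingale, because the martingale changes with the accuracy.\<close>

definition block_variance :: "(nat \<Rightarrow> nat) \<Rightarrow> (nat \<Rightarrow> nat) \<Rightarrow> real \<Rightarrow> bool" where
  "block_variance a b r \<longleftrightarrow> (\<forall>n\<ge>1. a n \<le> b n \<and> b n \<le> n) \<and> 0 \<le> r \<and>
    (\<forall>\<epsilon>>0. \<exists>T \<delta>. finite T \<and> T \<subseteq> {0<..1} \<and> 0 < \<delta> \<and>
      (\<forall>n\<ge>1. \<forall>D. good_martingale \<delta> T n D \<longrightarrow>
        prob {\<omega>\<in>space M. \<bar>(\<Sum>j=a n..<b n. (D j \<omega>)\<^sup>2) - r\<bar> > \<epsilon>} \<le> \<epsilon>))"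

lemma block_varianceD:
  assumes "block_variance a b r" "0 < \<epsilon>"
  shows "\<exists>T \<delta>. finite T \<and> T \<subseteq> {0<..1} \<and> 0 < \<delta> \<and>
      (\<forall>n\<ge>1. \<forall>D. good_martingale \<delta> T n D \<longrightarrow>
        prob {\<omega>\<in>space M. \<bar>(\<Sum>j=a n..<b n. (D j \<omega>)\<^sup>2) - r\<bar> > \<epsilon>} \<le> \<epsilon>)"
  using assms unfolding block_variance_def by simp

lemma block_variance_initial:
  assumes "t \<in> {0..1}"
  shows "block_variance (\<lambda>n. 0) (\<lambda>n. v n t) (t * c\<^sup>2)"
  unfolding block_variance_def
proof (intro conjI allI impI)
  show "v n t \<le> n" if "1 \<le> n" for n using v_range[OF that assms] .
  show "0 \<le> t * c\<^sup>2" using assms by simp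
  fix \<epsilon> :: real assume \<epsilon>: "0 < \<epsilon>"
  show "\<exists>T \<delta>. finite T \<and> T \<subseteq> {0<..1} \<and> 0 < \<delta> \<and>
      (\<forall>n\<ge>1. \<forall>D. good_martingale \<delta> T n D \<longrightarrow>
        prob {\<omega>\<in>space M. \<bar>(\<Sum>j=0..<v n t. (D j \<omega>)\<^sup>2) - t * c\<^sup>2\<bar> > \<epsilon>} \<le> \<epsilon>)"
  proof (cases "t = 0")
    case False
    then show ?thesis using assms \<epsilon>
      by (intro exI[of _ "{t}"] exI[of _ \<epsilon>]) (auto simp: good_martingale_def atLeast0LessThan)
  next
    case True
    (* v n 0 need not be 0, but the variance accumulated up to v n 0 is at most that up to v n s, s small *)
    define s where "s = min 1 (\<epsilon> / (2 * (c\<^sup>2 + 1)))"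
    have c1: "0 < c\<^sup>2 + 1" using zero_le_power2[of c] by linarith
    have s: "0 < s" "s \<le> 1" using \<epsilon> c1 by (auto simp: s_def)
    have sc: "s * c\<^sup>2 \<le> \<epsilon> / 2"
    proof -
      have "s * c\<^sup>2 \<le> s * (c\<^sup>2 + 1)" using s by (intro mult_left_mono) auto
      also have "\<dots> \<le> \<epsilon> / (2 * (c\<^sup>2 + 1)) * (c\<^sup>2 + 1)" using c1 by (intro mult_right_mono) (auto simp: s_def)
      also have "\<dots> = \<epsilon> / 2" using c1 by (simp add: field_simps)
      finally show ?thesis .
    qed
    have "prob {\<omega>\<in>space M. \<bar>(\<Sum>j=0..<v n 0. (D j \<omega>)\<^sup>2)\<bar> > \<epsilon>} \<le> \<epsilon>"
      if n: "1 \<le> n" and D: "good_martingale (\<epsilon> / 2) {s} n D" for n D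
    proof -
      interpret L2_martingale M "\<lambda>k. \<F> n (int k)" D using D by (simp add: good_martingale_def)
      have v0: "v n 0 \<le> v n s" using mono_onD[OF v_mono[OF n], of 0 s] s by simp
      have "prob {\<omega>\<in>space M. \<bar>(\<Sum>j=0..<v n 0. (D j \<omega>)\<^sup>2)\<bar> > \<epsilon>}
        \<le> prob {\<omega>\<in>space M. \<bar>(\<Sum>j<v n s. (D j \<omega>)\<^sup>2) - s * c\<^sup>2\<bar> > \<epsilon> / 2}"
      proof (rule finite_measure_mono)
        show "{\<omega>\<in>space M. \<bar>(\<Sum>j=0..<v n 0. (D j \<omega>)\<^sup>2)\<bar> > \<epsilon>}
          \<subseteq> {\<omega>\<in>space M. \<bar>(\<Sum>j<v n s. (D j \<omega>)\<^sup>2) - s * c\<^sup>2\<bar> > \<epsilon> / 2}"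
        proof safe
          fix \<omega> assume "\<epsilon> < \<bar>(\<Sum>j=0..<v n 0. (D j \<omega>)\<^sup>2)\<bar>"
          moreover have "0 \<le> (\<Sum>j=0..<v n 0. (D j \<omega>)\<^sup>2)" by (simp add: sum_nonneg)
          moreover have "(\<Sum>j=0..<v n 0. (D j \<omega>)\<^sup>2) \<le> (\<Sum>j<v n s. (D j \<omega>)\<^sup>2)"
            using v0 by (intro sum_mono2) auto
          ultimately show "\<epsilon> / 2 < \<bar>(\<Sum>j<v n s. (D j \<omega>)\<^sup>2) - s * c\<^sup>2\<bar>" using sc by linarith
        qed
      qed measurable
      also have "\<dots> \<le> \<epsilon> / 2" using D by (simp add: good_martingale_def)
      finally show ?thesis using \<epsilon> by simp
    qed
    then show ?thesis using s \<epsilon> True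
      by (intro exI[of _ "{s}"] exI[of _ "\<epsilon> / 2"]) auto
  qed
qed simp

lemma block_variance_diff:
  assumes a: "block_variance (\<lambda>n. 0) a r" and b: "block_variance (\<lambda>n. 0) b q"
    and le: "\<And>n. 1 \<le> n \<Longrightarrow> a n \<le> b n" "r \<le> q"
  shows "block_variance a b (q - r)"
  unfolding block_variance_def
proof (intro conjI allI impI)
  show "a n \<le> b n" "b n \<le> n" if "1 \<le> n" for n using le(1)[OF that] b that by (auto simp: block_variance_def)
  show "0 \<le> q - r" using le by simp
  fix \<epsilon> :: real assume \<epsilon>: "0 < \<epsilon>"
  then have \<epsilon>2: "0 < \<epsilon> / 2" by simp
  obtain T \<delta> where T: "finite T" "T \<subseteq> {0<..1}" "0 < \<delta>" "\<forall>n\<ge>1. \<forall>D. good_martingale \<delta> T n D \<longrightarrow>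
        prob {\<omega>\<in>space M. \<bar>(\<Sum>j=0..<a n. (D j \<omega>)\<^sup>2) - r\<bar> > \<epsilon> / 2} \<le> \<epsilon> / 2"
    using block_varianceD[OF a \<epsilon>2] by (elim exE conjE) (rule that)
  obtain T' \<delta>' where T': "finite T'" "T' \<subseteq> {0<..1}" "0 < \<delta>'" "\<forall>n\<ge>1. \<forall>D. good_martingale \<delta>' T' n D \<longrightarrow>
        prob {\<omega>\<in>space M. \<bar>(\<Sum>j=0..<b n. (D j \<omega>)\<^sup>2) - q\<bar> > \<epsilon> / 2} \<le> \<epsilon> / 2"
    using block_varianceD[OF b \<epsilon>2] by (elim exE conjE) (rule that)
  have "prob {\<omega>\<in>space M. \<bar>(\<Sum>j=a n..<b n. (D j \<omega>)\<^sup>2) - (q - r)\<bar> > \<epsilon>} \<le> \<epsilon>"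
    if n: "1 \<le> n" and D: "good_martingale (min \<delta> \<delta>') (T \<union> T') n D" for n D
  proof -
    interpret L2_martingale M "\<lambda>k. \<F> n (int k)" D using D by (simp add: good_martingale_def)
    let ?A = "{\<omega>\<in>space M. \<bar>(\<Sum>j=0..<a n. (D j \<omega>)\<^sup>2) - r\<bar> > \<epsilon> / 2}"
      and ?B = "{\<omega>\<in>space M. \<bar>(\<Sum>j=0..<b n. (D j \<omega>)\<^sup>2) - q\<bar> > \<epsilon> / 2}"
    have "prob {\<omega>\<in>space M. \<bar>(\<Sum>j=a n..<b n. (D j \<omega>)\<^sup>2) - (q - r)\<bar> > \<epsilon>} \<le> prob (?A \<union> ?B)"
    proof (rule finite_measure_mono)
      have "\<epsilon> / 2 < \<bar>(\<Sum>j=0..<a n. (D j \<omega>)\<^sup>2) - r\<bar> \<or> \<epsilon> / 2 < \<bar>(\<Sum>j=0..<b n. (D j \<omega>)\<^sup>2) - q\<bar>"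
        if "\<epsilon> < \<bar>(\<Sum>j=a n..<b n. (D j \<omega>)\<^sup>2) - (q - r)\<bar>" for \<omega>
      proof -
        have "(\<Sum>j=0..<b n. (D j \<omega>)\<^sup>2) = (\<Sum>j=0..<a n. (D j \<omega>)\<^sup>2) + (\<Sum>j=a n..<b n. (D j \<omega>)\<^sup>2)"
          using le(1)[OF n] by (simp add: sum.atLeastLessThan_concat)
        then show ?thesis using that by linarith
      qed
      then show "{\<omega>\<in>space M. \<bar>(\<Sum>j=a n..<b n. (D j \<omega>)\<^sup>2) - (q - r)\<bar> > \<epsilon>} \<subseteq> ?A \<union> ?B" by blast
    qed measurable
    also have "\<dots> \<le> prob ?A + prob ?B" by (rule measure_Un_le) measurable
    also have "\<dots> \<le> \<epsilon> / 2 + \<epsilon> / 2"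
      by (intro add_mono T(4)[rule_format] T'(4)[rule_format] n good_martingale_mono[OF D]) auto
    finally show ?thesis by simp
  qed
  then show "\<exists>T \<delta>. finite T \<and> T \<subseteq> {0<..1} \<and> 0 < \<delta> \<and>
      (\<forall>n\<ge>1. \<forall>D. good_martingale \<delta> T n D \<longrightarrow>
        prob {\<omega>\<in>space M. \<bar>(\<Sum>j=a n..<b n. (D j \<omega>)\<^sup>2) - (q - r)\<bar> > \<epsilon>} \<le> \<epsilon>)"
    using T T' by (intro exI[of _ "T \<union> T'"] exI[of _ "min \<delta> \<delta>'"]) auto
qed

definition incr :: "(nat \<Rightarrow> nat) \<Rightarrow> (nat \<Rightarrow> nat) \<Rightarrow> nat \<Rightarrow> 'a \<Rightarrow> real" where
  "incr a b n \<omega> = row_sum X n (b n) \<omega> - row_sum X n (a n) \<omega>"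

lemma incr_L2: "1 \<le> n \<Longrightarrow> L2_rv M (incr a b n)"
  unfolding incr_def[abs_def] by (intro L2_rv_diff adapted_row.S_L2[OF row])

lemma incr_measurable [measurable]: "1 \<le> n \<Longrightarrow> incr a b n \<in> borel_measurable M"
  using incr_L2 by auto

definition block_martingale ::
  "(nat \<Rightarrow> nat) \<Rightarrow> (nat \<Rightarrow> nat) \<Rightarrow> real \<Rightarrow> real \<Rightarrow> nat \<Rightarrow> (nat \<Rightarrow> 'a \<Rightarrow> real) \<Rightarrow> bool" where
  "block_martingale a b r \<epsilon> n D \<longleftrightarrow>
     L2_martingale M (\<lambda>k. \<F> n (int (a n + k))) D \<and>
     max_dominated M (\<lambda>k \<omega>. (row_sum X n (a n + k) \<omega> - row_sum X n (a n) \<omega>) - (\<Sum>j<k. D j \<omega>)) (b n - a n) \<epsilon> \<and>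
     max_dominated M D (b n - a n) \<epsilon> \<and>
     prob {\<omega>\<in>space M. \<bar>(\<Sum>j<b n - a n. (D j \<omega>)\<^sup>2) - r\<bar> > \<epsilon>} \<le> \<epsilon>"

text \<open>Restarting an approximating martingale at the beginning of the block doubles its distance from the partial sums, hence
  the accuracy \<open>\<epsilon> / 2\<close> in the proof.\<close>

lemma block_approximation:
  assumes bv: "block_variance a b r" and \<epsilon>: "0 < \<epsilon>"
  shows "\<exists>D N. 1 \<le> N \<and> (\<forall>n\<ge>N. block_martingale a b r \<epsilon> n (D n))"
proof -
  obtain T \<delta> where T: "finite T" "T \<subseteq> {0<..1}" "0 < \<delta>" "\<forall>n\<ge>1. \<forall>D. good_martingale \<delta> T n D \<longrightarrow>
        prob {\<omega>\<in>space M. \<bar>(\<Sum>j=a n..<b n. (D j \<omega>)\<^sup>2) - r\<bar> > \<epsilon>} \<le> \<epsilon>"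
    using block_varianceD[OF bv \<epsilon>] by (elim exE conjE) (rule that)
  define \<gamma> where "\<gamma> = min \<delta> (\<epsilon> / 2)"
  have \<gamma>: "0 < \<gamma>" "\<gamma> \<le> \<delta>" "\<gamma> \<le> \<epsilon> / 2" using T \<epsilon> by (auto simp: \<gamma>_def)
  obtain D N where N: "1 \<le> N" and D: "\<forall>n\<ge>N. good_martingale \<gamma> T n (D n)"
    using martingale_approximation[OF \<gamma>(1) T(1,2)] by auto
  have "block_martingale a b r \<epsilon> n (\<lambda>k. D n (a n + k))" if n: "N \<le> n" for n
    unfolding block_martingale_def
  proof (intro conjI)
    have n1: "1 \<le> n" using N n by simp
    have ab: "a n \<le> b n" "b n \<le> n" using bv n1 by (auto simp: block_variance_def)
    note good = D[rule_format, OF n]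
    interpret L2_martingale M "\<lambda>k. \<F> n (int k)" "D n" using good by (simp add: good_martingale_def)
    show "L2_martingale M (\<lambda>k. \<F> n (int (a n + k))) (\<lambda>k. D n (a n + k))" by (rule martingale_shift)
    have 1: "max_dominated M (\<lambda>k \<omega>. row_sum X n k \<omega> - mg k \<omega>) n \<gamma>"
      using good by (simp add: good_martingale_def mg_def)
    have s: "(\<Sum>j<k. D n (a n + j) \<omega>) = mg (a n + k) \<omega> - mg (a n) \<omega>" for k \<omega>
      by (induction k) (auto simp: mg_Suc)
    have "max_dominated M (\<lambda>k \<omega>. (row_sum X n (a n + k) \<omega> - row_sum X n (a n) \<omega>)
        - (\<Sum>j<k. D n (a n + j) \<omega>)) (b n - a n) (\<gamma> + \<gamma>)"
    proof (rule max_dominated_add)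
      show "max_dominated M (\<lambda>k \<omega>. row_sum X n (a n + k) \<omega> - mg (a n + k) \<omega>) (b n - a n) \<gamma>"
        by (rule max_dominated_reindex[OF 1, where \<tau>="\<lambda>k. a n + k"]) (use ab in auto)
      show "max_dominated M (\<lambda>k \<omega>. row_sum X n (a n) \<omega> - mg (a n) \<omega>) (b n - a n) \<gamma>"
        by (rule max_dominated_reindex[OF 1, where \<tau>="\<lambda>k. a n"]) (use ab in auto)
    qed (unfold s, linarith)
    then show "max_dominated M (\<lambda>k \<omega>. (row_sum X n (a n + k) \<omega> - row_sum X n (a n) \<omega>)
        - (\<Sum>j<k. D n (a n + j) \<omega>)) (b n - a n) \<epsilon>"
      by (rule max_dominated_mono) (use \<gamma> in simp)
    have "max_dominated M (D n) n \<gamma>" using good by (simp add: good_martingale_def)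
    then have "max_dominated M (D n) n \<epsilon>" by (rule max_dominated_mono) (use \<gamma> \<epsilon> in simp)
    then show "max_dominated M (\<lambda>k. D n (a n + k)) (b n - a n) \<epsilon>"
      by (rule max_dominated_reindex[where \<tau>="\<lambda>k. a n + k"]) (use ab in auto)
    have "prob {\<omega>\<in>space M. \<bar>(\<Sum>j=a n..<b n. (D n j \<omega>)\<^sup>2) - r\<bar> > \<epsilon>} \<le> \<epsilon>"
      using \<gamma> by (intro T(4)[rule_format] n1 good_martingale_mono[OF good]) auto
    moreover have "(\<Sum>j=a n..<b n. (D n j \<omega>)\<^sup>2) = (\<Sum>j<b n - a n. (D n (a n + j) \<omega>)\<^sup>2)" for \<omega>
      using sum.shift_bounds_nat_ivl[of "\<lambda>j. (D n j \<omega>)\<^sup>2" 0 "a n" "b n - a n"] ab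
      by (simp add: add.commute atLeast0LessThan)
    ultimately show "prob {\<omega>\<in>space M. \<bar>(\<Sum>j<b n - a n. (D n (a n + j) \<omega>)\<^sup>2) - r\<bar> > \<epsilon>} \<le> \<epsilon>" by simp
  qed
  then show ?thesis using N by (intro exI[of _ "\<lambda>n k. D n (a n + k)"] exI[of _ N]) auto
qed

lemma block_char:
  fixes g :: "nat \<Rightarrow> 'a \<Rightarrow> real"
  assumes bv: "block_variance a b r"
    and g: "\<And>n. 1 \<le> n \<Longrightarrow> g n \<in> borel_measurable (\<F> n (int (a n)))" "\<And>n \<omega>. \<bar>g n \<omega>\<bar> \<le> 1"
  shows "(\<lambda>n. (\<integral>\<omega>. g n \<omega> * iexp (u * incr a b n \<omega>) \<partial>M) - (\<integral>\<omega>. g n \<omega> \<partial>M) * exp (- (u\<^sup>2 * r / 2))) \<longlonglongrightarrow> 0"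
proof (rule LIMSEQ_I)
  fix \<epsilon> :: real assume \<epsilon>: "0 < \<epsilon>"
  have r: "0 \<le> r" using bv by (simp add: block_variance_def)
  define K where "K = McLeish_const u r + \<bar>u\<bar> + 1"
  have Mc: "0 \<le> McLeish_const u r" using r by (auto simp: McLeish_const_def intro!: add_nonneg_nonneg)
  then have K: "0 < K" using abs_ge_zero[of u] unfolding K_def by linarith
  define \<delta> where "\<delta> = min (min 1 (\<epsilon> / (2 * K))) (1 / (\<bar>u\<bar> + 1))"
  have \<delta>: "0 < \<delta>" "\<delta> \<le> 1" "\<delta> \<le> \<epsilon> / (2 * K)" "\<delta> \<le> 1 / (\<bar>u\<bar> + 1)"
    using \<epsilon> K by (auto simp: \<delta>_def)
  have \<delta>u: "\<bar>u\<bar> * \<delta> \<le> 1"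
  proof -
    have "\<bar>u\<bar> * \<delta> \<le> \<bar>u\<bar> * (1 / (\<bar>u\<bar> + 1))" by (intro mult_left_mono \<delta>) auto
    also have "\<dots> \<le> 1" by (simp add: divide_le_eq)
    finally show ?thesis .
  qed
  have \<delta>2: "\<delta>\<^sup>2 \<le> \<delta>" using \<delta> by (simp add: power2_eq_square mult_left_le)
  have \<delta>2p: "0 < \<delta>\<^sup>2" using \<delta> by simp
  obtain D N where N: "1 \<le> N" and BM: "\<And>n. N \<le> n \<Longrightarrow> block_martingale a b r (\<delta>\<^sup>2) n (D n)"
    using block_approximation[OF bv \<delta>2p] by blast
  show "\<exists>no. \<forall>n\<ge>no. norm ((\<integral>\<omega>. g n \<omega> * iexp (u * incr a b n \<omega>) \<partial>M) - (\<integral>\<omega>. g n \<omega> \<partial>M) * exp (- (u\<^sup>2 * r / 2)) - 0) < \<epsilon>"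
  proof (intro exI[of _ N] allI impI)
    fix n assume n: "N \<le> n"
    then have n1: "1 \<le> n" using N by simp
    have ab: "a n \<le> b n" using bv n1 by (auto simp: block_variance_def)
    interpret D: L2_martingale M "\<lambda>k. \<F> n (int (a n + k))" "D n" using BM[OF n] by (simp add: block_martingale_def)
    let ?k = "b n - a n"
    have gM [measurable]: "g n \<in> borel_measurable M"
      using measurable_from_subalg[OF subalg[OF n1] g(1)[OF n1]] .
    have [measurable]: "incr a b n \<in> borel_measurable M" using n1 by measurable
    obtain Q where Q: "L2_rv M Q" "AE \<omega> in M. \<forall>k\<le>?k. \<bar>D n k \<omega>\<bar> \<le> Q \<omega>" "l2 M Q \<le> \<delta>\<^sup>2"
      using BM[OF n] unfolding block_martingale_def max_dominated_def by blast
    obtain P where P: "L2_rv M P" "AE \<omega> in M. \<forall>k\<le>?k. \<bar>(row_sum X n (a n + k) \<omega> - row_sum X n (a n) \<omega>)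
        - D.mg k \<omega>\<bar> \<le> P \<omega>" "l2 M P \<le> \<delta>\<^sup>2"
      using BM[OF n] unfolding block_martingale_def max_dominated_def D.mg_def by blast
    have 1: "cmod ((\<integral>\<omega>. g n \<omega> * iexp (u * D.mg ?k \<omega>) \<partial>M) - (\<integral>\<omega>. g n \<omega> \<partial>M) * exp (- (u\<^sup>2 * r / 2)))
      \<le> \<delta> * McLeish_const u r"
    proof (rule D.martingale_char_bound[OF Q(1) _ Q(3) _ r \<delta>(1,2) \<delta>u _ g(2)])
      show "AE \<omega> in M. \<forall>i<?k. \<bar>D n i \<omega>\<bar> \<le> Q \<omega>" using Q(2) by eventually_elim auto
      have "prob {\<omega>\<in>space M. \<bar>(\<Sum>j<?k. (D n j \<omega>)\<^sup>2) - r\<bar> > \<delta>}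
         \<le> prob {\<omega>\<in>space M. \<bar>(\<Sum>j<?k. (D n j \<omega>)\<^sup>2) - r\<bar> > \<delta>\<^sup>2}"
      proof (rule finite_measure_mono)
        have [measurable]: "D n j \<in> borel_measurable M" for j by (rule D.D_M)
        show "{\<omega>\<in>space M. \<bar>(\<Sum>j<?k. (D n j \<omega>)\<^sup>2) - r\<bar> > \<delta>\<^sup>2} \<in> sets M" by measurable
      qed (use \<delta>2 in auto)
      then show "prob {\<omega>\<in>space M. \<bar>(\<Sum>j<?k. (D n j \<omega>)\<^sup>2) - r\<bar> > \<delta>} \<le> \<delta>\<^sup>2" using BM[OF n] by (simp add: block_martingale_def)
      show "g n \<in> borel_measurable (\<F> n (int (a n + 0)))" using g(1)[OF n1] by simp
    qed
    have i: "integrable M (\<lambda>\<omega>. g n \<omega> * iexp (u * incr a b n \<omega>))" "integrable M (\<lambda>\<omega>. g n \<omega> * iexp (u * D.mg ?k \<omega>))"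
      by (rule Bochner_Integration.integrable_bound[OF integrable_const[of "1::real"]]; use g(2) in \<open>auto simp: norm_mult\<close>)+
    have 2: "cmod ((\<integral>\<omega>. g n \<omega> * iexp (u * incr a b n \<omega>) \<partial>M) - (\<integral>\<omega>. g n \<omega> * iexp (u * D.mg ?k \<omega>) \<partial>M)) \<le> \<bar>u\<bar> * \<delta>"
    proof -
      have "cmod ((\<integral>\<omega>. g n \<omega> * iexp (u * incr a b n \<omega>) \<partial>M) - (\<integral>\<omega>. g n \<omega> * iexp (u * D.mg ?k \<omega>) \<partial>M))
         = cmod (\<integral>\<omega>. g n \<omega> * iexp (u * incr a b n \<omega>) - g n \<omega> * iexp (u * D.mg ?k \<omega>) \<partial>M)"
        using i by simp
      also have "\<dots> \<le> (\<integral>\<omega>. cmod (g n \<omega> * iexp (u * incr a b n \<omega>) - g n \<omega> * iexp (u * D.mg ?k \<omega>)) \<partial>M)"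
        by (rule integral_norm_bound)
      also have "\<dots> \<le> (\<integral>\<omega>. \<bar>u\<bar> * \<bar>P \<omega>\<bar> \<partial>M)"
      proof (rule integral_mono_AE)
        show "integrable M (\<lambda>\<omega>. cmod (g n \<omega> * iexp (u * incr a b n \<omega>) - g n \<omega> * iexp (u * D.mg ?k \<omega>)))" using i by auto
        show "integrable M (\<lambda>\<omega>. \<bar>u\<bar> * \<bar>P \<omega>\<bar>)" using L2_rv_integrable[OF P(1)] by auto
        show "AE \<omega> in M. cmod (g n \<omega> * iexp (u * incr a b n \<omega>) - g n \<omega> * iexp (u * D.mg ?k \<omega>)) \<le> \<bar>u\<bar> * \<bar>P \<omega>\<bar>"
          using P(2)
        proof eventually_elim
          case (elim \<omega>)
          have inc: "row_sum X n (a n + ?k) \<omega> - row_sum X n (a n) \<omega> = incr a b n \<omega>" using ab by (simp add: incr_def)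
          have "\<bar>incr a b n \<omega> - D.mg ?k \<omega>\<bar> \<le> P \<omega>" using elim[rule_format, of ?k] unfolding inc by simp
          then have p: "\<bar>incr a b n \<omega> - D.mg ?k \<omega>\<bar> \<le> \<bar>P \<omega>\<bar>" by linarith
          have "cmod (g n \<omega> * iexp (u * incr a b n \<omega>) - g n \<omega> * iexp (u * D.mg ?k \<omega>))
             = \<bar>g n \<omega>\<bar> * cmod (iexp (u * incr a b n \<omega>) - iexp (u * D.mg ?k \<omega>))"
            by (simp add: right_diff_distrib[symmetric] norm_mult)
          also have "\<dots> \<le> 1 * \<bar>u * incr a b n \<omega> - u * D.mg ?k \<omega>\<bar>"
            by (intro mult_mono g(2) cmod_iexp_diff_le) auto
          also have "\<dots> \<le> \<bar>u\<bar> * \<bar>P \<omega>\<bar>"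
            using mult_left_mono[OF p, of "\<bar>u\<bar>"] by (simp add: right_diff_distrib[symmetric] abs_mult)
          finally show ?case .
        qed
      qed
      also have "\<dots> \<le> \<bar>u\<bar> * \<delta>"
        using order_trans[OF integral_abs_le_l2[OF P(1)] order_trans[OF P(3) \<delta>2]] by (simp add: mult_left_mono)
      finally show ?thesis .
    qed
    have "norm ((\<integral>\<omega>. g n \<omega> * iexp (u * incr a b n \<omega>) \<partial>M) - (\<integral>\<omega>. g n \<omega> \<partial>M) * exp (- (u\<^sup>2 * r / 2)) - 0)
      \<le> \<bar>u\<bar> * \<delta> + \<delta> * McLeish_const u r"
      using norm_triangle_le[OF add_mono[OF 2 1]] by (simp add: algebra_simps)
    also have "\<dots> \<le> \<delta> * K" using \<delta>(1) by (simp add: K_def algebra_simps)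
    also have "\<dots> \<le> \<epsilon> / (2 * K) * K" using K by (intro mult_right_mono \<delta>) auto
    also have "\<dots> = \<epsilon> / 2" using K by simp
    also have "\<dots> < \<epsilon>" using \<epsilon> by simp
    finally show "norm ((\<integral>\<omega>. g n \<omega> * iexp (u * incr a b n \<omega>) \<partial>M) - (\<integral>\<omega>. g n \<omega> \<partial>M) * exp (- (u\<^sup>2 * r / 2)) - 0) < \<epsilon>" .
  qed
qed

text \<open>The density \<open>1 + g n / 2\<close> stays between \<open>1/2\<close> and \<open>3/2\<close>, so after normalisation it defines a probability measure
  even though \<open>g n\<close> may change sign and need not converge. Under this measure the characteristic function of the block
  converges by \<open>block_char\<close>, and Levy's theorem applies.\<close>

lemma tilted_block_limit:
  fixes g :: "nat \<Rightarrow> 'a \<Rightarrow> real" and h :: "real \<Rightarrow> real"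
  assumes bv: "block_variance a b r"
    and g: "\<And>n. 1 \<le> n \<Longrightarrow> g n \<in> borel_measurable (\<F> n (int (a n)))" "\<And>n \<omega>. \<bar>g n \<omega>\<bar> \<le> 1"
    and \<mu>: "real_distribution \<mu>" "\<And>u. char \<mu> u = exp (- (u\<^sup>2 * r / 2))"
    and h: "continuous_on UNIV h" "\<And>x. \<bar>h x\<bar> \<le> B"
  shows "(\<lambda>n. (\<integral>\<omega>. (1 + g n \<omega> / 2) * h (incr a b n \<omega>) \<partial>M) / (\<integral>\<omega>. 1 + g n \<omega> / 2 \<partial>M)) \<longlonglongrightarrow> (\<integral>x. h x \<partial>\<mu>)"
proof -
  define Z where "Z = (\<lambda>n. \<integral>\<omega>. 1 + g n \<omega> / 2 \<partial>M)"
  define q where "q = (\<lambda>n \<omega>. (1 + g n \<omega> / 2) / Z n)"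
  define \<nu> where "\<nu> = (\<lambda>n. distr (density M (\<lambda>\<omega>. ennreal (q n \<omega>))) borel (incr a b n))"
  have gM: "g n \<in> borel_measurable M" if "1 \<le> n" for n
    using measurable_from_subalg[OF subalg[OF that] g(1)[OF that]] .
  have gi: "integrable M (g n)" if "1 \<le> n" for n
    by (rule Bochner_Integration.integrable_bound[OF integrable_const[of "1::real"] gM[OF that]]) (use g(2) in auto)
  have Z: "Z n = 1 + (\<integral>\<omega>. g n \<omega> \<partial>M) / 2" if "1 \<le> n" for n
    unfolding Z_def using gi[OF that] by (simp add: prob_space)
  have Zge: "1 / 2 \<le> Z n" if "1 \<le> n" for n
  proof -
    have "\<bar>\<integral>\<omega>. g n \<omega> \<partial>M\<bar> \<le> (\<integral>\<omega>. \<bar>g n \<omega>\<bar> \<partial>M)" by (rule integral_abs_bound)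
    also have "\<dots> \<le> (\<integral>\<omega>. 1 \<partial>M)" using gi[OF that] g(2) by (intro integral_mono) auto
    finally have "\<bar>\<integral>\<omega>. g n \<omega> \<partial>M\<bar> \<le> 1" by (simp add: prob_space)
    then show ?thesis unfolding Z[OF that] by linarith
  qed
  have q0: "0 \<le> q n \<omega>" if "1 \<le> n" for n \<omega>
    using Zge[OF that] g(2)[of n \<omega>] by (auto simp: q_def intro!: divide_nonneg_nonneg)
  have qM: "q n \<in> borel_measurable M" if "1 \<le> n" for n unfolding q_def using gM[OF that] by measurable
  have density: "(\<integral>x. f x \<partial>\<nu> n) = (\<integral>\<omega>. q n \<omega> *\<^sub>R f (incr a b n \<omega>) \<partial>M)"
    if n: "1 \<le> n" and f: "f \<in> borel_measurable borel" for n and f :: "real \<Rightarrow> 'c::{banach, second_countable_topology}"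
    unfolding \<nu>_def using incr_measurable[OF n] f q0[OF n] qM[OF n]
    by (subst integral_distr) (auto simp: integral_density)
  have \<nu>: "real_distribution (\<nu> n)" if n: "1 \<le> n" for n
  proof -
    have "emeasure (density M (\<lambda>\<omega>. ennreal (q n \<omega>))) (space M) = (\<integral>\<^sup>+\<omega>. ennreal (q n \<omega>) \<partial>M)"
      using qM[OF n] by (subst emeasure_density) (auto intro!: nn_integral_cong)
    also have "\<dots> = ennreal (\<integral>\<omega>. q n \<omega> \<partial>M)"
      using gi[OF n] q0[OF n] by (intro nn_integral_eq_integral) (auto simp: q_def)
    also have "(\<integral>\<omega>. q n \<omega> \<partial>M) = Z n / Z n"
      unfolding q_def by (subst integral_divide_zero) (simp only: Z_def)
    also have "\<dots> = 1" using Zge[OF n] by simp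
    finally have "prob_space (density M (\<lambda>\<omega>. ennreal (q n \<omega>)))" by (intro prob_spaceI) simp
    then show ?thesis unfolding \<nu>_def
      using incr_measurable[OF n] by (intro prob_space.real_distribution_distr) auto
  qed
  have conv: "weak_conv_m (\<lambda>n. \<nu> (Suc n)) \<mu>"
  proof (rule levy_continuity)
    fix u :: real
    let ?e = "exp (- (u\<^sup>2 * r / 2))"
    let ?d1 = "\<lambda>n. (\<integral>\<omega>. 1 * iexp (u * incr a b n \<omega>) \<partial>M) - (\<integral>\<omega>. 1 \<partial>M) * complex_of_real ?e"
    let ?dg = "\<lambda>n. (\<integral>\<omega>. g n \<omega> * iexp (u * incr a b n \<omega>) \<partial>M) - (\<integral>\<omega>. g n \<omega> \<partial>M) * complex_of_real ?e"
    have d: "?d1 \<longlonglongrightarrow> 0" "?dg \<longlonglongrightarrow> 0"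
      using block_char[OF bv, of "\<lambda>n \<omega>. 1" u] block_char[OF bv g, of u] by (auto simp: prob_space)
    have eq: "char (\<nu> n) u - ?e = (?d1 n + ?dg n / 2) / Z n" if n: "1 \<le> n" for n
    proof -
      have [measurable]: "g n \<in> borel_measurable M" "incr a b n \<in> borel_measurable M"
        using gM[OF n] incr_measurable[OF n] by auto
      have i: "integrable M (\<lambda>\<omega>. iexp (u * incr a b n \<omega>))" "integrable M (\<lambda>\<omega>. g n \<omega> * iexp (u * incr a b n \<omega>))"
        by (rule Bochner_Integration.integrable_bound[OF integrable_const[of "1::real"]]; use g(2) in \<open>auto simp: norm_mult\<close>)+
      have Z0: "complex_of_real (Z n) \<noteq> 0" using Zge[OF n] by auto
      have "char (\<nu> n) u = (\<integral>\<omega>. q n \<omega> *\<^sub>R iexp (u * incr a b n \<omega>) \<partial>M)"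
        unfolding char_def by (rule density[OF n]) measurable
      also have "\<dots> = (\<integral>\<omega>. (iexp (u * incr a b n \<omega>) + g n \<omega> * iexp (u * incr a b n \<omega>) / 2) / Z n \<partial>M)"
        using Z0 by (intro Bochner_Integration.integral_cong refl) (simp add: q_def scaleR_conv_of_real field_simps)
      also have "\<dots> = ((\<integral>\<omega>. iexp (u * incr a b n \<omega>) \<partial>M) + (\<integral>\<omega>. g n \<omega> * iexp (u * incr a b n \<omega>) \<partial>M) / 2) / Z n"
        using i by simp
      finally have "char (\<nu> n) u = \<dots>" .
      moreover have "complex_of_real ?e = (?e + complex_of_real (\<integral>\<omega>. g n \<omega> \<partial>M) * ?e / 2) / Z n"
      proof -
        have "?e + complex_of_real (\<integral>\<omega>. g n \<omega> \<partial>M) * ?e / 2 = ?e * complex_of_real (Z n)"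
          unfolding Z[OF n] by (simp add: distrib_left)
        then show ?thesis using Z0 by simp
      qed
      ultimately have "char (\<nu> n) u - ?e =
          ((\<integral>\<omega>. iexp (u * incr a b n \<omega>) \<partial>M) + (\<integral>\<omega>. g n \<omega> * iexp (u * incr a b n \<omega>) \<partial>M) / 2) / Z n
          - (?e + complex_of_real (\<integral>\<omega>. g n \<omega> \<partial>M) * ?e / 2) / Z n"
        by (rule arg_cong2[where f="(-)"])
      also have "\<dots> = (?d1 n + ?dg n / 2) / Z n"
        unfolding diff_divide_distrib[symmetric] by (rule arg_cong[where f="\<lambda>x. x / _"]) (simp add: prob_space field_simps)
      finally show ?thesis .
    qed
    have t: "norm (p + q / 2) / (1 / 2) \<le> (norm p + norm q) * 2" for p q :: complex
      using norm_triangle_ineq[of p "q / 2"] by (simp add: norm_divide) (use norm_ge_zero[of q] in linarith)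
    have "(\<lambda>n. char (\<nu> n) u - ?e) \<longlonglongrightarrow> 0"
    proof (rule Lim_null_comparison)
      show "\<forall>\<^sub>F n in sequentially. norm (char (\<nu> n) u - ?e) \<le> (norm (?d1 n) + norm (?dg n)) * 2"
        using eventually_ge_at_top[of 1]
      proof eventually_elim
        case (elim n)
        have "norm (char (\<nu> n) u - ?e) = norm (?d1 n + ?dg n / 2) / Z n"
          unfolding eq[OF elim] norm_divide using Zge[OF elim] by simp
        also have "\<dots> \<le> norm (?d1 n + ?dg n / 2) / (1 / 2)"
          using Zge[OF elim] by (intro divide_left_mono) auto
        also have "\<dots> \<le> (norm (?d1 n) + norm (?dg n)) * 2"
          by (rule t)
        finally show ?case .
      qed
      have "(\<lambda>n. (norm (?d1 n) + norm (?dg n)) * 2) \<longlonglongrightarrow> (norm (0::complex) + norm (0::complex)) * 2"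
        by (intro tendsto_intros d)
      then show "(\<lambda>n. (norm (?d1 n) + norm (?dg n)) * 2) \<longlonglongrightarrow> 0" by simp
    qed
    then have "(\<lambda>n. char (\<nu> n) u) \<longlonglongrightarrow> complex_of_real ?e" by (rule Lim_null[THEN iffD2])
    then show "(\<lambda>n. char (\<nu> (Suc n)) u) \<longlonglongrightarrow> char \<mu> u" unfolding \<mu>(2) by (rule LIMSEQ_Suc)
  qed (use \<nu> \<mu>(1) in auto)
  have hB: "h \<in> borel_measurable borel" using h(1) by (rule borel_measurable_continuous_onI)
  have "(\<lambda>n. \<integral>x. h x \<partial>\<nu> (Suc n)) \<longlonglongrightarrow> (\<integral>x. h x \<partial>\<mu>)"
    by (rule weak_conv_imp_integral_bdd_continuous_conv[OF \<nu> \<mu>(1) conv])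
      (use h in \<open>auto simp: continuous_on_eq_continuous_at\<close>)
  then have "(\<lambda>n. \<integral>x. h x \<partial>\<nu> n) \<longlonglongrightarrow> (\<integral>x. h x \<partial>\<mu>)" by (rule LIMSEQ_imp_Suc)
  then show ?thesis
  proof (rule Lim_transform_eventually)
    show "\<forall>\<^sub>F n in sequentially. (\<integral>x. h x \<partial>\<nu> n)
       = (\<integral>\<omega>. (1 + g n \<omega> / 2) * h (incr a b n \<omega>) \<partial>M) / (\<integral>\<omega>. 1 + g n \<omega> / 2 \<partial>M)"
      using eventually_ge_at_top[of 1]
    proof eventually_elim
      case (elim n)
      have "(\<integral>x. h x \<partial>\<nu> n) = (\<integral>\<omega>. (1 + g n \<omega> / 2) * h (incr a b n \<omega>) / Z n \<partial>M)"
        unfolding density[OF elim hB] by (simp add: q_def)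
      then show ?case by (simp add: Z_def)
    qed
  qed
qed

text \<open>The difference of the statements of the previous lemma for \<open>g\<close> and for 0.\<close>

lemma asymptotic_independence:
  fixes g :: "nat \<Rightarrow> 'a \<Rightarrow> real" and h :: "real \<Rightarrow> real"
  assumes bv: "block_variance a b r"
    and g: "\<And>n. 1 \<le> n \<Longrightarrow> g n \<in> borel_measurable (\<F> n (int (a n)))" "\<And>n \<omega>. \<bar>g n \<omega>\<bar> \<le> 1"
    and \<mu>: "real_distribution \<mu>" "\<And>u. char \<mu> u = exp (- (u\<^sup>2 * r / 2))"
    and h: "continuous_on UNIV h" "\<And>x. \<bar>h x\<bar> \<le> B"
  shows "(\<lambda>n. (\<integral>\<omega>. g n \<omega> * h (incr a b n \<omega>) \<partial>M) - (\<integral>\<omega>. g n \<omega> \<partial>M) * (\<integral>x. h x \<partial>\<mu>)) \<longlonglongrightarrow> 0"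
proof -
  let ?I = "\<integral>x. h x \<partial>\<mu>"
  define Z where "Z = (\<lambda>n. \<integral>\<omega>. 1 + g n \<omega> / 2 \<partial>M)"
  let ?x = "\<lambda>n. (\<integral>\<omega>. (1 + g n \<omega> / 2) * h (incr a b n \<omega>) \<partial>M) / Z n"
  let ?y = "\<lambda>n. \<integral>\<omega>. h (incr a b n \<omega>) \<partial>M"
  have x: "?x \<longlonglongrightarrow> ?I" unfolding Z_def by (rule tilted_block_limit[OF bv g \<mu> h])
  have y: "?y \<longlonglongrightarrow> ?I"
    using tilted_block_limit[OF bv _ _ \<mu> h, of "\<lambda>n \<omega>. 0"] by (simp add: prob_space)
  show ?thesis
  proof (rule Lim_null_comparison)
    have "(\<lambda>n. 3 * \<bar>?x n - ?I\<bar> + 2 * \<bar>?y n - ?I\<bar>) \<longlonglongrightarrow> 3 * \<bar>?I - ?I\<bar> + 2 * \<bar>?I - ?I\<bar>"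
      by (intro tendsto_intros x y)
    then show "(\<lambda>n. 3 * \<bar>?x n - ?I\<bar> + 2 * \<bar>?y n - ?I\<bar>) \<longlonglongrightarrow> 0" by simp
    show "\<forall>\<^sub>F n in sequentially. norm ((\<integral>\<omega>. g n \<omega> * h (incr a b n \<omega>) \<partial>M) - (\<integral>\<omega>. g n \<omega> \<partial>M) * ?I)
       \<le> 3 * \<bar>?x n - ?I\<bar> + 2 * \<bar>?y n - ?I\<bar>"
      using eventually_ge_at_top[of 1]
    proof eventually_elim
      case (elim n)
      have gM [measurable]: "g n \<in> borel_measurable M"
        using measurable_from_subalg[OF subalg[OF elim] g(1)[OF elim]] .
      have [measurable]: "incr a b n \<in> borel_measurable M" by (rule incr_measurable[OF elim])
      have [measurable]: "h \<in> borel_measurable borel" using h(1) by (rule borel_measurable_continuous_onI)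
      have gi: "integrable M (g n)"
        by (rule Bochner_Integration.integrable_bound[OF integrable_const[of "1::real"] gM]) (use g(2) in auto)
      have hi: "integrable M (\<lambda>\<omega>. h (incr a b n \<omega>))"
        by (rule Bochner_Integration.integrable_bound[OF integrable_const[of B]])
          (use order_trans[OF h(2) abs_ge_self] in auto)
      have ghi: "integrable M (\<lambda>\<omega>. g n \<omega> * h (incr a b n \<omega>))"
      proof (rule Bochner_Integration.integrable_bound[OF integrable_norm[OF hi]])
        show "AE \<omega> in M. norm (g n \<omega> * h (incr a b n \<omega>)) \<le> norm (norm (h (incr a b n \<omega>)))"
          using mult_right_mono[OF g(2)[of n]] by (auto simp: abs_mult)
      qed measurable
      define G where "G = (\<integral>\<omega>. g n \<omega> \<partial>M)"
      have Z: "Z n = 1 + G / 2" unfolding Z_def G_def using gi by (simp add: prob_space)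
      have "\<bar>G\<bar> \<le> (\<integral>\<omega>. \<bar>g n \<omega>\<bar> \<partial>M)" unfolding G_def by (rule integral_abs_bound)
      also have "\<dots> \<le> (\<integral>\<omega>. 1 \<partial>M)" using gi g(2) by (intro integral_mono) auto
      finally have G: "\<bar>G\<bar> \<le> 1" by (simp add: prob_space)
      then have Zb: "1 / 2 \<le> Z n" "Z n \<le> 3 / 2" unfolding Z by linarith+
      have "(\<integral>\<omega>. (1 + g n \<omega> / 2) * h (incr a b n \<omega>) \<partial>M) = ?y n + (\<integral>\<omega>. g n \<omega> * h (incr a b n \<omega>) \<partial>M) / 2"
        using hi ghi by (simp add: distrib_right)
      then have "(\<integral>\<omega>. g n \<omega> * h (incr a b n \<omega>) \<partial>M) = 2 * (Z n * ?x n - ?y n)"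
        using Zb by simp
      then have eq: "(\<integral>\<omega>. g n \<omega> * h (incr a b n \<omega>) \<partial>M) - G * ?I = 2 * Z n * (?x n - ?I) - 2 * (?y n - ?I)"
        unfolding Z by (simp add: algebra_simps)
      have "\<bar>2 * Z n * (?x n - ?I)\<bar> \<le> 3 * \<bar>?x n - ?I\<bar>"
        unfolding abs_mult using Zb by (intro mult_right_mono) auto
      moreover have "\<bar>p - 2 * q\<bar> \<le> \<bar>p\<bar> + 2 * \<bar>q\<bar>" for p q :: real by linarith
      ultimately show ?case unfolding G_def[symmetric] eq real_norm_def
        by (meson add_right_mono order_trans)
    qed
  qed
qed

subsection \<open>Oscillation within a block\<close>

text \<open>The maximal inequality for the approximating martingale reduces the oscillation to the expectation of
  \<open>(|M| - \<alpha>)\<^sup>+\<close>. Cut off at a high level \<open>R\<close> this is a bounded continuous function \<open>\<phi>\<close>, so its limit is the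
  integral under the normal law \<open>\<mu>\<close>; the part above \<open>R\<close> is controlled by the second moments, uniformly in \<open>n\<close>.\<close>

lemma block_oscillation:
  assumes bv: "block_variance a b r"
    and \<mu>: "real_distribution \<mu>" "\<And>u. char \<mu> u = exp (- (u\<^sup>2 * r / 2))"
    and m4: "integrable \<mu> (\<lambda>x. x ^ 4)" "(\<integral>x. x ^ 4 \<partial>\<mu>) \<le> 3 * r\<^sup>2"
    and pos: "0 < \<alpha>" "0 < \<eta>"
  shows "\<forall>\<^sub>F n in sequentially. prob {\<omega>\<in>space M. \<exists>k\<in>{a n..b n}. 4 * \<alpha> < \<bar>row_sum X n k \<omega> - row_sum X n (a n) \<omega>\<bar>}
    \<le> 3 * r\<^sup>2 / \<alpha> ^ 4 + \<eta>"
proof -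
  obtain \<sigma> N0 where \<sigma>: "0 \<le> \<sigma>" "1 \<le> N0" "\<And>n k. N0 \<le> n \<Longrightarrow> k \<le> n \<Longrightarrow> l2 M (row_sum X n k) \<le> \<sigma>"
    using S_bounded by blast
  interpret \<mu>: real_distribution \<mu> by (rule \<mu>(1))
  define R where "R = (2 * \<sigma> + 1)\<^sup>2 / (\<alpha> * \<eta> / 4)"
  have s1: "0 < 2 * \<sigma> + 1" using \<sigma> by simp
  have R: "0 < R" using s1 pos by (simp add: R_def)
  have Rr: "(2 * \<sigma> + 1)\<^sup>2 / R = \<alpha> * \<eta> / 4" using s1 by (simp add: R_def)
  define \<phi> where "\<phi> = (\<lambda>x::real. min (max 0 (\<bar>x\<bar> - \<alpha>)) R)"
  have \<phi>c: "continuous_on UNIV \<phi>" unfolding \<phi>_def by (intro continuous_intros)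
  have \<phi>b: "\<bar>\<phi> x\<bar> \<le> R" for x using R by (auto simp: \<phi>_def)
  have \<phi>m [measurable]: "\<phi> \<in> borel_measurable borel" using \<phi>c by (rule borel_measurable_continuous_onI)
  have \<phi>L: "\<bar>\<phi> x - \<phi> y\<bar> \<le> \<bar>x - y\<bar>" for x y unfolding \<phi>_def by linarith
  have \<phi>\<mu>: "(\<integral>x. \<phi> x \<partial>\<mu>) \<le> 3 * r\<^sup>2 / \<alpha> ^ 3"
  proof -
    have "(\<integral>x. \<phi> x \<partial>\<mu>) \<le> (\<integral>x. x ^ 4 / \<alpha> ^ 3 \<partial>\<mu>)"
    proof (rule integral_mono)
      show "integrable \<mu> \<phi>"
        by (rule Bochner_Integration.integrable_bound[OF \<mu>.integrable_const[of R]]) (use \<phi>b R in auto)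
      show "integrable \<mu> (\<lambda>x. x ^ 4 / \<alpha> ^ 3)" using m4(1) by simp
      fix x :: real
      show "\<phi> x \<le> x ^ 4 / \<alpha> ^ 3"
      proof (cases "\<alpha> < \<bar>x\<bar>")
        case True
        have "\<phi> x \<le> \<bar>x\<bar>" using True pos by (simp add: \<phi>_def)
        also have "\<bar>x\<bar> * \<alpha> ^ 3 \<le> \<bar>x\<bar> * \<bar>x\<bar> ^ 3" using True pos by (intro mult_left_mono power_mono) auto
        then have "\<bar>x\<bar> \<le> \<bar>x\<bar> * \<bar>x\<bar> ^ 3 / \<alpha> ^ 3" using pos by (simp add: pos_le_divide_eq)
        also have "\<bar>x\<bar> * \<bar>x\<bar> ^ 3 = x ^ 4" using power_even_abs[of 4 x] by (simp add: power_Suc[symmetric] del: power_Suc)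
        finally show ?thesis .
      next
        case False
        then have "\<phi> x = 0" using R by (simp add: \<phi>_def)
        moreover have "0 \<le> x ^ 4 / \<alpha> ^ 3" using pos by simp
        ultimately show ?thesis by simp
      qed
    qed
    also have "\<dots> = (\<integral>x. x ^ 4 \<partial>\<mu>) / \<alpha> ^ 3" by simp
    also have "\<dots> \<le> 3 * r\<^sup>2 / \<alpha> ^ 3" using m4(2) pos by (intro divide_right_mono) auto
    finally show ?thesis .
  qed
  define \<delta> where "\<delta> = min (min 1 \<alpha>) (\<alpha> * \<eta> / 4)"
  have \<delta>: "0 < \<delta>" "\<delta> \<le> 1" "\<delta> \<le> \<alpha>" "\<delta> \<le> \<alpha> * \<eta> / 4" using pos by (auto simp: \<delta>_def)
  obtain D N where N: "1 \<le> N" and BM: "\<And>n. N \<le> n \<Longrightarrow> block_martingale a b r \<delta> n (D n)"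
    using block_approximation[OF bv \<delta>(1)] by blast
  have "(\<lambda>n. (\<integral>\<omega>. 1 * \<phi> (incr a b n \<omega>) \<partial>M) - (\<integral>\<omega>. 1 \<partial>M) * (\<integral>x. \<phi> x \<partial>\<mu>)) \<longlonglongrightarrow> 0"
    by (rule asymptotic_independence[OF bv _ _ \<mu> \<phi>c \<phi>b]) auto
  then have "\<forall>\<^sub>F n in sequentially. (\<integral>\<omega>. \<phi> (incr a b n \<omega>) \<partial>M) - (\<integral>x. \<phi> x \<partial>\<mu>) < \<alpha> * \<eta> / 4"
    using pos by (intro order_tendstoD(2)) (auto simp: prob_space)
  then show ?thesis using eventually_ge_at_top[of N] eventually_ge_at_top[of N0]
  proof eventually_elim
    case (elim n)
    have n1: "1 \<le> n" using elim N by simp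
    have ab: "a n \<le> b n" "b n \<le> n" using bv n1 by (auto simp: block_variance_def)
    interpret row: adapted_row M \<F> X n by (rule row[OF n1])
    let ?k = "b n - a n"
    interpret D: L2_martingale M "\<lambda>k. \<F> n (int (a n + k))" "D n"
      using BM[OF elim(2)] by (simp add: block_martingale_def)
    obtain P where P: "L2_rv M P" "AE \<omega> in M. \<forall>k\<le>?k. \<bar>(row_sum X n (a n + k) \<omega> - row_sum X n (a n) \<omega>)
        - D.mg k \<omega>\<bar> \<le> P \<omega>" "l2 M P \<le> \<delta>"
      using BM[OF elim(2)] unfolding block_martingale_def max_dominated_def D.mg_def by blast
    have inc: "row_sum X n (a n + ?k) \<omega> - row_sum X n (a n) \<omega> = incr a b n \<omega>" for \<omega> using ab by (simp add: incr_def)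
    have P': "AE \<omega> in M. \<bar>D.mg ?k \<omega> - incr a b n \<omega>\<bar> \<le> \<bar>P \<omega>\<bar>"
      using P(2)
    proof eventually_elim
      case (elim \<omega>)
      show ?case using elim[rule_format, of ?k] unfolding inc by linarith
    qed
    have [measurable]: "P \<in> borel_measurable M" "incr a b n \<in> borel_measurable M" using P(1) incr_measurable[OF n1] by auto
    have [measurable]: "row_sum X n k \<in> borel_measurable M" for k using row.S_L2 by auto
    note incL = incr_L2[OF n1, of a b]
    have l2inc: "l2 M (incr a b n) \<le> 2 * \<sigma>"
      using l2_diff[OF row.S_L2[of "b n"] row.S_L2[of "a n"]] \<sigma>(3)[OF elim(3), of "a n"] \<sigma>(3)[OF elim(3), of "b n"] ab
      by (simp add: incr_def[abs_def])
    have l2mg: "l2 M (D.mg ?k) \<le> 2 * \<sigma> + 1"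
    proof -
      have d: "L2_rv M (\<lambda>\<omega>. D.mg ?k \<omega> - incr a b n \<omega>)" by (intro L2_rv_diff D.mg_L2 incL)
      have "l2 M (\<lambda>\<omega>. D.mg ?k \<omega> - incr a b n \<omega>) \<le> 1"
        using L2_rv_bound(2)[OF P(1) L2_rvD(1)[OF d] P'] P(3) \<delta> by simp
      moreover have "l2 M (\<lambda>\<omega>. (D.mg ?k \<omega> - incr a b n \<omega>) + incr a b n \<omega>)
        \<le> l2 M (\<lambda>\<omega>. D.mg ?k \<omega> - incr a b n \<omega>) + l2 M (incr a b n)" by (rule l2_add[OF d incL])
      ultimately show ?thesis using l2inc by simp
    qed
    have "(\<integral>\<omega>. max 0 (\<bar>D.mg ?k \<omega>\<bar> - \<alpha>) \<partial>M) \<le> (\<integral>\<omega>. \<phi> (incr a b n \<omega>) + \<bar>P \<omega>\<bar> + (D.mg ?k \<omega>)\<^sup>2 / R \<partial>M)"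
    proof (rule integral_mono_AE)
      show "integrable M (\<lambda>\<omega>. max 0 (\<bar>D.mg ?k \<omega>\<bar> - \<alpha>))" using L2_rv_integrable[OF D.mg_L2] by auto
      have "integrable M (\<lambda>\<omega>. \<phi> (incr a b n \<omega>))"
        by (rule Bochner_Integration.integrable_bound[OF integrable_const[of R]]) (use \<phi>b R in auto)
      then show "integrable M (\<lambda>\<omega>. \<phi> (incr a b n \<omega>) + \<bar>P \<omega>\<bar> + (D.mg ?k \<omega>)\<^sup>2 / R)"
        using L2_rv_integrable[OF P(1)] L2_rvD(2)[OF D.mg_L2[of ?k]] by auto
      show "AE \<omega> in M. max 0 (\<bar>D.mg ?k \<omega>\<bar> - \<alpha>) \<le> \<phi> (incr a b n \<omega>) + \<bar>P \<omega>\<bar> + (D.mg ?k \<omega>)\<^sup>2 / R"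
        using P'
      proof eventually_elim
        case (elim \<omega>)
        let ?x = "D.mg ?k \<omega>"
        have "max 0 (\<bar>?x\<bar> - \<alpha>) \<le> \<phi> ?x + ?x\<^sup>2 / R"
        proof (cases "\<bar>?x\<bar> - \<alpha> \<le> R")
          case True
          then show ?thesis using R by (simp add: \<phi>_def)
        next
          case False
          then have "\<bar>?x\<bar> * R \<le> \<bar>?x\<bar> * \<bar>?x\<bar>" using pos by (intro mult_left_mono) auto
          then have "\<bar>?x\<bar> \<le> ?x\<^sup>2 / R" using R by (simp add: pos_le_divide_eq power2_eq_square)
          then show ?thesis using False R pos by (simp add: \<phi>_def)
        qed
        then show ?case using \<phi>L[of ?x "incr a b n \<omega>"] elim by linarith
      qed
    qed
    also have "\<dots> = (\<integral>\<omega>. \<phi> (incr a b n \<omega>) \<partial>M) + (\<integral>\<omega>. \<bar>P \<omega>\<bar> \<partial>M) + (l2 M (D.mg ?k))\<^sup>2 / R"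
    proof -
      have "integrable M (\<lambda>\<omega>. \<phi> (incr a b n \<omega>))"
        by (rule Bochner_Integration.integrable_bound[OF integrable_const[of R]]) (use \<phi>b R in auto)
      then show ?thesis
        using L2_rv_integrable[OF P(1)] L2_rvD(2)[OF D.mg_L2[of ?k]] by (simp add: l2_power2)
    qed
    also have "\<dots> \<le> (3 * r\<^sup>2 / \<alpha> ^ 3 + \<alpha> * \<eta> / 4) + \<alpha> * \<eta> / 4 + \<alpha> * \<eta> / 4"
    proof (intro add_mono)
      show "(\<integral>\<omega>. \<phi> (incr a b n \<omega>) \<partial>M) \<le> 3 * r\<^sup>2 / \<alpha> ^ 3 + \<alpha> * \<eta> / 4" using elim(1) \<phi>\<mu> by linarith
      show "(\<integral>\<omega>. \<bar>P \<omega>\<bar> \<partial>M) \<le> \<alpha> * \<eta> / 4" using integral_abs_le_l2[OF P(1)] P(3) \<delta> by linarith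
      have "(l2 M (D.mg ?k))\<^sup>2 / R \<le> (2 * \<sigma> + 1)\<^sup>2 / R"
        using l2mg R by (intro divide_right_mono power_mono) auto
      then show "(l2 M (D.mg ?k))\<^sup>2 / R \<le> \<alpha> * \<eta> / 4" using Rr by simp
    qed
    finally have ex: "(\<integral>\<omega>. max 0 (\<bar>D.mg ?k \<omega>\<bar> - \<alpha>) \<partial>M) \<le> 3 * r\<^sup>2 / \<alpha> ^ 3 + 3 * (\<alpha> * \<eta> / 4)" by simp
    let ?B1 = "{\<omega>\<in>space M. \<bar>P \<omega>\<bar> \<ge> \<alpha>}" and ?B2 = "{\<omega>\<in>space M. 2 * \<alpha> \<le> run_max (\<lambda>i. \<bar>D.mg i \<omega>\<bar>) ?k}"
    have "prob {\<omega>\<in>space M. \<exists>k\<in>{a n..b n}. 4 * \<alpha> < \<bar>row_sum X n k \<omega> - row_sum X n (a n) \<omega>\<bar>} \<le> prob (?B1 \<union> ?B2)"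
    proof (rule finite_measure_mono_AE)
      show "AE \<omega> in M. \<omega> \<in> {\<omega>\<in>space M. \<exists>k\<in>{a n..b n}. 4 * \<alpha> < \<bar>row_sum X n k \<omega> - row_sum X n (a n) \<omega>\<bar>}
         \<longrightarrow> \<omega> \<in> ?B1 \<union> ?B2"
        using P(2)
      proof eventually_elim
        case (elim \<omega>)
        show ?case
        proof (intro impI, elim CollectE conjE bexE)
          fix k assume \<omega>: "\<omega> \<in> space M" and k: "k \<in> {a n..b n}"
            and big: "4 * \<alpha> < \<bar>row_sum X n k \<omega> - row_sum X n (a n) \<omega>\<bar>"
          define j where "j = k - a n"
          have j: "j \<le> ?k" "k = a n + j" using k by (auto simp: j_def)
          have "\<bar>(row_sum X n k \<omega> - row_sum X n (a n) \<omega>) - D.mg j \<omega>\<bar> \<le> P \<omega>" using elim j by simp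
          moreover have "\<bar>D.mg j \<omega>\<bar> \<le> run_max (\<lambda>i. \<bar>D.mg i \<omega>\<bar>) ?k"
            using run_max_ge[OF j(1), of "\<lambda>i. \<bar>D.mg i \<omega>\<bar>"] .
          ultimately have "\<bar>P \<omega>\<bar> \<ge> \<alpha> \<or> 2 * \<alpha> \<le> run_max (\<lambda>i. \<bar>D.mg i \<omega>\<bar>) ?k" using big pos by linarith
          then show "\<omega> \<in> ?B1 \<union> ?B2" using \<omega> by blast
        qed
      qed
    qed measurable
    also have "\<dots> \<le> prob ?B1 + prob ?B2" by (rule measure_Un_le) measurable
    also have "\<dots> \<le> \<eta> / 4 + (3 * r\<^sup>2 / \<alpha> ^ 4 + 3 * (\<eta> / 4))"
    proof (rule add_mono)
      have "prob ?B1 \<le> (l2 M P)\<^sup>2 / \<alpha>\<^sup>2" by (rule Chebyshev_l2[OF P(1) pos(1)])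
      also have "\<dots> \<le> (\<alpha> * (\<alpha> * \<eta> / 4)) / \<alpha>\<^sup>2"
        using P(3) \<delta> pos unfolding power2_eq_square[of "l2 M P"] by (intro divide_right_mono mult_mono) auto
      also have "\<dots> = \<eta> / 4" using pos by (simp add: power2_eq_square)
      finally show "prob ?B1 \<le> \<eta> / 4" .
      have "\<alpha> * prob ?B2 \<le> 3 * r\<^sup>2 / \<alpha> ^ 3 + 3 * (\<alpha> * \<eta> / 4)"
        by (rule order_trans[OF D.maximal_excess[OF pos(1)] ex])
      also have "\<dots> = \<alpha> * (3 * r\<^sup>2 / \<alpha> ^ 4 + 3 * (\<eta> / 4))"
        using pos by (simp add: field_simps eval_nat_numeral)
      finally show "prob ?B2 \<le> 3 * r\<^sup>2 / \<alpha> ^ 4 + 3 * (\<eta> / 4)" using pos by simp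
    qed
    finally show ?case by simp
  qed
qed

end


section \<open>Finite-dimensional convergence\<close>

subsection \<open>Centred normal laws\<close>

definition gauss :: "real \<Rightarrow> real measure" where
  "gauss r = distr std_normal_distribution borel (\<lambda>x. sqrt r * x)"

lemma gauss_real_distribution: "real_distribution (gauss r)"
proof -
  interpret real_distribution std_normal_distribution by (rule real_dist_normal_dist)
  show ?thesis unfolding gauss_def by (rule real_distribution_distr) simp
qed

lemma char_gauss: "0 \<le> r \<Longrightarrow> char (gauss r) u = exp (- (u\<^sup>2 * r / 2))"
proof -
  assume r: "0 \<le> r"
  have "char (gauss r) u = char std_normal_distribution (u * sqrt r)"
    unfolding gauss_def char_def by (subst integral_distr) (auto simp: mult.assoc)
  then show ?thesis using r by (simp add: char_std_normal_distribution power_mult_distrib)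
qed

lemma gauss_fourth_moment:
  assumes "0 \<le> r"
  shows "integrable (gauss r) (\<lambda>x. x ^ 4)" "(\<integral>x. x ^ 4 \<partial>gauss r) \<le> 3 * r\<^sup>2"
proof -
  have s: "sqrt r ^ 4 = r\<^sup>2" using assms by (metis real_sqrt_pow2 power_mult numeral_times_numeral mult_2 numeral_Bit0 power2_eq_square semiring_normalization_rules(31) power_even_eq)
  have i: "integrable std_normal_distribution (\<lambda>x. x ^ 4)" by (rule integrable_std_normal_distribution_moment)
  show "integrable (gauss r) (\<lambda>x. x ^ 4)"
    unfolding gauss_def using i by (subst integrable_distr_eq) (auto simp: power_mult_distrib)
  have "(\<integral>x. x ^ 4 \<partial>gauss r) = r\<^sup>2 * (\<integral>x. x ^ 4 \<partial>std_normal_distribution)"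
    unfolding gauss_def by (subst integral_distr) (auto simp: power_mult_distrib s)
  also have "(\<integral>x. x ^ 4 \<partial>std_normal_distribution) = 3"
    using std_normal_distribution_even_moments(1)[of 2] by (simp add: fact_numeral)
  finally show "(\<integral>x. x ^ 4 \<partial>gauss r) \<le> 3 * r\<^sup>2" by simp
qed

subsection \<open>A partition of unity on the line\<close>

definition hat :: "real \<Rightarrow> real" where
  "hat x = max 0 (1 - \<bar>x\<bar>)"

definition hat_sum :: "nat \<Rightarrow> real \<Rightarrow> real" where
  "hat_sum R y = (\<Sum>z\<in>{- int R..int R}. hat (y - of_int z))"

lemma hat_nonneg: "0 \<le> hat x" and hat_le_1: "hat x \<le> 1" and hat_abs_le_1: "\<bar>hat x\<bar> \<le> 1"
  by (auto simp: hat_def)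

lemma hat_zero: "1 \<le> \<bar>x\<bar> \<Longrightarrow> hat x = 0"
  by (simp add: hat_def)

lemma continuous_hat: "continuous_on A f \<Longrightarrow> continuous_on A (\<lambda>x. hat (f x))"
  unfolding hat_def by (intro continuous_intros)

lemma hat_measurable [measurable]: "hat \<in> borel_measurable borel"
  by (intro borel_measurable_continuous_onI continuous_hat continuous_intros)

text \<open>Only the two integers next to \<open>y\<close> contribute.\<close>

lemma hat_sum_eq: "hat_sum R y = (\<Sum>z\<in>{- int R..int R} \<inter> {\<lfloor>y\<rfloor>, \<lfloor>y\<rfloor> + 1}. hat (y - of_int z))"
proof -
  have "hat (y - of_int z) = 0" if z: "z \<notin> {\<lfloor>y\<rfloor>, \<lfloor>y\<rfloor> + 1}" for z
  proof -
    have "z + 1 \<le> \<lfloor>y\<rfloor> \<or> \<lfloor>y\<rfloor> + 2 \<le> z" using z by auto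
    then have "of_int z + 1 \<le> (of_int \<lfloor>y\<rfloor> :: real) \<or> of_int \<lfloor>y\<rfloor> + 2 \<le> (of_int z :: real)" by linarith
    then show ?thesis by (intro hat_zero) linarith
  qed
  then show ?thesis unfolding hat_sum_def by (intro sum.mono_neutral_right) auto
qed

lemma hat_pair: "(\<Sum>z\<in>{\<lfloor>y\<rfloor>, \<lfloor>y\<rfloor> + 1}. hat (y - of_int z)) = 1"
proof -
  have "hat (y - of_int \<lfloor>y\<rfloor>) = 1 - (y - of_int \<lfloor>y\<rfloor>)" unfolding hat_def by linarith
  moreover have "hat (y - of_int (\<lfloor>y\<rfloor> + 1)) = y - of_int \<lfloor>y\<rfloor>" unfolding hat_def by linarith
  ultimately show ?thesis by simp
qed

lemma hat_sum_bounds: "0 \<le> hat_sum R y" "hat_sum R y \<le> 1"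
proof -
  show "0 \<le> hat_sum R y" unfolding hat_sum_def by (intro sum_nonneg hat_nonneg)
  have "hat_sum R y \<le> (\<Sum>z\<in>{\<lfloor>y\<rfloor>, \<lfloor>y\<rfloor> + 1}. hat (y - of_int z))"
    unfolding hat_sum_eq by (intro sum_mono2) (auto intro: hat_nonneg)
  then show "hat_sum R y \<le> 1" unfolding hat_pair .
qed

lemma hat_sum_1: "\<bar>y\<bar> < R \<Longrightarrow> hat_sum R y = 1"
proof -
  assume "\<bar>y\<bar> < R"
  then have "{- int R..int R} \<inter> {\<lfloor>y\<rfloor>, \<lfloor>y\<rfloor> + 1} = {\<lfloor>y\<rfloor>, \<lfloor>y\<rfloor> + 1}"
    by (auto; linarith)
  then show ?thesis unfolding hat_sum_eq using hat_pair by simp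
qed

lemma hat_sum_tendsto: "(\<lambda>R. hat_sum R y) \<longlonglongrightarrow> 1"
proof (rule tendsto_eventually)
  show "\<forall>\<^sub>F R in sequentially. hat_sum R y = 1"
    using eventually_gt_at_top[of "nat \<lceil>\<bar>y\<bar>\<rceil>"]
  proof eventually_elim
    case (elim R)
    then have "\<bar>y\<bar> < R" by linarith
    then show ?case by (rule hat_sum_1)
  qed
qed

lemma continuous_hat_sum: "continuous_on UNIV (\<lambda>y. hat_sum R (y / d))"
  unfolding hat_sum_def divide_inverse by (intro continuous_on_sum continuous_hat continuous_intros)

subsection \<open>Bounded Lipschitz functions of finitely many coordinates\<close>

definition coord_lip :: "nat \<Rightarrow> real \<Rightarrow> real \<Rightarrow> ((nat \<Rightarrow> real) \<Rightarrow> real) \<Rightarrow> bool" where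
  "coord_lip r L B F \<longleftrightarrow> 0 \<le> L \<and> (\<forall>x. \<bar>F x\<bar> \<le> B) \<and> (\<forall>x y. \<bar>F x - F y\<bar> \<le> L * (\<Sum>i<r. \<bar>x i - y i\<bar>))"

lemma coord_lip_cong: "coord_lip r L B F \<Longrightarrow> (\<And>i. i < r \<Longrightarrow> x i = y i) \<Longrightarrow> F x = F y"
proof -
  assume F: "coord_lip r L B F" and eq: "\<And>i. i < r \<Longrightarrow> x i = y i"
  have "\<bar>F x - F y\<bar> \<le> L * (\<Sum>i<r. \<bar>x i - y i\<bar>)" using F by (simp add: coord_lip_def)
  also have "(\<Sum>i<r. \<bar>x i - y i\<bar>) = 0" using eq by (intro sum.neutral) auto
  finally show "F x = F y" by simp
qed

text \<open>Such a function is continuous for the product topology, whose Borel sets are the product sigma-algebra.\<close>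

lemma coordinate_lipschitz_measurable:
  fixes \<Phi> :: "(nat \<Rightarrow> real) \<Rightarrow> 'd::metric_space"
  assumes \<Phi>: "\<And>x y. dist (\<Phi> x) (\<Phi> y) \<le> L * (\<Sum>i<r. \<bar>x i - y i\<bar>)"
    and Y: "\<And>i. i < r \<Longrightarrow> Y i \<in> borel_measurable G"
  shows "(\<lambda>\<omega>. \<Phi> (\<lambda>i. Y i \<omega>)) \<in> borel_measurable G"
proof -
  have c: "continuous_on UNIV \<Phi>"
    unfolding continuous_on_eq_continuous_at[OF open_UNIV] isCont_def
  proof (intro ballI)
    fix x :: "nat \<Rightarrow> real"
    have "((\<lambda>y. y i) \<longlongrightarrow> x i) (at x)" for i
    proof -
      have "continuous_on UNIV (\<lambda>y :: nat \<Rightarrow> real. y i)" by simp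
      then show ?thesis unfolding continuous_on_eq_continuous_at[OF open_UNIV] isCont_def by blast
    qed
    then have "((\<lambda>y. L * (\<Sum>i<r. \<bar>y i - x i\<bar>)) \<longlongrightarrow> L * (\<Sum>i<r. \<bar>x i - x i\<bar>)) (at x)"
      by (intro tendsto_intros)
    then have "((\<lambda>y. L * (\<Sum>i<r. \<bar>y i - x i\<bar>)) \<longlongrightarrow> 0) (at x)" by simp
    then have "((\<lambda>y. dist (\<Phi> y) (\<Phi> x)) \<longlongrightarrow> 0) (at x)"
      by (rule Lim_null_comparison[rotated]) (simp add: \<Phi>)
    then show "(\<Phi> \<longlongrightarrow> \<Phi> x) (at x)" by (rule tendsto_dist_iff[THEN iffD2])
  qed
  \<comment> \<open>Only the first \<open>r\<close> coordinates are known to be measurable, so the others are set to 0.\<close>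
  have "(\<lambda>\<omega> i. if i < r then Y i \<omega> else 0) \<in> borel_measurable G"
  proof (rule measurable_coordinatewise_then_product)
    show "(\<lambda>\<omega>. if i < r then Y i \<omega> else 0) \<in> borel_measurable G" for i
      using Y[of i] by (cases "i < r") auto
  qed
  then have "(\<lambda>\<omega>. \<Phi> (\<lambda>i. if i < r then Y i \<omega> else 0)) \<in> borel_measurable G"
    by (rule measurable_compose[OF _ borel_measurable_continuous_onI[OF c]])
  moreover have "\<Phi> (\<lambda>i. if i < r then Y i \<omega> else 0) = \<Phi> (\<lambda>i. Y i \<omega>)" for \<omega>
    using \<Phi>[of "\<lambda>i. if i < r then Y i \<omega> else 0" "\<lambda>i. Y i \<omega>"] by simp
  ultimately show ?thesis by simp
qed

lemma coord_lip_measurable: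
  assumes F: "coord_lip r L B F" and Y: "\<And>i. i < r \<Longrightarrow> Y i \<in> borel_measurable G"
  shows "(\<lambda>\<omega>. F (\<lambda>i. Y i \<omega>)) \<in> borel_measurable G"
  by (rule coordinate_lipschitz_measurable[where L=L and r=r])
    (use F Y in \<open>auto simp: coord_lip_def dist_real_def\<close>)

lemma coord_lip_integrable:
  assumes "prob_space P" "coord_lip r L B F" "\<And>i. i < r \<Longrightarrow> Y i \<in> borel_measurable P"
  shows "integrable P (\<lambda>\<omega>. F (\<lambda>i. Y i \<omega>))"
proof -
  interpret prob_space P by fact
  have B: "\<bar>F x\<bar> \<le> \<bar>B\<bar>" for x using assms(2) abs_ge_self order_trans unfolding coord_lip_def by blast
  show ?thesis
    by (rule Bochner_Integration.integrable_bound[OF integrable_const[of B] coord_lip_measurable[OF assms(2,3)]])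
      (use B in auto)
qed

lemma coord_lip_fix_last:
  assumes F: "coord_lip (Suc r) L B F"
  shows "coord_lip r L B (\<lambda>x. F (x(r := y)))"
  unfolding coord_lip_def
proof (intro conjI allI)
  show "0 \<le> L" "\<bar>F (x(r := y))\<bar> \<le> B" for x using F by (auto simp: coord_lip_def)
  fix x x' :: "nat \<Rightarrow> real"
  have "\<bar>F (x(r := y)) - F (x'(r := y))\<bar> \<le> L * (\<Sum>i<Suc r. \<bar>(x(r := y)) i - (x'(r := y)) i\<bar>)"
    using F unfolding coord_lip_def by blast
  also have "(\<Sum>i<Suc r. \<bar>(x(r := y)) i - (x'(r := y)) i\<bar>) = (\<Sum>i<r. \<bar>x i - x' i\<bar>)" by simp
  finally show "\<bar>F (x(r := y)) - F (x'(r := y))\<bar> \<le> L * (\<Sum>i<r. \<bar>x i - x' i\<bar>)" .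
qed

text \<open>Discretising the last coordinate splits a function of \<open>r + 1\<close> coordinates into finitely many
  products of a function of the first \<open>r\<close> and a function of the last.\<close>

lemma coord_lip_discretise:
  assumes F: "coord_lip (Suc r) L B F" and d: "0 < d"
  shows "\<bar>F x - (\<Sum>z\<in>{- int R..int R}. F (x(r := d * of_int z)) * hat (x r / d - of_int z))\<bar>
     \<le> L * d + B * (1 - hat_sum R (x r / d))"
proof -
  let ?Z = "{- int R..int R}" and ?h = "\<lambda>z::int. hat (x r / d - of_int z)"
  have L: "0 \<le> L" and B: "\<bar>F x\<bar> \<le> B" using F by (auto simp: coord_lip_def)
  have t: "\<bar>(F x - F (x(r := d * of_int z))) * ?h z\<bar> \<le> L * d * ?h z" for z :: int
  proof (cases "1 \<le> \<bar>x r / d - of_int z\<bar>")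
    case True
    then show ?thesis by (simp add: hat_zero)
  next
    case False
    have "\<bar>F x - F (x(r := d * of_int z))\<bar> \<le> L * (\<Sum>i<Suc r. \<bar>x i - (x(r := d * of_int z)) i\<bar>)"
      using F unfolding coord_lip_def by blast
    also have "(\<Sum>i<Suc r. \<bar>x i - (x(r := d * of_int z)) i\<bar>) = \<bar>x r - d * of_int z\<bar>" by simp
    also have "\<bar>x r - d * of_int z\<bar> = d * \<bar>x r / d - of_int z\<bar>"
      using d by (simp add: abs_mult[of d, symmetric, unfolded abs_of_pos[OF d]] right_diff_distrib)
    also have "L * (d * \<bar>x r / d - of_int z\<bar>) \<le> L * (d * 1)" using False L d by (intro mult_left_mono) auto
    finally have "\<bar>F x - F (x(r := d * of_int z))\<bar> \<le> L * d" by (simp only: mult_1_right)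
    then show ?thesis unfolding abs_mult abs_of_nonneg[OF hat_nonneg] by (rule mult_right_mono[OF _ hat_nonneg])
  qed
  have "F x - (\<Sum>z\<in>?Z. F (x(r := d * of_int z)) * ?h z)
     = (\<Sum>z\<in>?Z. (F x - F (x(r := d * of_int z))) * ?h z) + F x * (1 - hat_sum R (x r / d))"
    unfolding hat_sum_def by (simp add: left_diff_distrib right_diff_distrib sum_subtractf sum_distrib_left)
  moreover have "\<bar>\<Sum>z\<in>?Z. (F x - F (x(r := d * of_int z))) * ?h z\<bar> \<le> L * d"
  proof -
    have "\<bar>\<Sum>z\<in>?Z. (F x - F (x(r := d * of_int z))) * ?h z\<bar> \<le> (\<Sum>z\<in>?Z. L * d * ?h z)"
      by (intro order_trans[OF sum_abs] sum_mono t)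
    also have "\<dots> = L * d * hat_sum R (x r / d)" by (simp add: hat_sum_def sum_distrib_left)
    also have "\<dots> \<le> L * d * 1" using L d hat_sum_bounds by (intro mult_left_mono) auto
    finally show ?thesis by simp
  qed
  moreover have "\<bar>F x * (1 - hat_sum R (x r / d))\<bar> \<le> B * (1 - hat_sum R (x r / d))"
    unfolding abs_mult using B hat_sum_bounds[of R "x r / d"] by (intro mult_mono) auto
  ultimately show ?thesis by linarith
qed

lemma coord_lip_discretise_integral:
  assumes P: "prob_space P" and F: "coord_lip (Suc r) L B F" and d: "0 < d"
    and Y: "\<And>i. i < Suc r \<Longrightarrow> Y i \<in> borel_measurable P"
  shows "\<bar>(\<integral>\<omega>. F (\<lambda>i. Y i \<omega>) \<partial>P) - (\<Sum>z\<in>{- int R..int R}. \<integral>\<omega>. F ((\<lambda>i. Y i \<omega>)(r := d * of_int z)) * hat (Y r \<omega> / d - of_int z) \<partial>P)\<bar>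
     \<le> L * d + B * (1 - (\<integral>\<omega>. hat_sum R (Y r \<omega> / d) \<partial>P))"
proof -
  interpret prob_space P by fact
  let ?Z = "{- int R..int R}"
  let ?f = "\<lambda>z \<omega>. F ((\<lambda>i. Y i \<omega>)(r := d * of_int z)) * hat (Y r \<omega> / d - of_int z)"
  have [measurable]: "Y r \<in> borel_measurable P" using Y by simp
  have Fi: "integrable P (\<lambda>\<omega>. F (\<lambda>i. Y i \<omega>))" by (rule coord_lip_integrable[OF P F Y])
  have fi: "integrable P (?f z)" for z
  proof -
    have i: "integrable P (\<lambda>\<omega>. F ((\<lambda>i. Y i \<omega>)(r := d * of_int z)))"
      using coord_lip_integrable[OF P coord_lip_fix_last[OF F, of "d * of_int z"], of Y] Y by simp
    have [measurable]: "(\<lambda>\<omega>. F ((\<lambda>i. Y i \<omega>)(r := d * of_int z))) \<in> borel_measurable P" using i by auto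
    show ?thesis
    proof (rule Bochner_Integration.integrable_bound[OF i])
      show "AE \<omega> in P. norm (?f z \<omega>) \<le> norm (F ((\<lambda>i. Y i \<omega>)(r := d * of_int z)))"
        using hat_le_1 hat_nonneg by (auto simp: abs_mult intro!: mult_left_le)
    qed measurable
  qed
  have hm [measurable]: "hat_sum R \<in> borel_measurable borel"
    using continuous_hat_sum[of R 1] by (intro borel_measurable_continuous_onI) simp
  have hi: "integrable P (\<lambda>\<omega>. hat_sum R (Y r \<omega> / d))"
    by (rule Bochner_Integration.integrable_bound[OF integrable_const[of "1::real"]]) (use hat_sum_bounds in auto)
  have "(\<integral>\<omega>. F (\<lambda>i. Y i \<omega>) \<partial>P) - (\<Sum>z\<in>?Z. \<integral>\<omega>. ?f z \<omega> \<partial>P) = (\<integral>\<omega>. F (\<lambda>i. Y i \<omega>) - (\<Sum>z\<in>?Z. ?f z \<omega>) \<partial>P)"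
    using Fi fi by simp
  also have "\<bar>\<dots>\<bar> \<le> (\<integral>\<omega>. \<bar>F (\<lambda>i. Y i \<omega>) - (\<Sum>z\<in>?Z. ?f z \<omega>)\<bar> \<partial>P)" by (rule integral_abs_bound)
  also have "\<dots> \<le> (\<integral>\<omega>. L * d + B * (1 - hat_sum R (Y r \<omega> / d)) \<partial>P)"
    using Fi fi hi coord_lip_discretise[OF F d] by (intro integral_mono) auto
  also have "\<dots> = L * d + B * (1 - (\<integral>\<omega>. hat_sum R (Y r \<omega> / d) \<partial>P))"
    using hi by (simp add: prob_space)
  finally show ?thesis .
qed

context martingale_like_array begin

text \<open>Induction on the number of blocks. After discretising the last coordinate, every summand is a product to which
  asymptotic independence and the induction hypothesis apply; the mass outside the discretised range is the limit of
  \<open>1 - hat_sum\<close>, which is small by convergence of the last coordinate alone.\<close>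

lemma fdd_convergence:
  fixes G :: "nat \<Rightarrow> 'b \<Rightarrow> real"
  assumes bv: "\<And>i. i < q \<Longrightarrow> block_variance (w i) (w (Suc i)) (\<rho> i)"
    and P: "prob_space P"
    and Gm: "\<And>i. i < q \<Longrightarrow> G i \<in> borel_measurable P"
    and Gc: "\<And>i u. i < q \<Longrightarrow> char (distr P borel (G i)) u = exp (- (u\<^sup>2 * \<rho> i / 2))"
    and ind: "\<And>r L B F h. r < q \<Longrightarrow> coord_lip r L B F \<Longrightarrow> h \<in> borel_measurable borel \<Longrightarrow> (\<And>x. \<bar>h x\<bar> \<le> (1::real)) \<Longrightarrow>
       (\<integral>\<omega>. F (\<lambda>i. G i \<omega>) * h (G r \<omega>) \<partial>P) = (\<integral>\<omega>. F (\<lambda>i. G i \<omega>) \<partial>P) * (\<integral>\<omega>. h (G r \<omega>) \<partial>P)"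
  shows "r \<le> q \<Longrightarrow> coord_lip r L B F \<Longrightarrow>
    (\<lambda>n. \<integral>\<omega>. F (\<lambda>i. incr (w i) (w (Suc i)) n \<omega>) \<partial>M) \<longlonglongrightarrow> (\<integral>\<omega>. F (\<lambda>i. G i \<omega>) \<partial>P)"
proof (induction r arbitrary: F)
  case 0
  interpret P: prob_space P by fact
  define k where "k = F (\<lambda>_. 0)"
  have "F x = k" for x unfolding k_def by (rule coord_lip_cong[OF 0(2)]) simp
  then show ?case using prob_space P.prob_space by simp
next
  case (Suc r)
  interpret P: prob_space P by fact
  have r: "r < q" using Suc.prems by simp
  let ?Y = "\<lambda>n i. incr (w i) (w (Suc i)) n"
  note F = Suc.prems(2)
  have L: "0 \<le> L" and B: "\<And>x. \<bar>F x\<bar> \<le> B" using F by (auto simp: coord_lip_def)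
  have B0: "0 \<le> B" using B[of undefined] by linarith
  let ?\<mu> = "distr P borel (G r)"
  have [measurable]: "G r \<in> borel_measurable P" by (rule Gm[OF r])
  have \<mu>: "real_distribution ?\<mu>" "\<And>u. char ?\<mu> u = exp (- (u\<^sup>2 * \<rho> r / 2))"
    using Gc[OF r] by (auto intro: P.real_distribution_distr)
  have mono: "w i n \<le> w j n" if "i \<le> j" "j \<le> q" "1 \<le> n" for i j n
    using that
  proof (induction j rule: dec_induct)
    case (step j)
    then show ?case using bv[of j] by (force simp: block_variance_def)
  qed simp
  have past: "?Y n i \<in> borel_measurable (\<F> n (int (w r n)))" if "i < r" "1 \<le> n" for i n
  proof -
    interpret adapted_row M \<F> X n by (rule row[OF that(2)])
    have "w i n \<le> w r n" "w (Suc i) n \<le> w r n" using mono[of _ r n] that r by auto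
    then show ?thesis unfolding incr_def[abs_def]
      by (intro borel_measurable_diff F_measurable_mono[OF S_adapted]) auto
  qed
  have Ym: "?Y n i \<in> borel_measurable M" if "1 \<le> n" for n i using incr_measurable[OF that] .
  have product_limit: "(\<lambda>n. \<integral>\<omega>. F' (\<lambda>i. ?Y n i \<omega>) * h (?Y n r \<omega>) \<partial>M) \<longlonglongrightarrow> (\<integral>\<omega>. F' (\<lambda>i. G i \<omega>) * h (G r \<omega>) \<partial>P)"
    if F': "coord_lip r L B F'" and h: "continuous_on UNIV h" "\<And>x. \<bar>h x\<bar> \<le> (1::real)" for F' h
  proof -
    define B' where "B' = B + 1"
    have B': "0 < B'" using B0 by (simp add: B'_def)
    have hm: "h \<in> borel_measurable borel" using h(1) by (rule borel_measurable_continuous_onI)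
    define g where "g = (\<lambda>n \<omega>. F' (\<lambda>i. ?Y n i \<omega>) / B')"
    have g1: "g n \<in> borel_measurable (\<F> n (int (w r n)))" if "1 \<le> n" for n
      unfolding g_def by (intro borel_measurable_divide coord_lip_measurable[OF F'] past that) auto
    have g2: "\<bar>g n \<omega>\<bar> \<le> 1" for n \<omega>
    proof -
      have "\<bar>F' (\<lambda>i. ?Y n i \<omega>)\<bar> \<le> B" using F' by (simp add: coord_lip_def)
      then show ?thesis using B' by (simp add: g_def B'_def)
    qed
    have "(\<lambda>n. (\<integral>\<omega>. g n \<omega> * h (?Y n r \<omega>) \<partial>M) - (\<integral>\<omega>. g n \<omega> \<partial>M) * (\<integral>x. h x \<partial>?\<mu>)) \<longlonglongrightarrow> 0"
      by (rule asymptotic_independence[OF bv[OF r] g1 g2 \<mu> h])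
    then have "(\<lambda>n. B' * ((\<integral>\<omega>. g n \<omega> * h (?Y n r \<omega>) \<partial>M) - (\<integral>\<omega>. g n \<omega> \<partial>M) * (\<integral>x. h x \<partial>?\<mu>))) \<longlonglongrightarrow> B' * 0"
      by (rule tendsto_mult_left)
    moreover have "B' * ((\<integral>\<omega>. g n \<omega> * h (?Y n r \<omega>) \<partial>M) - (\<integral>\<omega>. g n \<omega> \<partial>M) * (\<integral>x. h x \<partial>?\<mu>))
       = (\<integral>\<omega>. F' (\<lambda>i. ?Y n i \<omega>) * h (?Y n r \<omega>) \<partial>M) - (\<integral>\<omega>. F' (\<lambda>i. ?Y n i \<omega>) \<partial>M) * (\<integral>x. h x \<partial>?\<mu>)" for n
      using B' by (simp add: g_def right_diff_distrib)
    ultimately have 1: "(\<lambda>n. (\<integral>\<omega>. F' (\<lambda>i. ?Y n i \<omega>) * h (?Y n r \<omega>) \<partial>M) - (\<integral>\<omega>. F' (\<lambda>i. ?Y n i \<omega>) \<partial>M) * (\<integral>x. h x \<partial>?\<mu>)) \<longlonglongrightarrow> 0"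
      by simp
    have 2: "(\<lambda>n. (\<integral>\<omega>. F' (\<lambda>i. ?Y n i \<omega>) \<partial>M) * (\<integral>x. h x \<partial>?\<mu>)) \<longlonglongrightarrow> (\<integral>\<omega>. F' (\<lambda>i. G i \<omega>) \<partial>P) * (\<integral>x. h x \<partial>?\<mu>)"
      by (intro tendsto_mult_right Suc.IH F') (use r in simp)
    have 3: "(\<integral>\<omega>. F' (\<lambda>i. G i \<omega>) \<partial>P) * (\<integral>x. h x \<partial>?\<mu>) = (\<integral>\<omega>. F' (\<lambda>i. G i \<omega>) * h (G r \<omega>) \<partial>P)"
      using ind[OF r F' hm h(2)] hm by (simp add: integral_distr)
    show ?thesis using tendsto_add[OF 1 2] unfolding 3 by simp
  qed
  have one: "coord_lip r L B (\<lambda>_. B)" using L B0 by (auto simp: coord_lip_def intro: mult_nonneg_nonneg sum_nonneg)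
  have hs: "(\<lambda>n. \<integral>\<omega>. B * hat_sum R (?Y n r \<omega> / d) \<partial>M) \<longlonglongrightarrow> (\<integral>\<omega>. B * hat_sum R (G r \<omega> / d) \<partial>P)" for R d
    by (rule product_limit[OF one continuous_hat_sum]) (use hat_sum_bounds in auto)
  have hz: "(\<lambda>n. \<integral>\<omega>. F ((\<lambda>i. ?Y n i \<omega>)(r := d * of_int z)) * hat (?Y n r \<omega> / d - of_int z) \<partial>M)
     \<longlonglongrightarrow> (\<integral>\<omega>. F ((\<lambda>i. G i \<omega>)(r := d * of_int z)) * hat (G r \<omega> / d - of_int z) \<partial>P)" for z :: int and d
    by (rule product_limit[OF coord_lip_fix_last[OF F]])
      (auto simp: divide_inverse hat_abs_le_1 intro!: continuous_hat continuous_intros)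
  show ?case
  proof (rule LIMSEQ_I)
    fix \<epsilon> :: real assume \<epsilon>: "0 < \<epsilon>"
    define d where "d = \<epsilon> / (8 * (L + 1))"
    have d: "0 < d" using \<epsilon> L by (simp add: d_def)
    have Ld: "L * d \<le> \<epsilon> / 8"
    proof -
      have "L * d \<le> (L + 1) * d" using d by (intro mult_right_mono) auto
      also have "\<dots> = \<epsilon> / 8" using L by (simp add: d_def field_simps)
      finally show ?thesis .
    qed
    have hm [measurable]: "hat_sum R \<in> borel_measurable borel" for R
      using continuous_hat_sum[of R 1] by (intro borel_measurable_continuous_onI) simp
    have "(\<lambda>R. \<integral>\<omega>. hat_sum R (G r \<omega> / d) \<partial>P) \<longlonglongrightarrow> (\<integral>\<omega>. 1 \<partial>P)"
      by (rule integral_dominated_convergence[where w="\<lambda>_. 1"]) (use hat_sum_tendsto hat_sum_bounds in auto)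
    then have "(\<lambda>R. B * (1 - (\<integral>\<omega>. hat_sum R (G r \<omega> / d) \<partial>P))) \<longlonglongrightarrow> B * (1 - 1)"
      by (intro tendsto_intros) (simp add: P.prob_space)
    then have "\<forall>\<^sub>F R in sequentially. B * (1 - (\<integral>\<omega>. hat_sum R (G r \<omega> / d) \<partial>P)) < \<epsilon> / 8"
      using \<epsilon> by (intro order_tendstoD) auto
    then obtain R where R: "B * (1 - (\<integral>\<omega>. hat_sum R (G r \<omega> / d) \<partial>P)) < \<epsilon> / 8"
      using eventually_happens[of _ sequentially] by auto
    let ?Z = "{- int R..int R}"
    let ?s = "\<lambda>n. \<Sum>z\<in>?Z. \<integral>\<omega>. F ((\<lambda>i. ?Y n i \<omega>)(r := d * of_int z)) * hat (?Y n r \<omega> / d - of_int z) \<partial>M"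
    let ?t = "\<Sum>z\<in>?Z. \<integral>\<omega>. F ((\<lambda>i. G i \<omega>)(r := d * of_int z)) * hat (G r \<omega> / d - of_int z) \<partial>P"
    let ?e = "\<lambda>n. (L * d + (B - (\<integral>\<omega>. B * hat_sum R (?Y n r \<omega> / d) \<partial>M))) + \<bar>?s n - ?t\<bar> + (L * d + B * (1 - (\<integral>\<omega>. hat_sum R (G r \<omega> / d) \<partial>P)))"
    have st: "?s \<longlonglongrightarrow> ?t" by (intro tendsto_sum hz)
    have "?e \<longlonglongrightarrow> (L * d + (B - (\<integral>\<omega>. B * hat_sum R (G r \<omega> / d) \<partial>P))) + \<bar>?t - ?t\<bar> + (L * d + B * (1 - (\<integral>\<omega>. hat_sum R (G r \<omega> / d) \<partial>P)))"
      by (intro tendsto_add tendsto_diff tendsto_rabs tendsto_const st hs)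
    moreover have "(L * d + (B - (\<integral>\<omega>. B * hat_sum R (G r \<omega> / d) \<partial>P))) + \<bar>?t - ?t\<bar> + (L * d + B * (1 - (\<integral>\<omega>. hat_sum R (G r \<omega> / d) \<partial>P))) < \<epsilon>"
      using Ld R \<epsilon> by (simp add: right_diff_distrib)
    ultimately have "\<forall>\<^sub>F n in sequentially. ?e n < \<epsilon>" by (rule order_tendstoD)
    then have "\<forall>\<^sub>F n in sequentially. norm ((\<integral>\<omega>. F (\<lambda>i. ?Y n i \<omega>) \<partial>M) - (\<integral>\<omega>. F (\<lambda>i. G i \<omega>) \<partial>P)) < \<epsilon>"
      using eventually_ge_at_top[of 1]
    proof eventually_elim
      case (elim n)
      have "\<bar>(\<integral>\<omega>. F (\<lambda>i. ?Y n i \<omega>) \<partial>M) - ?s n\<bar> \<le> L * d + B * (1 - (\<integral>\<omega>. hat_sum R (?Y n r \<omega> / d) \<partial>M))"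
        by (rule coord_lip_discretise_integral[OF prob_space_axioms F d Ym[OF elim(2)]])
      moreover have "\<bar>(\<integral>\<omega>. F (\<lambda>i. G i \<omega>) \<partial>P) - ?t\<bar> \<le> L * d + B * (1 - (\<integral>\<omega>. hat_sum R (G r \<omega> / d) \<partial>P))"
        by (rule coord_lip_discretise_integral[OF P F d Gm]) (use r in simp)
      moreover have "(\<integral>\<omega>. B * hat_sum R (?Y n r \<omega> / d) \<partial>M) = B * (\<integral>\<omega>. hat_sum R (?Y n r \<omega> / d) \<partial>M)" by simp
      ultimately show ?case using elim(1) unfolding real_norm_def right_diff_distrib by linarith
    qed
    then show "\<exists>no. \<forall>n\<ge>no. norm ((\<integral>\<omega>. F (\<lambda>i. ?Y n i \<omega>) \<partial>M) - (\<integral>\<omega>. F (\<lambda>i. G i \<omega>) \<partial>P)) < \<epsilon>"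
      unfolding eventually_sequentially .
  qed
qed

end


section \<open>Weak convergence in a metric space from Lipschitz functions\<close>

text \<open>The Lipschitz regularisation of a function from below.\<close>

definition inf_conv :: "('d::metric_space \<Rightarrow> real) \<Rightarrow> nat \<Rightarrow> 'd \<Rightarrow> real" where
  "inf_conv f k x = (INF y. f y + real k * dist x y)"

lemma inf_conv_bounds:
  assumes "\<And>x. \<bar>f x\<bar> \<le> B"
  shows "inf_conv f k x \<le> f x" "- B \<le> inf_conv f k x" "\<bar>inf_conv f k x\<bar> \<le> B"
    "inf_conv f k x \<le> inf_conv f k x' + k * dist x x'"
proof -
  have lb: "- B \<le> f y + k * dist x y" for x y
  proof -
    have "0 \<le> k * dist x y" by simp
    then show ?thesis using assms[of y] by linarith
  qed
  have bdd: "bdd_below (range (\<lambda>y. f y + k * dist x y))" for x using lb by (intro bdd_belowI2)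
  have up: "inf_conv f k x \<le> f y + k * dist x y" for x y
    unfolding inf_conv_def by (rule cINF_lower[OF bdd]) simp
  show 1: "inf_conv f k x \<le> f x" using up[of x x] by simp
  show 2: "- B \<le> inf_conv f k x" unfolding inf_conv_def by (rule cINF_greatest) (use lb in auto)
  show "\<bar>inf_conv f k x\<bar> \<le> B" using 1 2 assms[of x] by linarith
  have "inf_conv f k x - k * dist x x' \<le> inf_conv f k x'"
    unfolding inf_conv_def[of f k x']
  proof (rule cINF_greatest)
    fix y
    have "k * dist x y \<le> k * (dist x x' + dist x' y)" by (intro mult_left_mono dist_triangle) simp
    then show "inf_conv f k x - k * dist x x' \<le> f y + k * dist x' y"
      using up[of x y] by (simp add: distrib_left)
  qed simp
  then show "inf_conv f k x \<le> inf_conv f k x' + k * dist x x'" by simp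
qed

lemma inf_conv_lipschitz:
  assumes "\<And>x. \<bar>f x\<bar> \<le> B"
  shows "\<bar>inf_conv f k x - inf_conv f k x'\<bar> \<le> k * dist x x'"
  using inf_conv_bounds(4)[where f=f and k=k and x=x and x'=x', OF assms]
    inf_conv_bounds(4)[where f=f and k=k and x=x' and x'=x, OF assms]
  by (simp add: dist_commute[of x' x] abs_le_iff)

lemma inf_conv_tendsto:
  assumes B: "\<And>x. \<bar>f x\<bar> \<le> B" and f: "continuous_on UNIV f"
  shows "(\<lambda>k. inf_conv f k x) \<longlonglongrightarrow> f x"
proof (rule LIMSEQ_I)
  fix \<epsilon> :: real assume \<epsilon>: "0 < \<epsilon>"
  then have "0 < \<epsilon> / 2" by simp
  then obtain \<delta> where \<delta>: "0 < \<delta>" "\<And>y. dist y x < \<delta> \<Longrightarrow> dist (f y) (f x) < \<epsilon> / 2"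
    using f unfolding continuous_on_iff by (metis UNIV_I)
  obtain k0 :: nat where k0: "2 * B / \<delta> < k0" using reals_Archimedean2 by blast
  show "\<exists>no. \<forall>k\<ge>no. norm (inf_conv f k x - f x) < \<epsilon>"
  proof (intro exI[of _ k0] allI impI)
    fix k assume k: "k0 \<le> k"
    have "f x - \<epsilon> / 2 \<le> inf_conv f k x"
      unfolding inf_conv_def
    proof (rule cINF_greatest)
      fix y
      show "f x - \<epsilon> / 2 \<le> f y + k * dist x y"
      proof (cases "dist y x < \<delta>")
        case True
        have "0 \<le> k * dist x y" by simp
        moreover have "\<bar>f y - f x\<bar> < \<epsilon> / 2" using \<delta>(2)[OF True] by (simp add: dist_real_def)
        ultimately show ?thesis by linarith
      next
        case False
        have "2 * B < k0 * \<delta>" using k0 \<delta>(1) by (simp add: divide_less_eq)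
        also have "\<dots> \<le> k * dist x y" using k False \<delta>(1) by (intro mult_mono) (auto simp: dist_commute)
        finally show ?thesis using B[of x] B[of y] \<epsilon> by linarith
      qed
    qed simp
    moreover have "inf_conv f k x \<le> f x" by (rule inf_conv_bounds(1)[OF B])
    ultimately show "norm (inf_conv f k x - f x) < \<epsilon>" using \<epsilon> unfolding real_norm_def by linarith
  qed
qed

text \<open>The regularisations lie below \<open>f\<close> and converge to it pointwise, which gives the lower estimate of the expectations;
  the upper one is the lower estimate for \<open>- f\<close>.\<close>

lemma weak_convergence_from_lipschitz:
  fixes Y :: "nat \<Rightarrow> 'a \<Rightarrow> 'd::metric_space" and Z :: "'b \<Rightarrow> 'd"
  fixes f :: "'d \<Rightarrow> real"
  assumes M: "prob_space M" and P: "prob_space P"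
    and Y: "\<And>n. 1 \<le> n \<Longrightarrow> Y n \<in> borel_measurable M" and Z: "Z \<in> borel_measurable P"
    and lip: "\<And>(f :: 'd \<Rightarrow> real) L B. 0 \<le> L \<Longrightarrow> (\<And>x. \<bar>f x\<bar> \<le> B) \<Longrightarrow> (\<And>x y. \<bar>f x - f y\<bar> \<le> L * dist x y) \<Longrightarrow>
      (\<lambda>n. \<integral>\<omega>. f (Y n \<omega>) \<partial>M) \<longlonglongrightarrow> (\<integral>\<omega>. f (Z \<omega>) \<partial>P)"
    and f: "continuous_on UNIV f" "\<And>x. \<bar>f x\<bar> \<le> (B::real)"
  shows "(\<lambda>n. \<integral>\<omega>. f (Y n \<omega>) \<partial>M) \<longlonglongrightarrow> (\<integral>\<omega>. f (Z \<omega>) \<partial>P)"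
proof -
  interpret M: prob_space M by fact
  interpret P: prob_space P by fact
  have lower: "\<forall>\<^sub>F n in sequentially. (\<integral>\<omega>. f (Z \<omega>) \<partial>P) - \<epsilon> < (\<integral>\<omega>. f (Y n \<omega>) \<partial>M)"
    if f: "continuous_on UNIV f" and B: "\<And>x. \<bar>f x\<bar> \<le> B" and \<epsilon>: "0 < \<epsilon>" for f :: "'d \<Rightarrow> real" and \<epsilon>
  proof -
    let ?g = "inf_conv f"
    have gb: "\<bar>?g k x\<bar> \<le> B" for k x by (rule inf_conv_bounds(3)[OF B])
    have gl: "\<bar>?g k x - ?g k y\<bar> \<le> k * dist x y" for k x y by (rule inf_conv_lipschitz[OF B])
    have gc: "continuous_on UNIV (?g k)" for k
      by (rule lipschitz_on_continuous_on[OF lipschitz_onI[of _ _ k]]) (simp_all add: dist_real_def gl)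
    have gm [measurable]: "?g k \<in> borel_measurable borel" for k using gc by (rule borel_measurable_continuous_onI)
    have fm [measurable]: "f \<in> borel_measurable borel" using f by (rule borel_measurable_continuous_onI)
    note Z [measurable]
    have "(\<lambda>k. \<integral>\<omega>. ?g k (Z \<omega>) \<partial>P) \<longlonglongrightarrow> (\<integral>\<omega>. f (Z \<omega>) \<partial>P)"
      by (rule integral_dominated_convergence[where w="\<lambda>_. B"]) (use gb inf_conv_tendsto[OF B f] in auto)
    then have "\<forall>\<^sub>F k in sequentially. (\<integral>\<omega>. f (Z \<omega>) \<partial>P) - \<epsilon> / 2 < (\<integral>\<omega>. ?g k (Z \<omega>) \<partial>P)"
      using \<epsilon> by (intro order_tendstoD) auto
    then obtain k where k: "(\<integral>\<omega>. f (Z \<omega>) \<partial>P) - \<epsilon> / 2 < (\<integral>\<omega>. ?g k (Z \<omega>) \<partial>P)"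
      using eventually_happens[of _ sequentially] by auto
    have "(\<lambda>n. \<integral>\<omega>. ?g k (Y n \<omega>) \<partial>M) \<longlonglongrightarrow> (\<integral>\<omega>. ?g k (Z \<omega>) \<partial>P)"
      by (rule lip[OF _ gb gl]) simp
    then have "\<forall>\<^sub>F n in sequentially. (\<integral>\<omega>. ?g k (Z \<omega>) \<partial>P) - \<epsilon> / 2 < (\<integral>\<omega>. ?g k (Y n \<omega>) \<partial>M)"
      using \<epsilon> by (intro order_tendstoD) auto
    then show ?thesis using eventually_ge_at_top[of 1]
    proof eventually_elim
      case (elim n)
      note Y[OF elim(2), measurable]
      have i: "integrable M (\<lambda>\<omega>. ?g k (Y n \<omega>))" "integrable M (\<lambda>\<omega>. f (Y n \<omega>))"
        by (rule Bochner_Integration.integrable_bound[OF M.integrable_const[of B]];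
            use gb order_trans[OF gb abs_ge_self] order_trans[OF B abs_ge_self] in auto)+
      have "(\<integral>\<omega>. ?g k (Y n \<omega>) \<partial>M) \<le> (\<integral>\<omega>. f (Y n \<omega>) \<partial>M)"
        by (intro integral_mono i inf_conv_bounds(1)[OF B])
      then show ?case using elim(1) k by linarith
    qed
  qed
  show ?thesis
  proof (rule LIMSEQ_I)
    fix \<epsilon> :: real assume \<epsilon>: "0 < \<epsilon>"
    have "\<forall>\<^sub>F n in sequentially. (\<integral>\<omega>. - f (Z \<omega>) \<partial>P) - \<epsilon> < (\<integral>\<omega>. - f (Y n \<omega>) \<partial>M)"
      by (rule lower[of "\<lambda>x. - f x"]) (use f \<epsilon> in \<open>auto intro: continuous_intros\<close>)
    then have "\<forall>\<^sub>F n in sequentially. norm ((\<integral>\<omega>. f (Y n \<omega>) \<partial>M) - (\<integral>\<omega>. f (Z \<omega>) \<partial>P)) < \<epsilon>"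
      using lower[OF f \<epsilon>] by eventually_elim (simp add: abs_less_iff)
    then show "\<exists>no. \<forall>n\<ge>no. norm ((\<integral>\<omega>. f (Y n \<omega>) \<partial>M) - (\<integral>\<omega>. f (Z \<omega>) \<partial>P)) < \<epsilon>"
      unfolding eventually_sequentially .
  qed
qed

section \<open>Step functions in D([0,1])\<close>

lemma dist_D01_le:
  assumes "\<And>t. t \<in> {0..1} \<Longrightarrow> \<bar>path_of x t - path_of y t\<bar> \<le> b"
  shows "dist x y \<le> b"
  unfolding dist_D01_def by (rule cSUP_least) (use assms in auto)

lemma D01_valued_measurable:
  fixes \<Phi> :: "(nat \<Rightarrow> real) \<Rightarrow> D01"
  assumes "\<And>x y. dist (\<Phi> x) (\<Phi> y) \<le> (\<Sum>i<r. \<bar>x i - y i\<bar>)"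
    and "\<And>i. i < r \<Longrightarrow> Y i \<in> borel_measurable G"
  shows "(\<lambda>\<omega>. \<Phi> (\<lambda>i. Y i \<omega>)) \<in> borel_measurable G"
  by (rule coordinate_lipschitz_measurable[where L=1 and r=r, OF _ assms(2)]) (simp_all add: assms(1))

text \<open>The step function on the grid of mesh \<open>1 / K\<close> with given jumps, the first of them at time 0.\<close>

definition stepD :: "nat \<Rightarrow> (nat \<Rightarrow> real) \<Rightarrow> D01" where
  "stepD K x = to_D01 (\<lambda>t. \<Sum>i\<le>nat \<lfloor>real K * t\<rfloor>. x i)"

lemma path_of_stepD:
  assumes t: "t \<in> {0..1}"
  shows "path_of (stepD K x) t = (\<Sum>i\<le>nat \<lfloor>real K * t\<rfloor>. x i)"
proof -
  have "cadlag (\<lambda>t. (\<lambda>k. \<Sum>i\<le>k. x i) (nat \<lfloor>real K * t\<rfloor>))"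
  proof (rule cadlag_time_change)
    show "mono_on {0..1} (\<lambda>t. nat \<lfloor>real K * t\<rfloor>)"
      by (intro mono_onI nat_mono floor_mono mult_left_mono) auto
    fix t :: real assume t: "t \<in> {0..<1}"
    show "((\<lambda>t. nat \<lfloor>real K * t\<rfloor>) \<longlongrightarrow> nat \<lfloor>real K * t\<rfloor>) (at_right t)"
    proof (cases "K = 0")
      case False
      define s where "s = (of_int \<lfloor>real K * t\<rfloor> + 1) / real K"
      have ts: "t < s" using False by (simp add: s_def pos_less_divide_eq mult.commute)
      have "\<lfloor>real K * y\<rfloor> = \<lfloor>real K * t\<rfloor>" if "t < y" "y < s" for y
      proof -
        have "real K * y < of_int \<lfloor>real K * t\<rfloor> + 1" using that(2) False by (simp add: s_def pos_less_divide_eq mult.commute)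
        moreover have "real K * t \<le> real K * y" using that(1) by (intro mult_left_mono) auto
        ultimately show ?thesis by linarith
      qed
      then have "\<forall>\<^sub>F y in at_right t. nat \<lfloor>real K * y\<rfloor> = nat \<lfloor>real K * t\<rfloor>"
        unfolding eventually_at_right_field using ts by metis
      then show ?thesis by (rule tendsto_eventually)
    qed simp
  qed
  then show ?thesis unfolding stepD_def by (rule path_of_to_D01[OF _ t])
qed

lemma floor_grid_le: "t \<in> {0..1} \<Longrightarrow> nat \<lfloor>real K * t\<rfloor> \<le> K"
proof -
  assume "t \<in> {0..1}"
  then have "real K * t \<le> real K * 1" by (intro mult_left_mono) auto
  then show ?thesis by linarith
qed

lemma stepD_lipschitz: "dist (stepD K x) (stepD K y) \<le> (\<Sum>i<Suc K. \<bar>x i - y i\<bar>)"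
proof (rule dist_D01_le)
  fix t :: real assume t: "t \<in> {0..1}"
  have "\<bar>path_of (stepD K x) t - path_of (stepD K y) t\<bar> \<le> (\<Sum>i\<le>nat \<lfloor>real K * t\<rfloor>. \<bar>x i - y i\<bar>)"
    unfolding path_of_stepD[OF t] sum_subtractf[symmetric] by (rule sum_abs)
  also have "\<dots> \<le> (\<Sum>i<Suc K. \<bar>x i - y i\<bar>)"
    using floor_grid_le[OF t, of K] by (intro sum_mono2) auto
  finally show "\<bar>path_of (stepD K x) t - path_of (stepD K y) t\<bar> \<le> (\<Sum>i<Suc K. \<bar>x i - y i\<bar>)" .
qed

lemma grid_position:
  assumes K: "1 \<le> K" and t: "t \<in> {0..1}"
  defines "j \<equiv> nat \<lfloor>real K * t\<rfloor>"
  shows "real j / K \<le> t" "t < (real j + 1) / K" "j \<le> K"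
proof -
  have "0 \<le> real K * t" using t by simp
  then have "real j \<le> real K * t" "real K * t < real j + 1" unfolding j_def by linarith+
  then show "real j / K \<le> t" "t < (real j + 1) / K"
    using K by (auto simp: pos_divide_le_eq pos_less_divide_eq mult.commute)
  show "j \<le> K" unfolding j_def by (rule floor_grid_le[OF t])
qed

text \<open>Grid points, with the time 0 listed twice, so that the first block is the jump at time 0.\<close>

definition grid :: "nat \<Rightarrow> nat \<Rightarrow> real" where
  "grid K i = real (i - 1) / real K"

lemma grid_in: "1 \<le> K \<Longrightarrow> i \<le> Suc K \<Longrightarrow> grid K i \<in> {0..1}"
  by (auto simp: grid_def divide_le_eq)

lemma grid_mono: "i \<le> j \<Longrightarrow> grid K i \<le> grid K j"
  by (auto simp: grid_def intro!: divide_right_mono)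

section \<open>The Brownian side\<close>

locale brownian_limit = P: prob_space P
  for P :: "'b measure" +
  fixes W :: "real \<Rightarrow> 'b \<Rightarrow> real" and c :: real
  assumes W: "standard_brownian_motion P W"
begin

lemma W_meas: "t \<in> {0..1} \<Longrightarrow> W t \<in> borel_measurable P"
  and W_0: "AE \<omega> in P. W 0 \<omega> = 0"
  and W_cont: "\<omega> \<in> space P \<Longrightarrow> continuous_on {0..1} (\<lambda>t. W t \<omega>)"
  and W_normal: "0 \<le> s \<Longrightarrow> s < t \<Longrightarrow> t \<le> 1 \<Longrightarrow>
        distributed P lborel (\<lambda>\<omega>. W t \<omega> - W s \<omega>) (normal_density 0 (sqrt (t - s)))"
  and W_indep: "(\<forall>i\<le>r. \<tau> i \<in> {0..1}) \<Longrightarrow> (\<forall>i<r. \<tau> i \<le> \<tau> (Suc i)) \<Longrightarrow>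
        P.indep_vars (\<lambda>_. borel) (\<lambda>i \<omega>. W (\<tau> (Suc i)) \<omega> - W (\<tau> i) \<omega>) {..<r}"
  using W unfolding standard_brownian_motion_def by blast+

definition limit_jump :: "nat \<Rightarrow> nat \<Rightarrow> 'b \<Rightarrow> real" where
  "limit_jump K i \<omega> = c * (W (grid K (Suc i)) \<omega> - W (grid K i) \<omega>)"

lemma limit_jump_meas: "1 \<le> K \<Longrightarrow> i < Suc K \<Longrightarrow> limit_jump K i \<in> borel_measurable P"
  unfolding limit_jump_def[abs_def]
  by (intro borel_measurable_times borel_measurable_diff W_meas grid_in) auto

lemma char_limit_jump:
  assumes K: "1 \<le> K" and i: "i < Suc K"
  shows "char (distr P borel (limit_jump K i)) u = exp (- (u\<^sup>2 * ((grid K (Suc i) - grid K i) * c\<^sup>2) / 2))"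
proof -
  have [measurable]: "limit_jump K i \<in> borel_measurable P" by (rule limit_jump_meas[OF K i])
  have ch: "char (distr P borel (limit_jump K i)) u = (\<integral>\<omega>. iexp (u * limit_jump K i \<omega>) \<partial>P)"
    unfolding char_def by (subst integral_distr) auto
  have g: "grid K i \<in> {0..1}" "grid K (Suc i) \<in> {0..1}" using grid_in[OF K] i by auto
  define s where "s = sqrt (grid K (Suc i) - grid K i)"
  consider "grid K i = grid K (Suc i)" | "grid K i < grid K (Suc i)"
    using grid_mono[of i "Suc i" K] by linarith
  then show ?thesis
  proof cases
    case 1
    then show ?thesis unfolding ch by (simp add: limit_jump_def P.prob_space)
  next
    case 2
    have s: "0 < s" "s\<^sup>2 = grid K (Suc i) - grid K i" using 2 by (auto simp: s_def)
    define V where "V = (\<lambda>\<omega>. (W (grid K (Suc i)) \<omega> - W (grid K i) \<omega>) / s)"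
    have "distributed P lborel (\<lambda>\<omega>. W (grid K (Suc i)) \<omega> - W (grid K i) \<omega>) (normal_density 0 s)"
      unfolding s_def using 2 g by (intro W_normal) auto
    then have "distributed P lborel V std_normal_density"
      unfolding V_def using P.normal_standard_normal_convert[OF s(1), of _ 0] by simp
    then have V: "distr P lborel V = std_normal_distribution" "V \<in> measurable P lborel"
      by (auto simp: distributed_def)
    have "(\<integral>\<omega>. iexp (u * limit_jump K i \<omega>) \<partial>P) = (\<integral>\<omega>. iexp (u * c * s * V \<omega>) \<partial>P)"
      using s(1) by (intro Bochner_Integration.integral_cong refl) (simp add: limit_jump_def V_def)
    also have "\<dots> = (\<integral>x. iexp (u * c * s * x) \<partial>distr P lborel V)"
      using V(2) by (subst integral_distr) auto
    also have "\<dots> = char std_normal_distribution (u * c * s)" unfolding V(1) char_def ..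
    also have "\<dots> = exp (- (u\<^sup>2 * ((grid K (Suc i) - grid K i) * c\<^sup>2) / 2))"
      by (simp add: char_std_normal_distribution power_mult_distrib s(2) mult_ac)
    finally show ?thesis unfolding ch .
  qed
qed

lemma limit_jump_independent:
  fixes F :: "(nat \<Rightarrow> real) \<Rightarrow> real" and h :: "real \<Rightarrow> real"
  assumes K: "1 \<le> K" and r: "r < Suc K" and F: "coord_lip r L B F"
    and h: "h \<in> borel_measurable borel" "\<And>x. \<bar>h x\<bar> \<le> 1"
  shows "(\<integral>\<omega>. F (\<lambda>i. limit_jump K i \<omega>) * h (limit_jump K r \<omega>) \<partial>P) = (\<integral>\<omega>. F (\<lambda>i. limit_jump K i \<omega>) \<partial>P) * (\<integral>\<omega>. h (limit_jump K r \<omega>) \<partial>P)"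
proof -
  have "P.indep_vars (\<lambda>_. borel) (\<lambda>i \<omega>. W (grid K (Suc i)) \<omega> - W (grid K i) \<omega>) {..<Suc K}"
    using grid_in[OF K] grid_mono by (intro W_indep) auto
  then have "P.indep_vars (\<lambda>_. borel) (\<lambda>i \<omega>. c * (W (grid K (Suc i)) \<omega> - W (grid K i) \<omega>)) {..<Suc K}"
    by (rule P.indep_vars_compose2) auto
  then have ind: "P.indep_vars (\<lambda>_. borel) (limit_jump K) {..<Suc K}" unfolding limit_jump_def[abs_def] .
  have iv: "P.indep_var (PiM {..<r} (\<lambda>_. borel)) (\<lambda>\<omega>. restrict (\<lambda>i. limit_jump K i \<omega>) {..<r})
     (PiM {r} (\<lambda>_. borel)) (\<lambda>\<omega>. restrict (\<lambda>i. limit_jump K i \<omega>) {r})"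
    by (rule P.indep_var_restrict[OF ind]) (use r in auto)
  have Fm: "F \<in> borel_measurable (PiM {..<r} (\<lambda>_. borel))"
    using coord_lip_measurable[OF F, of "\<lambda>i x. x i" "PiM {..<r} (\<lambda>_. borel)"] by simp
  have hm: "(\<lambda>x. h (x r)) \<in> borel_measurable (PiM {r} (\<lambda>_. borel))"
    by (rule measurable_compose[OF _ h(1)]) simp
  have "P.indep_var borel (F \<circ> (\<lambda>\<omega>. restrict (\<lambda>i. limit_jump K i \<omega>) {..<r})) borel ((\<lambda>x. h (x r)) \<circ> (\<lambda>\<omega>. restrict (\<lambda>i. limit_jump K i \<omega>) {r}))"
    by (rule P.indep_var_compose[OF iv Fm hm])
  moreover have "F \<circ> (\<lambda>\<omega>. restrict (\<lambda>i. limit_jump K i \<omega>) {..<r}) = (\<lambda>\<omega>. F (\<lambda>i. limit_jump K i \<omega>))"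
    by (auto simp: fun_eq_iff intro!: coord_lip_cong[OF F])
  moreover have "(\<lambda>x. h (x r)) \<circ> (\<lambda>\<omega>. restrict (\<lambda>i. limit_jump K i \<omega>) {r}) = (\<lambda>\<omega>. h (limit_jump K r \<omega>))"
    by (auto simp: fun_eq_iff)
  ultimately have "P.indep_var borel (\<lambda>\<omega>. F (\<lambda>i. limit_jump K i \<omega>)) borel (\<lambda>\<omega>. h (limit_jump K r \<omega>))" by simp
  moreover have "integrable P (\<lambda>\<omega>. F (\<lambda>i. limit_jump K i \<omega>))"
    by (rule coord_lip_integrable[OF P.prob_space_axioms F limit_jump_meas[OF K]]) (use r in auto)
  moreover have "integrable P (\<lambda>\<omega>. h (limit_jump K r \<omega>))"
    by (rule Bochner_Integration.integrable_bound[OF P.integrable_const[of "1::real"] measurable_compose[OF limit_jump_meas[OF K r] h(1)]])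
      (use h(2) in auto)
  ultimately show ?thesis by (rule P.indep_var_lebesgue_integral)
qed

abbreviation limit_path :: "'b \<Rightarrow> D01" where
  "limit_path \<omega> \<equiv> to_D01 (\<lambda>t. c * W t \<omega>)"

lemma path_of_limit_path: "\<omega> \<in> space P \<Longrightarrow> t \<in> {0..1} \<Longrightarrow> path_of (limit_path \<omega>) t = c * W t \<omega>"
  by (intro path_of_to_D01 cadlag_continuous continuous_intros W_cont)

text \<open>The increments whose sums reproduce \<open>c W\<close> on the grid also where \<open>W\<close> does not start at 0. They make the
  approximation of the path hold everywhere, which measurability requires, whereas \<open>limit_jump\<close> has independent entries.\<close>

definition limit_jump_from_0 :: "nat \<Rightarrow> nat \<Rightarrow> 'b \<Rightarrow> real" where
  "limit_jump_from_0 K i \<omega> = (if i = 0 then c * W 0 \<omega> else limit_jump K i \<omega>)"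

lemma limit_jump_from_0_sum: "(\<Sum>i\<le>j. limit_jump_from_0 K i \<omega>) = c * W (real j / K) \<omega>"
proof (induction j)
  case (Suc j)
  then show ?case by (simp add: limit_jump_from_0_def limit_jump_def grid_def algebra_simps)
qed (simp add: limit_jump_from_0_def)

lemma stepD_limit_jump_from_0_tendsto:
  assumes \<omega>: "\<omega> \<in> space P"
  shows "(\<lambda>K. stepD (Suc K) (\<lambda>i. limit_jump_from_0 (Suc K) i \<omega>)) \<longlonglongrightarrow> limit_path \<omega>"
proof (rule metric_LIMSEQ_I)
  fix \<epsilon> :: real assume \<epsilon>: "0 < \<epsilon>"
  have "continuous_on {0..1} (\<lambda>t. c * W t \<omega>)" by (intro continuous_intros W_cont \<omega>)
  then have "uniformly_continuous_on {0..1} (\<lambda>t. c * W t \<omega>)"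
    by (intro compact_uniformly_continuous) auto
  then obtain \<delta> where \<delta>: "0 < \<delta>" "\<And>s t. s \<in> {0..1} \<Longrightarrow> t \<in> {0..1} \<Longrightarrow> dist t s < \<delta> \<Longrightarrow> dist (c * W t \<omega>) (c * W s \<omega>) < \<epsilon> / 2"
    unfolding uniformly_continuous_on_def using half_gt_zero[OF \<epsilon>] by metis
  obtain K0 :: nat where K0: "1 / \<delta> < K0" using reals_Archimedean2 by blast
  show "\<exists>no. \<forall>K\<ge>no. dist (stepD (Suc K) (\<lambda>i. limit_jump_from_0 (Suc K) i \<omega>)) (limit_path \<omega>) < \<epsilon>"
  proof (intro exI[of _ K0] allI impI)
    fix K assume K: "K0 \<le> K"
    have d: "1 / Suc K < \<delta>"
    proof -
      have "1 / \<delta> < Suc K" using K K0 by simp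
      then show ?thesis using \<delta>(1) by (simp add: field_simps)
    qed
    have "dist (stepD (Suc K) (\<lambda>i. limit_jump_from_0 (Suc K) i \<omega>)) (limit_path \<omega>) \<le> \<epsilon> / 2"
    proof (rule dist_D01_le)
      fix t :: real assume t: "t \<in> {0..1}"
      let ?j = "nat \<lfloor>real (Suc K) * t\<rfloor>"
      note p = grid_position[of "Suc K" t, OF _ t]
      have j: "real ?j / Suc K \<in> {0..1}" using p(3) by (simp add: divide_le_eq)
      have "\<bar>t - real ?j / Suc K\<bar> < \<delta>" using p(1,2) d by (simp add: add_divide_distrib)
      then have "dist (c * W (real ?j / Suc K) \<omega>) (c * W t \<omega>) < \<epsilon> / 2"
        by (intro \<delta>(2) t j) (simp add: dist_real_def abs_minus_commute)
      then show "\<bar>path_of (stepD (Suc K) (\<lambda>i. limit_jump_from_0 (Suc K) i \<omega>)) t - path_of (limit_path \<omega>) t\<bar> \<le> \<epsilon> / 2"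
        unfolding path_of_stepD[OF t] path_of_limit_path[OF \<omega> t] limit_jump_from_0_sum dist_real_def by simp
    qed
    then show "dist (stepD (Suc K) (\<lambda>i. limit_jump_from_0 (Suc K) i \<omega>)) (limit_path \<omega>) < \<epsilon>" using \<epsilon> by simp
  qed
qed

lemma stepD_limit_jump_meas: "1 \<le> K \<Longrightarrow> (\<lambda>\<omega>. stepD K (\<lambda>i. limit_jump K i \<omega>)) \<in> borel_measurable P"
  by (rule D01_valued_measurable[OF stepD_lipschitz]) (rule limit_jump_meas)

lemma limit_path_meas: "limit_path \<in> borel_measurable P"
proof (rule borel_measurable_LIMSEQ_metric)
  show "(\<lambda>\<omega>. stepD (Suc K) (\<lambda>i. limit_jump_from_0 (Suc K) i \<omega>)) \<in> borel_measurable P" for K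
  proof (rule D01_valued_measurable[OF stepD_lipschitz])
    fix i assume i: "i < Suc (Suc K)"
    show "limit_jump_from_0 (Suc K) i \<in> borel_measurable P"
      using limit_jump_meas[of "Suc K" i] i W_meas[of 0] by (cases "i = 0") (auto simp: limit_jump_from_0_def[abs_def])
  qed
qed (rule stepD_limit_jump_from_0_tendsto)

lemma stepD_limit_jump_AE: "AE \<omega> in P. \<forall>K. stepD K (\<lambda>i. limit_jump K i \<omega>) = stepD K (\<lambda>i. limit_jump_from_0 K i \<omega>)"
  using W_0
proof eventually_elim
  case (elim \<omega>)
  have "limit_jump K i \<omega> = limit_jump_from_0 K i \<omega>" for K i using elim by (simp add: limit_jump_from_0_def limit_jump_def grid_def)
  then show ?case by simp
qed

lemma stepD_limit_jump_expectation:
  assumes f: "continuous_on UNIV f" "\<And>x. \<bar>f x\<bar> \<le> (B::real)"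
  shows "(\<lambda>K. \<integral>\<omega>. f (stepD (Suc K) (\<lambda>i. limit_jump (Suc K) i \<omega>)) \<partial>P) \<longlonglongrightarrow> (\<integral>\<omega>. f (limit_path \<omega>) \<partial>P)"
proof (rule integral_dominated_convergence[where w="\<lambda>_. B"])
  have fm: "f \<in> borel_measurable borel" using f(1) by (rule borel_measurable_continuous_onI)
  show "(\<lambda>\<omega>. f (limit_path \<omega>)) \<in> borel_measurable P" by (rule measurable_compose[OF limit_path_meas fm])
  show "(\<lambda>\<omega>. f (stepD (Suc K) (\<lambda>i. limit_jump (Suc K) i \<omega>))) \<in> borel_measurable P" for K
    by (rule measurable_compose[OF stepD_limit_jump_meas fm]) simp
  show "AE \<omega> in P. (\<lambda>K. f (stepD (Suc K) (\<lambda>i. limit_jump (Suc K) i \<omega>))) \<longlonglongrightarrow> f (limit_path \<omega>)"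
    using stepD_limit_jump_AE AE_space
  proof eventually_elim
    case (elim \<omega>)
    have "(\<lambda>K. f (stepD (Suc K) (\<lambda>i. limit_jump_from_0 (Suc K) i \<omega>))) \<longlonglongrightarrow> f (limit_path \<omega>)"
      using f(1) stepD_limit_jump_from_0_tendsto[OF elim(2)] by (intro continuous_on_tendsto_compose[OF f(1)]) auto
    then show ?case using elim(1) by simp
  qed
qed (use f(2) in auto)

end


section \<open>The functional central limit theorem\<close>

context martingale_like_array begin

text \<open>Block 0 ends at \<open>v n 0\<close>, which may be positive; its limiting variance is 0.\<close>

definition wgrid :: "nat \<Rightarrow> nat \<Rightarrow> nat \<Rightarrow> nat" where
  "wgrid K i n = (if i = 0 then 0 else v n (grid K i))"

abbreviation jump :: "nat \<Rightarrow> nat \<Rightarrow> nat \<Rightarrow> 'a \<Rightarrow> real" where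
  "jump K i \<equiv> incr (wgrid K i) (wgrid K (Suc i))"

definition sum_path :: "nat \<Rightarrow> 'a \<Rightarrow> D01" where
  "sum_path n \<omega> = to_D01 (\<lambda>t. \<Sum>k=1..v n t. X n k \<omega>)"

lemma wgrid_block:
  assumes K: "1 \<le> K" and i: "i < Suc K"
  shows "block_variance (wgrid K i) (wgrid K (Suc i)) ((grid K (Suc i) - grid K i) * c\<^sup>2)"
proof (cases "i = 0")
  case True
  then have "wgrid K i = (\<lambda>n. 0)" "wgrid K (Suc i) = (\<lambda>n. v n 0)" "grid K (Suc i) - grid K i = 0"
    by (auto simp: wgrid_def grid_def)
  then show ?thesis using block_variance_initial[of 0] by simp
next
  case False
  have g: "grid K i \<in> {0..1}" "grid K (Suc i) \<in> {0..1}" using grid_in[OF K] i by auto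
  have le: "grid K i \<le> grid K (Suc i)" by (rule grid_mono) simp
  have "wgrid K i = (\<lambda>n. v n (grid K i))" "wgrid K (Suc i) = (\<lambda>n. v n (grid K (Suc i)))"
    using False by (auto simp: wgrid_def)
  moreover have "block_variance (\<lambda>n. v n (grid K i)) (\<lambda>n. v n (grid K (Suc i))) (grid K (Suc i) * c\<^sup>2 - grid K i * c\<^sup>2)"
    using g le by (intro block_variance_diff block_variance_initial mono_onD[OF v_mono] mult_right_mono) auto
  ultimately show ?thesis by (simp add: left_diff_distrib)
qed

lemma time_change_path:
  assumes n: "1 \<le> n" and t: "t \<in> {0..1}"
  shows "path_of (to_D01 (\<lambda>t. g (v n t))) t = g (v n t)"
  using v_mono[OF n] v_right_cont[OF n] by (intro path_of_to_D01[OF cadlag_time_change t]) auto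

lemma path_of_sum_path: "1 \<le> n \<Longrightarrow> t \<in> {0..1} \<Longrightarrow> path_of (sum_path n \<omega>) t = row_sum X n (v n t) \<omega>"
  unfolding sum_path_def row_sum_def by (rule time_change_path)

lemma sum_path_measurable:
  assumes n: "1 \<le> n" shows "sum_path n \<in> borel_measurable M"
proof -
  let ?\<Phi> = "\<lambda>x. to_D01 (\<lambda>t. \<Sum>k=1..v n t. x (k - 1) :: real)"
  have \<Phi>: "dist (?\<Phi> x) (?\<Phi> y) \<le> (\<Sum>i<n. \<bar>x i - y i\<bar>)" for x y
  proof (rule dist_D01_le)
    fix t :: real assume t: "t \<in> {0..1}"
    have p: "path_of (?\<Phi> x) t = (\<Sum>k=1..v n t. x (k - 1))" for x
      by (rule time_change_path[OF n t, where g="\<lambda>j. \<Sum>k=1..j. x (k - 1)"])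
    have "\<bar>path_of (?\<Phi> x) t - path_of (?\<Phi> y) t\<bar> \<le> (\<Sum>k=1..v n t. \<bar>x (k - 1) - y (k - 1)\<bar>)"
      unfolding p sum_subtractf[symmetric] by (rule sum_abs)
    also have "\<dots> \<le> (\<Sum>k=1..n. \<bar>x (k - 1) - y (k - 1)\<bar>)"
      using v_range[OF n t] by (intro sum_mono2) auto
    also have "\<dots> = (\<Sum>i<n. \<bar>x i - y i\<bar>)"
      by (rule sum.reindex_bij_witness[where i=Suc and j="\<lambda>k. k - 1"]) auto
    finally show "\<bar>path_of (?\<Phi> x) t - path_of (?\<Phi> y) t\<bar> \<le> (\<Sum>i<n. \<bar>x i - y i\<bar>)" .
  qed
  have "(\<lambda>\<omega>. ?\<Phi> (\<lambda>i. X n (Suc i) \<omega>)) \<in> borel_measurable M"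
    by (rule D01_valued_measurable[where Y="\<lambda>i. X n (Suc i)" and \<Phi>="?\<Phi>", OF \<Phi>]) (use adapted_row.X_L2[OF row[OF n]] in auto)
  moreover have "?\<Phi> (\<lambda>i. X n (Suc i) \<omega>) = sum_path n \<omega>" for \<omega>
    unfolding sum_path_def by (rule arg_cong[where f=to_D01]) (auto simp: fun_eq_iff intro!: sum.cong)
  ultimately show ?thesis by simp
qed

lemma jump_sum:
  "(\<Sum>i\<le>j. jump K i n \<omega>) = row_sum X n (wgrid K (Suc j) n) \<omega>"
  by (induction j) (auto simp: incr_def wgrid_def row_sum_def)

text \<open>Replacing the process by its step approximation costs no more than the oscillation within the blocks.\<close>

lemma sum_path_step_distance:
  assumes n: "1 \<le> n" and K: "1 \<le> K" and b: "0 \<le> b"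
    and osc: "\<And>i k. i \<in> {1..K} \<Longrightarrow> k \<in> {wgrid K i n..wgrid K (Suc i) n} \<Longrightarrow>
      \<bar>row_sum X n k \<omega> - row_sum X n (wgrid K i n) \<omega>\<bar> \<le> b"
  shows "dist (sum_path n \<omega>) (stepD K (\<lambda>i. jump K i n \<omega>)) \<le> b"
proof (rule dist_D01_le)
  fix t :: real assume t: "t \<in> {0..1}"
  define j where "j = nat \<lfloor>real K * t\<rfloor>"
  note p = grid_position[OF K t, folded j_def]
  have w: "wgrid K (Suc j) n = v n (grid K (Suc j))" by (simp add: wgrid_def)
  have g: "grid K (Suc j) \<in> {0..1}" using grid_in[OF K] p(3) by simp
  have "\<bar>row_sum X n (v n t) \<omega> - row_sum X n (wgrid K (Suc j) n) \<omega>\<bar> \<le> b"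
  proof (cases "j < K")
    case True
    have g2: "grid K (Suc (Suc j)) \<in> {0..1}" using grid_in[OF K] True by simp
    have "grid K (Suc j) \<le> t" "t \<le> grid K (Suc (Suc j))"
      using p(1) less_imp_le[OF p(2)] by (simp_all add: grid_def add.commute)
    then have "v n t \<in> {wgrid K (Suc j) n..wgrid K (Suc (Suc j)) n}"
      using mono_onD[OF v_mono[OF n]] t g g2 by (auto simp: wgrid_def)
    then show ?thesis using True by (intro osc) auto
  next
    case False
    then have "j = K" using p(3) by simp
    then have "t = 1" using p(1) t K by simp
    then have "t = grid K (Suc j)" using \<open>j = K\<close> K by (simp add: grid_def)
    then show ?thesis using b w by simp
  qed
  then show "\<bar>path_of (sum_path n \<omega>) t - path_of (stepD K (\<lambda>i. jump K i n \<omega>)) t\<bar> \<le> b"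
    unfolding path_of_sum_path[OF n t] path_of_stepD[OF t] j_def[symmetric] jump_sum .
qed

text \<open>Each of the \<open>K\<close> blocks contributes a multiple of \<open>(c\<^sup>2 / K)\<^sup>2\<close>, which leaves a total of order \<open>1 / K\<close>.\<close>

lemma oscillation_small:
  assumes K: "1 \<le> K" and pos: "0 < \<alpha>" "0 < \<eta>"
  shows "\<forall>\<^sub>F n in sequentially. prob {\<omega>\<in>space M. \<exists>i\<in>{1..K}. \<exists>k\<in>{wgrid K i n..wgrid K (Suc i) n}.
      4 * \<alpha> < \<bar>row_sum X n k \<omega> - row_sum X n (wgrid K i n) \<omega>\<bar>} \<le> 3 * c ^ 4 / (K * \<alpha> ^ 4) + \<eta>"
proof -
  let ?B = "\<lambda>n i. {\<omega>\<in>space M. \<exists>k\<in>{wgrid K i n..wgrid K (Suc i) n}. 4 * \<alpha> < \<bar>row_sum X n k \<omega> - row_sum X n (wgrid K i n) \<omega>\<bar>}"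
  have K0: "0 < real K" using K by simp
  have "\<forall>\<^sub>F n in sequentially. \<forall>i\<in>{1..K}. prob (?B n i) \<le> 3 * (c\<^sup>2 / K)\<^sup>2 / \<alpha> ^ 4 + \<eta> / K"
  proof (intro eventually_ball_finite ballI)
    fix i assume i: "i \<in> {1..K}"
    have r: "(grid K (Suc i) - grid K i) * c\<^sup>2 = c\<^sup>2 / K"
    proof -
      have "grid K (Suc i) - grid K i = (real i - real (i - 1)) / K" by (simp add: grid_def diff_divide_distrib)
      also have "real i - real (i - 1) = 1" using i by (simp add: of_nat_diff)
      finally show ?thesis by simp
    qed
    have bv: "block_variance (wgrid K i) (wgrid K (Suc i)) (c\<^sup>2 / K)"
      using wgrid_block[OF K, of i] i unfolding r by simp
    have r0: "0 \<le> c\<^sup>2 / K" by simp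
    show "\<forall>\<^sub>F n in sequentially. prob (?B n i) \<le> 3 * (c\<^sup>2 / K)\<^sup>2 / \<alpha> ^ 4 + \<eta> / K"
      using pos K0 by (intro block_oscillation[OF bv gauss_real_distribution char_gauss[OF r0] gauss_fourth_moment[OF r0]]) auto
  qed simp
  then show ?thesis using eventually_ge_at_top[of 1]
  proof eventually_elim
    case (elim n)
    interpret row: adapted_row M \<F> X n by (rule row[OF elim(2)])
    have [measurable]: "row_sum X n k \<in> borel_measurable M" for k using row.S_L2 by auto
    have "prob {\<omega>\<in>space M. \<exists>i\<in>{1..K}. \<exists>k\<in>{wgrid K i n..wgrid K (Suc i) n}.
      4 * \<alpha> < \<bar>row_sum X n k \<omega> - row_sum X n (wgrid K i n) \<omega>\<bar>} = prob (\<Union>i\<in>{1..K}. ?B n i)"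
      by (rule arg_cong[where f=prob]) auto
    also have "\<dots> \<le> (\<Sum>i\<in>{1..K}. prob (?B n i))"
    proof (rule finite_measure_subadditive_finite)
      have "?B n i \<in> sets M" for i by measurable
      then show "(\<lambda>i. ?B n i) ` {1..K} \<subseteq> sets M" by blast
    qed simp
    also have "\<dots> \<le> (\<Sum>i\<in>{1..K}. 3 * (c\<^sup>2 / K)\<^sup>2 / \<alpha> ^ 4 + \<eta> / K)" using elim(1) by (intro sum_mono) auto
    also have "\<dots> = K * (3 * (c\<^sup>2 / K)\<^sup>2 / \<alpha> ^ 4 + \<eta> / K)" by simp
    also have "\<dots> = 3 * c ^ 4 / (K * \<alpha> ^ 4) + \<eta>"
    proof -
      have "(c\<^sup>2)\<^sup>2 = c ^ 4" by simp
      then have "(c\<^sup>2 / K)\<^sup>2 = c ^ 4 / (K * K)" unfolding power_divide by (simp add: power2_eq_square[of "real K"])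
      then show ?thesis using K0 pos by (simp only: distrib_left) (simp add: field_simps power2_eq_square[of "real K"])
    qed
    finally show ?case .
  qed
qed

end

locale functional_clt = martingale_like_array M X \<F> v C c + brownian_limit P W c
  for M :: "'a measure" and X \<F> v C c and P :: "'b measure" and W
begin

lemma step_expectation_limit:
  assumes K: "1 \<le> K" and f: "0 \<le> L" "\<And>x. \<bar>f x\<bar> \<le> B" "\<And>x y. \<bar>f x - f y\<bar> \<le> L * dist x y"
  shows "(\<lambda>n. \<integral>\<omega>. f (stepD K (\<lambda>i. jump K i n \<omega>)) \<partial>M) \<longlonglongrightarrow> (\<integral>\<omega>. f (stepD K (\<lambda>i. limit_jump K i \<omega>)) \<partial>P)"
proof -
  have F: "coord_lip (Suc K) L B (\<lambda>x. f (stepD K x))"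
    unfolding coord_lip_def using f order_trans[OF f(3) mult_left_mono[OF stepD_lipschitz f(1)]] by blast
  show ?thesis
    by (rule fdd_convergence[where q="Suc K" and w="wgrid K" and r="Suc K" and F="\<lambda>x. f (stepD K x)" and G="limit_jump K",
          OF wgrid_block[OF K] P.prob_space_axioms limit_jump_meas[OF K] char_limit_jump[OF K] limit_jump_independent[OF K] order_refl F])
qed

text \<open>Both processes are replaced by their step approximations on a fine grid, which are compared by
  finite-dimensional convergence. The constants split \<open>\<epsilon>\<close> into eighths.\<close>

lemma lipschitz_expectation_limit:
  fixes f :: "D01 \<Rightarrow> real"
  assumes f: "0 \<le> L" "\<And>x. \<bar>f x\<bar> \<le> B" "\<And>x y. \<bar>f x - f y\<bar> \<le> L * dist x y"
  shows "(\<lambda>n. \<integral>\<omega>. f (sum_path n \<omega>) \<partial>M) \<longlonglongrightarrow> (\<integral>\<omega>. f (limit_path \<omega>) \<partial>P)"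
proof (rule LIMSEQ_I)
  fix \<epsilon> :: real assume \<epsilon>: "0 < \<epsilon>"
  have B0: "0 \<le> B" using f(2)[of undefined] by linarith
  have fc: "continuous_on UNIV f"
    by (rule lipschitz_on_continuous_on[OF lipschitz_onI[of _ _ L]]) (use f in \<open>simp_all add: dist_real_def\<close>)
  have fm: "f \<in> borel_measurable borel" using fc by (rule borel_measurable_continuous_onI)
  define \<alpha> where "\<alpha> = \<epsilon> / (32 * (L + 1))"
  have \<alpha>: "0 < \<alpha>" using \<epsilon> f(1) by (simp add: \<alpha>_def)
  have L\<alpha>: "L * (4 * \<alpha>) \<le> \<epsilon> / 8"
  proof -
    have "L * (4 * \<alpha>) \<le> (L + 1) * (4 * \<alpha>)" using \<alpha> by (intro mult_right_mono) auto
    also have "\<dots> = \<epsilon> / 8" using f(1) by (simp add: \<alpha>_def field_simps)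
    finally show ?thesis .
  qed
  have "(\<lambda>K. 2 * B * (3 * c ^ 4 / \<alpha> ^ 4) * inverse (real (Suc K))) \<longlonglongrightarrow> 2 * B * (3 * c ^ 4 / \<alpha> ^ 4) * 0"
    by (intro tendsto_mult_left LIMSEQ_inverse_real_of_nat)
  then have "\<forall>\<^sub>F K in sequentially. 2 * B * (3 * c ^ 4 / \<alpha> ^ 4) * inverse (real (Suc K)) < \<epsilon> / 8"
    using \<epsilon> by (intro order_tendstoD) auto
  moreover have "\<forall>\<^sub>F K in sequentially. dist (\<integral>\<omega>. f (stepD (Suc K) (\<lambda>i. limit_jump (Suc K) i \<omega>)) \<partial>P) (\<integral>\<omega>. f (limit_path \<omega>) \<partial>P) < \<epsilon> / 8"
    using \<epsilon> by (intro tendstoD[OF stepD_limit_jump_expectation[OF fc f(2)]]) auto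
  ultimately have "\<forall>\<^sub>F K in sequentially. 2 * B * (3 * c ^ 4 / \<alpha> ^ 4) * inverse (real (Suc K)) < \<epsilon> / 8 \<and>
     dist (\<integral>\<omega>. f (stepD (Suc K) (\<lambda>i. limit_jump (Suc K) i \<omega>)) \<partial>P) (\<integral>\<omega>. f (limit_path \<omega>) \<partial>P) < \<epsilon> / 8" by (rule eventually_conj)
  then obtain K' where K': "2 * B * (3 * c ^ 4 / \<alpha> ^ 4) * inverse (real (Suc K')) < \<epsilon> / 8"
     "dist (\<integral>\<omega>. f (stepD (Suc K') (\<lambda>i. limit_jump (Suc K') i \<omega>)) \<partial>P) (\<integral>\<omega>. f (limit_path \<omega>) \<partial>P) < \<epsilon> / 8"
    using eventually_happens[of _ sequentially] by auto
  define K where "K = Suc K'"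
  have K: "1 \<le> K" by (simp add: K_def)
  have K1: "2 * B * (3 * c ^ 4 / (K * \<alpha> ^ 4)) < \<epsilon> / 8" using K'(1) by (simp add: K_def field_simps)
  have K2: "\<bar>(\<integral>\<omega>. f (stepD K (\<lambda>i. limit_jump K i \<omega>)) \<partial>P) - (\<integral>\<omega>. f (limit_path \<omega>) \<partial>P)\<bar> < \<epsilon> / 8"
    using K'(2) by (simp add: K_def dist_real_def)
  define \<eta> where "\<eta> = \<epsilon> / (16 * (B + 1))"
  have \<eta>: "0 < \<eta>" using \<epsilon> B0 by (simp add: \<eta>_def)
  have B\<eta>: "2 * B * \<eta> \<le> \<epsilon> / 8"
  proof -
    have "2 * B * \<eta> \<le> 2 * (B + 1) * \<eta>" using \<eta> by (intro mult_right_mono) auto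
    also have "\<dots> = \<epsilon> / 8" using B0 by (simp add: \<eta>_def field_simps)
    finally show ?thesis .
  qed
  let ?bad = "\<lambda>n. {\<omega>\<in>space M. \<exists>i\<in>{1..K}. \<exists>k\<in>{wgrid K i n..wgrid K (Suc i) n}.
      4 * \<alpha> < \<bar>row_sum X n k \<omega> - row_sum X n (wgrid K i n) \<omega>\<bar>}"
  have "\<forall>\<^sub>F n in sequentially. dist (\<integral>\<omega>. f (stepD K (\<lambda>i. jump K i n \<omega>)) \<partial>M) (\<integral>\<omega>. f (stepD K (\<lambda>i. limit_jump K i \<omega>)) \<partial>P) < \<epsilon> / 8"
    using \<epsilon> by (intro tendstoD[OF step_expectation_limit[OF K f]]) auto
  then have "\<forall>\<^sub>F n in sequentially. norm ((\<integral>\<omega>. f (sum_path n \<omega>) \<partial>M) - (\<integral>\<omega>. f (limit_path \<omega>) \<partial>P)) < \<epsilon>"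
    using oscillation_small[OF K \<alpha> \<eta>] eventually_ge_at_top[of 1]
  proof eventually_elim
    case (elim n)
    interpret row: adapted_row M \<F> X n by (rule row[OF elim(3)])
    have [measurable]: "row_sum X n k \<in> borel_measurable M" for k using row.S_L2 by auto
    have bad: "?bad n \<in> sets M" by measurable
    have Ym: "(\<lambda>\<omega>. f (sum_path n \<omega>)) \<in> borel_measurable M" by (rule measurable_compose[OF sum_path_measurable[OF elim(3)] fm])
    have Sm: "(\<lambda>\<omega>. f (stepD K (\<lambda>i. jump K i n \<omega>))) \<in> borel_measurable M"
      by (rule measurable_compose[OF D01_valued_measurable[OF stepD_lipschitz] fm]) (rule incr_measurable[OF elim(3)])
    have Yi: "integrable M (\<lambda>\<omega>. f (sum_path n \<omega>))"
      by (rule Bochner_Integration.integrable_bound[OF integrable_const[of B] Ym]) (use order_trans[OF f(2) abs_ge_self] in auto)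
    have Si: "integrable M (\<lambda>\<omega>. f (stepD K (\<lambda>i. jump K i n \<omega>)))"
      by (rule Bochner_Integration.integrable_bound[OF integrable_const[of B] Sm]) (use order_trans[OF f(2) abs_ge_self] in auto)
    have bi: "integrable M (indicat_real (?bad n))"
      using bad by (intro integrable_real_indicator) (auto simp: emeasure_eq_measure)
    have pw: "\<bar>f (sum_path n \<omega>) - f (stepD K (\<lambda>i. jump K i n \<omega>))\<bar> \<le> L * (4 * \<alpha>) + 2 * B * indicat_real (?bad n) \<omega>"
      if \<omega>: "\<omega> \<in> space M" for \<omega>
    proof (cases "\<omega> \<in> ?bad n")
      case True
      have "\<bar>f (sum_path n \<omega>) - f (stepD K (\<lambda>i. jump K i n \<omega>))\<bar> \<le> 2 * B"
        using f(2)[of "sum_path n \<omega>"] f(2)[of "stepD K (\<lambda>i. jump K i n \<omega>)"] by linarith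
      then show ?thesis using True \<alpha> f(1) by (simp add: add_increasing)
    next
      case False
      have "dist (sum_path n \<omega>) (stepD K (\<lambda>i. jump K i n \<omega>)) \<le> 4 * \<alpha>"
        using False \<omega> \<alpha> by (intro sum_path_step_distance elim(3) K) (auto simp: not_less)
      then show ?thesis using order_trans[OF f(3) mult_left_mono[OF _ f(1)]] False by auto
    qed
    have "\<bar>(\<integral>\<omega>. f (sum_path n \<omega>) \<partial>M) - (\<integral>\<omega>. f (stepD K (\<lambda>i. jump K i n \<omega>)) \<partial>M)\<bar>
        = \<bar>\<integral>\<omega>. f (sum_path n \<omega>) - f (stepD K (\<lambda>i. jump K i n \<omega>)) \<partial>M\<bar>" using Yi Si by simp
    also have "\<dots> \<le> (\<integral>\<omega>. \<bar>f (sum_path n \<omega>) - f (stepD K (\<lambda>i. jump K i n \<omega>))\<bar> \<partial>M)" by (rule integral_abs_bound)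
    also have "\<dots> \<le> (\<integral>\<omega>. L * (4 * \<alpha>) + 2 * B * indicat_real (?bad n) \<omega> \<partial>M)"
      using Yi Si bi pw by (intro integral_mono) auto
    also have "\<dots> = L * (4 * \<alpha>) + 2 * B * prob (?bad n)" using bi bad by (simp add: prob_space)
    also have "\<dots> \<le> \<epsilon> / 8 + 2 * B * (3 * c ^ 4 / (K * \<alpha> ^ 4) + \<eta>)"
      using L\<alpha> elim(2) B0 by (intro add_mono mult_left_mono) auto
    also have "\<dots> \<le> \<epsilon> / 8 + (\<epsilon> / 8 + \<epsilon> / 8)" unfolding distrib_left using K1 B\<eta> by linarith
    finally have "\<bar>(\<integral>\<omega>. f (sum_path n \<omega>) \<partial>M) - (\<integral>\<omega>. f (stepD K (\<lambda>i. jump K i n \<omega>)) \<partial>M)\<bar> \<le> \<epsilon> / 8 + (\<epsilon> / 8 + \<epsilon> / 8)" .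
    then show ?case using elim(1) K2 \<epsilon> unfolding dist_real_def real_norm_def by linarith
  qed
  then show "\<exists>no. \<forall>n\<ge>no. norm ((\<integral>\<omega>. f (sum_path n \<omega>) \<partial>M) - (\<integral>\<omega>. f (limit_path \<omega>) \<partial>P)) < \<epsilon>"
    unfolding eventually_sequentially .
qed

lemma functional_convergence: "converges_in_distribution M sum_path P limit_path"
  unfolding converges_in_distribution_def
proof (intro conjI allI impI)
  show "sum_path n \<in> borel_measurable M" if "1 \<le> n" for n by (rule sum_path_measurable[OF that])
  show "limit_path \<in> borel_measurable P" by (rule limit_path_meas)
  fix f :: "D01 \<Rightarrow> real" assume f: "continuous_on UNIV f \<and> bounded (range f)"
  then obtain B where B: "\<And>x. \<bar>f x\<bar> \<le> B" unfolding bounded_iff by auto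
  show "(\<lambda>n. \<integral>\<omega>. f (sum_path n \<omega>) \<partial>M) \<longlonglongrightarrow> (\<integral>\<omega>. f (limit_path \<omega>) \<partial>P)"
    by (rule weak_convergence_from_lipschitz[OF prob_space_axioms P.prob_space_axioms sum_path_measurable limit_path_meas
          lipschitz_expectation_limit _ B]) (use f in auto)
qed

end

theorem theorem3p1:
  fixes M :: "'a measure"
    and X :: "nat \<Rightarrow> nat \<Rightarrow> 'a \<Rightarrow> real"
    and \<F> :: "nat \<Rightarrow> int \<Rightarrow> 'a measure"
    and v :: "nat \<Rightarrow> real \<Rightarrow> nat"
    and C c :: real
    and N :: "'b measure"
    and W :: "real \<Rightarrow> 'b \<Rightarrow> real"
  assumes prob: "prob_space M"
    and filtr: "\<And>n i j. n \<ge> 1 \<Longrightarrow> i \<le> j \<Longrightarrow> sets (\<F> n i) \<subseteq> sets (\<F> n j)"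
    and subalg: "\<And>n i. n \<ge> 1 \<Longrightarrow> subalgebra M (\<F> n i)"
    and filtr_conv: "\<And>n i. n \<ge> 1 \<Longrightarrow> i > int n \<Longrightarrow> sets (\<F> n i) = sets (\<F> n (int n))"
    and adapted: "\<And>n i. n \<ge> 1 \<Longrightarrow> 1 \<le> i \<Longrightarrow> i \<le> n \<Longrightarrow> X n i \<in> borel_measurable (\<F> n (int i))"
    and X_conv: "\<And>n i \<omega>. n \<ge> 1 \<Longrightarrow> i > n \<Longrightarrow> \<omega> \<in> space M \<Longrightarrow> X n i \<omega> = 0"
    and square_int: "\<And>n i. n \<ge> 1 \<Longrightarrow> 1 \<le> i \<Longrightarrow> i \<le> n \<Longrightarrow> integrable M (\<lambda>\<omega>. (X n i \<omega>)\<^sup>2)"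
    and centered: "\<And>n i. n \<ge> 1 \<Longrightarrow> 1 \<le> i \<Longrightarrow> i \<le> n \<Longrightarrow> (\<integral>\<omega>. X n i \<omega> \<partial>M) = 0"
    and variance_bound: "\<And>n. n \<ge> 1 \<Longrightarrow> (\<Sum>j=1..n. \<integral>\<omega>. (X n j \<omega>)\<^sup>2 \<partial>M) \<le> C"
    and lindeberg: "\<And>\<epsilon>. \<epsilon> > 0 \<Longrightarrow>
      (\<lambda>n. \<Sum>k=1..n. \<integral>\<omega>. (X n k \<omega>)\<^sup>2 * indicator {\<omega>'. \<bar>X n k \<omega>'\<bar> > \<epsilon>} \<omega> \<partial>M) \<longlonglongrightarrow> 0"
    and A_cond: "(\<lambda>j. ennreal (2 powr (- (real j / 2))) * A_coeff M \<F> X (2 ^ j)) \<longlonglongrightarrow> 0"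
    and B_cond: "liminf (\<lambda>j. \<Sum>i. B_coeff M \<F> X (2 ^ (j + i)) (2 ^ j)) = 0"
    and v_range: "\<And>n t. n \<ge> 1 \<Longrightarrow> t \<in> {0..1} \<Longrightarrow> v n t \<le> n"
    and v_mono: "\<And>n. n \<ge> 1 \<Longrightarrow> mono_on {0..1} (v n)"
    and v_right_cont: "\<And>n t. n \<ge> 1 \<Longrightarrow> t \<in> {0..<1} \<Longrightarrow> (v n \<longlongrightarrow> v n t) (at_right t)"
    and c_nonneg: "c \<ge> 0"
    and variance_conv: "\<And>t \<epsilon>. t \<in> {0<..1} \<Longrightarrow> \<epsilon> > 0 \<Longrightarrow>
      (\<lambda>m. limsup (\<lambda>n. emeasure M {\<omega> \<in> space M.
         \<bar>(\<Sum>k=1..v n t. (X n k \<omega>)\<^sup>2 + 2 * X n k \<omega> * theta M \<F> X m n k \<omega>) - t * c\<^sup>2\<bar> > \<epsilon>}))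
      \<longlonglongrightarrow> 0"
    and brownian: "standard_brownian_motion N W"
  shows "converges_in_distribution
    M (\<lambda>n \<omega>. to_D01 (\<lambda>t. \<Sum>k=1..v n t. X n k \<omega>))
    N (\<lambda>\<omega>. to_D01 (\<lambda>t. c * W t \<omega>))"
proof -
  interpret prob_space M by (rule prob)
  interpret B: prob_space N using brownian by (simp add: standard_brownian_motion_def)
  interpret functional_clt M X \<F> v C c N W
    by unfold_locales
      (fact filtr subalg adapted X_conv square_int variance_bound lindeberg A_cond B_cond
        v_range v_mono v_right_cont variance_conv brownian)+
  show ?thesis using functional_convergence by (simp add: sum_path_def[abs_def])
qed

end
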